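(* Let $p>2$ be a prime number. Then every monomial $c_{ijk}\,b_1'^{\,i}b_2'^{\,j}b_3'^{\,k}$ with $c_{ijk}\neq0$ of the polynomial $L'_p\in\mathbb{Q}[b'_1,b'_2,b'_3]$ satisfies $$i\equiv j\equiv k\equiv0\bmod 2\qquad\text{and}\qquad i+j\equiv j+k\equiv0\bmod4.$$ Moreover, assume the conjecture that $L'_p$ is the denominator of all the coefficients of the three modular polynomials $\Phi_{1,p},\Psi_{2,p},\Psi_{3,p}$ for $b'_1,b'_2,b'_3$. Then, for $m\in\{1,2\}$ and every $\ell$, every monomial $c_{ijk}\,b_1'^{\,i}b_2'^{\,j}b_3'^{\,k}$ with $c_{ijk}\ne0$ of the numerator of the coefficient of $X^\ell$ of the $m$-th modular polynomial (the first being $\Phi_{1,p}$ and the second $\Psi_{2,p}$) satisfies $$i\equiv\ell+m+1\bmod2,\qquad i+j\equiv-p\ell\bmod4,\qquad j+k\equiv p(m-1)\bmod4.$$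
   Context: $\mathcal{H}_2$ is the Siegel upper half-space of symmetric $2\times2$ complex matrices with positive definite imaginary part; $\Gamma_2=\mathrm{Sp}_4(\mathbb{Z})$ acts on it by $\begin{pmatrix}A&B\\C&D\end{pmatrix}\Omega=(A\Omega+B)(C\Omega+D)^{-1}$. For a square matrix $X$, $X_0$ is the vector of its diagonal entries. Put $$\Gamma(2,4)=\left\{\begin{pmatrix}A&B\\C&D\end{pmatrix}\in\Gamma_2:\begin{pmatrix}A&B\\C&D\end{pmatrix}\equiv I_4\bmod 2,\ B_0\equiv C_0\equiv0\bmod4\right\},$$ a normal subgroup of $\Gamma_2$, and let $\Gamma_0(p)$ be the subgroup of $\Gamma_2$ of matrices with $C\equiv0\bmod p$. For $b=(b_0,b_1)\in\{0,1\}^2$ let $\theta_{b_0+2b_1}(\Omega)=\sum_{n\in\mathbb{Z}^2}\exp(i\pi\,{}^tn\Omega n+i\pi\,{}^tn b)$ (here $i=\sqrt{-1}$), and for $r=1,2,3$ let $b'_r(\Omega)=\theta_r(\Omega/2)/\theta_0(\Omega/2)$. The functions $b'_1,b'_2,b'_3$ are algebraically independent generators of the field of modular functions for $\Gamma(2,4)$. For a function $f$ put $f_p^\gamma(\Omega)=f(p\gamma\Omega)$. Let $C_p$ be a set of representatives of the cosets $(\Gamma(2,4)\cap\Gamma_0(p))\gamma$ in $\Gamma(2,4)$. The modular polynomials for $b'_1,b'_2,b'_3$ are, for $r=2,3$, $$\Phi_{1,p}(X)=\prod_{\gamma\in C_p}(X-b_{1,p}'^{\,\gamma}),\qquad \Psi_{r,p}(X)=\sum_{\gamma\in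 C_p}b_{r,p}'^{\,\gamma}\prod_{\gamma'\in C_p\setminus\{\gamma\}}(X-b_{1,p}'^{\,\gamma'}).$$ They lie in $\mathbb{Q}(b'_1,b'_2,b'_3)[X]$, so each coefficient is a quotient of polynomials in $b'_1,b'_2,b'_3$ (numerator over denominator). Let $\mathcal{L}'_p\subset\Gamma(2,4)\backslash\mathcal{H}_2$ be the locus of principally polarized abelian surfaces modulo $\Gamma(2,4)$ that are $(p,p)$-isogenous to a surface with period matrix $\Omega'$ such that $\theta_0(\Omega'/2)=0$; explicitly, it is the set of classes of $\Omega$ for which there is $M\in\Gamma(2,4)$ with $\theta_0(pM\Omega/2)=0$. The polynomial $L'_p$ is the irreducible polynomial in $\mathbb{Q}[b'_1,b'_2,b'_3]$ (determined up to a nonzero constant) describing the locus $\mathcal{L}'_p$. *)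

theory Defs
  imports
    "HOL-Analysis.Analysis"
    "HOL-Computational_Algebra.Computational_Algebra"
    "HOL-Number_Theory.Cong"
begin

type_synonym cmat2 = "complex ^ 2 ^ 2"

(* A 4 x 4 matrix is indexed by the sum type 2 + 2, so that its 2 x 2 blocks are
   the restrictions along Inl and Inr. *)
type_synonym imat4 = "int ^ (2 + 2) ^ (2 + 2)"

definition blockA :: "imat4 \<Rightarrow> int ^ 2 ^ 2" where
  "blockA M = (\<chi> i j. M $ Inl i $ Inl j)"

definition blockB :: "imat4 \<Rightarrow> int ^ 2 ^ 2" where
  "blockB M = (\<chi> i j. M $ Inl i $ Inr j)"

definition blockC :: "imat4 \<Rightarrow> int ^ 2 ^ 2" where
  "blockC M = (\<chi> i j. M $ Inr i $ Inl j)"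

definition blockD :: "imat4 \<Rightarrow> int ^ 2 ^ 2" where
  "blockD M = (\<chi> i j. M $ Inr i $ Inr j)"

definition symplectic_form :: imat4 where
  "symplectic_form = (\<chi> i j. case (i, j) of
       (Inl k, Inr l) \<Rightarrow> (if k = l then 1 else 0)
     | (Inr k, Inl l) \<Rightarrow> (if k = l then - 1 else 0)
     | _ \<Rightarrow> 0)"

definition Sp4Z :: "imat4 set" where
  "Sp4Z = {M. transpose M ** symplectic_form ** M = symplectic_form}"

definition Gamma24 :: "imat4 set" where
  "Gamma24 = {M \<in> Sp4Z.
     (\<forall>i j. [M $ i $ j = (mat 1 :: imat4) $ i $ j] (mod 2)) \<and>
     (\<forall>i. [blockB M $ i $ i = 0] (mod 4)) \<and>
     (\<forall>i. [blockC M $ i $ i = 0] (mod 4))}"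

definition Gamma0 :: "nat \<Rightarrow> imat4 set" where
  "Gamma0 p = {M \<in> Sp4Z. \<forall>i j. [blockC M $ i $ j = 0] (mod int p)}"

definition siegel2 :: "cmat2 set" where
  "siegel2 = {\<Omega>. transpose \<Omega> = \<Omega> \<and>
     (\<forall>v :: real ^ 2. v \<noteq> 0 \<longrightarrow> v \<bullet> ((\<chi> i j. Im (\<Omega> $ i $ j)) *v v) > 0)}"

definition cmat_of_int :: "int ^ 2 ^ 2 \<Rightarrow> cmat2" where
  "cmat_of_int X = (\<chi> i j. of_int (X $ i $ j))"

definition act :: "imat4 \<Rightarrow> cmat2 \<Rightarrow> cmat2" where
  "act M \<Omega> = (cmat_of_int (blockA M) ** \<Omega> + cmat_of_int (blockB M)) **
      matrix_inv (cmat_of_int (blockC M) ** \<Omega> + cmat_of_int (blockD M))"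

definition theta_char :: "int ^ 2 \<Rightarrow> cmat2 \<Rightarrow> complex" where
  "theta_char b \<Omega> = (\<Sum>\<^sub>\<infinity>n :: int ^ 2.
     exp (\<i> * of_real pi * (\<Sum>i\<in>UNIV. \<Sum>j\<in>UNIV. of_int (n $ i) * \<Omega> $ i $ j * of_int (n $ j))
        + \<i> * of_real pi * of_int (\<Sum>i\<in>UNIV. n $ i * b $ i)))"

(* Meant for r < 4, where r = b0 + 2 * b1 with b0, b1 in {0, 1}. *)
definition theta :: "nat \<Rightarrow> cmat2 \<Rightarrow> complex" where
  "theta r = theta_char (vector [int (r mod 2), int (r div 2)])"

(* Division by 0 is 0, so the values at the poles theta 0 (\<Omega> / 2) = 0 carry no information;
   they are excluded wherever b' is used below. *)
definition b' :: "nat \<Rightarrow> cmat2 \<Rightarrow> complex" where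
  "b' r \<Omega> = theta r (\<Omega> /\<^sub>R 2) / theta 0 (\<Omega> /\<^sub>R 2)"

(* Polynomials in b'_1, b'_2, b'_3 over the rationals: the outermost variable is b'_1,
   the innermost one is b'_3. *)
type_synonym poly3 = "rat poly poly poly"

definition coeff3 :: "poly3 \<Rightarrow> nat \<Rightarrow> nat \<Rightarrow> nat \<Rightarrow> rat" where
  "coeff3 P i j k = coeff (coeff (coeff P i) j) k"

definition eval3 :: "poly3 \<Rightarrow> complex \<Rightarrow> complex \<Rightarrow> complex \<Rightarrow> complex" where
  "eval3 P x y z =
     poly (map_poly (\<lambda>Q. poly (map_poly (\<lambda>R. poly (map_poly of_rat R) z) Q) y) P) x"

definition eval_b' :: "poly3 \<Rightarrow> cmat2 \<Rightarrow> complex" where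
  "eval_b' P \<Omega> = eval3 P (b' 1 \<Omega>) (b' 2 \<Omega>) (b' 3 \<Omega>)"

definition is_coset_reps :: "nat \<Rightarrow> imat4 set \<Rightarrow> bool" where
  "is_coset_reps p R \<longleftrightarrow> R \<subseteq> Gamma24 \<and>
     (\<forall>\<delta>\<in>Gamma24. \<exists>!\<gamma>. \<gamma> \<in> R \<and> \<delta> \<in> (\<lambda>g. g ** \<gamma>) ` (Gamma24 \<inter> Gamma0 p))"

definition twist :: "nat \<Rightarrow> imat4 \<Rightarrow> (cmat2 \<Rightarrow> complex) \<Rightarrow> cmat2 \<Rightarrow> complex" where
  "twist p \<gamma> f \<Omega> = f (real p *\<^sub>R act \<gamma> \<Omega>)"

(* A polynomial in X over the modular functions is given by its value at each \<Omega>. *)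
definition Phi1 :: "nat \<Rightarrow> imat4 set \<Rightarrow> cmat2 \<Rightarrow> complex poly" where
  "Phi1 p R \<Omega> = (\<Prod>\<gamma>\<in>R. [:- twist p \<gamma> (b' 1) \<Omega>, 1:])"

definition Psi :: "nat \<Rightarrow> nat \<Rightarrow> imat4 set \<Rightarrow> cmat2 \<Rightarrow> complex poly" where
  "Psi r p R \<Omega> = (\<Sum>\<gamma>\<in>R. smult (twist p \<gamma> (b' r) \<Omega>)
     (\<Prod>\<gamma>'\<in>R - {\<gamma>}. [:- twist p \<gamma>' (b' 1) \<Omega>, 1:]))"

definition modular_poly :: "nat \<Rightarrow> nat \<Rightarrow> imat4 set \<Rightarrow> cmat2 \<Rightarrow> complex poly" where
  "modular_poly m p R = (if m = 1 then Phi1 p R else Psi m p R)"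

(* The points at which b'_r and all its twists b'_{r,p}^\<gamma> are given by their formulas. *)
definition regular_points :: "nat \<Rightarrow> imat4 set \<Rightarrow> cmat2 set" where
  "regular_points p R = {\<Omega> \<in> siegel2. theta 0 (\<Omega> /\<^sub>R 2) \<noteq> 0 \<and>
     (\<forall>\<gamma>\<in>R. theta 0 ((real p *\<^sub>R act \<gamma> \<Omega>) /\<^sub>R 2) \<noteq> 0)}"

(* The coefficient of X^l of the m-th modular polynomial equals N / D as a meromorphic function
   on the upper half-space. The points left out form a proper analytic subset, so equality at
   the remaining ones is equality of meromorphic functions. *)
definition coeff_is_quotient ::
    "nat \<Rightarrow> imat4 set \<Rightarrow> nat \<Rightarrow> nat \<Rightarrow> poly3 \<Rightarrow> poly3 \<Rightarrow> bool" where
  "coeff_is_quotient p R m l N D \<longleftrightarrow> D \<noteq> 0 \<and>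
     (\<forall>\<Omega>\<in>regular_points p R. eval_b' D \<Omega> \<noteq> 0 \<longrightarrow>
        coeff (modular_poly m p R \<Omega>) l = eval_b' N \<Omega> / eval_b' D \<Omega>)"

definition is_common_denominator :: "nat \<Rightarrow> imat4 set \<Rightarrow> poly3 \<Rightarrow> bool" where
  "is_common_denominator p R D \<longleftrightarrow>
     (\<forall>m\<in>{1, 2, 3}. \<forall>l. \<exists>N. coeff_is_quotient p R m l N D)"

(* The class of \<Omega> in the quotient of the upper half-space by Gamma(2,4). *)
definition Gamma24_class :: "cmat2 \<Rightarrow> cmat2 set" where
  "Gamma24_class \<Omega> = (\<lambda>M. act M \<Omega>) ` Gamma24"

definition isogeny_locus :: "nat \<Rightarrow> cmat2 set set" where
  "isogeny_locus p = {Gamma24_class \<Omega> | \<Omega>. \<Omega> \<in> siegel2 \<and>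
     (\<exists>M\<in>Gamma24. theta 0 ((real p *\<^sub>R act M \<Omega>) /\<^sub>R 2) = 0)}"

(* L cuts out the locus in the affine chart theta 0 (\<Omega> / 2) \<noteq> 0 on which
   (b'_1, b'_2, b'_3) are coordinates. *)
definition describes_locus :: "nat \<Rightarrow> poly3 \<Rightarrow> bool" where
  "describes_locus p L \<longleftrightarrow> (\<forall>\<Omega>\<in>siegel2. theta 0 (\<Omega> /\<^sub>R 2) \<noteq> 0 \<longrightarrow>
     (eval_b' L \<Omega> = 0 \<longleftrightarrow> Gamma24_class \<Omega> \<in> isogeny_locus p))"

definition is_L' :: "nat \<Rightarrow> poly3 \<Rightarrow> bool" where
  "is_L' p L \<longleftrightarrow> irreducible L \<and> describes_locus p L"

end

theory Submission
  imports Defs "HOL-Complex_Analysis.Complex_Analysis" "HOL-Computational_Algebra.Field_as_Ring"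
begin

text \<open>
  Let \<open>f\<^sub>c(\<Omega>)\<close> be the sum of \<open>exp(i \<pi> n\<Omega>n / 2)\<close> over the integer vectors \<open>n \<equiv> c\<close> modulo 2. The
  \<open>\<theta>\<^sub>b(\<Omega>/2)\<close> are the finite Fourier transforms of the \<open>f\<^sub>c\<close>, and up to a common factor the symplectic
  group acts on the \<open>f\<^sub>c\<close> by a Weil representation that is trivial on \<open>\<Gamma>(2,4)\<close>. Hence a lower
  unipotent matrix with \<open>C = pS\<close> multiplies \<open>b'\<^sub>b\<close> by a power of \<open>i\<close> that is linear in \<open>p\<cdot>bSb\<close>, while
  integral changes of basis permute the \<open>b'\<^sub>b\<close>. All these matrices normalise \<open>\<Gamma>(2,4)\<close> and \<open>\<Gamma>\<^sub>0(p)\<close>, so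
  they preserve the locus \<open>L'\<^sub>p = 0\<close>.

  A polynomial vanishing on the locus is divisible by \<open>L'\<^sub>p\<close>: otherwise elimination of \<open>b'\<^sub>1\<close> yields a
  nonzero relation between \<open>b'\<^sub>2\<close> and \<open>b'\<^sub>3\<close> on the locus, which is contradicted by the asymptotics along
  an explicit family of points isogenous to products of elliptic curves. So the homogeneous
  components and the permutations of \<open>L'\<^sub>p\<close> are constant multiples of \<open>L'\<^sub>p\<close>, which yields its exponents.
  The same unipotent matrices multiply the coefficients of the modular polynomials by powers of \<open>i\<close>,
  because the number \<open>p\<^sup>3 + p\<^sup>2 + p + 1\<close> of cosets is divisible by 4; as \<open>b'\<^sub>1, b'\<^sub>2, b'\<^sub>3\<close> are algebraically
  independent, this fixes the exponents of the numerators.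
\<close>

section \<open>Inversion of the one-variable theta series\<close>

text \<open>The analytic input is Jacobi's inversion in one variable: \<open>gJ\<close> inverts in
  the first variable only, and every other generator of \<open>Sp4Z\<close> acts on the
  \<open>fth\<close> by phases or reindexing. The constants in the transformation formulas are never
  computed, because only quotients of theta constants occur; it is enough that they do not vanish.
  \<open>Gamma24\<close> acts by scalars because its operators commute with the Heisenberg
  operators, which act irreducibly. Two obstacles shape the algebra. A unipotent matrix multiplies
  monomials by fourth roots of unity and so leads out of the rational polynomials; averaging over
  four such matrices gives instead a component of \<open>L\<close> that is again rational. And
  neither irreducibility nor dimension of the locus is available, so divisibility by
  \<open>L\<close> rests on one family of points for each degree bound, with a parameter
  \<open>l\<close> that grows with the bound and keeps the growth rates of all monomials apart. For
  the exponents it suffices to know \<open>i + k\<close> modulo 4 and the invariance under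
  permutations: a residue other than 0 would make all exponents odd and \<open>L\<close> a multiple
  of \<open>b' 3\<close>.\<close>

lemma holomorphic_on_infsum:
  fixes f :: "'i \<Rightarrow> complex \<Rightarrow> complex"
  assumes "open S" "\<And>n. n \<in> I \<Longrightarrow> f n holomorphic_on S"
    and bnd: "\<And>z. z \<in> S \<Longrightarrow> \<exists>r>0. \<exists>M. M summable_on I \<and> (\<forall>n\<in>I. \<forall>w\<in>cball z r. norm (f n w) \<le> M n)"
  shows "(\<lambda>w. \<Sum>\<^sub>\<infinity>n\<in>I. f n w) holomorphic_on S"
proof -
  have "\<exists>f'. ((\<lambda>w. \<Sum>\<^sub>\<infinity>n\<in>I. f n w) has_field_derivative f') (at z)" if z: "z \<in> S" for z
  proof -
  obtain r0 where r0: "r0 > 0" "cball z r0 \<subseteq> S"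
    using \<open>open S\<close> z open_contains_cball by blast
  obtain r M where r: "r > 0" "M summable_on I" "\<forall>n\<in>I. \<forall>w\<in>cball z r. norm (f n w) \<le> M n"
    using bnd[OF z] by blast
  define d where "d = min r r0"
  have d: "d > 0" "cball z d \<subseteq> S" "cball z d \<subseteq> cball z r"
    using r0 r by (auto simp: d_def)
  have ul: "uniform_limit (cball z d) (\<lambda>X w. \<Sum>n\<in>X. f n w) (\<lambda>w. \<Sum>\<^sub>\<infinity>n\<in>I. f n w) (finite_subsets_at_top I)"
    by (rule Weierstrass_m_test_general) (use r d in auto)
  have ev: "eventually (\<lambda>X. finite X \<and> X \<subseteq> I) (finite_subsets_at_top I)"
    by (rule eventually_finite_subsets_at_top_weakI) auto
  have "(\<lambda>w. \<Sum>\<^sub>\<infinity>n\<in>I. f n w) holomorphic_on ball z d"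
  proof (rule conjunct2[OF holomorphic_uniform_limit[OF _ ul]])
    show "\<forall>\<^sub>F n in finite_subsets_at_top I. continuous_on (cball z d) (\<lambda>w. \<Sum>n\<in>n. f n w) \<and>
        (\<lambda>w. \<Sum>n\<in>n. f n w) holomorphic_on ball z d"
      using ev
    proof eventually_elim
      case (elim X)
      have "(\<lambda>w. \<Sum>n\<in>X. f n w) holomorphic_on S"
        using elim assms(2) by (intro holomorphic_on_sum) auto
      thus ?case using d ball_subset_cball
        by (meson holomorphic_on_imp_continuous_on holomorphic_on_subset order_trans)
    qed
  qed auto
  moreover have "z \<in> ball z d" using d by simp
  ultimately show "\<exists>f'. ((\<lambda>w. \<Sum>\<^sub>\<infinity>n\<in>I. f n w) has_field_derivative f') (at z)"
    using holomorphic_on_imp_differentiable_at field_differentiable_def by blast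
  qed
  thus ?thesis using \<open>open S\<close> by (simp add: holomorphic_on_open)
qed

lemma summable_on_exp_neg_abs_int: "(\<lambda>m::int. exp (- \<bar>real_of_int m\<bar>)) summable_on UNIV"
proof -
  have g: "(\<lambda>n::nat. exp (- real n)) summable_on UNIV"
  proof -
    have "summable (\<lambda>n. exp (-1::real) ^ n)" by (rule summable_geometric) auto
    hence "summable (\<lambda>n::nat. exp (- real n))" by (simp add: exp_of_nat_mult[symmetric])
    thus ?thesis by (intro norm_summable_imp_summable_on) auto
  qed
  have "(\<lambda>m::int. exp (- \<bar>real_of_int m\<bar>)) summable_on range int"
    using g by (subst summable_on_reindex) (auto simp: o_def)
  moreover have "(\<lambda>m::int. exp (- \<bar>real_of_int m\<bar>)) summable_on range (\<lambda>n. - int n)"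
    using g by (subst summable_on_reindex) (auto simp: o_def inj_on_def)
  ultimately have "(\<lambda>m::int. exp (- \<bar>real_of_int m\<bar>)) summable_on (range int \<union> range (\<lambda>n. - int n))"
    by (rule summable_on_union)
  moreover have "range int \<union> range (\<lambda>n. - int n) = UNIV"
  proof -
    have "x \<in> range int \<union> range (\<lambda>n. - int n)" for x :: int
      by (cases "x \<ge> 0") (auto simp: image_iff intro: exI[of _ "nat x"] exI[of _ "nat (-x)"])
    thus ?thesis by blast
  qed
  ultimately show ?thesis by simp
qed

text \<open>The gap is the square of \<open>2 * a * \<bar>x\<bar> - (b + 1)\<close> over
  \<open>4 * a\<close>; the spare \<open>- \<bar>x\<bar>\<close> lets Gaussian sums be compared with
  a geometric series.\<close>

lemma quadratic_dominates_linear: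
  fixes a b x :: real assumes "a > 0"
  shows "b * \<bar>x\<bar> - a * x\<^sup>2 \<le> (b + 1)\<^sup>2 / (4 * a) - \<bar>x\<bar>"
proof -
  have "0 \<le> (2 * a * \<bar>x\<bar> - (b + 1))\<^sup>2 / (4 * a)" using assms by simp
  also have "\<dots> = a * x\<^sup>2 - (b + 1) * \<bar>x\<bar> + (b + 1)\<^sup>2 / (4 * a)"
    using assms by (simp add: field_simps power2_eq_square)
  finally show ?thesis by (simp add: algebra_simps)
qed

lemma summable_on_gaussian_int:
  fixes a b :: real assumes "a > 0"
  shows "(\<lambda>m::int. exp (b * \<bar>real_of_int m\<bar> - a * (real_of_int m)\<^sup>2)) summable_on UNIV"
proof (rule summable_on_comparison_test)
  show "(\<lambda>m::int. exp ((b + 1)\<^sup>2 / (4 * a)) * exp (- \<bar>real_of_int m\<bar>)) summable_on UNIV"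
    by (intro summable_on_cmult_right summable_on_exp_neg_abs_int)
  fix m :: int
  show "exp (b * \<bar>real_of_int m\<bar> - a * (real_of_int m)\<^sup>2) \<le> exp ((b + 1)\<^sup>2 / (4 * a)) * exp (- \<bar>real_of_int m\<bar>)"
    using quadratic_dominates_linear[OF assms, of b m] by (simp add: exp_add[symmetric])
qed auto

text \<open>Jacobi's theta function at modulus \<open>t / 2\<close> and argument
  \<open>w / 2\<close>. In this normalisation the period is 2, the quasi-period is \<open>t\<close>,
  and \<open>t\<close> is directly the first entry of the period matrix.\<close>

definition jtheta :: "complex \<Rightarrow> complex \<Rightarrow> complex" where
  "jtheta t w = (\<Sum>\<^sub>\<infinity>m::int. exp (\<i> * pi * t * (of_int m)\<^sup>2 / 2 + \<i> * pi * of_int m * w))"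

lemma norm_jtheta_term:
  "norm (exp (\<i> * pi * t * (of_int m)\<^sup>2 / 2 + \<i> * pi * of_int m * w)) =
   exp (- (pi * Im t / 2 * (real_of_int m)\<^sup>2) - pi * of_int m * Im w)"
proof -
  have "(complex_of_int m)\<^sup>2 = of_real ((real_of_int m)\<^sup>2)" by simp
  thus ?thesis by (simp add: Im_divide del: of_real_power)
qed

lemma jtheta_term_bound:
  assumes "\<bar>Im w\<bar> \<le> B"
  shows "norm (exp (\<i> * pi * t * (of_int m)\<^sup>2 / 2 + \<i> * pi * of_int m * w)) \<le>
   exp (pi * B * \<bar>real_of_int m\<bar> - pi * Im t / 2 * (real_of_int m)\<^sup>2)"
proof -
  have "- (of_int m * Im w) \<le> \<bar>real_of_int m\<bar> * \<bar>Im w\<bar>" 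
    by (metis abs_ge_minus_self abs_mult)
  also have "\<dots> \<le> \<bar>real_of_int m\<bar> * B" using assms by (intro mult_left_mono) auto
  finally have "pi * (- (of_int m * Im w)) \<le> pi * (\<bar>real_of_int m\<bar> * B)"
    by (intro mult_left_mono) auto
  thus ?thesis unfolding norm_jtheta_term by (simp add: mult_ac)
qed

lemma jtheta_uniform:
  assumes "Im t > 0"
  shows "uniform_limit (cball z r) (\<lambda>X w. \<Sum>m\<in>X. exp (\<i> * pi * t * (of_int m)\<^sup>2 / 2 + \<i> * pi * of_int m * w))
     (jtheta t) (finite_subsets_at_top UNIV)"
  unfolding jtheta_def
proof (rule Weierstrass_m_test_general)
  show "(\<lambda>m::int. exp (pi * (\<bar>Im z\<bar> + r) * \<bar>real_of_int m\<bar> - pi * Im t / 2 * (real_of_int m)\<^sup>2)) summable_on UNIV"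
    using assms by (intro summable_on_gaussian_int) auto
  fix m :: int and w assume w: "w \<in> cball z r"
  have "\<bar>Im w - Im z\<bar> \<le> r" using w abs_Im_le_cmod[of "w - z"] by (simp add: dist_norm norm_minus_commute)
  hence "\<bar>Im w\<bar> \<le> \<bar>Im z\<bar> + r" by linarith
  thus "norm (exp (\<i> * pi * t * (of_int m)\<^sup>2 / 2 + \<i> * pi * of_int m * w)) \<le>
     exp (pi * (\<bar>Im z\<bar> + r) * \<bar>real_of_int m\<bar> - pi * Im t / 2 * (real_of_int m)\<^sup>2)"
    by (rule jtheta_term_bound)
qed

lemma holomorphic_jtheta:
  assumes "Im t > 0" shows "jtheta t holomorphic_on UNIV"
  unfolding jtheta_def
proof (rule holomorphic_on_infsum)
  fix z :: complex
  have "norm (exp (\<i> * pi * t * (of_int n)\<^sup>2 / 2 + \<i> * pi * of_int n * w)) \<le>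
     exp (pi * (\<bar>Im z\<bar> + 1) * \<bar>real_of_int n\<bar> - pi * Im t / 2 * (real_of_int n)\<^sup>2)" if "w \<in> cball z 1" for n w
  proof (rule jtheta_term_bound)
    have "\<bar>Im w - Im z\<bar> \<le> 1" using that abs_Im_le_cmod[of "w - z"] by (simp add: dist_norm norm_minus_commute)
    thus "\<bar>Im w\<bar> \<le> \<bar>Im z\<bar> + 1" by linarith
  qed
  moreover have "(\<lambda>m::int. exp (pi * (\<bar>Im z\<bar> + 1) * \<bar>real_of_int m\<bar> - pi * Im t / 2 * (real_of_int m)\<^sup>2)) summable_on UNIV"
    using assms by (intro summable_on_gaussian_int) auto
  ultimately show "\<exists>r>0. \<exists>M. M summable_on UNIV \<and> (\<forall>n\<in>UNIV. \<forall>w\<in>cball z r. norm (exp (\<i> * pi * t * (of_int n)\<^sup>2 / 2 + \<i> * pi * of_int n * w)) \<le> M n)"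
    by (meson zero_less_one)
qed (auto intro!: holomorphic_intros)

lemma exp_pi_int: "exp (\<i> * pi * of_int m * 2) = 1" 
proof -
  have "\<i> * pi * of_int m * 2 = of_int (2*m) * pi * \<i>" by simp
  thus ?thesis using exp_integer_2pi[of "of_int m"] by (simp add: mult_ac)
qed

lemma jtheta_add_2: "jtheta t (w + 2) = jtheta t w"
  unfolding jtheta_def by (simp add: algebra_simps exp_add exp_pi_int[simplified mult_ac])

lemma jtheta_add_period: "jtheta t (w + t) = exp (- \<i> * pi * t / 2 - \<i> * pi * w) * jtheta t w"
proof -
  have eq: "\<i> * pi * t * (of_int m)\<^sup>2 / 2 + \<i> * pi * of_int m * (w + t) =
    (- \<i> * pi * t / 2 - \<i> * pi * w) + (\<i> * pi * t * (of_int (m+1))\<^sup>2 / 2 + \<i> * pi * of_int (m+1) * w)" for m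
    by (simp add: field_simps power2_eq_square)
  have "jtheta t (w + t) = (\<Sum>\<^sub>\<infinity>m::int. exp (- \<i> * pi * t / 2 - \<i> * pi * w) *
     exp (\<i> * pi * t * (of_int (m+1))\<^sup>2 / 2 + \<i> * pi * of_int (m+1) * w))"
    unfolding jtheta_def eq exp_add ..
  also have "\<dots> = exp (- \<i> * pi * t / 2 - \<i> * pi * w) * (\<Sum>\<^sub>\<infinity>m::int. 
     exp (\<i> * pi * t * (of_int (m+1))\<^sup>2 / 2 + \<i> * pi * of_int (m+1) * w))"
    by (rule infsum_cmult_right')
  also have "(\<Sum>\<^sub>\<infinity>m::int. exp (\<i> * pi * t * (of_int (m+1))\<^sup>2 / 2 + \<i> * pi * of_int (m+1) * w)) = jtheta t w"
    unfolding jtheta_def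
    by (rule infsum_reindex_bij_betw[of "\<lambda>m::int. m + 1" UNIV UNIV]) (auto intro: bij_plus_right simp: bij_betw_def inj_on_def surj_def intro: exI[of _ "_ - 1"])
  finally show ?thesis .
qed

text \<open>Written as a contour integral so that the path can be moved into the complex plane.
  There is no factor 1/2, so the constant 1 has coefficient 2 at index 0.\<close>

definition fourier :: "(complex \<Rightarrow> complex) \<Rightarrow> int \<Rightarrow> complex" where
  "fourier f m = contour_integral (linepath (-1) 1) (\<lambda>w. f w * exp (- \<i> * pi * of_int m * w))"

text \<open>For a primitive \<open>H\<close> the function \<open>H (w + 2) - H w\<close> has
  derivative zero, so its value is the same at every complex starting point
  \<open>a\<close>.\<close>

lemma periodic_integral_shift:
  assumes hol: "h holomorphic_on UNIV" and per: "\<And>w. h (w + 2) = h w"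
  shows "contour_integral (linepath a (a + 2)) h = contour_integral (linepath (-1) 1) h"
proof -
  obtain H where H: "\<And>x. (H has_field_derivative h x) (at x)"
    using holomorphic_convex_primitive'[of UNIV h] hol by auto
  have I: "contour_integral (linepath a b) h = H b - H a" for a b
  proof -
    have "(h has_contour_integral (H (pathfinish (linepath a b)) - H (pathstart (linepath a b)))) (linepath a b)"
      by (rule contour_integral_primitive[of UNIV]) (use H in auto)
    thus ?thesis by (simp add: contour_integral_unique)
  qed
  have "((\<lambda>w. H (w + 2) - H w) has_field_derivative 0) (at x within UNIV)" for x
  proof -
    have "((\<lambda>w. H (w + 2)) has_field_derivative h (x + 2) * 1) (at x)"
      by (rule DERIV_chain2[of H _ "\<lambda>w. w + 2"]) (auto intro!: derivative_eq_intros H)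
    from DERIV_diff[OF this H[of x]] show ?thesis by (simp add: per)
  qed
  hence "\<exists>c. \<forall>x\<in>UNIV. H (x + 2) - H x = c"
    by (intro has_field_derivative_zero_constant) auto
  then obtain c where c: "\<And>x. H (x + 2) - H x = c" by auto
  show ?thesis unfolding I using c[of a] c[of "-1"] by simp
qed

lemma fourier_kernel_periodic: "exp (- \<i> * pi * of_int m * (w + 2)) = exp (- \<i> * pi * of_int m * w)"
proof -
  have "- \<i> * pi * of_int m * (w + 2) = - \<i> * pi * of_int m * w + \<i> * pi * of_int (-m) * 2"
    by (simp add: algebra_simps)
  thus ?thesis by (simp only: exp_add exp_pi_int mult_1_right)
qed

text \<open>Moving the contour by a complex \<open>c\<close> serves three ends: translation of the
  function, decay of the coefficients (\<open>c\<close> imaginary) and the recursion that comes from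
  a quasi-period (\<open>c = t\<close>).\<close>

lemma fourier_shift:
  assumes hol: "f holomorphic_on UNIV" and per: "\<And>w. f (w + 2) = f w"
  shows "fourier f m = contour_integral (linepath (-1) 1) (\<lambda>w. f (w + c) * exp (- \<i> * pi * of_int m * (w + c)))"
proof -
  let ?h = "\<lambda>w. f w * exp (- \<i> * pi * of_int m * w)"
  have "?h holomorphic_on UNIV" using hol by (intro holomorphic_intros) auto
  hence "fourier f m = contour_integral (linepath (-1 + c) (-1 + c + 2)) ?h"
    unfolding fourier_def by (intro periodic_integral_shift[symmetric]) (simp_all only: per fourier_kernel_periodic)
  also have "linepath (-1 + c) (-1 + c + 2) = (+) c \<circ> linepath (-1) 1"
    by (auto simp: fun_eq_iff linepath_def algebra_simps scaleR_conv_of_real)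
  also have "contour_integral \<dots> ?h = contour_integral (linepath (-1) 1) (\<lambda>w. ?h (w + c))"
    unfolding contour_integral_translate by (simp add: add.commute)
  finally show ?thesis .
qed

lemma holomorphic_translate:
  fixes f :: "complex \<Rightarrow> complex"
  assumes "f holomorphic_on UNIV" shows "(\<lambda>w. f (w + c)) holomorphic_on UNIV"
proof -
  have "f \<circ> (\<lambda>w. w + c) holomorphic_on UNIV"
    by (rule holomorphic_on_compose_gen[of _ _ _ UNIV]) (use assms in \<open>auto intro!: holomorphic_intros\<close>)
  thus ?thesis by (simp add: o_def)
qed

lemma fourier_translate_zero:
  assumes "f holomorphic_on UNIV" "\<And>w. f (w + 2) = f w" "fourier f m = 0"
  shows "fourier (\<lambda>w. f (w + c)) m = 0"
proof -
  have "0 = contour_integral (linepath (-1) 1) (\<lambda>w. exp (- \<i> * pi * of_int m * c) * (f (w + c) * exp (- \<i> * pi * of_int m * w)))"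
    using fourier_shift[OF assms(1,2), of m c] assms(3) by (simp add: algebra_simps exp_add[symmetric] exp_diff)
  also have "\<dots> = exp (- \<i> * pi * of_int m * c) * fourier (\<lambda>w. f (w + c)) m"
    unfolding fourier_def
  proof (rule contour_integral_lmul)
    have "(\<lambda>w. f (w + c) * exp (- \<i> * pi * of_int m * w)) holomorphic_on UNIV"
      using holomorphic_translate[OF assms(1)] by (intro holomorphic_intros) auto
    thus "(\<lambda>w. f (w + c) * exp (- \<i> * pi * of_int m * w)) contour_integrable_on linepath (- 1) 1"
      by (intro contour_integrable_continuous_linepath) (auto intro: holomorphic_on_imp_continuous_on holomorphic_on_subset)
  qed
  finally show ?thesis by simp
qed

text \<open>The contour moves by one imaginary unit, up or down according to the sign of
  \<open>m\<close>, to where the kernel has modulus \<open>exp (- pi * \<bar>m\<bar>)\<close>; on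
  the moved segment \<open>h\<close> stays bounded.\<close>

lemma fourier_decay:
  assumes hol: "h holomorphic_on UNIV" and per: "\<And>w. h (w + 2) = h w"
  obtains C where "\<And>m. norm (fourier h m) \<le> C * exp (- pi * \<bar>real_of_int m\<bar>)"
proof -
  have "continuous_on UNIV h" using hol by (rule holomorphic_on_imp_continuous_on)
  hence "compact (h ` cball 0 2)"
    by (intro compact_continuous_image) (auto intro: continuous_on_subset)
  then obtain B where B: "\<And>w. w \<in> cball 0 2 \<Longrightarrow> norm (h w) \<le> B"
    using compact_imp_bounded bounded_iff by (metis imageI)
  have "norm (fourier h m) \<le> (2 * B) * exp (- pi * \<bar>real_of_int m\<bar>)" for m
  proof -
    define s :: real where "s = (if m \<ge> 0 then -1 else 1)"
    have s: "real_of_int m * s = - \<bar>real_of_int m\<bar>" "\<bar>s\<bar> = 1" by (auto simp: s_def)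
    let ?g = "\<lambda>w. h (w + \<i> * s) * exp (- \<i> * pi * of_int m * (w + \<i> * s))"
    have "?g holomorphic_on UNIV"
      using holomorphic_translate[OF hol] by (intro holomorphic_intros) auto
    hence int: "?g contour_integrable_on linepath (- 1) 1"
      by (intro contour_integrable_continuous_linepath) (auto intro: holomorphic_on_imp_continuous_on holomorphic_on_subset)
    have B0: "B \<ge> 0" using order_trans[OF norm_ge_zero B[of 0]] by simp
    have "norm (contour_integral (linepath (-1) 1) ?g) \<le> (B * exp (- pi * \<bar>real_of_int m\<bar>)) * norm (1 - (-1::complex))"
    proof (rule contour_integral_bound_linepath[OF int])
      show "0 \<le> B * exp (- pi * \<bar>real_of_int m\<bar>)" using B0 by simp
      fix x :: complex assume x: "x \<in> closed_segment (- 1) 1"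
      have "closed_segment (-1) 1 \<subseteq> cball (0::complex) 1"
        by (intro closed_segment_subset) auto
      hence "norm x \<le> 1" using x by auto
      moreover have "closed_segment (-1) 1 \<subseteq> {z. Im z = 0}"
        by (intro closed_segment_subset) (auto simp: convex_def)
      ultimately have x1: "norm x \<le> 1" "Im x = 0" using x by auto
      have "norm (x + \<i> * s) \<le> 1 + norm (\<i> * s)" using x1 norm_triangle_ineq order_trans by (metis add_right_mono)
      hence "norm (x + \<i> * s) \<le> 2" using s by (simp add: norm_mult)
      hence "norm (h (x + \<i> * s)) \<le> B" by (intro B) auto
      moreover have "norm (exp (- \<i> * pi * of_int m * (x + \<i> * s))) = exp (pi * (real_of_int m * s))"
        using x1 by simp
      hence "norm (exp (- \<i> * pi * of_int m * (x + \<i> * s))) = exp (- pi * \<bar>real_of_int m\<bar>)" by (simp only: s) simp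
      ultimately show "norm (?g x) \<le> B * exp (- pi * \<bar>real_of_int m\<bar>)"
        unfolding norm_mult by (intro mult_mono) (use B0 in auto)
    qed
    thus ?thesis using fourier_shift[OF hol per, of m "\<i> * s"] by (simp add: mult_ac)
  qed
  thus ?thesis using that by blast
qed

lemma fourier_const:
  assumes "m \<noteq> 0" shows "fourier (\<lambda>w. c) m = 0"
proof -
  have "((\<lambda>w. c * exp (- \<i> * pi * of_int m * w)) has_contour_integral 
     (c * exp (- \<i> * pi * of_int m * 1) / (- \<i> * pi * of_int m) - c * exp (- \<i> * pi * of_int m * (-1)) / (- \<i> * pi * of_int m))) (linepath (-1) 1)"
    using contour_integral_primitive[of UNIV "\<lambda>w. c * exp (- \<i> * pi * of_int m * w) / (- \<i> * pi * of_int m)" "\<lambda>w. c * exp (- \<i> * pi * of_int m * w)" "linepath (-1) 1"]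
    using assms by (force intro!: derivative_eq_intros simp: field_simps)
  moreover have "exp (- \<i> * pi * of_int m * 1) = exp (- \<i> * pi * of_int m * (-1))"
    using fourier_kernel_periodic[of m "-1"] by simp
  ultimately show ?thesis unfolding fourier_def by (simp add: contour_integral_unique)
qed

lemma exp_pi_eq_1_iff: "exp (\<i> * pi * w) = 1 \<longleftrightarrow> (\<exists>n::int. w = 2 * of_int n)"
proof -
  have "exp (\<i> * pi * w) = exp 0 \<longleftrightarrow> (\<exists>n::int. \<i> * pi * w = \<i> * pi * (2 * of_int n))"
    unfolding exp_eq by (simp add: mult_ac)
  thus ?thesis by simp
qed

text \<open>Chernoff's proof of pointwise convergence: writing \<open>f - f 0 = (exp (\<i> \<pi> w) - 1) h\<close> with \<open>h\<close>
  entire and periodic makes the Fourier coefficients of \<open>f\<close> telescope.\<close>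
lemma fourier_zero_imp_zero_at_0:
  assumes hol: "f holomorphic_on UNIV" and per: "\<And>w. f (w + 2) = f w" and z: "\<And>m. fourier f m = 0"
  shows "f 0 = 0"
proof -
  define F where "F = (\<lambda>w. f w - f 0)"
  define G :: "complex \<Rightarrow> complex" where "G = (\<lambda>w. exp (\<i> * pi * w) - 1)"
  \<comment> \<open>\<open>G\<close> has only simple zeros and \<open>F\<close> vanishes at each of
    them, so the quotient of the derivatives fills the removable singularities.\<close>
  define h where "h = (\<lambda>w. if G w = 0 then deriv F w / deriv G w else F w / G w)"
  have holF: "F holomorphic_on UNIV" unfolding F_def using hol by (intro holomorphic_intros)
  have holG: "G holomorphic_on UNIV" unfolding G_def by (intro holomorphic_intros)
  have perF: "F (w + 2) = F w" for w by (simp add: F_def per)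
  have perG: "G (w + 2) = G w" for w
    using exp_pi_int[of 1] by (simp add: G_def algebra_simps exp_add)
  have dG: "deriv G w = \<i> * pi * exp (\<i> * pi * w)" for w
    unfolding G_def by (rule DERIV_imp_deriv) (auto intro!: derivative_eq_intros)
  have dper: "deriv k (w + 2) = deriv k w" if "k holomorphic_on UNIV" "\<And>w. k (w + 2) = k w" for k w
  proof -
    have "(k has_field_derivative deriv k (w + 2)) (at (w + 2))"
      using that(1) holomorphic_derivI by blast
    hence "((\<lambda>w. k (w + 2)) has_field_derivative deriv k (w + 2) * 1) (at w)"
      by (intro DERIV_chain2[of k _ "\<lambda>w. w + 2"]) (auto intro!: derivative_eq_intros)
    thus ?thesis using that(2) by (simp add: DERIV_imp_deriv)
  qed
  have zG: "G w = 0 \<longleftrightarrow> (\<exists>n::int. w = 2 * of_int n)" for w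
    using exp_pi_eq_1_iff[of w] by (simp add: G_def)
  have fper: "f (2 * of_int n) = f 0" for n :: int
  proof (induction n rule: int_induct[of _ 0])
    case (step1 i)
    thus ?case using per[of "2 * of_int i"] by (simp add: algebra_simps)
  next
    case (step2 i)
    thus ?case using per[of "2 * of_int (i-1)"] by (simp add: algebra_simps)
  qed simp
  have zF: "F w = 0" if "G w = 0" for w using that fper by (auto simp: zG F_def)
  have h_eq: "F w = G w * h w" for w using zF by (auto simp: h_def)
  have perh: "h (w + 2) = h w" for w by (simp add: h_def perF perG dper[OF holF perF] dper[OF holG perG])
  have slope: "(\<lambda>w. if w = a then deriv k a else k w / (w - a)) holomorphic_on UNIV"
    if "k holomorphic_on UNIV" "k a = 0" for k and a :: complex
    by (rule pole_theorem_open_0[of k UNIV a]) (use that in auto)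
  have holh: "h holomorphic_on UNIV"
  proof -
    have "h holomorphic_on ball a 1" for a
    proof (cases "\<exists>c\<in>ball a 1. G c = 0")
      case False
      hence "(\<lambda>w. F w / G w) holomorphic_on ball a 1"
        using holF holG by (intro holomorphic_intros) (auto intro: holomorphic_on_subset)
      thus ?thesis using False by (rule_tac holomorphic_transform) (auto simp: h_def)
    next
      case True
      then obtain c where c: "c \<in> ball a 1" "G c = 0" by blast
      let ?F = "\<lambda>w. if w = c then deriv F c else F w / (w - c)"
      let ?G = "\<lambda>w. if w = c then deriv G c else G w / (w - c)"
      \<comment> \<open>The zeros of \<open>G\<close> are the even integers, at mutual distance at
        least 2; an open ball of radius 1 contains at most the one zero \<open>c\<close>.\<close>
      have nz: "?G w \<noteq> 0" if "w \<in> ball a 1" for w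
      proof (cases "w = c")
        case False
        have "G w \<noteq> 0"
        proof
          assume "G w = 0"
          then obtain n m :: int where nm: "w = 2 * of_int n" "c = 2 * of_int m" using c zG by blast
          hence "n \<noteq> m" using False by auto
          hence "1 \<le> \<bar>n - m\<bar>" by linarith
          hence "(1::real) \<le> \<bar>of_int (n - m)\<bar>" by linarith
          hence "2 \<le> norm (2 * of_int (n - m) :: complex)" unfolding norm_mult norm_of_int by simp
          hence "2 \<le> dist w c" by (simp add: nm dist_norm algebra_simps)
          moreover have "dist w c < 1 + 1" using that c dist_triangle_less_add[of w a 1 c 1] by (simp add: dist_commute)
          ultimately show False by simp
        qed
        thus ?thesis using False by simp
      qed (simp add: dG)
      have "(\<lambda>w. ?F w / ?G w) holomorphic_on ball a 1"
        by (intro holomorphic_intros nz holomorphic_on_subset[OF slope[OF holF zF[OF c(2)]]]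
           holomorphic_on_subset[OF slope[OF holG c(2)]]) auto
      moreover have "?F w / ?G w = h w" if "w \<in> ball a 1" for w
        using nz[OF that] c(2) by (auto simp: h_def)
      ultimately show ?thesis by (rule holomorphic_transform)
    qed
    hence "h analytic_on UNIV" unfolding analytic_on_def by (meson zero_less_one)
    thus ?thesis by (rule analytic_imp_holomorphic)
  qed
  have fint: "(\<lambda>w. k w * exp (- \<i> * pi * of_int m * w)) contour_integrable_on linepath (- 1) 1"
    if "k holomorphic_on UNIV" for k m
    using that by (intro contour_integrable_continuous_linepath)
      (auto intro!: continuous_intros intro: holomorphic_on_imp_continuous_on holomorphic_on_subset)
  \<comment> \<open>Multiplication by \<open>exp (\<i> * pi * w)\<close> shifts the index by one, so
    the coefficients of \<open>F = G * h\<close> are differences of consecutive coefficients of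
    \<open>h\<close>.\<close>
  have rec: "fourier h (m - 1) - fourier h m = - fourier (\<lambda>w. f 0) m" for m
  proof -
    have "fourier F m = contour_integral (linepath (-1) 1) (\<lambda>w. h w * exp (- \<i> * pi * of_int (m-1) * w) - h w * exp (- \<i> * pi * of_int m * w))"
      unfolding fourier_def h_eq G_def by (simp add: algebra_simps exp_add[symmetric])
    also have "\<dots> = fourier h (m - 1) - fourier h m"
      unfolding fourier_def by (rule contour_integral_diff[OF fint[OF holh] fint[OF holh]])
    finally have 1: "fourier F m = fourier h (m - 1) - fourier h m" .
    have "fourier F m = contour_integral (linepath (-1) 1) (\<lambda>w. f w * exp (- \<i> * pi * of_int m * w) - f 0 * exp (- \<i> * pi * of_int m * w))"
      unfolding fourier_def F_def by (simp add: algebra_simps)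
    also have "\<dots> = fourier f m - fourier (\<lambda>w. f 0) m"
      unfolding fourier_def by (rule contour_integral_diff[OF fint[OF hol] fint[of "\<lambda>w. f 0"]]) auto
    finally show ?thesis using 1 z by simp
  qed
  obtain C where C: "\<And>m. norm (fourier h m) \<le> C * exp (- pi * \<bar>real_of_int m\<bar>)"
    using fourier_decay[OF holh perh] by blast
  have small: "c = 0" if "\<And>n::nat. norm c \<le> C * exp (- pi * real n)" for c :: complex
  proof -
    have e: "C * exp (- pi) ^ n = C * exp (- pi * real n)" for n by (simp add: exp_of_nat_mult[symmetric] mult_ac)
    have "(\<lambda>n::nat. C * exp (- pi) ^ n) \<longlonglongrightarrow> C * 0"
      by (intro tendsto_mult tendsto_const LIMSEQ_power_zero) auto
    hence lim: "(\<lambda>n::nat. C * exp (- pi * real n)) \<longlonglongrightarrow> 0" by (simp only: e mult_zero_right)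
    have "norm c \<le> 0"
      by (rule LIMSEQ_le_const[OF lim]) (use that in blast)
    thus ?thesis by simp
  qed
  \<comment> \<open>The coefficients of \<open>h\<close> are constant on \<open>m \<ge> 0\<close>
    and on \<open>m \<le> -1\<close>. Decay makes both constants zero, and the relation at
    \<open>m = 0\<close> then reads \<open>f 0 = 0\<close>.\<close>
  have step: "fourier h (m - 1) = fourier h m" if "m \<noteq> 0" for m
    using rec[of m] fourier_const[OF that] by simp
  have "fourier h (int n) = fourier h 0" for n
    by (induction n) (use step[of "1 + int _"] in auto)
  hence 0: "fourier h 0 = 0" using C[of "int _"] by (intro small) (metis abs_of_nat of_int_of_nat_eq)
  have "fourier h (- 1 - int n) = fourier h (-1)" for n
    by (induction n) (use step[of "- 1 - int _"] in \<open>auto simp: algebra_simps\<close>)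
  hence 1: "fourier h (-1) = 0"
  proof (intro small)
    fix n :: nat
    assume *: "\<And>n. fourier h (- 1 - int n) = fourier h (-1)"
    have "C \<ge> 0" using order_trans[OF norm_ge_zero C[of 0]] by simp
    have "norm (fourier h (-1)) \<le> C * exp (- pi * \<bar>real_of_int (- 1 - int n)\<bar>)" using C[of "-1 - int n"] * by simp
    also have "\<dots> \<le> C * exp (- pi * real n)" using \<open>C \<ge> 0\<close> by (intro mult_left_mono) auto
    finally show "norm (fourier h (-1)) \<le> C * exp (- pi * real n)" .
  qed
  have "fourier (\<lambda>w. f 0) 0 = 2 * f 0" unfolding fourier_def by simp
  thus ?thesis using rec[of 0] 0 1 by simp
qed

lemma fourier_zero_imp_zero:
  assumes "f holomorphic_on UNIV" "\<And>w. f (w + 2) = f w" "\<And>m. fourier f m = 0"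
  shows "f c = 0"
proof -
  have "(\<lambda>w. f (w + c)) 0 = 0"
  proof (rule fourier_zero_imp_zero_at_0)
    show "(\<lambda>w. f (w + c)) holomorphic_on UNIV"
      by (rule holomorphic_translate) fact
    show "f (w + 2 + c) = f (w + c)" for w using assms(2)[of "w + c"] by (simp add: algebra_simps)
  qed (use fourier_translate_zero assms in blast)
  thus ?thesis by simp
qed

text \<open>The quasi-period relates the coefficients at \<open>m\<close> and \<open>m + 1\<close>
  by a nonzero factor, so all of them vanish with the one at 0. The solution space is thus at most
  one-dimensional.\<close>

lemma theta_functional_equation_unique:
  assumes hol: "f holomorphic_on UNIV" and per: "\<And>w. f (w + 2) = f w"
    and qper: "\<And>w. f (w + t) = exp (- \<i> * pi * t / 2 - \<i> * pi * w) * f w"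
    and "fourier f 0 = 0"
  shows "f w = 0"
proof -
  have rec: "fourier f m = exp (- \<i> * pi * t / 2 - \<i> * pi * of_int m * t) * fourier f (m + 1)" for m
  proof -
    have "fourier f m = contour_integral (linepath (-1) 1) (\<lambda>w. exp (- \<i> * pi * t / 2 - \<i> * pi * of_int m * t) * (f w * exp (- \<i> * pi * of_int (m + 1) * w)))"
    proof -
      have "f (w + t) * exp (- \<i> * pi * of_int m * (w + t)) = exp (- \<i> * pi * t / 2 - \<i> * pi * of_int m * t) * (f w * exp (- \<i> * pi * of_int (m + 1) * w))" for w
      proof -
        have "exp (- \<i> * pi * t / 2 - \<i> * pi * w) * exp (- \<i> * pi * of_int m * (w + t)) = exp (- \<i> * pi * t / 2 - \<i> * pi * of_int m * t) * exp (- \<i> * pi * of_int (m + 1) * w)"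
          unfolding exp_add[symmetric] by (rule arg_cong[where f = exp]) (simp add: algebra_simps)
        thus ?thesis unfolding qper by (metis mult.assoc mult.commute)
      qed
      thus ?thesis unfolding fourier_shift[OF hol per, of m t] by simp
    qed
    also have "\<dots> = exp (- \<i> * pi * t / 2 - \<i> * pi * of_int m * t) * fourier f (m + 1)"
      unfolding fourier_def
    proof (rule contour_integral_lmul, intro contour_integrable_continuous_linepath continuous_intros)
      show "continuous_on (closed_segment (- 1) 1) f"
        using hol holomorphic_on_imp_continuous_on holomorphic_on_subset by blast
    qed
    finally show ?thesis .
  qed
  have "fourier f m = 0" for m
  proof (induction m rule: int_induct[of _ 0])
    case (step1 i) thus ?case using rec[of i] by simp
  next
    case (step2 i) thus ?case using rec[of "i - 1"] by simp
  qed (use assms in simp)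
  thus ?thesis using fourier_zero_imp_zero[OF hol per] by blast
qed

text \<open>Uniform convergence on the segment permits termwise integration, and only the term
  \<open>m = 0\<close> survives.\<close>

lemma fourier_jtheta:
  assumes "Im t > 0" shows "fourier (jtheta t) 0 = 2"
proof -
  let ?g = "\<lambda>m w. exp (\<i> * pi * t * (of_int m)\<^sup>2 / 2 + \<i> * pi * of_int m * w)"
  let ?S = "\<lambda>X w. \<Sum>m\<in>X. ?g m w"
  have gint: "?g m contour_integrable_on linepath (-1) 1" for m
    by (intro contour_integrable_continuous_linepath continuous_intros)
  have gval: "contour_integral (linepath (-1) 1) (?g m) = (if m = 0 then 2 else 0)" for m
  proof (cases "m = 0")
    case False
    have "contour_integral (linepath (-1) 1) (?g m) = fourier (\<lambda>w. exp (\<i> * pi * t * (of_int m)\<^sup>2 / 2)) (-m)"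
      unfolding fourier_def by (simp add: exp_add)
    thus ?thesis using False fourier_const[of "-m"] by simp
  qed simp
  have ul: "uniform_limit (path_image (linepath (-1) 1)) ?S (jtheta t) (finite_subsets_at_top UNIV)"
    by (rule uniform_limit_on_subset[OF jtheta_uniform[OF assms, of 0 1]]) (use closed_segment_subset[of "-1::complex" "cball 0 1" 1] in auto)
  have "((\<lambda>X. contour_integral (linepath (-1) 1) (?S X)) \<longlongrightarrow> contour_integral (linepath (-1) 1) (jtheta t)) (finite_subsets_at_top UNIV)"
  proof (rule contour_integral_uniform_limit(2)[OF _ ul])
    show "\<forall>\<^sub>F X in finite_subsets_at_top UNIV. ?S X contour_integrable_on linepath (-1) 1"
      by (rule eventually_finite_subsets_at_top_weakI) (auto intro!: contour_integrable_sum gint)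
    show "norm (vector_derivative (linepath (- 1 :: complex) 1) (at x)) \<le> 2" for x :: real by simp
  qed auto
  moreover have "((\<lambda>X. contour_integral (linepath (-1) 1) (?S X)) \<longlongrightarrow> 2) (finite_subsets_at_top UNIV)"
  proof (rule tendsto_eventually)
  show "\<forall>\<^sub>F X in finite_subsets_at_top UNIV. contour_integral (linepath (-1) 1) (?S X) = 2"
  proof -
    have "\<forall>\<^sub>F X in finite_subsets_at_top UNIV. finite X \<and> {0::int} \<subseteq> X \<and> X \<subseteq> UNIV"
      unfolding eventually_finite_subsets_at_top by (intro exI[of _ "{0}"]) auto
    thus ?thesis
    proof eventually_elim
      case (elim X)
      hence "contour_integral (linepath (-1) 1) (?S X) = (\<Sum>m\<in>X. if m = 0 then 2 else 0)"
        using gint gval by (subst contour_integral_sum) auto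
      thus ?case using elim by simp
    qed
  qed
  qed
  ultimately have "contour_integral (linepath (-1) 1) (jtheta t) = 2"
    by (rule tendsto_unique[OF finite_subsets_at_top_neq_bot])
  thus ?thesis by (simp add: fourier_def)
qed

text \<open>Both sides are entire in \<open>w\<close>, have period 2 and the same multiplier under
  \<open>w + t\<close>, hence are proportional. The factor, classically a constant times a square
  root of \<open>t\<close>, is left undetermined: only its nonvanishing and its independence of
  \<open>w\<close> are used.\<close>

theorem jacobi_inversion:
  assumes t: "Im t > 0"
  obtains \<kappa> where "\<kappa> \<noteq> 0"
    "\<And>w. (\<Sum>\<^sub>\<infinity>n::int. exp (- \<i> * pi * (2 * of_int n - w)\<^sup>2 / (2 * t))) = \<kappa> * jtheta t w"
proof -
  define E where "E = (\<lambda>w. \<Sum>\<^sub>\<infinity>n::int. exp (- \<i> * pi * (2 * of_int n - w)\<^sup>2 / (2 * t)))"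
  have t0: "t \<noteq> 0" using t by auto
  have t': "Im (- 4 / t) > 0" using t by (simp add: Im_divide sum_power2_gt_zero_iff zero_less_divide_iff)
  \<comment> \<open>Completing the square makes \<open>E\<close> a Gaussian times the theta function
    of the inverted modulus, so that \<open>E\<close> is entire.\<close>
  have E_eq: "E w = exp (- \<i> * pi * w\<^sup>2 / (2 * t)) * jtheta (-4/t) (2 * w / t)" for w
  proof -
    have "- \<i> * pi * (2 * of_int n - w)\<^sup>2 / (2 * t) = - \<i> * pi * w\<^sup>2 / (2 * t) +
       (\<i> * pi * (-4/t) * (of_int n)\<^sup>2 / 2 + \<i> * pi * of_int n * (2 * w / t))" for n
      using t0 by (simp add: field_simps power2_eq_square)
    thus ?thesis unfolding E_def jtheta_def by (simp only: exp_add infsum_cmult_right')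
  qed
  have holE: "E holomorphic_on UNIV"
  proof -
    have hh: "(\<lambda>w. jtheta (-4/t) (2 * w / t)) holomorphic_on UNIV"
    proof -
      have "jtheta (-4/t) \<circ> (\<lambda>w. 2 * w / t) holomorphic_on UNIV"
        by (rule holomorphic_on_compose_gen[of _ _ _ UNIV]) (use holomorphic_jtheta[OF t'] t0 in \<open>auto intro!: holomorphic_intros\<close>)
      thus ?thesis by (simp add: o_def)
    qed
    have "(\<lambda>w. exp (- \<i> * pi * w\<^sup>2 / (2 * t)) * jtheta (-4/t) (2 * w / t)) holomorphic_on UNIV"
      by (intro holomorphic_intros hh) (use t0 in auto)
    moreover have "E = (\<lambda>w. exp (- \<i> * pi * w\<^sup>2 / (2 * t)) * jtheta (-4/t) (2 * w / t))" by (rule ext) (rule E_eq)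
    ultimately show ?thesis by (simp only:)
  qed
  have perE: "E (w + 2) = E w" for w
  proof -
    have "E (w + 2) = (\<Sum>\<^sub>\<infinity>n::int. exp (- \<i> * pi * (2 * of_int (n - 1) - w)\<^sup>2 / (2 * t)))"
      unfolding E_def by (simp add: algebra_simps)
    also have "\<dots> = E w"
      unfolding E_def
      by (rule infsum_reindex_bij_betw[of "\<lambda>n::int. n - 1" UNIV UNIV]) (auto simp: bij_betw_def inj_on_def surj_def intro: exI[of _ "_ + 1"])
    finally show ?thesis .
  qed
  have qperE: "E (w + t) = exp (- \<i> * pi * t / 2 - \<i> * pi * w) * E w" for w
  proof -
    have "exp (- \<i> * pi * (2 * of_int n - (w + t))\<^sup>2 / (2 * t)) = exp (- \<i> * pi * t / 2 - \<i> * pi * w) * exp (- \<i> * pi * (2 * of_int n - w)\<^sup>2 / (2 * t))" for n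
    proof -
      have "- \<i> * pi * (2 * of_int n - (w + t))\<^sup>2 / (2 * t) = (- \<i> * pi * t / 2 - \<i> * pi * w) + (- \<i> * pi * (2 * of_int n - w)\<^sup>2 / (2 * t)) + \<i> * pi * of_int n * 2"
        using t0 by (simp add: field_simps power2_eq_square)
      thus ?thesis by (simp only: exp_add exp_pi_int mult_1_right)
    qed
    thus ?thesis unfolding E_def by (simp only: infsum_cmult_right')
  qed
  define \<kappa> where "\<kappa> = fourier E 0 / 2"
  have eq: "E w = \<kappa> * jtheta t w" for w
  proof -
    have "E w - \<kappa> * jtheta t w = 0"
    proof (rule theta_functional_equation_unique[of "\<lambda>w. E w - \<kappa> * jtheta t w" t w])
      show "(\<lambda>w. E w - \<kappa> * jtheta t w) holomorphic_on UNIV"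
        using holE holomorphic_jtheta[OF t] by (intro holomorphic_intros)
      have ci: "(\<lambda>w. k w) contour_integrable_on linepath (- 1) 1" if "k holomorphic_on UNIV" for k
        using that by (intro contour_integrable_continuous_linepath) (auto intro: holomorphic_on_imp_continuous_on holomorphic_on_subset)
      have "fourier (\<lambda>w. E w - \<kappa> * jtheta t w) 0 = fourier E 0 - \<kappa> * fourier (jtheta t) 0"
        unfolding fourier_def using ci[OF holE] ci[OF holomorphic_jtheta[OF t]]
        by (simp add: contour_integral_diff contour_integral_lmul contour_integrable_lmul)
      thus "fourier (\<lambda>w. E w - \<kappa> * jtheta t w) 0 = 0" by (simp add: fourier_jtheta[OF t] \<kappa>_def)
      show "E (v + 2) - \<kappa> * jtheta t (v + 2) = E v - \<kappa> * jtheta t v" for v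
        by (simp only: perE jtheta_add_2)
      show "E (v + t) - \<kappa> * jtheta t (v + t) = exp (- \<i> * pi * t / 2 - \<i> * pi * v) * (E v - \<kappa> * jtheta t v)" for v
        unfolding qperE jtheta_add_period[of t] by (simp only: right_diff_distrib mult.left_commute)
    qed
    thus ?thesis by simp
  qed
  \<comment> \<open>Were the factor zero, the theta function with modulus \<open>-4 / t\<close>
    would vanish identically, against its zeroth coefficient 2.\<close>
  moreover have "\<kappa> \<noteq> 0"
  proof
    assume "\<kappa> = 0"
    hence *: "jtheta (-4/t) (2 * w / t) = 0" for w using eq[of w] E_eq[of w] by simp
    have "jtheta (-4/t) w = 0" for w using *[of "t * w / 2"] t0 by simp
    hence "jtheta (-4/t) = (\<lambda>w. 0)" by auto
    thus False using fourier_jtheta[OF t'] by (simp add: fourier_def)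
  qed
  ultimately show ?thesis using that[of \<kappa>] by (simp only: E_def) blast
qed

section \<open>Generators of the symplectic group and their action\<close>

definition M2 :: "'a \<Rightarrow> 'a \<Rightarrow> 'a \<Rightarrow> 'a \<Rightarrow> 'a::zero ^ 2 ^ 2" where
  "M2 a b c d = vector [vector [a, b], vector [c, d]]"

lemma M2_nth [simp]: "M2 a b c d $ 1 $ 1 = a" "M2 a b c d $ 1 $ 2 = b" "M2 a b c d $ 2 $ 1 = c" "M2 a b c d $ 2 $ 2 = d"
  by (simp_all add: M2_def)

lemma M2_eq_iff: "X = Y \<longleftrightarrow> X $ 1 $ 1 = Y $ 1 $ 1 \<and> X $ 1 $ 2 = Y $ 1 $ 2 \<and> X $ 2 $ 1 = Y $ 2 $ 1 \<and> X $ 2 $ 2 = Y $ 2 $ 2"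
  for X :: "'a ^ 2 ^ 2"
  by (auto simp: vec_eq_iff forall_2)

lemma M2_eq [simp]: "M2 a b c d = M2 a' bb c' d' \<longleftrightarrow> a = a' \<and> b = bb \<and> c = c' \<and> d = d'"
  by (simp add: M2_eq_iff)

lemma M2_cases: obtains a b c d where "X = M2 a b c d"
proof -
  have "X = M2 (X $ 1 $ 1) (X $ 1 $ 2) (X $ 2 $ 1) (X $ 2 $ 2)" by (simp add: M2_eq_iff)
  thus ?thesis using that by blast
qed

lemma M2_mult [simp]: "M2 a b c d ** M2 a' bb c' d' =
    M2 (a * a' + b * c') (a * bb + b * d') (c * a' + d * c') (c * bb + d * d')"
  by (simp add: M2_eq_iff matrix_matrix_mult_def sum_2)

lemma M2_arith [simp]: "M2 a b c d + M2 a' bb c' d' = M2 (a + a') (b + bb) (c + c') (d + d')"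
  "M2 e f g h - M2 e' f' g' h' = M2 (e - e') (f - f') (g - g') (h - h' :: 'b :: ab_group_add)"
  "- M2 e f g h = M2 (- e) (- f) (- g) (- h :: 'b :: ab_group_add)"
  by (simp_all add: M2_eq_iff)

lemma transpose_M2 [simp]: "transpose (M2 a b c d) = M2 a c b d"
  by (simp add: M2_eq_iff transpose_def)

lemma mat_1_M2: "mat 1 = M2 1 0 0 1"
  by (simp add: M2_eq_iff mat_def)

lemma zero_M2: "0 = M2 0 0 0 0"
  by (simp add: M2_eq_iff)

lemma scaleR_M2 [simp]: "r *\<^sub>R M2 a b c d = M2 (r *\<^sub>R a) (r *\<^sub>R b) (r *\<^sub>R c) (r *\<^sub>R (d :: 'a :: real_vector))"
  by (simp add: M2_eq_iff)

lemma cmat_of_int_M2 [simp]: "cmat_of_int (M2 a b c d) = M2 (of_int a) (of_int b) (of_int c) (of_int d)"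
  by (simp add: M2_eq_iff cmat_of_int_def)

definition bm :: "int ^ 2 ^ 2 \<Rightarrow> int ^ 2 ^ 2 \<Rightarrow> int ^ 2 ^ 2 \<Rightarrow> int ^ 2 ^ 2 \<Rightarrow> imat4" where
  "bm A B C D = (\<chi> i j. case i of
      Inl k \<Rightarrow> (case j of Inl l \<Rightarrow> A $ k $ l | Inr l \<Rightarrow> B $ k $ l)
    | Inr k \<Rightarrow> (case j of Inl l \<Rightarrow> C $ k $ l | Inr l \<Rightarrow> D $ k $ l))"

lemma block_bm [simp]: "blockA (bm A B C D) = A" "blockB (bm A B C D) = B" "blockC (bm A B C D) = C" "blockD (bm A B C D) = D"
  by (simp_all add: bm_def blockA_def blockB_def blockC_def blockD_def vec_eq_iff)

lemma all_sum: "(\<forall>x::'a + 'b. P x) \<longleftrightarrow> (\<forall>x. P (Inl x)) \<and> (\<forall>y. P (Inr y))"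
  using sumE by metis

lemma bm_eq [simp]: "bm A B C D = bm A' B' C' D' \<longleftrightarrow> A = A' \<and> B = B' \<and> C = C' \<and> D = D'"
  using block_bm by metis

lemma bm_cases: obtains A B C D where "M = bm A B C D"
proof -
  have "M = bm (blockA M) (blockB M) (blockC M) (blockD M)"
    by (simp add: bm_def blockA_def blockB_def blockC_def blockD_def vec_eq_iff all_sum)
  thus ?thesis using that by blast
qed

lemma sum_UNIV_sum: "sum f (UNIV :: ('a::finite + 'b::finite) set) = (\<Sum>x\<in>UNIV. f (Inl x)) + (\<Sum>y\<in>UNIV. f (Inr y))"
  by (simp add: UNIV_Plus_UNIV[symmetric] sum.Plus del: UNIV_Plus_UNIV)

lemma bm_mult [simp]: "bm A B C D ** bm A' B' C' D' = bm (A ** A' + B ** C') (A ** B' + B ** D') (C ** A' + D ** C') (C ** B' + D ** D')"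
  by (simp add: bm_def vec_eq_iff all_sum matrix_matrix_mult_def sum_UNIV_sum)

lemma transpose_bm [simp]: "transpose (bm A B C D) = bm (transpose A) (transpose C) (transpose B) (transpose D)"
  by (simp add: bm_def vec_eq_iff all_sum transpose_def)

lemma mat_1_bm: "mat 1 = bm (mat 1) 0 0 (mat 1)"
  by (simp add: bm_def vec_eq_iff all_sum mat_def)

lemma symplectic_form_bm: "symplectic_form = bm 0 (mat 1) (- mat 1) 0"
  by (simp add: bm_def vec_eq_iff all_sum mat_def symplectic_form_def)

abbreviation m4 where "m4 a1 a2 a3 a4 b1 b2 b3 b4 c1 c2 c3 c4 d1 d2 d3 d4 \<equiv>
  bm (M2 a1 a2 a3 a4) (M2 b1 b2 b3 b4) (M2 c1 c2 c3 c4) (M2 d1 d2 d3 d4)"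

lemma m4_cases: obtains a1 a2 a3 a4 b1 b2 b3 b4 c1 c2 c3 c4 d1 d2 d3 d4 where
  "M = m4 a1 a2 a3 a4 b1 b2 b3 b4 c1 c2 c3 c4 d1 d2 d3 d4"
proof -
  obtain A B C D where M: "M = bm A B C D" by (rule bm_cases)
  show ?thesis
    by (rule M2_cases[of A], rule M2_cases[of B], rule M2_cases[of C], rule M2_cases[of D], rule that) (simp only: M)
qed

lemma mat_1_m4: "mat 1 = m4 1 0 0 1 0 0 0 0 0 0 0 0 1 0 0 1"
  by (simp add: mat_1_bm mat_1_M2 zero_M2)

text \<open>In blocks: \<open>A^T C\<close> and \<open>B^T D\<close> are symmetric, and
  \<open>A^T D - C^T B\<close> is the identity.\<close>

lemma m4_Sp4Z: "m4 a1 a2 a3 a4 b1 b2 b3 b4 c1 c2 c3 c4 d1 d2 d3 d4 \<in> Sp4Z \<longleftrightarrow>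
  a1 * c2 + a3 * c4 = a2 * c1 + a4 * c3 \<and>
  b1 * d2 + b3 * d4 = b2 * d1 + b4 * d3 \<and>
  a1 * d1 + a3 * d3 - c1 * b1 - c3 * b3 = 1 \<and> a1 * d2 + a3 * d4 - c1 * b2 - c3 * b4 = 0 \<and>
  a2 * d1 + a4 * d3 - c2 * b1 - c4 * b3 = 0 \<and> a2 * d2 + a4 * d4 - c2 * b2 - c4 * b4 = 1"
proof -
  define M where "M = m4 a1 a2 a3 a4 b1 b2 b3 b4 c1 c2 c3 c4 d1 d2 d3 d4"
  define s1 where "s1 = a1 * c2 + a3 * c4 - (a2 * c1 + a4 * c3)"
  define s2 where "s2 = b1 * d2 + b3 * d4 - (b2 * d1 + b4 * d3)"
  define p where "p = a1 * d1 + a3 * d3 - c1 * b1 - c3 * b3"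
  define q where "q = a1 * d2 + a3 * d4 - c1 * b2 - c3 * b4"
  define r where "r = a2 * d1 + a4 * d3 - c2 * b1 - c4 * b3"
  define t where "t = a2 * d2 + a4 * d4 - c2 * b2 - c4 * b4"
  have "transpose M ** symplectic_form ** M = m4 0 s1 (- s1) 0 p q r t (- p) (- r) (- q) (- t) 0 s2 (- s2) 0"
    unfolding M_def symplectic_form_bm mat_1_M2 zero_M2 s1_def s2_def p_def q_def r_def t_def
    by (simp add: algebra_simps)
  hence "M \<in> Sp4Z \<longleftrightarrow> s1 = 0 \<and> s2 = 0 \<and> p = 1 \<and> q = 0 \<and> r = 0 \<and> t = 1"
    unfolding Sp4Z_def symplectic_form_bm mat_1_M2 zero_M2 by auto
  thus ?thesis unfolding M_def s1_def s2_def p_def q_def r_def t_def by simp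
qed

lemma Sp4Z_mult: "M \<in> Sp4Z \<Longrightarrow> N \<in> Sp4Z \<Longrightarrow> M ** N \<in> Sp4Z"
proof -
  assume M: "M \<in> Sp4Z" and N: "N \<in> Sp4Z"
  have "transpose (M ** N) ** symplectic_form ** (M ** N) = transpose N ** (transpose M ** symplectic_form ** M) ** N"
    by (simp add: matrix_transpose_mul matrix_mul_assoc)
  thus ?thesis using M N by (simp add: Sp4Z_def)
qed

section \<open>Elementary generators of the symplectic group\<close>

definition gT :: "int \<Rightarrow> imat4" where "gT k = m4 1 0 0 1 k 0 0 0 0 0 0 0 1 0 0 1"
definition gV :: "int \<Rightarrow> imat4" where "gV k = m4 1 k 0 1 0 0 0 0 0 0 0 0 1 0 (-k) 1"
definition gJ :: imat4 where "gJ = m4 0 0 0 1 (-1) 0 0 0 1 0 0 0 0 0 0 1"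
definition gW :: imat4 where "gW = m4 0 1 1 0 0 0 0 0 0 0 0 0 0 1 1 0"

text \<open>\<open>gT\<close> translates the upper left entry of the period matrix,
  \<open>gV\<close> and \<open>gW\<close> are changes of lattice basis, \<open>gJ\<close> inverts in
  the first variable alone. Only \<open>gJ\<close> acts on theta series by more than a phase or a
  reindexing.\<close>

inductive_set gens :: "imat4 set" where
  gensT: "gT k \<in> gens" | gensV: "gV k \<in> gens" | gensJ: "gJ \<in> gens" | gensW: "gW \<in> gens"

inductive_set gen :: "imat4 set" where
  one: "mat 1 \<in> gen"
| mult: "g \<in> gens \<Longrightarrow> M \<in> gen \<Longrightarrow> g ** M \<in> gen"

lemmas gen_defs = gT_def gV_def gJ_def gW_def

lemma gens_Sp4Z: "g \<in> gens \<Longrightarrow> g \<in> Sp4Z"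
  by (erule gens.cases) (simp_all add: gen_defs m4_Sp4Z)

lemma one_Sp4Z: "mat 1 \<in> Sp4Z" by (simp add: mat_1_m4 m4_Sp4Z)

lemma gen_Sp4Z: "M \<in> gen \<Longrightarrow> M \<in> Sp4Z"
  by (induction rule: gen.induct) (auto intro: Sp4Z_mult gens_Sp4Z one_Sp4Z)

lemma gens_gen: "g \<in> gens \<Longrightarrow> g \<in> gen"
  using gen.mult[OF _ gen.one] by fastforce

lemma gen_mult: "M \<in> gen \<Longrightarrow> N \<in> gen \<Longrightarrow> M ** N \<in> gen"
  by (induction rule: gen.induct) (auto simp: matrix_mul_assoc[symmetric] intro: gen.mult)

lemma gens_inverse:
  assumes "g \<in> gens" shows "\<exists>h\<in>gen. h ** g = mat 1 \<and> g ** h = mat 1"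
  using assms
proof cases
  case (gensT k)
  thus ?thesis by (intro bexI[of _ "gT (-k)"] conjI gens_gen gens.intros) (simp_all add: gT_def mat_1_m4)
next
  case (gensV k)
  thus ?thesis by (intro bexI[of _ "gV (-k)"] conjI gens_gen gens.intros) (simp_all add: gV_def mat_1_m4)
next
  case gensJ
  thus ?thesis by (intro bexI[of _ "gJ ** (gJ ** gJ)"] conjI gen_mult gens_gen gens.intros) (simp_all add: gJ_def mat_1_m4)
next
  case gensW
  thus ?thesis by (intro bexI[of _ "gW"] conjI gens_gen gens.intros) (simp_all add: gW_def mat_1_m4)
qed

lemma gen_inverse: "M \<in> gen \<Longrightarrow> \<exists>N\<in>gen. N ** M = mat 1 \<and> M ** N = mat 1"
proof (induction rule: gen.induct)
  case (mult g M)
  obtain h where h: "h \<in> gen" "h ** g = mat 1" "g ** h = mat 1" using gens_inverse mult by blast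
  obtain N where N: "N \<in> gen" "N ** M = mat 1" "M ** N = mat 1" using mult by blast
  have "(N ** h) ** (g ** M) = N ** (h ** g) ** M" "(g ** M) ** (N ** h) = g ** (M ** N) ** h"
    by (simp_all add: matrix_mul_assoc)
  thus ?case using h N gen_mult by (intro bexI[of _ "N ** h"]) auto
qed (auto intro!: bexI[of _ "mat 1"] gen.one)

lemma gen_cancel:
  assumes "N \<in> gen" "N ** M \<in> gen" shows "M \<in> gen"
proof -
  obtain N' where N': "N' \<in> gen" "N' ** N = mat 1" using gen_inverse assms(1) by blast
  have "N' ** (N ** M) = M" by (simp add: matrix_mul_assoc N')
  thus ?thesis using gen_mult[OF N'(1) assms(2)] by simp
qed

text \<open>Euclid's algorithm on the lower left entry. The predicate \<open>P\<close> is arbitrary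
  so that one argument serves several embeddings of the group of integral matrices of determinant
  1.\<close>

lemma SL2_generation:
  fixes P :: "int \<Rightarrow> int \<Rightarrow> int \<Rightarrow> int \<Rightarrow> bool"
  assumes T: "\<And>k. P 1 k 0 1" and J: "P 0 (-1) 1 0"
    and mul: "\<And>a b c d a' bb c' d'. P a b c d \<Longrightarrow> P a' bb c' d' \<Longrightarrow> P (a*a'+b*c') (a*bb+b*d') (c*a'+d*c') (c*bb+d*d')"
    and "a * d - b * c = 1"
  shows "P a b c d"
  using assms(4)
proof (induction "nat \<bar>c\<bar>" arbitrary: a b c d rule: less_induct)
  case less
  have neg: "P (-1) 0 0 (-1)" using mul[OF J J] by simp
  show ?case
  proof (cases "c = 0")
    case True
    hence "a * d = 1" using less by simp
    hence "a = 1 \<and> d = 1 \<or> a = -1 \<and> d = -1" by (simp add: zmult_eq_1_iff)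
    thus ?thesis using True T[of b] mul[OF neg T[of "-b"]] by auto
  next
    case False
    define q where "q = a div c"
    have lt: "nat \<bar>- (a - q * c)\<bar> < nat \<bar>c\<bar>"
      using abs_mod_less[OF False, of a] False unfolding q_def by (simp add: minus_div_mult_eq_mod)
    \<comment> \<open>\<open>(a b; c d) = T^q J (c d; -(a - q c) -(b - q d))\<close>\<close>
    have "P c d (- (a - q * c)) (- (b - q * d))"
      by (rule less(1)[OF lt]) (use less(2) in \<open>simp add: algebra_simps\<close>)
    from mul[OF T[of q] mul[OF J this]] show ?thesis by simp
  qed
qed

text \<open>\<open>emb1\<close> and \<open>emb2\<close> are two commuting copies of the determinant
  1 group, one for each variable. \<open>lev\<close> is the change of lattice basis by
  \<open>(a b; c d)\<close>: its lower right block is the inverse transpose when the determinant is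
  1.\<close>

definition emb1 where "emb1 a b c d = m4 a 0 0 1 b 0 0 0 c 0 0 0 d 0 0 1"
definition emb2 where "emb2 a b c d = m4 1 0 0 a 0 0 0 b 0 0 0 c 1 0 0 d"
definition lev where "lev a b c d = m4 a b c d 0 0 0 0 0 0 0 0 d (-c) (-b) a"

lemma emb1_gen: "a * d - b * c = 1 \<Longrightarrow> emb1 a b c d \<in> gen"
proof (rule SL2_generation[where P = "\<lambda>a b c d. emb1 a b c d \<in> gen"])
  show "emb1 1 k 0 1 \<in> gen" for k using gens_gen[OF gensT[of k]] by (simp add: emb1_def gT_def)
  show "emb1 0 (-1) 1 0 \<in> gen" using gens_gen[OF gensJ] by (simp add: emb1_def gJ_def)
  show "emb1 (a*a'+b*c') (a*bb+b*d') (c*a'+d*c') (c*bb+d*d') \<in> gen"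
    if "emb1 a b c d \<in> gen" "emb1 a' bb c' d' \<in> gen" for a b c d a' bb c' d'
    using gen_mult[OF that] by (simp add: emb1_def)
qed

lemma emb2_gen: assumes "a * d - b * c = 1" shows "emb2 a b c d \<in> gen"
proof -
  have "emb2 a b c d = gW ** emb1 a b c d ** gW" by (simp add: emb1_def emb2_def gW_def)
  thus ?thesis using gen_mult[OF gen_mult[OF gens_gen[OF gensW] emb1_gen[OF assms]] gens_gen[OF gensW]] by simp
qed

lemma lev_gen: "a * d - b * c = 1 \<Longrightarrow> lev a b c d \<in> gen"
proof (rule SL2_generation[where P = "\<lambda>a b c d. lev a b c d \<in> gen"])
  show "lev 1 k 0 1 \<in> gen" for k using gens_gen[OF gensV[of k]] by (simp add: lev_def gV_def)
  show "lev 0 (-1) 1 0 \<in> gen" using gen_mult[OF emb1_gen[of "-1" "-1" 0 0] gens_gen[OF gensW]] by (simp add: lev_def emb1_def gW_def)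
  show "lev (a*a'+b*c') (a*bb+b*d') (c*a'+d*c') (c*bb+d*d') \<in> gen"
    if "lev a b c d \<in> gen" "lev a' bb c' d' \<in> gen" for a b c d a' bb c' d'
    using gen_mult[OF that] by (simp add: lev_def algebra_simps)
qed

definition trans where "trans x y z = m4 1 0 0 1 x y y z 0 0 0 0 1 0 0 1"

text \<open>Integral symmetric matrices are combinations of the squares of three linear forms: the
  two coordinates and their sum. The last one arises from the second by conjugation with
  \<open>gV 1\<close>.\<close>

lemma trans_gen: "trans x y z \<in> gen"
proof -
  have 1: "trans k 0 0 \<in> gen" for k using gens_gen[OF gensT[of k]] by (simp add: trans_def gT_def)
  have 2: "trans 0 0 k \<in> gen" for k using emb2_gen[of 1 1 k 0] by (simp add: trans_def emb2_def)
  have 3: "trans k k k \<in> gen" for k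
    using gen_mult[OF gen_mult[OF gens_gen[OF gensV[of 1]] 2[of k]] gens_gen[OF gensV[of "-1"]]]
    by (simp add: trans_def gV_def)
  show ?thesis using gen_mult[OF 1[of "x - y"] gen_mult[OF 2[of "z - y"] 3[of y]]] by (simp add: trans_def)
qed

lemma SL2_column_reduce:
  obtains x y u v g :: int where "x * v - y * u = 1" "x * a + y * c = g" "u * a + v * c = 0" "g \<ge> 0"
proof (cases "a = 0 \<and> c = 0")
  case True thus ?thesis using that[of 1 1 0 0 0] by auto
next
  case False
  obtain x y where xy: "x * a + y * c = gcd a c" using bezout_int by metis
  obtain a' c' where ac: "a = gcd a c * a'" "c = gcd a c * c'" by (meson dvdE gcd_dvd1 gcd_dvd2)
  have g: "gcd a c \<noteq> 0" using False by simp
  have "gcd a c * (x * a' + y * c') = gcd a c * 1" using xy ac by (metis distrib_left mult.left_commute mult_1_right)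
  hence "x * a' + y * c' = 1" using g mult_cancel_left by blast
  moreover have "- c' * a + a' * c = 0" using ac by (metis add.commute add_uminus_conv_diff cancel_comm_monoid_add_class.diff_cancel minus_mult_left mult.assoc mult.commute)
  ultimately show ?thesis using that[of x a' y "-c'" "gcd a c"] xy by simp
qed

text \<open>The first column is cleared in three moves: \<open>emb1\<close> kills \<open>c1\<close>,
  \<open>emb2\<close> kills \<open>c3\<close>, and \<open>lev\<close> then kills \<open>a3\<close>
  without disturbing the zeros below. Symplecticity leaves 1 in the corner, and what remains is an
  inner block of determinant 1, a translation and a \<open>gV\<close>.\<close>

lemma Sp4Z_eq_gen: "Sp4Z = gen"
proof (intro equalityI subsetI gen_Sp4Z)
  fix M assume M: "M \<in> Sp4Z"
  obtain a1 a2 a3 a4 b1 b2 b3 b4 c1 c2 c3 c4 d1 d2 d3 d4 where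
    Meq: "M = m4 a1 a2 a3 a4 b1 b2 b3 b4 c1 c2 c3 c4 d1 d2 d3 d4" by (rule m4_cases)
  obtain x y u v g where 1: "x * v - y * u = 1" "x * a1 + y * c1 = g" "u * a1 + v * c1 = 0" "g \<ge> 0"
    by (rule SL2_column_reduce)
  obtain x' y' u' v' g' where 2: "x' * v' - y' * u' = 1" "x' * a3 + y' * c3 = g'" "u' * a3 + v' * c3 = 0" "g' \<ge> 0"
    by (rule SL2_column_reduce)
  obtain x'' y'' u'' v'' g'' where 3: "x'' * v'' - y'' * u'' = 1" "x'' * g + y'' * g' = g''" "u'' * g + v'' * g' = 0" "g'' \<ge> 0"
    by (rule SL2_column_reduce)
  define N1 where "N1 = emb1 x y u v ** M"
  have N1: "N1 = m4 g (x * a2+y * c2) a3 a4 (x * b1+y * d1) (x * b2+y * d2) b3 b4 0 (u * a2+v * c2) c3 c4 (u * b1+v * d1) (u * b2+v * d2) d3 d4"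
    using 1 by (simp add: N1_def Meq emb1_def)
  obtain e1 e2 e3 e4 e5 e6 e7 e8 e9 e10 e11 e12 where
    N2: "emb2 x' y' u' v' ** N1 = m4 g e1 g' e2 e3 e4 e5 e6 0 e7 0 e8 e9 e10 e11 e12"
    using 2 by (simp add: N1 emb2_def)
  define N where "N = lev x'' y'' u'' v'' ** (emb2 x' y' u' v' ** emb1 x y u v)"
  have N: "N \<in> gen" unfolding N_def using 1 2 3 by (intro gen_mult lev_gen emb1_gen emb2_gen)
  have NM: "N ** M = lev x'' y'' u'' v'' ** m4 g e1 g' e2 e3 e4 e5 e6 0 e7 0 e8 e9 e10 e11 e12"
    by (simp add: N_def N2[symmetric] N1_def matrix_mul_assoc del: bm_mult)
  obtain p1 p2 p3 p4 q1 q2 q3 q4 r1 r2 r3 r4 s1 s2 s3 s4 where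
    Neq: "N ** M = m4 p1 p2 p3 p4 q1 q2 q3 q4 r1 r2 r3 r4 s1 s2 s3 s4" by (rule m4_cases)
  have "p1 = g''" "p3 = 0" "r1 = 0" "r3 = 0"
    using Neq[symmetric] 3 unfolding NM by (simp_all add: lev_def)
  note p = this
  have S: "N ** M \<in> Sp4Z" using N M gen_Sp4Z Sp4Z_mult by blast
  hence "p1 * s1 = 1" using p unfolding Neq m4_Sp4Z by simp
  hence p1: "p1 = 1" "s1 = 1" using 3 p by (auto simp: zmult_eq_1_iff)
  have e: "r2 = 0" "s2 = 0" "p2 + p4 * s3 - r4 * q3 = 0" "p4 * s4 - r4 * q4 = 1" "q1 * s2 + q3 * s4 = q2 * s1 + q4 * s3"
    using S p p1 unfolding Neq m4_Sp4Z by auto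
  \<comment> \<open>This multiplies by the inverse of the inner block \<open>(p4 q4; r4 s4)\<close>,
    whose determinant is 1 by \<open>e\<close>.\<close>
  have inv: "emb2 s4 (-q4) (-r4) p4 ** (N ** M) = m4 1 p2 0 1 q1 q2 (s4 * q3 - q4 * s3) 0 0 0 0 0 1 0 (p4 * s3-r4 * q3) 1"
    unfolding Neq using e p p1 by (simp add: emb2_def algebra_simps)
  have "p4 * s3-r4 * q3 = - p2" "s4 * q3 - q4 * s3 = q2" using e p1 by (auto simp: algebra_simps)
  hence "emb2 s4 (-q4) (-r4) p4 ** (N ** M) = trans (q1 + q2 * p2) q2 0 ** gV p2"
    unfolding inv by (simp add: trans_def gV_def)
  also have "\<dots> \<in> gen" by (intro gen_mult trans_gen gens_gen gens.intros)
  finally have G: "emb2 s4 (-q4) (-r4) p4 ** (N ** M) \<in> gen" .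
  have "s4 * p4 - (- q4) * (- r4) = 1" using e by (simp add: algebra_simps)
  from gen_cancel[OF emb2_gen[OF this] G] show "M \<in> gen" by (rule gen_cancel[OF N])
qed

lemma Sp4Z_induct [consumes 1, case_names one mult]:
  assumes "M \<in> Sp4Z" "P (mat 1)" "\<And>g M. g \<in> gens \<Longrightarrow> M \<in> Sp4Z \<Longrightarrow> P M \<Longrightarrow> P (g ** M)"
  shows "P M"
  using assms(1) unfolding Sp4Z_eq_gen
proof (induction rule: gen.induct)
  case (mult g M)
  thus ?case using assms(3) Sp4Z_eq_gen by blast
qed (rule assms(2))

text \<open>For symplectic \<open>M\<close> this is the inverse, in a form that is explicit in the
  entries.\<close>

definition spinv :: "imat4 \<Rightarrow> imat4" where
  "spinv M = bm (transpose (blockD M)) (- transpose (blockB M)) (- transpose (blockC M)) (transpose (blockA M))"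

lemma spinv_m4 [simp]: "spinv (m4 a1 a2 a3 a4 b1 b2 b3 b4 c1 c2 c3 c4 d1 d2 d3 d4) = 
   m4 d1 d3 d2 d4 (-b1) (-b3) (-b2) (-b4) (-c1) (-c3) (-c2) (-c4) a1 a3 a2 a4"
  by (simp add: spinv_def)

lemma spinv_left: assumes "M \<in> Sp4Z" shows "spinv M ** M = mat 1"
proof -
  obtain a1 a2 a3 a4 b1 b2 b3 b4 c1 c2 c3 c4 d1 d2 d3 d4 where
    M: "M = m4 a1 a2 a3 a4 b1 b2 b3 b4 c1 c2 c3 c4 d1 d2 d3 d4" by (rule m4_cases)
  define s1 where "s1 = a1 * c2 + a3 * c4 - (a2 * c1 + a4 * c3)"
  define s2 where "s2 = b1 * d2 + b3 * d4 - (b2 * d1 + b4 * d3)"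
  define p where "p = a1 * d1 + a3 * d3 - c1 * b1 - c3 * b3"
  define q where "q = a1 * d2 + a3 * d4 - c1 * b2 - c3 * b4"
  define r where "r = a2 * d1 + a4 * d3 - c2 * b1 - c4 * b3"
  define t where "t = a2 * d2 + a4 * d4 - c2 * b2 - c4 * b4"
  have "s1 = 0" "s2 = 0" "p = 1" "q = 0" "r = 0" "t = 1"
    using assms unfolding M m4_Sp4Z s1_def s2_def p_def q_def r_def t_def by simp_all
  moreover have "spinv M ** M = m4 p r q t 0 (- s2) s2 0 0 s1 (- s1) 0 p q r t"
    unfolding M spinv_m4 s1_def s2_def p_def q_def r_def t_def by (simp add: algebra_simps)
  ultimately show ?thesis by (simp add: mat_1_m4)
qed

text \<open>The explicit formula is known only as a left inverse so far; a two-sided inverse exists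
  by generation and must coincide with it.\<close>

lemma Sp4Z_inverse:
  assumes "M \<in> Sp4Z" shows "spinv M \<in> Sp4Z" "spinv M ** M = mat 1" "M ** spinv M = mat 1"
proof -
  obtain N where N: "N \<in> Sp4Z" "N ** M = mat 1" "M ** N = mat 1" using gen_inverse assms Sp4Z_eq_gen by auto
  have "spinv M = spinv M ** (M ** N)" using N by simp
  also have "\<dots> = N" using spinv_left[OF assms] by (simp add: matrix_mul_assoc)
  finally have "spinv M = N" .
  thus "spinv M \<in> Sp4Z" "spinv M ** M = mat 1" "M ** spinv M = mat 1" using N by auto
qed

section \<open>The Siegel half-space and the action on it\<close>

lemma siegel2_iff: "\<Omega> \<in> siegel2 \<longleftrightarrow> (\<exists>t1 z t2. \<Omega> = M2 t1 z z t2 \<and> Im t1 > 0 \<and> (Im z)\<^sup>2 < Im t1 * Im t2)"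
proof -
  obtain a b c d where eq: "\<Omega> = M2 a b c d" by (rule M2_cases)
  have q: "v \<bullet> ((\<chi> i j. Im (\<Omega> $ i $ j)) *v v) = Im a * (v$1)\<^sup>2 + (Im b + Im c) * v$1 * v$2 + Im d * (v$2)\<^sup>2" for v :: "real^2"
    by (simp add: eq inner_vec_def matrix_vector_mult_def sum_2 algebra_simps power2_eq_square)
  show ?thesis
  proof
    assume "\<Omega> \<in> siegel2"
    hence tr: "transpose \<Omega> = \<Omega>" and P: "\<And>v::real^2. v \<noteq> 0 \<Longrightarrow> v \<bullet> ((\<chi> i j. Im (\<Omega> $ i $ j)) *v v) > 0"
      by (simp_all add: siegel2_def)
    have "M2 a c b d = M2 a b c d" using tr unfolding eq transpose_M2 .
    hence s: "c = b" unfolding M2_eq by blast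
    have pos: "\<And>v::real^2. v \<noteq> 0 \<Longrightarrow> Im a * (v$1)\<^sup>2 + (Im b + Im c) * v$1 * v$2 + Im d * (v$2)\<^sup>2 > 0"
      using P unfolding q .
    have a: "Im a > 0" using pos[of "vector [1, 0]"] by (auto simp: vec_eq_iff forall_2)
    \<comment> \<open>At this test vector the completed square vanishes, so the form equals
      \<open>Im a\<close> times the determinant.\<close>
    have "Im a * (Im b)\<^sup>2 - 2 * (Im b)\<^sup>2 * Im a + Im d * (Im a)\<^sup>2 > 0"
      using pos[of "vector [- Im b, Im a]"] a by (auto simp: vec_eq_iff forall_2 s power2_eq_square algebra_simps)
    hence "Im a * (Im a * Im d - (Im b)\<^sup>2) > 0" by (simp add: algebra_simps power2_eq_square)
    hence "Im a * Im d > (Im b)\<^sup>2" using a by (simp add: zero_less_mult_iff)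
    thus "\<exists>t1 z t2. \<Omega> = M2 t1 z z t2 \<and> Im t1 > 0 \<and> (Im z)\<^sup>2 < Im t1 * Im t2" using a s eq by auto
  next
    assume "\<exists>t1 z t2. \<Omega> = M2 t1 z z t2 \<and> Im t1 > 0 \<and> (Im z)\<^sup>2 < Im t1 * Im t2"
    hence s: "c = b" and a: "Im a > 0" and d: "(Im b)\<^sup>2 < Im a * Im d" by (auto simp: eq)
    have "Im a * (v$1)\<^sup>2 + (Im b + Im c) * v$1 * v$2 + Im d * (v$2)\<^sup>2 > 0" if "v \<noteq> 0" for v :: "real^2"
    proof -
      have e: "Im a * (Im a * (v$1)\<^sup>2 + (Im b + Im c) * v$1 * v$2 + Im d * (v$2)\<^sup>2) =
         (Im a * v$1 + Im b * v$2)\<^sup>2 + (Im a * Im d - (Im b)\<^sup>2) * (v$2)\<^sup>2"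
        by (simp add: s algebra_simps power2_eq_square)
      have "\<dots> > 0"
      proof (cases "v$2 = 0")
        case True
        hence "v$1 \<noteq> 0" using that by (auto simp: vec_eq_iff forall_2)
        thus ?thesis using True a by simp
      next
        case False
        thus ?thesis using d by (intro add_nonneg_pos mult_pos_pos) auto
      qed
      thus ?thesis using a e by (metis zero_less_mult_pos)
    qed
    hence "\<forall>v::real^2. v \<noteq> 0 \<longrightarrow> v \<bullet> ((\<chi> i j. Im (\<Omega> $ i $ j)) *v v) > 0" unfolding q by blast
    moreover have "transpose \<Omega> = \<Omega>" by (simp add: eq s)
    ultimately show "\<Omega> \<in> siegel2" by (simp add: siegel2_def)
  qed
qed

lemma siegel2_cases:
  assumes "\<Omega> \<in> siegel2"
  obtains t1 z t2 where "\<Omega> = M2 t1 z z t2" "Im t1 > 0" "(Im z)\<^sup>2 < Im t1 * Im t2"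
  using assms that unfolding siegel2_iff by blast

lemma siegel2I: "Im t1 > 0 \<Longrightarrow> (Im z)\<^sup>2 < Im t1 * Im t2 \<Longrightarrow> M2 t1 z z t2 \<in> siegel2"
  using siegel2_iff by blast

lemma siegel2_pos2:
  assumes "Im t1 > 0" "(Im z)\<^sup>2 < Im t1 * Im t2" shows "Im t2 > 0"
  using assms by (metis le_less_trans zero_le_power2 zero_less_mult_pos)

text \<open>The matrix automorphy factor; with its companion \<open>nmat\<close> for the numerator,
  values of \<open>act\<close> are characterised by an equation free of inverses.\<close>

definition jmat :: "imat4 \<Rightarrow> cmat2 \<Rightarrow> cmat2" where
  "jmat M \<Omega> = cmat_of_int (blockC M) ** \<Omega> + cmat_of_int (blockD M)"

definition nmat :: "imat4 \<Rightarrow> cmat2 \<Rightarrow> cmat2" where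
  "nmat M \<Omega> = cmat_of_int (blockA M) ** \<Omega> + cmat_of_int (blockB M)"

lemma act_nj: "act M \<Omega> = nmat M \<Omega> ** matrix_inv (jmat M \<Omega>)"
  by (simp add: act_def nmat_def jmat_def)

lemma matrix_inv_cancel:
  fixes X :: "complex^2^2" assumes "invertible X"
  shows "X ** matrix_inv X = mat 1" "matrix_inv X ** X = mat 1"
proof -
  have "X ** matrix_inv X = mat 1 \<and> matrix_inv X ** X = mat 1"
    unfolding matrix_inv_def by (rule someI_ex) (use assms in \<open>simp add: invertible_def\<close>)
  thus "X ** matrix_inv X = mat 1" "matrix_inv X ** X = mat 1" by blast+
qed

lemma act_eqI:
  assumes "invertible (jmat M \<Omega>)" "X ** jmat M \<Omega> = nmat M \<Omega>" shows "act M \<Omega> = X"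
  unfolding act_nj assms(2)[symmetric] by (simp add: matrix_mul_assoc[symmetric] matrix_inv_cancel[OF assms(1)])

lemma cmat_of_int_mult: "cmat_of_int (A ** B) = cmat_of_int A ** cmat_of_int B"
  by (cases A rule: M2_cases; cases B rule: M2_cases) simp

lemma cmat_of_int_add: "cmat_of_int (A + B) = cmat_of_int A + cmat_of_int B"
  by (cases A rule: M2_cases; cases B rule: M2_cases) simp

lemma cmat_add_rdistrib: "(X + Y) ** Z = X ** Z + Y ** Z" for X Y Z :: cmat2
  by (cases X rule: M2_cases; cases Y rule: M2_cases; cases Z rule: M2_cases) (simp add: algebra_simps)

text \<open>Invertibility is a hypothesis at this stage because it is established later, by
  induction over the generators, from this very relation.\<close>

lemma cocycle:
  assumes "invertible (jmat N \<Omega>)"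
  shows "jmat (M ** N) \<Omega> = jmat M (act N \<Omega>) ** jmat N \<Omega>" "nmat (M ** N) \<Omega> = nmat M (act N \<Omega>) ** jmat N \<Omega>"
proof -
  obtain A B C D where M: "M = bm A B C D" by (rule bm_cases)
  obtain A' B' C' D' where N: "N = bm A' B' C' D'" by (rule bm_cases)
  have a: "act N \<Omega> ** jmat N \<Omega> = nmat N \<Omega>"
    unfolding act_nj by (simp add: matrix_mul_assoc[symmetric] matrix_inv_cancel[OF assms])
  have "jmat (M ** N) \<Omega> = cmat_of_int C ** nmat N \<Omega> + cmat_of_int D ** jmat N \<Omega>"
       "nmat (M ** N) \<Omega> = cmat_of_int A ** nmat N \<Omega> + cmat_of_int B ** jmat N \<Omega>"
    by (simp_all add: jmat_def nmat_def M N cmat_of_int_mult cmat_of_int_add matrix_add_ldistrib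
        cmat_add_rdistrib matrix_mul_assoc add_ac)
  thus "jmat (M ** N) \<Omega> = jmat M (act N \<Omega>) ** jmat N \<Omega>" "nmat (M ** N) \<Omega> = nmat M (act N \<Omega>) ** jmat N \<Omega>"
    unfolding a[symmetric] by (simp_all add: jmat_def nmat_def M cmat_add_rdistrib matrix_mul_assoc)
qed

lemma act_mult_aux:
  assumes "invertible (jmat N \<Omega>)" "invertible (jmat M (act N \<Omega>))"
  shows "invertible (jmat (M ** N) \<Omega>)" "act (M ** N) \<Omega> = act M (act N \<Omega>)"
proof -
  show 1: "invertible (jmat (M ** N) \<Omega>)" using assms by (simp add: cocycle invertible_mult)
  show "act (M ** N) \<Omega> = act M (act N \<Omega>)"
  proof (rule act_eqI[OF 1])
    have "act M (act N \<Omega>) ** jmat M (act N \<Omega>) = nmat M (act N \<Omega>)"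
      unfolding act_nj[of M] by (simp add: matrix_mul_assoc[symmetric] matrix_inv_cancel[OF assms(2)])
    thus "act M (act N \<Omega>) ** jmat (M ** N) \<Omega> = nmat (M ** N) \<Omega>"
      by (simp add: cocycle[OF assms(1)] matrix_mul_assoc)
  qed
qed

lemma invertible_M2: "invertible (M2 a b c d :: complex^2^2) \<longleftrightarrow> a * d - b * c \<noteq> 0"
  by (simp add: invertible_det_nz det_2)

lemma invertible_mat_1: "invertible (mat 1 :: cmat2)" by (simp add: mat_1_M2 invertible_M2)

lemma act_one: "act (mat 1) \<Omega> = \<Omega>"
proof (rule act_eqI)
  have j: "jmat (mat 1) \<Omega> = mat 1" by (cases \<Omega> rule: M2_cases) (simp add: jmat_def mat_1_m4 mat_1_M2)
  show "invertible (jmat (mat 1) \<Omega>)" by (simp add: j invertible_mat_1)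
  show "\<Omega> ** jmat (mat 1) \<Omega> = nmat (mat 1) \<Omega>" unfolding j by (cases \<Omega> rule: M2_cases) (simp add: nmat_def mat_1_m4 mat_1_M2)
qed

lemma act_gT: "act (gT k) (M2 t1 z z t2) = M2 (t1 + of_int k) z z t2" "invertible (jmat (gT k) (M2 t1 z z t2))"
proof -
  show i: "invertible (jmat (gT k) (M2 t1 z z t2))" by (simp add: jmat_def gT_def invertible_M2)
  show "act (gT k) (M2 t1 z z t2) = M2 (t1 + of_int k) z z t2"
    by (rule act_eqI[OF i]) (simp add: jmat_def nmat_def gT_def)
qed

lemma act_gV: "act (gV k) (M2 t1 z z t2) = M2 (t1 + 2 * of_int k * z + (of_int k)\<^sup>2 * t2) (z + of_int k * t2) (z + of_int k * t2) t2"
    "invertible (jmat (gV k) (M2 t1 z z t2))"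
proof -
  show i: "invertible (jmat (gV k) (M2 t1 z z t2))" by (simp add: jmat_def gV_def invertible_M2)
  show "act (gV k) (M2 t1 z z t2) = M2 (t1 + 2 * of_int k * z + (of_int k)\<^sup>2 * t2) (z + of_int k * t2) (z + of_int k * t2) t2"
    by (rule act_eqI[OF i]) (simp add: jmat_def nmat_def gV_def algebra_simps power2_eq_square)
qed

lemma act_gW: "act gW (M2 t1 z z t2) = M2 t2 z z t1" "invertible (jmat gW (M2 t1 z z t2))"
proof -
  show i: "invertible (jmat gW (M2 t1 z z t2))" by (simp add: jmat_def gW_def invertible_M2)
  show "act gW (M2 t1 z z t2) = M2 t2 z z t1"
    by (rule act_eqI[OF i]) (simp add: jmat_def nmat_def gW_def)
qed

lemma act_gJ: assumes "t1 \<noteq> 0"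
  shows "act gJ (M2 t1 z z t2) = M2 (- 1 / t1) (z / t1) (z / t1) (t2 - z\<^sup>2 / t1)" "invertible (jmat gJ (M2 t1 z z t2))"
proof -
  show i: "invertible (jmat gJ (M2 t1 z z t2))" using assms by (simp add: jmat_def gJ_def invertible_M2)
  show "act gJ (M2 t1 z z t2) = M2 (- 1 / t1) (z / t1) (z / t1) (t2 - z\<^sup>2 / t1)"
    by (rule act_eqI[OF i]) (use assms in \<open>simp add: jmat_def nmat_def gJ_def field_simps power2_eq_square\<close>)
qed

text \<open>The inversion divides the determinant of the imaginary part by \<open>n\<close>, the
  squared modulus of \<open>t1\<close>, so positivity is kept.\<close>

lemma gJ_siegel2:
  assumes "Im t1 > 0" "(Im z)\<^sup>2 < Im t1 * Im t2"
  shows "M2 (- 1 / t1) (z / t1) (z / t1) (t2 - z\<^sup>2 / t1) \<in> siegel2"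
proof -
  define n where "n = (Re t1)\<^sup>2 + (Im t1)\<^sup>2"
  have n: "n > 0" using assms unfolding n_def by (simp add: add_nonneg_pos)
  have 1: "Im (- 1 / t1) = Im t1 / n" by (simp add: Im_divide n_def)
  have 2: "Im (z / t1) = (Im z * Re t1 - Re z * Im t1) / n" by (simp add: Im_divide n_def)
  have 3: "Im (t2 - z\<^sup>2 / t1) = Im t2 - (2 * Re z * Im z * Re t1 - ((Re z)\<^sup>2 - (Im z)\<^sup>2) * Im t1) / n"
    by (simp add: Im_divide n_def power2_eq_square algebra_simps)
  have "Im (- 1 / t1) * Im (t2 - z\<^sup>2 / t1) - (Im (z / t1))\<^sup>2 = (Im t1 * Im t2 - (Im z)\<^sup>2) / n"
  proof -
    have "n * (n * (Im (- 1 / t1) * Im (t2 - z\<^sup>2 / t1) - (Im (z / t1))\<^sup>2)) = n * (Im t1 * Im t2 - (Im z)\<^sup>2)"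
      unfolding 1 2 3 using n by (simp add: field_simps power2_eq_square) (simp add: n_def algebra_simps power2_eq_square)
    hence "n * (Im (- 1 / t1) * Im (t2 - z\<^sup>2 / t1) - (Im (z / t1))\<^sup>2) = Im t1 * Im t2 - (Im z)\<^sup>2"
      using n mult_cancel_left by (metis less_irrefl)
    thus ?thesis using n by (metis less_irrefl nonzero_mult_div_cancel_left)
  qed
  moreover have "\<dots> > 0" using n assms by simp
  ultimately have "(Im (z / t1))\<^sup>2 < Im (- 1 / t1) * Im (t2 - z\<^sup>2 / t1)" by linarith
  moreover have "Im (- 1 / t1) > 0" unfolding 1 using assms n by simp
  ultimately show ?thesis by (intro siegel2I)
qed

lemma gens_act: "g \<in> gens \<Longrightarrow> \<Omega> \<in> siegel2 \<Longrightarrow> invertible (jmat g \<Omega>) \<and> act g \<Omega> \<in> siegel2"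
proof -
  assume g: "g \<in> gens" and "\<Omega> \<in> siegel2"
  then obtain t1 z t2 where O: "\<Omega> = M2 t1 z z t2" "Im t1 > 0" "(Im z)\<^sup>2 < Im t1 * Im t2" using siegel2_cases by metis
  have t1: "t1 \<noteq> 0" using O by auto
  have t2: "Im t2 > 0" using O siegel2_pos2 by blast
  show ?thesis using g
  proof cases
    case (gensT k) thus ?thesis using O by (auto simp: act_gT siegel2_iff)
  next
    case (gensV k) 
    have "(Im (z + of_int k * t2))\<^sup>2 < Im (t1 + 2 * of_int k * z + (of_int k)\<^sup>2 * t2) * Im t2"
    proof -
      have "Im (t1 + 2 * of_int k * z + (of_int k)\<^sup>2 * t2) = Im t1 + 2 * of_int k * Im z + (of_int k)\<^sup>2 * Im t2"
        by (simp add: power2_eq_square)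
      thus ?thesis using O by (simp add: algebra_simps power2_eq_square)
    qed
    moreover have "Im (t1 + 2 * of_int k * z + (of_int k)\<^sup>2 * t2) > 0"
      using calculation t2 by (metis le_less_trans zero_le_power2 zero_less_mult_pos2)
    ultimately show ?thesis using gensV O by (auto simp: act_gV siegel2_iff)
  next
    case gensJ thus ?thesis using O t1 gJ_siegel2 by (auto simp: act_gJ)
  next
    case gensW thus ?thesis using O t2 by (auto simp: act_gW siegel2_iff mult.commute)
  qed
qed

text \<open>Invertibility of the automorphy factor and stability of the half-space pass along words
  in the generators, so four explicit cases replace the general positivity argument.\<close>

lemma Sp4Z_act_aux: "M \<in> Sp4Z \<Longrightarrow> \<forall>\<Omega>\<in>siegel2. invertible (jmat M \<Omega>) \<and> act M \<Omega> \<in> siegel2"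
proof (induction rule: Sp4Z_induct)
  case one
  have "jmat (mat 1) \<Omega> = mat 1" for \<Omega> by (cases \<Omega> rule: M2_cases) (simp add: jmat_def mat_1_m4 mat_1_M2)
  thus ?case by (simp add: act_one invertible_mat_1)
next
  case (mult g M)
  thus ?case using gens_act act_mult_aux by metis
qed

lemma invertible_jmat: "M \<in> Sp4Z \<Longrightarrow> \<Omega> \<in> siegel2 \<Longrightarrow> invertible (jmat M \<Omega>)"
  and act_siegel2: "M \<in> Sp4Z \<Longrightarrow> \<Omega> \<in> siegel2 \<Longrightarrow> act M \<Omega> \<in> siegel2"
  using Sp4Z_act_aux by blast+

lemma act_mult: "M \<in> Sp4Z \<Longrightarrow> N \<in> Sp4Z \<Longrightarrow> \<Omega> \<in> siegel2 \<Longrightarrow> act (M ** N) \<Omega> = act M (act N \<Omega>)"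
  using act_mult_aux invertible_jmat act_siegel2 by blast

lemma act_eqI': "M \<in> Sp4Z \<Longrightarrow> \<Omega> \<in> siegel2 \<Longrightarrow> X ** jmat M \<Omega> = nmat M \<Omega> \<Longrightarrow> act M \<Omega> = X"
  using act_eqI invertible_jmat by blast

lemma act_times_jmat: "M \<in> Sp4Z \<Longrightarrow> \<Omega> \<in> siegel2 \<Longrightarrow> act M \<Omega> ** jmat M \<Omega> = nmat M \<Omega>"
  unfolding act_nj by (simp add: matrix_mul_assoc[symmetric] matrix_inv_cancel invertible_jmat)

lemma scaleR_siegel2:
  assumes "r > 0" "\<Omega> \<in> siegel2" shows "r *\<^sub>R \<Omega> \<in> siegel2"
proof -
  obtain t1 z t2 where O: "\<Omega> = M2 t1 z z t2" "Im t1 > 0" "(Im z)\<^sup>2 < Im t1 * Im t2"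
    using assms siegel2_cases by metis
  have "r\<^sup>2 * (Im z)\<^sup>2 < r\<^sup>2 * (Im t1 * Im t2)" using O assms by simp
  hence "(Im (r *\<^sub>R z))\<^sup>2 < Im (r *\<^sub>R t1) * Im (r *\<^sub>R t2)"
    by (simp add: power2_eq_square mult_ac)
  thus ?thesis unfolding O scaleR_M2 using assms O by (intro siegel2I) auto
qed

section \<open>Theta constants in two variables\<close>

text \<open>Determinant over trace is a lower bound for the smaller eigenvalue; after subtracting it
  from the diagonal the determinant is exactly \<open>\<epsilon>\<^sup>2\<close>.\<close>

lemma quadratic_form_coercive:
  fixes y1 y y2 :: real
  assumes "y1 > 0" "y\<^sup>2 < y1 * y2"
  obtains \<epsilon> where "\<epsilon> > 0" "\<And>a b. \<epsilon> * (a\<^sup>2 + b\<^sup>2) \<le> y1 * a\<^sup>2 + 2 * y * a * b + y2 * b\<^sup>2"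
proof -
  have y2: "y2 > 0" using assms by (metis le_less_trans zero_le_power2 zero_less_mult_pos)
  define \<epsilon> where "\<epsilon> = (y1 * y2 - y\<^sup>2) / (y1 + y2)"
  have e: "\<epsilon> > 0" using assms y2 by (simp add: \<epsilon>_def)
  have e1: "\<epsilon> < y1"
  proof -
    have "y1 * y2 - y\<^sup>2 < y1 * (y1 + y2)" using assms by (simp add: algebra_simps add_pos_nonneg)
    thus ?thesis using assms y2 by (simp add: \<epsilon>_def divide_less_eq)
  qed
  have det: "(y1 - \<epsilon>) * (y2 - \<epsilon>) - y\<^sup>2 = \<epsilon>\<^sup>2"
  proof -
    have "\<epsilon> * (y1 + y2) = y1 * y2 - y\<^sup>2" using assms y2 by (simp add: \<epsilon>_def)
    thus ?thesis by (simp add: algebra_simps power2_eq_square)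
  qed
  have "\<epsilon> * (a\<^sup>2 + b\<^sup>2) \<le> y1 * a\<^sup>2 + 2 * y * a * b + y2 * b\<^sup>2" for a b
  proof -
    have "(y1 - \<epsilon>) * (y1 * a\<^sup>2 + 2 * y * a * b + y2 * b\<^sup>2 - \<epsilon> * (a\<^sup>2 + b\<^sup>2)) =
       ((y1 - \<epsilon>) * a + y * b)\<^sup>2 + ((y1 - \<epsilon>) * (y2 - \<epsilon>) - y\<^sup>2) * b\<^sup>2"
      by (simp add: algebra_simps power2_eq_square)
    also have "\<dots> \<ge> 0" unfolding det by simp
    finally have "0 \<le> y1 * a\<^sup>2 + 2 * y * a * b + y2 * b\<^sup>2 - \<epsilon> * (a\<^sup>2 + b\<^sup>2)"
      using e1 by (simp add: zero_le_mult_iff)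
    thus ?thesis by simp
  qed
  thus ?thesis using e that by blast
qed

lemma summable_on_gaussian_int2:
  assumes "\<epsilon> > 0"
  shows "(\<lambda>(m::int, n::int). exp (- \<epsilon> * ((real_of_int m)\<^sup>2 + (real_of_int n)\<^sup>2))) summable_on UNIV"
proof -
  have s: "(\<lambda>m::int. exp (- \<epsilon> * (real_of_int m)\<^sup>2)) summable_on UNIV"
    using summable_on_gaussian_int[OF assms, of 0] by simp
  define S where "S = (\<Sum>\<^sub>\<infinity>m::int. exp (- \<epsilon> * (real_of_int m)\<^sup>2))"
  have "(\<lambda>p::int \<times> int. exp (- \<epsilon> * (real_of_int (fst p))\<^sup>2) * exp (- \<epsilon> * (real_of_int (snd p))\<^sup>2)) summable_on (SIGMA x:UNIV. UNIV)"
  proof (rule summable_on_SigmaI)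
    fix x :: int
    show "((\<lambda>y. exp (- \<epsilon> * (real_of_int (fst (x, y)))\<^sup>2) * exp (- \<epsilon> * (real_of_int (snd (x, y)))\<^sup>2)) has_sum (exp (- \<epsilon> * (real_of_int x)\<^sup>2) * S)) UNIV"
      unfolding fst_conv snd_conv S_def using s by (intro has_sum_cmult_right has_sum_infsum)
    show "(\<lambda>x::int. exp (- \<epsilon> * (real_of_int x)\<^sup>2) * S) summable_on UNIV" using s by (rule summable_on_cmult_left)
  qed auto
  thus ?thesis by (simp add: case_prod_unfold exp_add[symmetric] algebra_simps)
qed

text \<open>The factor 1/2 builds the argument \<open>\<Omega> / 2\<close> of the theta constants
  into the term.\<close>

definition qterm :: "cmat2 \<Rightarrow> int \<Rightarrow> int \<Rightarrow> complex" where
  "qterm \<Omega> m n = exp (\<i> * pi / 2 * ((of_int m)\<^sup>2 * \<Omega> $ 1 $ 1 + 2 * of_int m * of_int n * \<Omega> $ 1 $ 2 + (of_int n)\<^sup>2 * \<Omega> $ 2 $ 2))"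

lemma norm_qterm: "norm (qterm \<Omega> m n) = exp (- (pi / 2) * (Im (\<Omega> $ 1 $ 1) * (real_of_int m)\<^sup>2
    + 2 * Im (\<Omega> $ 1 $ 2) * real_of_int m * real_of_int n + Im (\<Omega> $ 2 $ 2) * (real_of_int n)\<^sup>2))"
proof -
  have r: "complex_of_int k = of_real (real_of_int k)" for k by simp
  have "\<i> * pi / 2 * x = \<i> * of_real (pi / 2) * x" for x by simp
  thus ?thesis unfolding qterm_def norm_exp_eq_Re r of_real_power[symmetric]
    by (simp add: algebra_simps del: of_real_power of_real_of_int_eq)
qed

lemma qterm_summable:
  assumes "\<Omega> \<in> siegel2"
  shows "(\<lambda>(m, n). qterm \<Omega> m n) summable_on UNIV"
proof -
  obtain t1 z t2 where O: "\<Omega> = M2 t1 z z t2" "Im t1 > 0" "(Im z)\<^sup>2 < Im t1 * Im t2"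
    using assms by (rule siegel2_cases)
  obtain \<epsilon> where e: "\<epsilon> > 0" "\<And>a b. \<epsilon> * (a\<^sup>2 + b\<^sup>2) \<le> Im t1 * a\<^sup>2 + 2 * Im z * a * b + Im t2 * b\<^sup>2"
    using quadratic_form_coercive[OF O(2,3)] by blast
  have "(\<lambda>p. norm (case p of (m, n) \<Rightarrow> qterm \<Omega> m n)) summable_on UNIV"
  proof (rule summable_on_comparison_test)
    show "(\<lambda>(m::int, n::int). exp (- (pi / 2 * \<epsilon>) * ((real_of_int m)\<^sup>2 + (real_of_int n)\<^sup>2))) summable_on UNIV"
      using e by (intro summable_on_gaussian_int2) simp
    show "norm (case p of (m, n) \<Rightarrow> qterm \<Omega> m n) \<le> (case p of (m, n) \<Rightarrow> exp (- (pi / 2 * \<epsilon>) * ((real_of_int m)\<^sup>2 + (real_of_int n)\<^sup>2)))" for p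
    proof -
      have "pi / 2 * (\<epsilon> * ((of_int (fst p))\<^sup>2 + (of_int (snd p))\<^sup>2)) \<le> pi / 2 * (Im t1 * (of_int (fst p))\<^sup>2 + 2 * Im z * of_int (fst p) * of_int (snd p) + Im t2 * (of_int (snd p))\<^sup>2)"
        using e(2)[of "of_int (fst p)" "of_int (snd p)"] by (intro mult_left_mono) auto
      thus ?thesis by (simp add: case_prod_unfold norm_qterm O mult.assoc)
    qed
  qed auto
  thus ?thesis by (rule abs_summable_summable)
qed

text \<open>These are the second order theta constants: the characteristic is
  \<open>(a, b) / 2\<close> and the argument \<open>2 \<Omega>\<close>.\<close>

definition fth :: "cmat2 \<Rightarrow> int \<Rightarrow> int \<Rightarrow> complex" where
  "fth \<Omega> a b = (\<Sum>\<^sub>\<infinity>(m, n). qterm \<Omega> (2 * m + a) (2 * n + b))"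

lemma qterm_shift_summable:
  assumes "\<Omega> \<in> siegel2"
  shows "(\<lambda>(m, n). qterm \<Omega> (2 * m + a) (2 * n + b)) summable_on UNIV"
proof -
  have "(\<lambda>(m, n). qterm \<Omega> m n) summable_on range (\<lambda>(m, n). (2 * m + a, 2 * n + b))"
    using qterm_summable[OF assms] summable_on_subset_banach by blast
  hence "(\<lambda>(m, n). qterm \<Omega> m n) \<circ> (\<lambda>(m, n). (2 * m + a, 2 * n + b)) summable_on UNIV"
    by (subst (asm) summable_on_reindex) (auto simp: inj_on_def)
  thus ?thesis by (simp add: o_def case_prod_unfold)
qed

lemma fth_period: "fth \<Omega> (a + 2 * k) (b + 2 * l) = fth \<Omega> a b"
proof -
  have "bij (\<lambda>(m, n). (m + k, n + l))"
    by (rule o_bij[of "\<lambda>(m, n). (m - k, n - l)"]) (auto simp: o_def)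
  hence "(\<Sum>\<^sub>\<infinity>p. (\<lambda>(m, n). qterm \<Omega> (2 * m + a) (2 * n + b)) ((\<lambda>(m, n). (m + k, n + l)) p)) = fth \<Omega> a b"
    unfolding fth_def by (rule infsum_reindex_bij_betw)
  thus ?thesis unfolding fth_def by (simp add: case_prod_unfold algebra_simps)
qed

text \<open>The powers of -1 and, for \<open>ip\<close>, of the imaginary unit. \<open>ip\<close> is
  an exponential so that it accepts negative exponents and merges with the theta terms.\<close>

definition sg :: "int \<Rightarrow> complex" where "sg k = (if even k then 1 else - 1)"
definition ip :: "int \<Rightarrow> complex" where "ip k = exp (\<i> * pi / 2 * of_int k)"

lemma sg_add: "sg (a + b) = sg a * sg b" and sg_minus [simp]: "sg (- a) = sg a" by (auto simp: sg_def)
lemma sg_diff: "sg (a - b) = sg a * sg b" by (auto simp: sg_def)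
lemma sg_0 [simp]: "sg 0 = 1" and sg_1 [simp]: "sg 1 = -1" by (auto simp: sg_def)
lemma sg_sg [simp]: "sg a * sg a = 1" by (auto simp: sg_def)
lemma sg_even: "even a \<Longrightarrow> sg a = 1" by (auto simp: sg_def)
lemma sg_neq_0 [simp]: "sg a \<noteq> 0" by (auto simp: sg_def)

lemma exp_pi_sg: "exp (\<i> * pi * of_int k) = sg k"
proof (cases "even k")
  case True
  then obtain j where j: "k = 2 * j" by blast
  show ?thesis using exp_pi_int[of j] True by (simp add: j mult_ac sg_def)
next
  case False
  then obtain j where j: "k = 2 * j + 1" using oddE by blast
  have "\<i> * pi * of_int k = \<i> * pi * of_int j * 2 + \<i> * pi" by (simp add: j algebra_simps)
  hence "exp (\<i> * pi * of_int k) = exp (\<i> * pi)" by (simp only: exp_add exp_pi_int mult_1_left)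
  also have "\<dots> = -1" using exp_pi_i by (simp add: mult.commute)
  finally show ?thesis using False by (simp add: sg_def)
qed

lemma ip_add: "ip (a + b) = ip a * ip b" unfolding ip_def exp_add[symmetric] by (rule arg_cong[where f = exp]) (simp add: algebra_simps)
lemma ip_2: "ip (2 * a) = sg a"
  unfolding exp_pi_sg[symmetric] by (simp add: ip_def mult_ac)
lemma ip_0 [simp]: "ip 0 = 1" by (simp add: ip_def)
lemma ip_1 [simp]: "ip 1 = \<i>"
proof -
  have "ip 1 = cis (pi / 2)" by (simp add: ip_def cis_conv_exp)
  thus ?thesis by simp
qed
lemma ip_minus: "ip (- a) = inverse (ip a)" by (simp add: ip_def exp_minus)
lemma ip_neq_0 [simp]: "ip a \<noteq> 0" by (simp add: ip_def)
lemma ip_4: "ip (4 * a) = 1" using ip_2[of "2 * a"] by (simp add: sg_even)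
lemma ip_cong: assumes "[a = b] (mod 4)" shows "ip a = ip b"
proof -
  obtain k where "a = b + 4 * k" using assms by (metis cong_iff_lin cong_sym)
  thus ?thesis by (simp add: ip_add ip_4)
qed

lemma parity_split:
  fixes f :: "int \<Rightarrow> int \<Rightarrow> complex"
  assumes s: "(\<lambda>(m, n). f m n) summable_on UNIV"
  shows "(\<Sum>\<^sub>\<infinity>(m, n). f m n) = (\<Sum>\<^sub>\<infinity>(m, n). f (2 * m) n) + (\<Sum>\<^sub>\<infinity>(m, n). f (2 * m + 1) n)"
proof -
  define h :: "int \<Rightarrow> int \<times> int \<Rightarrow> int \<times> int" where "h c p = (2 * fst p + c, snd p)" for c p
  have inj: "inj (h c)" for c by (rule injI) (simp add: h_def prod_eq_iff)
  have mem: "p \<in> range (h c) \<longleftrightarrow> even (fst p - c)" for p c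
  proof
    assume "even (fst p - c)"
    then obtain j where "fst p - c = 2 * j" by blast
    hence "p = h c (j, snd p)" by (simp add: h_def prod_eq_iff)
    thus "p \<in> range (h c)" by blast
  qed (auto simp: h_def)
  have U: "range (h 0) \<union> range (h 1) = UNIV" and disj: "range (h 0) \<inter> range (h 1) = {}"
    by (rule set_eqI, simp add: mem)+
  have "(\<Sum>\<^sub>\<infinity>(m, n). f m n) = infsum (\<lambda>(m, n). f m n) (range (h 0) \<union> range (h 1))" by (simp only: U)
  also have "\<dots> = infsum (\<lambda>(m, n). f m n) (range (h 0)) + infsum (\<lambda>(m, n). f m n) (range (h 1))"
    by (rule infsum_Un_disjoint[OF summable_on_subset_banach[OF s] summable_on_subset_banach[OF s] disj]) auto
  finally show ?thesis unfolding infsum_reindex[OF inj] by (simp add: o_def case_prod_unfold h_def)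
qed

lemma infsum_prod_swap: "(\<Sum>\<^sub>\<infinity>(m, n). f m n :: complex) = (\<Sum>\<^sub>\<infinity>(n, m). f m n)"
proof -
  have "bij (prod.swap :: 'b \<times> 'a \<Rightarrow> 'a \<times> 'b)" by (rule bij_swap)
  from infsum_reindex_bij_betw[OF this, of "\<lambda>(m, n). f m n"] show ?thesis
    by (simp add: case_prod_unfold)
qed

lemma summable_prod_swap:
  assumes "(\<lambda>(m, n). f m n :: complex) summable_on UNIV" shows "(\<lambda>(n, m). f m n) summable_on UNIV"
proof -
  have "bij (prod.swap :: 'b \<times> 'a \<Rightarrow> 'a \<times> 'b)" by (rule bij_swap)
  from summable_on_reindex_bij_betw[OF this, of "\<lambda>(m, n). f m n"] assms show ?thesis
    by (simp add: case_prod_unfold)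
qed

text \<open>The phase is constant on a parity class because \<open>(2 * m + a)^2\<close> and
  \<open>a^2\<close> agree modulo 4.\<close>

lemma fth_gT: "fth (act (gT k) (M2 t1 z z t2)) a b = ip (k * a\<^sup>2) * fth (M2 t1 z z t2) a b"
proof -
  have "qterm (M2 (t1 + of_int k) z z t2) (2 * m + a) n = ip (k * a\<^sup>2) * qterm (M2 t1 z z t2) (2 * m + a) n" for m n
  proof -
    have "ip (k * a\<^sup>2) = ip (k * (2 * m + a)\<^sup>2)"
      by (rule ip_cong) (simp add: cong_iff_dvd_diff power2_eq_square algebra_simps)
    thus ?thesis unfolding qterm_def by (simp add: ip_def exp_add[symmetric] algebra_simps)
  qed
  thus ?thesis unfolding fth_def act_gT by (simp add: case_prod_unfold infsum_cmult_right')
qed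

lemma fth_gV: "fth (act (gV k) (M2 t1 z z t2)) a b = fth (M2 t1 z z t2) a (b + k * a)"
proof -
  let ?O = "M2 t1 z z t2"
  have q: "qterm (act (gV k) ?O) m n = qterm ?O m (n + k * m)" for m n
    unfolding qterm_def act_gV by (simp add: algebra_simps power2_eq_square)
  have "bij (\<lambda>(m, n). (m, n + k * m))"
    by (rule o_bij[of "\<lambda>(m, n). (m, n - k * m)"]) (auto simp: o_def)
  from infsum_reindex_bij_betw[OF this, of "\<lambda>(m, n). qterm ?O (2 * m + a) (2 * n + (b + k * a))"]
  show ?thesis unfolding fth_def q by (simp add: case_prod_unfold algebra_simps)
qed

lemma fth_gW: "fth (act gW (M2 t1 z z t2)) a b = fth (M2 t1 z z t2) b a"
proof -
  have q: "qterm (act gW (M2 t1 z z t2)) m n = qterm (M2 t1 z z t2) n m" for m n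
    unfolding qterm_def act_gW by (simp add: algebra_simps)
  show ?thesis unfolding fth_def q by (rule infsum_prod_swap)
qed

text \<open>Poisson summation in the first index with the second one fixed. Splitting the result by
  parity gives the Fourier transform on two points; the factor depends on \<open>t1\<close> only, so
  it is common to all \<open>a\<close> and \<open>b\<close>.\<close>

lemma fth_gJ:
  assumes "M2 t1 z z t2 \<in> siegel2"
  obtains \<kappa> where "\<kappa> \<noteq> 0"
    "\<And>a b. fth (act gJ (M2 t1 z z t2)) a b = \<kappa> * (fth (M2 t1 z z t2) 0 b + sg a * fth (M2 t1 z z t2) 1 b)"
proof -
  let ?O = "M2 t1 z z t2"
  have t: "Im t1 > 0" using assms unfolding siegel2_iff by auto
  hence t0: "t1 \<noteq> 0" by auto
  have O': "act gJ ?O \<in> siegel2" using assms gens_act gensJ by blast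
  obtain \<kappa> where k: "\<kappa> \<noteq> 0" "\<And>w. (\<Sum>\<^sub>\<infinity>n::int. exp (- \<i> * pi * (2 * of_int n - w)\<^sup>2 / (2 * t1))) = \<kappa> * jtheta t1 w"
    using jacobi_inversion[OF t] by blast
  have "fth (act gJ ?O) a b = \<kappa> * (fth ?O 0 b + sg a * fth ?O 1 b)" for a b
  proof -
    have inner: "(\<Sum>\<^sub>\<infinity>m. qterm (act gJ ?O) (2 * m + a) n) = \<kappa> * (\<Sum>\<^sub>\<infinity>m. sg (m * a) * qterm ?O m n)" for n
    proof -
      \<comment> \<open>Completing the square in the first index moves the cross term and the shift
        \<open>a\<close> into the argument of the one-variable series.\<close>
      let ?w = "of_int n * z - of_int a"
      have "qterm (act gJ ?O) (2 * m + a) n = exp (\<i> * pi / 2 * (of_int n)\<^sup>2 * t2) * exp (- \<i> * pi * (2 * of_int m - ?w)\<^sup>2 / (2 * t1))" for m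
        unfolding qterm_def act_gJ[OF t0] exp_add[symmetric] using t0
        by (intro arg_cong[where f = exp]) (simp add: field_simps power2_eq_square)
      hence "(\<Sum>\<^sub>\<infinity>m. qterm (act gJ ?O) (2 * m + a) n) = exp (\<i> * pi / 2 * (of_int n)\<^sup>2 * t2) * (\<kappa> * jtheta t1 ?w)"
        by (simp only: infsum_cmult_right' k(2))
      also have "\<dots> = \<kappa> * (\<Sum>\<^sub>\<infinity>m. exp (\<i> * pi / 2 * (of_int n)\<^sup>2 * t2) * exp (\<i> * pi * t1 * (of_int m)\<^sup>2 / 2 + \<i> * pi * of_int m * ?w))"
        unfolding jtheta_def by (simp only: infsum_cmult_right' mult.left_commute)
      also have "(\<lambda>m::int. exp (\<i> * pi / 2 * (of_int n)\<^sup>2 * t2) * exp (\<i> * pi * t1 * (of_int m)\<^sup>2 / 2 + \<i> * pi * of_int m * ?w)) = (\<lambda>m. sg (m * a) * qterm ?O m n)"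
      proof
        fix m
        have "sg (m * a) = exp (\<i> * pi * of_int (- (m * a)))" unfolding exp_pi_sg by simp
        thus "exp (\<i> * pi / 2 * (of_int n)\<^sup>2 * t2) * exp (\<i> * pi * t1 * (of_int m)\<^sup>2 / 2 + \<i> * pi * of_int m * ?w) = sg (m * a) * qterm ?O m n"
          by (simp only: qterm_def exp_add[symmetric]) (rule arg_cong[where f = exp], simp add: field_simps)
      qed
      finally show ?thesis .
    qed
    have s1: "(\<lambda>(m, n). qterm (act gJ ?O) (2 * m + a) (2 * n + b)) summable_on UNIV" by (rule qterm_shift_summable[OF O'])
    have s2: "(\<lambda>(m, n). sg (m * a) * qterm ?O m (2 * n + b)) summable_on UNIV"
    proof -
      have "(\<lambda>(m, n). qterm ?O m n) summable_on range (\<lambda>(m, n). (m, 2 * n + b))"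
        using qterm_summable[OF assms] summable_on_subset_banach by blast
      hence "(\<lambda>(m, n). qterm ?O m n) \<circ> (\<lambda>(m, n). (m, 2 * n + b)) summable_on UNIV"
        by (subst (asm) summable_on_reindex) (auto simp: inj_on_def)
      hence "(\<lambda>p. norm (qterm ?O (fst p) (2 * snd p + b))) summable_on UNIV"
        unfolding summable_on_iff_abs_summable_on_complex by (simp add: o_def case_prod_unfold)
      moreover have "norm (sg k * w) = norm w" for k w by (simp add: sg_def)
      ultimately show ?thesis unfolding summable_on_iff_abs_summable_on_complex by (simp add: case_prod_unfold)
    qed
    have "fth (act gJ ?O) a b = (\<Sum>\<^sub>\<infinity>(n, m). qterm (act gJ ?O) (2 * m + a) (2 * n + b))"
      unfolding fth_def by (rule infsum_prod_swap)
    also have "\<dots> = (\<Sum>\<^sub>\<infinity>n. \<Sum>\<^sub>\<infinity>m. qterm (act gJ ?O) (2 * m + a) (2 * n + b))"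
      using infsum_Sigma'_banach[of "\<lambda>n m. qterm (act gJ ?O) (2 * m + a) (2 * n + b)" UNIV "\<lambda>_. UNIV"] summable_prod_swap[OF s1] by simp
    also have "\<dots> = \<kappa> * (\<Sum>\<^sub>\<infinity>n. \<Sum>\<^sub>\<infinity>m. sg (m * a) * qterm ?O m (2 * n + b))"
      unfolding inner by (rule infsum_cmult_right')
    also have "(\<Sum>\<^sub>\<infinity>n. \<Sum>\<^sub>\<infinity>m. sg (m * a) * qterm ?O m (2 * n + b)) = (\<Sum>\<^sub>\<infinity>(n, m). sg (m * a) * qterm ?O m (2 * n + b))"
      using infsum_Sigma'_banach[of "\<lambda>n m. sg (m * a) * qterm ?O m (2 * n + b)" UNIV "\<lambda>_. UNIV"] summable_prod_swap[OF s2] by simp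
    also have "\<dots> = (\<Sum>\<^sub>\<infinity>(m, n). sg (m * a) * qterm ?O m (2 * n + b))" by (rule infsum_prod_swap)
    also have "\<dots> = (\<Sum>\<^sub>\<infinity>(m, n). sg (2 * m * a) * qterm ?O (2 * m) (2 * n + b)) + (\<Sum>\<^sub>\<infinity>(m, n). sg ((2 * m + 1) * a) * qterm ?O (2 * m + 1) (2 * n + b))"
      by (rule parity_split[OF s2])
    also have "\<dots> = fth ?O 0 b + sg a * fth ?O 1 b"
    proof -
      have "sg (2 * m * a) = 1" "sg ((2 * m + 1) * a) = sg a" for m by (auto simp: sg_def)
      thus ?thesis unfolding fth_def by (simp add: case_prod_unfold infsum_cmult_right')
    qed
    finally show ?thesis .
  qed
  thus ?thesis using k that by blast
qed

text \<open>By \<open>theta_half\<close> below, \<open>gth \<Omega> a b\<close> is \<open>\<theta>\<^sub>a\<^sub>+\<^sub>2\<^sub>b(\<Omega>/2)\<close>.\<close>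
definition gth :: "cmat2 \<Rightarrow> int \<Rightarrow> int \<Rightarrow> complex" where
  "gth \<Omega> a b = (\<Sum>c\<in>{0,1}. \<Sum>d\<in>{0,1}. sg (a * c + b * d) * fth \<Omega> c d)"

lemma gth_infsum:
  assumes "\<Omega> \<in> siegel2"
  shows "gth \<Omega> a b = (\<Sum>\<^sub>\<infinity>(m, n). sg (a * m + b * n) * qterm \<Omega> m n)"
proof -
  let ?f = "\<lambda>m n. sg (a * m + b * n) * qterm \<Omega> m n"
  have s: "(\<lambda>(m, n). ?f m n) summable_on UNIV"
  proof -
    have "(\<lambda>p. norm (qterm \<Omega> (fst p) (snd p))) summable_on UNIV"
      using qterm_summable[OF assms] unfolding summable_on_iff_abs_summable_on_complex by (simp add: case_prod_unfold)
    moreover have "norm (sg k * w) = norm w" for k w by (simp add: sg_def)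
    ultimately show ?thesis unfolding summable_on_iff_abs_summable_on_complex by (simp add: case_prod_unfold)
  qed
  have s': "(\<lambda>(m, n). ?f (2 * m + c) n) summable_on UNIV" for c
  proof -
    have "(\<lambda>(m, n). ?f m n) summable_on range (\<lambda>(m, n). (2 * m + c, n))"
      using s summable_on_subset_banach by blast
    hence "(\<lambda>(m, n). ?f m n) \<circ> (\<lambda>(m, n). (2 * m + c, n)) summable_on UNIV"
      by (subst (asm) summable_on_reindex) (auto simp: inj_on_def)
    thus ?thesis by (simp add: o_def case_prod_unfold)
  qed
  have split: "(\<Sum>\<^sub>\<infinity>(m, n). ?f (2 * m + c) n) = (\<Sum>d\<in>{0,1}. sg (a * c + b * d) * fth \<Omega> c d)" for c
  proof -
    have "(\<Sum>\<^sub>\<infinity>(m, n). ?f (2 * m + c) n) = (\<Sum>\<^sub>\<infinity>(n, m). ?f (2 * m + c) n)" by (rule infsum_prod_swap)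
    also have "\<dots> = (\<Sum>\<^sub>\<infinity>(n, m). ?f (2 * m + c) (2 * n)) + (\<Sum>\<^sub>\<infinity>(n, m). ?f (2 * m + c) (2 * n + 1))"
      by (rule parity_split) (rule summable_prod_swap[OF s'])
    also have "\<dots> = (\<Sum>\<^sub>\<infinity>(m, n). ?f (2 * m + c) (2 * n)) + (\<Sum>\<^sub>\<infinity>(m, n). ?f (2 * m + c) (2 * n + 1))"
      using infsum_prod_swap[of "\<lambda>m n. ?f (2 * m + c) (2 * n)"] infsum_prod_swap[of "\<lambda>m n. ?f (2 * m + c) (2 * n + 1)"] by simp
    also have "\<dots> = (\<Sum>d\<in>{0,1}. sg (a * c + b * d) * fth \<Omega> c d)"
    proof -
      have "sg (a * (2 * m + c) + b * (2 * n)) = sg (a * c)" "sg (a * (2 * m + c) + b * (2 * n + 1)) = sg (a * c + b)" for m n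
        by (auto simp: sg_def)
      thus ?thesis unfolding fth_def by (simp add: case_prod_unfold infsum_cmult_right')
    qed
    finally show ?thesis .
  qed
  have "(\<Sum>\<^sub>\<infinity>(m, n). ?f m n) = (\<Sum>\<^sub>\<infinity>(m, n). ?f (2 * m + 0) n) + (\<Sum>\<^sub>\<infinity>(m, n). ?f (2 * m + 1) n)"
    using parity_split[OF s] by simp
  thus ?thesis unfolding split gth_def by simp
qed

lemma theta_char_half:
  assumes "\<Omega> \<in> siegel2"
  shows "theta_char (vector [a, b]) (\<Omega> /\<^sub>R 2) = gth \<Omega> a b"
proof -
  obtain t1 z t2 where O: "\<Omega> = M2 t1 z z t2" using assms by (rule siegel2_cases)
  have S: "M2 t1 z z t2 /\<^sub>R 2 = M2 (t1 / 2) (z / 2) (z / 2) (t2 / 2)"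
    unfolding scaleR_M2 M2_eq by (simp add: scaleR_conv_of_real)
  have bij: "bij (\<lambda>(m, n). vector [m, n] :: int ^ 2)"
    by (rule o_bij[of "\<lambda>v :: int ^ 2. (v $ 1, v $ 2)"]) (auto simp: o_def vec_eq_iff forall_2)
  have "theta_char (vector [a, b]) (\<Omega> /\<^sub>R 2) = (\<Sum>\<^sub>\<infinity>p. (\<lambda>n :: int ^ 2.
     exp (\<i> * of_real pi * (\<Sum>i\<in>UNIV. \<Sum>j\<in>UNIV. of_int (n $ i) * (\<Omega> /\<^sub>R 2) $ i $ j * of_int (n $ j))
        + \<i> * of_real pi * of_int (\<Sum>i\<in>UNIV. n $ i * vector [a, b] $ i))) ((\<lambda>(m, n). vector [m, n]) p))"
    unfolding theta_char_def by (rule infsum_reindex_bij_betw[OF bij, symmetric])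
  also have "\<dots> = (\<Sum>\<^sub>\<infinity>(m, n). sg (a * m + b * n) * qterm \<Omega> m n)"
  proof (rule infsum_cong)
    fix p :: "int \<times> int"
    obtain m n where p: "p = (m, n)" by (cases p)
    show "(\<lambda>n :: int ^ 2. exp (\<i> * of_real pi * (\<Sum>i\<in>UNIV. \<Sum>j\<in>UNIV. of_int (n $ i) * (\<Omega> /\<^sub>R 2) $ i $ j * of_int (n $ j))
        + \<i> * of_real pi * of_int (\<Sum>i\<in>UNIV. n $ i * vector [a, b] $ i))) ((\<lambda>(m, n). vector [m, n]) p) =
       (case p of (m, n) \<Rightarrow> sg (a * m + b * n) * qterm \<Omega> m n)"
      unfolding p S O exp_pi_sg[symmetric] qterm_def prod.case exp_add[symmetric]
      by (intro arg_cong[where f = exp]) (simp add: sum_2 field_simps power2_eq_square)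
  qed
  finally show ?thesis by (simp add: gth_infsum[OF assms])
qed

lemma theta_half: "\<Omega> \<in> siegel2 \<Longrightarrow> theta r (\<Omega> /\<^sub>R 2) = gth \<Omega> (int (r mod 2)) (int (r div 2))"
  unfolding theta_def by (rule theta_char_half)

lemma bprime_eq: "\<Omega> \<in> siegel2 \<Longrightarrow> b' r \<Omega> = gth \<Omega> (int (r mod 2)) (int (r div 2)) / gth \<Omega> 0 0"
  unfolding b'_def by (subst (1 2) theta_half) simp_all

section \<open>Transformation of theta constants under the symplectic group\<close>

lemma ip_diff: "ip (a - b) = ip a * ip (- b)" using ip_add[of a "- b"] by simp

text \<open>The four generators as operators on functions on the plane over the field with two
  elements. Arguments are integers; periodicity is imposed separately by
  \<open>per2\<close>.\<close>

definition rT :: "int \<Rightarrow> (int \<Rightarrow> int \<Rightarrow> complex) \<Rightarrow> int \<Rightarrow> int \<Rightarrow> complex" where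
  "rT k \<phi> = (\<lambda>a b. ip (k * a\<^sup>2) * \<phi> a b)"
definition rV :: "int \<Rightarrow> (int \<Rightarrow> int \<Rightarrow> complex) \<Rightarrow> int \<Rightarrow> int \<Rightarrow> complex" where
  "rV k \<phi> = (\<lambda>a b. \<phi> a (b + k * a))"
definition rJ :: "(int \<Rightarrow> int \<Rightarrow> complex) \<Rightarrow> int \<Rightarrow> int \<Rightarrow> complex" where
  "rJ \<phi> = (\<lambda>a b. \<phi> 0 b + sg a * \<phi> 1 b)"
definition rW :: "(int \<Rightarrow> int \<Rightarrow> complex) \<Rightarrow> int \<Rightarrow> int \<Rightarrow> complex" where
  "rW \<phi> = (\<lambda>a b. \<phi> b a)"

text \<open>A relation, because the operator belongs to a word in the generators: four factors
  \<open>gJ\<close> multiply to the identity matrix, but on periodic functions their operators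
  multiply to 4.\<close>

inductive weil :: "imat4 \<Rightarrow> ((int \<Rightarrow> int \<Rightarrow> complex) \<Rightarrow> int \<Rightarrow> int \<Rightarrow> complex) \<Rightarrow> bool" where
  weil_one: "weil (mat 1) (\<lambda>\<phi>. \<phi>)"
| weil_T: "weil M \<rho> \<Longrightarrow> weil (gT k ** M) (\<lambda>\<phi>. rT k (\<rho> \<phi>))"
| weil_V: "weil M \<rho> \<Longrightarrow> weil (gV k ** M) (\<lambda>\<phi>. rV k (\<rho> \<phi>))"
| weil_J: "weil M \<rho> \<Longrightarrow> weil (gJ ** M) (\<lambda>\<phi>. rJ (\<rho> \<phi>))"
| weil_W: "weil M \<rho> \<Longrightarrow> weil (gW ** M) (\<lambda>\<phi>. rW (\<rho> \<phi>))"

lemma weil_exists: "M \<in> Sp4Z \<Longrightarrow> \<exists>\<rho>. weil M \<rho>"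
proof (induction rule: Sp4Z_induct)
  case one show ?case using weil_one by blast
next
  case (mult g M)
  then obtain \<rho> where r: "weil M \<rho>" by blast
  from mult(1) show ?case
    by cases (use weil_T[OF r] weil_V[OF r] weil_J[OF r] weil_W[OF r] in blast)+
qed

lemma weil_Sp4Z: "weil M \<rho> \<Longrightarrow> M \<in> Sp4Z"
  by (induction rule: weil.induct) (auto intro: one_Sp4Z Sp4Z_mult gens_Sp4Z gens.intros)

lemma weil_linear: "weil M \<rho> \<Longrightarrow> \<rho> (\<lambda>a b. x * \<phi> a b + y * \<psi> a b) = (\<lambda>a b. x * \<rho> \<phi> a b + y * \<rho> \<psi> a b)"
  by (induction rule: weil.induct) (auto simp: rT_def rV_def rJ_def rW_def algebra_simps)

text \<open>The scalar may depend on the point, but it is common to all components and so cancels in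
  every quotient.\<close>

lemma weil_fth:
  assumes "weil M \<rho>" "\<Omega> \<in> siegel2"
  shows "\<exists>\<kappa>. \<kappa> \<noteq> 0 \<and> fth (act M \<Omega>) = (\<lambda>a b. \<kappa> * \<rho> (fth \<Omega>) a b)"
  using assms(1)
proof (induction rule: weil.induct)
  case weil_one
  show ?case by (intro exI[of _ 1]) (simp add: act_one)
next
  case (weil_T M \<rho> k)
  then obtain \<kappa> where k: "\<kappa> \<noteq> 0" "fth (act M \<Omega>) = (\<lambda>a b. \<kappa> * \<rho> (fth \<Omega>) a b)" by blast
  have "act M \<Omega> \<in> siegel2" using weil_T weil_Sp4Z assms act_siegel2 by blast
  then obtain t1 z t2 where O: "act M \<Omega> = M2 t1 z z t2" using siegel2_cases by metis
  have "act (gT k ** M) \<Omega> = act (gT k) (M2 t1 z z t2)"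
    using act_mult[of "gT k" M \<Omega>] weil_T assms weil_Sp4Z gens_Sp4Z gens.intros O by simp
  thus ?case using k fth_gT[of k t1 z t2] unfolding O by (intro exI[of _ \<kappa>]) (auto simp: fun_eq_iff rT_def)
next
  case (weil_V M \<rho> k)
  then obtain \<kappa> where k: "\<kappa> \<noteq> 0" "fth (act M \<Omega>) = (\<lambda>a b. \<kappa> * \<rho> (fth \<Omega>) a b)" by blast
  have "act M \<Omega> \<in> siegel2" using weil_V weil_Sp4Z assms act_siegel2 by blast
  then obtain t1 z t2 where O: "act M \<Omega> = M2 t1 z z t2" using siegel2_cases by metis
  have "act (gV k ** M) \<Omega> = act (gV k) (M2 t1 z z t2)"
    using act_mult[of "gV k" M \<Omega>] weil_V assms weil_Sp4Z gens_Sp4Z gens.intros O by simp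
  thus ?case using k fth_gV[of k t1 z t2] unfolding O by (intro exI[of _ \<kappa>]) (auto simp: fun_eq_iff rV_def)
next
  case (weil_J M \<rho>)
  then obtain \<kappa> where k: "\<kappa> \<noteq> 0" "fth (act M \<Omega>) = (\<lambda>a b. \<kappa> * \<rho> (fth \<Omega>) a b)" by blast
  have s: "act M \<Omega> \<in> siegel2" using weil_J weil_Sp4Z assms act_siegel2 by blast
  then obtain t1 z t2 where O: "act M \<Omega> = M2 t1 z z t2" using siegel2_cases by metis
  have a: "act (gJ ** M) \<Omega> = act gJ (M2 t1 z z t2)"
    using act_mult[of gJ M \<Omega>] weil_J assms weil_Sp4Z gens_Sp4Z gens.intros O by simp
  obtain \<kappa>' where k': "\<kappa>' \<noteq> 0" "\<And>a b. fth (act gJ (M2 t1 z z t2)) a b = \<kappa>' * (fth (M2 t1 z z t2) 0 b + sg a * fth (M2 t1 z z t2) 1 b)"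
    using fth_gJ s unfolding O by blast
  show ?case using k k' unfolding a O by (intro exI[of _ "\<kappa> * \<kappa>'"]) (auto simp: fun_eq_iff rJ_def algebra_simps)
next
  case (weil_W M \<rho>)
  then obtain \<kappa> where k: "\<kappa> \<noteq> 0" "fth (act M \<Omega>) = (\<lambda>a b. \<kappa> * \<rho> (fth \<Omega>) a b)" by blast
  have "act M \<Omega> \<in> siegel2" using weil_W weil_Sp4Z assms act_siegel2 by blast
  then obtain t1 z t2 where O: "act M \<Omega> = M2 t1 z z t2" using siegel2_cases by metis
  have "act (gW ** M) \<Omega> = act gW (M2 t1 z z t2)"
    using act_mult[of gW M \<Omega>] weil_W assms weil_Sp4Z gens_Sp4Z gens.intros O by simp
  thus ?case using k fth_gW[of t1 z t2] unfolding O by (intro exI[of _ \<kappa>]) (auto simp: fun_eq_iff rW_def)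
qed

definition per2 :: "(int \<Rightarrow> int \<Rightarrow> complex) \<Rightarrow> bool" where
  "per2 \<phi> \<longleftrightarrow> (\<forall>a b k l. \<phi> (a + 2 * k) (b + 2 * l) = \<phi> a b)"

lemma per2D: "per2 \<phi> \<Longrightarrow> even (a - c) \<Longrightarrow> even (b - d) \<Longrightarrow> \<phi> a b = \<phi> c d"
proof -
  assume p: "per2 \<phi>" and "even (a - c)" "even (b - d)"
  then obtain k l where "a = c + 2 * k" "b = d + 2 * l" by (metis add.commute diff_add_cancel dvdE)
  thus ?thesis using p by (simp add: per2_def)
qed

lemma per2I: "(\<And>a b c d. even (a - c) \<Longrightarrow> even (b - d) \<Longrightarrow> \<phi> a b = \<phi> c d) \<Longrightarrow> per2 \<phi>"
  unfolding per2_def by (metis add_diff_cancel_left' dvd_triv_left)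

lemma per2_fth: "per2 (fth \<Omega>)"
  unfolding per2_def using fth_period by blast

lemma ip_sq_cong: "even (a - c) \<Longrightarrow> ip (k * a\<^sup>2) = ip (k * c\<^sup>2)"
proof -
  assume "even (a - c)"
  then obtain j where "a - c = 2 * j" by blast
  hence a: "a = c + 2 * j" by simp
  have "k * a\<^sup>2 - k * c\<^sup>2 = 4 * (k * j * (c + j))" by (simp add: a power2_eq_square algebra_simps)
  thus ?thesis by (intro ip_cong) (metis cong_iff_dvd_diff dvd_triv_left)
qed

lemma sg_cong: "even (a - c) \<Longrightarrow> sg a = sg c" by (auto simp: sg_def)

lemma weil_per2: "weil M \<rho> \<Longrightarrow> per2 \<phi> \<Longrightarrow> per2 (\<rho> \<phi>)"
proof (induction rule: weil.induct)
  case (weil_T M \<rho> k)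
  hence p: "per2 (\<rho> \<phi>)" by blast
  show ?case
  proof (rule per2I)
    fix a b c d :: int assume e: "even (a - c)" "even (b - d)"
    show "rT k (\<rho> \<phi>) a b = rT k (\<rho> \<phi>) c d" unfolding rT_def per2D[OF p e] ip_sq_cong[OF e(1)] ..
  qed
next
  case (weil_V M \<rho> k)
  hence p: "per2 (\<rho> \<phi>)" by blast
  show ?case
  proof (rule per2I)
    fix a b c d :: int assume e: "even (a - c)" "even (b - d)"
    hence "even ((b - d) + k * (a - c))" by simp
    hence "even (b + k * a - (d + k * c))" by (simp add: algebra_simps)
    thus "rV k (\<rho> \<phi>) a b = rV k (\<rho> \<phi>) c d" unfolding rV_def using per2D[OF p] e by blast
  qed
next
  case (weil_J M \<rho>)
  hence p: "per2 (\<rho> \<phi>)" by blast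
  show ?case 
  proof (rule per2I)
    fix a b c d :: int assume e: "even (a - c)" "even (b - d)"
    have "\<rho> \<phi> 0 b = \<rho> \<phi> 0 d" "\<rho> \<phi> 1 b = \<rho> \<phi> 1 d" by (rule per2D[OF p]; use e in simp)+
    thus "rJ (\<rho> \<phi>) a b = rJ (\<rho> \<phi>) c d" unfolding rJ_def sg_cong[OF e(1)] by simp
  qed
next
  case (weil_W M \<rho>)
  hence p: "per2 (\<rho> \<phi>)" by blast
  show ?case by (rule per2I) (unfold rW_def, rule per2D[OF p])
qed simp

text \<open>Each generator acts invertibly on functions modulo 2. This excludes the scalar 0 once an
  operator is known to be scalar.\<close>

lemma weil_inj: "weil M \<rho> \<Longrightarrow> per2 \<phi> \<Longrightarrow> \<rho> \<phi> = (\<lambda>a b. 0) \<Longrightarrow> \<phi> = (\<lambda>a b. 0)"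
proof (induction rule: weil.induct)
  case (weil_T M \<rho> k)
  hence "\<rho> \<phi> = (\<lambda>a b. 0)" by (auto simp: fun_eq_iff rT_def)
  thus ?case using weil_T by blast
next
  case (weil_V M \<rho> k)
  have "\<rho> \<phi> a b = 0" for a b using fun_cong[OF fun_cong[OF weil_V(4)], of a "b - k * a"] by (simp add: rV_def)
  hence "\<rho> \<phi> = (\<lambda>a b. 0)" by (auto simp: fun_eq_iff)
  thus ?case using weil_V by blast
next
  case (weil_J M \<rho>)
  have p: "per2 (\<rho> \<phi>)" using weil_J weil_per2 by blast
  have *: "\<rho> \<phi> 0 b + \<rho> \<phi> 1 b = 0" "\<rho> \<phi> 0 b - \<rho> \<phi> 1 b = 0" for b
    using fun_cong[OF fun_cong[OF weil_J(4)], of 0 b] fun_cong[OF fun_cong[OF weil_J(4)], of 1 b] by (simp_all add: rJ_def)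
  have 0: "\<rho> \<phi> 0 b = 0" "\<rho> \<phi> 1 b = 0" for b using *[of b] by auto
  have "\<rho> \<phi> a b = 0" for a b
  proof (cases "even a")
    case True thus ?thesis using per2D[OF p, of a 0 b b] 0 by simp
  next
    case False thus ?thesis using per2D[OF p, of a 1 b b] 0 by simp
  qed
  hence "\<rho> \<phi> = (\<lambda>a b. 0)" by (auto simp: fun_eq_iff)
  thus ?case using weil_J by blast
next
  case (weil_W M \<rho>)
  have "\<rho> \<phi> a b = 0" for a b using fun_cong[OF fun_cong[OF weil_W(4)], of b a] by (simp add: rW_def)
  hence "\<rho> \<phi> = (\<lambda>a b. 0)" by (auto simp: fun_eq_iff)
  thus ?case using weil_W by blast
qed

text \<open>The Heisenberg operator \<open>\<i>^(x \<bullet> y) X^y Z^x\<close> attached to \<open>v = (x, y)\<close>. The phase makes the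
  intertwining relation below exact, so that it detects the condition on diagonals modulo 4.\<close>
definition heis :: "int ^ (2 + 2) \<Rightarrow> (int \<Rightarrow> int \<Rightarrow> complex) \<Rightarrow> int \<Rightarrow> int \<Rightarrow> complex" where
  "heis v \<phi> = (\<lambda>a b. ip (v $ Inl 1 * v $ Inr 1 + v $ Inl 2 * v $ Inr 2) *
     sg (v $ Inl 1 * (a - v $ Inr 1) + v $ Inl 2 * (b - v $ Inr 2)) * \<phi> (a - v $ Inr 1) (b - v $ Inr 2))"

lemma bm_vec [simp]:
  "(bm A B C D *v v) $ Inl i = A $ i $ 1 * v $ Inl 1 + A $ i $ 2 * v $ Inl 2 + (B $ i $ 1 * v $ Inr 1 + B $ i $ 2 * v $ Inr 2)"
  "(bm A B C D *v v) $ Inr i = C $ i $ 1 * v $ Inl 1 + C $ i $ 2 * v $ Inl 2 + (D $ i $ 1 * v $ Inr 1 + D $ i $ 2 * v $ Inr 2)"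
  by (simp_all add: matrix_vector_mult_def sum_UNIV_sum sum_2 bm_def)

text \<open>Covariance is checked on the generators, where it reduces to phases: expanding the
  square of \<open>(a - y) + y\<close> for \<open>gT\<close>, and
  \<open>i^(xy) (-1)^(xy) = i^(-xy)\<close> for \<open>gJ\<close>.\<close>

lemma weil_heis: "weil M \<rho> \<Longrightarrow> per2 \<phi> \<Longrightarrow> \<rho> (heis v \<phi>) = heis (M *v v) (\<rho> \<phi>)"
proof (induction rule: weil.induct)
  case weil_one
  show ?case by simp
next
  case (weil_T M \<rho> k)
  hence p: "per2 (\<rho> \<phi>)" using weil_per2 by blast
  have *: "rT k (heis w \<psi>) = heis (gT k *v w) (rT k \<psi>)" for w \<psi>
  proof (intro ext)
    fix a b
    have "ip (k * a\<^sup>2) = sg (k * w $ Inr 1 * (a - w $ Inr 1)) * ip (k * (w $ Inr 1)\<^sup>2) * ip (k * (a - w $ Inr 1)\<^sup>2)"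
      unfolding ip_2[symmetric] ip_add[symmetric] by (rule arg_cong[where f = ip]) (simp add: power2_eq_square algebra_simps)
    thus "rT k (heis w \<psi>) a b = heis (gT k *v w) (rT k \<psi>) a b" unfolding rT_def heis_def gT_def
      by (simp add: ip_add sg_add distrib_right power2_eq_square) (simp add: mult_ac)
  qed
  thus ?case using weil_T by (simp add: matrix_vector_mul_assoc[symmetric])
next
  case (weil_V M \<rho> k)
  have *: "rV k (heis w \<psi>) = heis (gV k *v w) (rV k \<psi>)" for w \<psi>
    unfolding rV_def heis_def gV_def by (simp add: fun_eq_iff algebra_simps)
  thus ?case using weil_V by (simp add: matrix_vector_mul_assoc[symmetric])
next
  case (weil_J M \<rho>)
  hence p: "per2 (\<rho> \<phi>)" using weil_per2 by blast
  have *: "rJ (heis w \<psi>) = heis (gJ *v w) (rJ \<psi>)" if p: "per2 \<psi>" for w \<psi>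
  proof (intro ext)
    fix a b
    define x where "x = w $ Inl 1"
    define y where "y = w $ Inr 1"
    define i where "i = ip (w $ Inl 2 * w $ Inr 2)"
    define s where "s = sg (w $ Inl 2 * (b - w $ Inr 2))"
    define h where "h c = \<psi> c (b - w $ Inr 2)" for c
    have ch: "h (0 - y) = (if even y then h 0 else h 1)" "h (1 - y) = (if even y then h 1 else h 0)"
      unfolding h_def by (cases "even y"; simp only: if_True if_False; rule per2D[OF p]; simp)+
    have "ip (x * y) * sg (x * y) = ip (- (x * y))"
      unfolding ip_2[symmetric] ip_add[symmetric] using ip_4[of "x * y"] ip_add[of "4 * (x*y)" "-(x*y)"] by simp
    hence inv: "ip (- (x * y)) = ip (x * y) * sg (x * y)" by simp
    have L: "rJ (heis w \<psi>) a b = ip (x * y) * i * s * (sg (x * (0 - y)) * h (0 - y) + sg a * sg (x * (1 - y)) * h (1 - y))"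
      unfolding rJ_def heis_def x_def y_def i_def s_def h_def by (simp add: ip_add sg_add sg_diff algebra_simps)
    have R: "heis (gJ *v w) (rJ \<psi>) a b = ip (- (x * y)) * i * sg (- y * (a - x)) * s * (h 0 + sg (a - x) * h 1)"
      unfolding rJ_def heis_def x_def y_def i_def s_def h_def gJ_def by (simp add: ip_diff sg_add sg_diff algebra_simps)
    show "rJ (heis w \<psi>) a b = heis (gJ *v w) (rJ \<psi>) a b" unfolding L R ch inv
      by (cases "even x"; cases "even y"; cases "even a") (simp_all add: sg_def algebra_simps)
  qed
  show ?case using weil_J *[OF p] by (simp add: matrix_vector_mul_assoc[symmetric])
next
  case (weil_W M \<rho>)
  have *: "rW (heis w \<psi>) = heis (gW *v w) (rW \<psi>)" for w \<psi>
    unfolding rW_def heis_def gW_def by (simp add: fun_eq_iff algebra_simps)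
  thus ?case using weil_W by (simp add: matrix_vector_mul_assoc[symmetric])
qed

lemma Gamma24_m4:
  "m4 a1 a2 a3 a4 b1 b2 b3 b4 c1 c2 c3 c4 d1 d2 d3 d4 \<in> Gamma24 \<longleftrightarrow>
   m4 a1 a2 a3 a4 b1 b2 b3 b4 c1 c2 c3 c4 d1 d2 d3 d4 \<in> Sp4Z \<and>
   odd a1 \<and> even a2 \<and> even a3 \<and> odd a4 \<and> even b2 \<and> even b3 \<and> even c2 \<and> even c3 \<and>
   odd d1 \<and> even d2 \<and> even d3 \<and> odd d4 \<and> 4 dvd b1 \<and> 4 dvd b4 \<and> 4 dvd c1 \<and> 4 dvd c4"
proof -
  have e: "even x" if "4 dvd x" for x :: int using that by (metis dvd_trans even_numeral)
  have m: "[x = 1] (mod 2) \<longleftrightarrow> odd x" for x :: int by (simp add: cong_iff_dvd_diff)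
  show ?thesis
    unfolding Gamma24_def mat_1_m4 mem_Collect_eq all_sum forall_2 block_bm M2_nth cong_0_iff
    unfolding bm_def by (simp add: cong_0_iff m) (use e in blast)
qed

lemma Gamma24_Sp4Z: "M \<in> Gamma24 \<Longrightarrow> M \<in> Sp4Z" by (simp add: Gamma24_def)

text \<open>The vectors \<open>M *v v\<close> and \<open>v\<close> agree modulo 2, so the operators
  agree up to the phase. For a column of \<open>M\<close> the phase exponent is divisible by 4
  thanks to the conditions on the diagonals of \<open>B\<close> and \<open>C\<close>.\<close>

lemma heis_Gamma24:
  assumes M: "M \<in> Gamma24" and p: "per2 \<phi>"
    and v: "v \<in> {axis (Inl 1) 1, axis (Inl 2) 1, axis (Inr 1) 1, axis (Inr 2) 1}"
  shows "heis (M *v v) \<phi> = heis v \<phi>"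
proof -
  obtain a1 a2 a3 a4 b1 b2 b3 b4 c1 c2 c3 c4 d1 d2 d3 d4 where
    Meq: "M = m4 a1 a2 a3 a4 b1 b2 b3 b4 c1 c2 c3 c4 d1 d2 d3 d4" by (rule m4_cases)
  have c: "odd a1" "even a2" "even a3" "odd a4" "even b2" "even b3" "even c2" "even c3"
     "odd d1" "even d2" "even d3" "odd d4" "4 dvd b1" "4 dvd b4" "4 dvd c1" "4 dvd c4"
    using M unfolding Meq Gamma24_m4 by auto
  have c': "even b1" "even b4" "even c1" "even c4" using c by (meson dvd_trans even_numeral)+
  have m: "4 dvd x * y" if "even x" "even y" for x y :: int using mult_dvd_mono[OF that] by simp
  have ip4: "ip x = 1" if "4 dvd x" for x using that ip_4 by (metis dvdE)
  have i: "ip (a1 * c1 + a3 * c3) = 1" "ip (a2 * c2 + a4 * c4) = 1" "ip (b1 * d1 + b3 * d3) = 1" "ip (b2 * d2 + b4 * d4) = 1"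
    by (rule ip4, rule dvd_add, use c m in \<open>simp_all add: dvd_mult dvd_mult2\<close>)+
  have sgc: "sg x = sg y" if "even (x - y)" for x y using that by (rule sg_cong)
  from v consider "v = axis (Inl 1) 1" | "v = axis (Inl 2) 1" | "v = axis (Inr 1) 1" | "v = axis (Inr 2) 1" by blast
  thus ?thesis
  proof cases
    case 1
    have "sg (a1 * (a - c1) + a3 * (b - c3)) = sg a" "\<phi> (a - c1) (b - c3) = \<phi> a b" for a b
      by (rule sgc per2D[OF p]; use c c' in simp)+
    thus ?thesis by (simp add: fun_eq_iff heis_def Meq 1 axis_def i)
  next
    case 2
    have "sg (a2 * (a - c2) + a4 * (b - c4)) = sg b" "\<phi> (a - c2) (b - c4) = \<phi> a b" for a b
      by (rule sgc per2D[OF p]; use c c' in simp)+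
    thus ?thesis by (simp add: fun_eq_iff heis_def Meq 2 axis_def i)
  next
    case 3
    have "sg (b1 * (a - d1) + b3 * (b - d3)) = 1" "\<phi> (a - d1) (b - d3) = \<phi> (a - 1) b" for a b
      by (rule sg_even per2D[OF p]; use c c' in simp)+
    thus ?thesis by (simp add: fun_eq_iff heis_def Meq 3 axis_def i)
  next
    case 4
    have "sg (b2 * (a - d2) + b4 * (b - d4)) = 1" "\<phi> (a - d2) (b - d4) = \<phi> a (b - 1)" for a b
      by (rule sg_even per2D[OF p]; use c c' in simp)+
    thus ?thesis by (simp add: fun_eq_iff heis_def Meq 4 axis_def i)
  qed
qed

text \<open>Schur's lemma by hand. Commuting with the two modulations keeps the image of
  \<open>\<delta>\<close> supported at the origin, commuting with the two shifts carries the same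
  scalar to its translates, and these span all periodic functions.\<close>

lemma Gamma24_fth:
  assumes M: "M \<in> Gamma24" and O: "\<Omega> \<in> siegel2"
  obtains \<kappa> where "\<kappa> \<noteq> 0" "\<And>a b. fth (act M \<Omega>) a b = \<kappa> * fth \<Omega> a b"
proof -
  obtain \<rho> where r: "weil M \<rho>" using weil_exists M Gamma24_Sp4Z by blast
  define \<delta> :: "int \<Rightarrow> int \<Rightarrow> complex" where "\<delta> a b = (if even a \<and> even b then 1 else 0)" for a b
  have pd: "per2 \<delta>" by (rule per2I) (auto simp: \<delta>_def)
  have pr: "per2 (\<rho> \<phi>)" if "per2 \<phi>" for \<phi> using weil_per2[OF r that] .
  have comm: "\<rho> (heis v \<phi>) = heis v (\<rho> \<phi>)"
    if "per2 \<phi>" "v \<in> {axis (Inl 1) 1, axis (Inl 2) 1, axis (Inr 1) 1, axis (Inr 2) 1}" for v \<phi>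
    using weil_heis[OF r that(1)] heis_Gamma24[OF M pr[OF that(1)] that(2)] by simp
  have Z1: "heis (axis (Inl 1) 1) \<phi> = (\<lambda>a b. sg a * \<phi> a b)" for \<phi> by (simp add: heis_def axis_def fun_eq_iff)
  have Z2: "heis (axis (Inl 2) 1) \<phi> = (\<lambda>a b. sg b * \<phi> a b)" for \<phi> by (simp add: heis_def axis_def fun_eq_iff)
  have X1: "heis (axis (Inr 1) 1) \<phi> = (\<lambda>a b. \<phi> (a - 1) b)" for \<phi> by (simp add: heis_def axis_def fun_eq_iff)
  have X2: "heis (axis (Inr 2) 1) \<phi> = (\<lambda>a b. \<phi> a (b - 1))" for \<phi> by (simp add: heis_def axis_def fun_eq_iff)
  define lam where "lam = \<rho> \<delta> 0 0"
  have rd: "\<rho> \<delta> = (\<lambda>a b. lam * \<delta> a b)"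
  proof -
    have "heis (axis (Inl 1) 1) \<delta> = \<delta>" "heis (axis (Inl 2) 1) \<delta> = \<delta>" unfolding Z1 Z2 by (auto simp: fun_eq_iff \<delta>_def sg_def)
    hence e: "\<rho> \<delta> = heis (axis (Inl 1) 1) (\<rho> \<delta>)" "\<rho> \<delta> = heis (axis (Inl 2) 1) (\<rho> \<delta>)"
      using comm[OF pd, of "axis (Inl 1) 1"] comm[OF pd, of "axis (Inl 2) 1"] by auto
    have "\<rho> \<delta> a b = lam * \<delta> a b" for a b
    proof (cases "even a \<and> even b")
      case True thus ?thesis using per2D[OF pr[OF pd], of a 0 b 0] by (simp add: \<delta>_def lam_def)
    next
      case False
      have "\<rho> \<delta> a b = sg a * \<rho> \<delta> a b" "\<rho> \<delta> a b = sg b * \<rho> \<delta> a b"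
        using fun_cong[OF fun_cong[OF e(1)], of a b] fun_cong[OF fun_cong[OF e(2)], of a b] unfolding Z1 Z2 by auto
      thus ?thesis using False by (auto simp: sg_def \<delta>_def)
    qed
    thus ?thesis by (simp add: fun_eq_iff)
  qed
  let ?X1 = "\<lambda>\<phi> a b. \<phi> (a - 1) b :: complex" and ?X2 = "\<lambda>\<phi> a b. \<phi> a (b - 1) :: complex"
  have cX1: "\<rho> (?X1 \<phi>) = ?X1 (\<rho> \<phi>)" if "per2 \<phi>" for \<phi> using comm[OF that, of "axis (Inr 1) 1"] unfolding X1 by simp
  have cX2: "\<rho> (?X2 \<phi>) = ?X2 (\<rho> \<phi>)" if "per2 \<phi>" for \<phi> using comm[OF that, of "axis (Inr 2) 1"] unfolding X2 by simp
  have scal: "\<rho> \<phi> = (\<lambda>a b. lam * \<phi> a b)" if p: "per2 \<phi>" for \<phi>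
  proof -
    have p1: "per2 (?X1 \<delta>)" and p2: "per2 (?X2 \<delta>)" by (rule per2I, auto simp: \<delta>_def)+
    have r1: "\<rho> (?X1 \<delta>) = (\<lambda>a b. lam * ?X1 \<delta> a b)" unfolding cX1[OF pd] rd ..
    have r2: "\<rho> (?X2 \<delta>) = (\<lambda>a b. lam * ?X2 \<delta> a b)" unfolding cX2[OF pd] rd ..
    have r12: "\<rho> (?X2 (?X1 \<delta>)) = (\<lambda>a b. lam * ?X2 (?X1 \<delta>) a b)" unfolding cX2[OF p1] r1 ..
    have eq: "\<phi> = (\<lambda>a b. 1 * (\<phi> 0 0 * \<delta> a b + \<phi> 1 0 * ?X1 \<delta> a b) + 1 * (\<phi> 0 1 * ?X2 \<delta> a b + \<phi> 1 1 * ?X2 (?X1 \<delta>) a b))"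
    proof (intro ext)
      fix a b
      have "\<phi> a b = \<phi> (if even a then 0 else 1) (if even b then 0 else 1)" by (rule per2D[OF p]) auto
      thus "\<phi> a b = 1 * (\<phi> 0 0 * \<delta> a b + \<phi> 1 0 * ?X1 \<delta> a b) + 1 * (\<phi> 0 1 * ?X2 \<delta> a b + \<phi> 1 1 * ?X2 (?X1 \<delta>) a b)"
        by (auto simp: \<delta>_def)
    qed
    have "\<rho> \<phi> = (\<lambda>a b. 1 * (\<phi> 0 0 * \<rho> \<delta> a b + \<phi> 1 0 * \<rho> (?X1 \<delta>) a b) + 1 * (\<phi> 0 1 * \<rho> (?X2 \<delta>) a b + \<phi> 1 1 * \<rho> (?X2 (?X1 \<delta>)) a b))"
      by (subst eq, subst weil_linear[OF r], subst weil_linear[OF r], subst weil_linear[OF r]) (rule refl)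
    also have "\<dots> = (\<lambda>a b. lam * (1 * (\<phi> 0 0 * \<delta> a b + \<phi> 1 0 * ?X1 \<delta> a b) + 1 * (\<phi> 0 1 * ?X2 \<delta> a b + \<phi> 1 1 * ?X2 (?X1 \<delta>) a b)))"
      unfolding rd r1 r2 r12 by (simp add: fun_eq_iff algebra_simps)
    also have "\<dots> = (\<lambda>a b. lam * \<phi> a b)" using eq by metis
    finally show ?thesis .
  qed
  have l0: "lam \<noteq> 0"
  proof
    assume "lam = 0"
    hence "\<delta> = (\<lambda>a b. 0)" using weil_inj[OF r pd] rd by simp
    hence "\<delta> 0 0 = 0" by metis
    thus False by (simp add: \<delta>_def)
  qed
  obtain \<kappa> where k: "\<kappa> \<noteq> 0" "fth (act M \<Omega>) = (\<lambda>a b. \<kappa> * \<rho> (fth \<Omega>) a b)" using weil_fth[OF r O] by blast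
  show ?thesis using that[of "\<kappa> * lam"] k l0 scal[OF per2_fth] by simp
qed

lemma Gamma24_gth:
  assumes M: "M \<in> Gamma24" and O: "\<Omega> \<in> siegel2"
  obtains \<kappa> where "\<kappa> \<noteq> 0" "\<And>a b. gth (act M \<Omega>) a b = \<kappa> * gth \<Omega> a b"
proof -
  obtain \<kappa> where "\<kappa> \<noteq> 0" "\<And>a b. fth (act M \<Omega>) a b = \<kappa> * fth \<Omega> a b" using Gamma24_fth[OF assms] by blast
  thus ?thesis using that[of \<kappa>] by (simp add: gth_def algebra_simps)
qed

text \<open>The inversion of both variables, \<open>- \<Omega>^(-1)\<close>. It exchanges the
  \<open>fth\<close> with their Fourier transforms \<open>gth\<close>, and upper with lower
  unipotent matrices.\<close>

definition gF :: imat4 where "gF = m4 0 0 0 0 (-1) 0 0 (-1) 1 0 0 1 0 0 0 0"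

lemma gF_Sp4Z: "gF \<in> Sp4Z" by (simp add: gF_def m4_Sp4Z)

lemma fth_gF:
  assumes O: "\<Omega> \<in> siegel2"
  obtains \<kappa> where "\<kappa> \<noteq> 0" "\<And>a b. fth (act gF \<Omega>) a b = \<kappa> * gth \<Omega> a b"
proof -
  have e: "gJ ** (gW ** (gJ ** (gW ** mat 1))) = gF" by (simp add: gJ_def gW_def gF_def mat_1_m4)
  have "weil gF (\<lambda>\<phi>. rJ (rW (rJ (rW \<phi>))))"
    using weil_J[OF weil_W[OF weil_J[OF weil_W[OF weil_one]]]] unfolding e .
  from weil_fth[OF this O] obtain \<kappa> where "\<kappa> \<noteq> 0" "fth (act gF \<Omega>) = (\<lambda>a b. \<kappa> * rJ (rW (rJ (rW (fth \<Omega>)))) a b)" by blast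
  thus ?thesis using that[of \<kappa>] by (simp add: gth_def rJ_def rW_def sg_add algebra_simps)
qed

text \<open>The Fourier transform on four points squares to 4 times the identity on periodic
  functions.\<close>

lemma gth_gF:
  assumes O: "\<Omega> \<in> siegel2"
  obtains \<kappa> where "\<kappa> \<noteq> 0" "\<And>a b. gth (act gF \<Omega>) a b = \<kappa> * fth \<Omega> a b"
proof -
  obtain \<kappa> where k: "\<kappa> \<noteq> 0" "\<And>a b. fth (act gF \<Omega>) a b = \<kappa> * gth \<Omega> a b" using fth_gF[OF O] by blast
  have "gth (act gF \<Omega>) a b = (4 * \<kappa>) * fth \<Omega> a b" for a b
  proof -
    have "fth \<Omega> a b = fth \<Omega> (if even a then 0 else 1) (if even b then 0 else 1)"
      by (rule per2D[OF per2_fth]) auto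
    thus ?thesis unfolding gth_def k by (auto simp: sg_def algebra_simps)
  qed
  thus ?thesis using that[of "4 * \<kappa>"] k by simp
qed

section \<open>The actions on the functions \<open>b' r\<close>\<close>

lemma four_dvd_even_mult: "even x \<Longrightarrow> even y \<Longrightarrow> 4 dvd x * (y::int)"
  using mult_dvd_mono[of 2 x 2 y] by simp

lemma four_dvd_imp_even: "4 dvd x \<Longrightarrow> even (x::int)"
  by (meson dvd_trans even_numeral)

lemma Gamma24_parity:
  assumes "m4 a1 a2 a3 a4 b1 b2 b3 b4 c1 c2 c3 c4 d1 d2 d3 d4 \<in> Gamma24"
  shows "odd a1" "even a2" "even a3" "odd a4" "even b2" "even b3" "even c2" "even c3"
    "odd d1" "even d2" "even d3" "odd d4" "4 dvd b1" "4 dvd b4" "4 dvd c1" "4 dvd c4"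
    "even b1" "even b4" "even c1" "even c4"
  using assms four_dvd_imp_even unfolding Gamma24_m4 by blast+

lemma Gamma24_mult:
  assumes "M \<in> Gamma24" "N \<in> Gamma24" shows "M ** N \<in> Gamma24"
proof -
  have S: "M ** N \<in> Sp4Z" using assms Gamma24_Sp4Z Sp4Z_mult by blast
  obtain a1 a2 a3 a4 b1 b2 b3 b4 c1 c2 c3 c4 d1 d2 d3 d4 where
    M: "M = m4 a1 a2 a3 a4 b1 b2 b3 b4 c1 c2 c3 c4 d1 d2 d3 d4" by (rule m4_cases)
  note M' = Gamma24_parity[OF assms(1)[unfolded M]]
  obtain A1 A2 A3 A4 B1 B2 B3 B4 C1 C2 C3 C4 D1 D2 D3 D4 where
    N: "N = m4 A1 A2 A3 A4 B1 B2 B3 B4 C1 C2 C3 C4 D1 D2 D3 D4" by (rule m4_cases)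
  note N' = Gamma24_parity[OF assms(2)[unfolded N]]
  have par: "odd (a1 * A1 + a2 * A3 + (b1 * C1 + b2 * C3))" "even (a1 * A2 + a2 * A4 + (b1 * C2 + b2 * C4))"
    "even (a3 * A1 + a4 * A3 + (b3 * C1 + b4 * C3))" "odd (a3 * A2 + a4 * A4 + (b3 * C2 + b4 * C4))"
    "even (a1 * B2 + a2 * B4 + (b1 * D2 + b2 * D4))" "even (a3 * B1 + a4 * B3 + (b3 * D1 + b4 * D3))"
    "even (c1 * A2 + c2 * A4 + (d1 * C2 + d2 * C4))" "even (c3 * A1 + c4 * A3 + (d3 * C1 + d4 * C3))"
    "odd (c1 * B1 + c2 * B3 + (d1 * D1 + d2 * D3))" "even (c1 * B2 + c2 * B4 + (d1 * D2 + d2 * D4))"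
    "even (c3 * B1 + c4 * B3 + (d3 * D1 + d4 * D3))" "odd (c3 * B2 + c4 * B4 + (d3 * D2 + d4 * D4))"
    by (simp_all only: even_add even_mult_iff M' N' simp_thms)
  have four: "4 dvd a1 * B1 + a2 * B3 + (b1 * D1 + b2 * D3)" "4 dvd a3 * B2 + a4 * B4 + (b3 * D2 + b4 * D4)"
    "4 dvd c1 * A1 + c2 * A3 + (d1 * C1 + d2 * C3)" "4 dvd c3 * A2 + c4 * A4 + (d3 * C2 + d4 * C4)"
    by (intro dvd_add; simp add: M' N' four_dvd_even_mult dvd_mult dvd_mult2)+
  show ?thesis using S par four unfolding M N bm_mult M2_mult M2_arith Gamma24_m4 by blast
qed

lemma Gamma24_one: "mat 1 \<in> Gamma24"
  unfolding mat_1_m4 Gamma24_m4 m4_Sp4Z by simp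

lemma Gamma24_spinv: assumes "M \<in> Gamma24" shows "spinv M \<in> Gamma24"
proof -
  have S: "spinv M \<in> Sp4Z" using Sp4Z_inverse(1) Gamma24_Sp4Z assms by blast
  obtain a1 a2 a3 a4 b1 b2 b3 b4 c1 c2 c3 c4 d1 d2 d3 d4 where
    M: "M = m4 a1 a2 a3 a4 b1 b2 b3 b4 c1 c2 c3 c4 d1 d2 d3 d4" by (rule m4_cases)
  note M' = Gamma24_parity[OF assms(1)[unfolded M]]
  show ?thesis using S unfolding M spinv_m4 Gamma24_m4 by (simp add: M')
qed

text \<open>Odd squares are 1 modulo 4, so an odd number is its own inverse modulo 4.\<close>

lemma odd_diff_mod_4: assumes "odd x" "4 dvd x * y - (1::int)" shows "4 dvd x - y"
proof -
  have "4 dvd x * x - 1"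
  proof -
    obtain k where k: "x = 2 * k + 1" using assms(1) oddE by blast
    have "x * x - 1 = 4 * (k * (k + 1))" by (simp add: k algebra_simps)
    thus ?thesis by simp
  qed
  hence "4 dvd x * (x - y)" using assms(2) dvd_diff[of 4 "x * x - 1" "x * y - 1"] by (simp add: algebra_simps)
  moreover have "coprime 4 x"
  proof -
    have "coprime (2 ^ 2) x" using assms(1) by (simp only: coprime_power_left_iff) simp
    thus ?thesis by simp
  qed
  ultimately show ?thesis by (simp add: coprime_dvd_mult_right_iff)
qed

lemma even_mult_odd_mod_4: assumes "even x" "even y" "odd u" "odd v" "4 dvd x * u - y * (v::int)" shows "4 dvd x + y"
proof -
  obtain k l m n where "x = 2 * k" "y = 2 * l" "u = 2 * m + 1" "v = 2 * n + 1"
    using assms by (meson evenE oddE)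
  hence "x + y = (x * u - y * v) + 4 * (l + l * n - k * m)" by (simp add: algebra_simps)
  thus ?thesis using assms(5) by (metis dvd_add dvd_triv_left)
qed

text \<open>Conjugation mixes the diagonals of \<open>B\<close> and \<open>C\<close> with
  \<open>a1 - d1\<close>, \<open>b2 + b3\<close> and \<open>c2 + c3\<close>. The symplectic
  relations make these divisible by 4, so a condition modulo 4 on the diagonals alone survives
  conjugation.\<close>

lemma Gamma24_conj_gens:
  assumes g: "g \<in> gens" and M: "M \<in> Gamma24" shows "g ** M ** spinv g \<in> Gamma24"
proof -
  have S: "g ** M ** spinv g \<in> Sp4Z" using g M gens_Sp4Z Gamma24_Sp4Z Sp4Z_mult Sp4Z_inverse(1) by metis
  obtain a1 a2 a3 a4 b1 b2 b3 b4 c1 c2 c3 c4 d1 d2 d3 d4 where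
    Meq: "M = m4 a1 a2 a3 a4 b1 b2 b3 b4 c1 c2 c3 c4 d1 d2 d3 d4" by (rule m4_cases)
  note M' = Gamma24_parity[OF M[unfolded Meq]]
  have sp: "a1 * c2 + a3 * c4 = a2 * c1 + a4 * c3" "b1 * d2 + b3 * d4 = b2 * d1 + b4 * d3"
     "a1 * d1 + a3 * d3 - c1 * b1 - c3 * b3 = 1"
    using Gamma24_Sp4Z[OF M] unfolding Meq m4_Sp4Z by blast+
  have ad: "4 dvd a1 - d1"
  proof (rule odd_diff_mod_4)
    have "a1 * d1 - 1 = c1 * b1 + c3 * b3 - a3 * d3" using sp(3) by linarith
    thus "4 dvd a1 * d1 - 1" using M' by (simp add: four_dvd_even_mult dvd_diff dvd_add)
  qed (rule M')
  have bb: "4 dvd b2 + b3"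
  proof (rule even_mult_odd_mod_4)
    have "b2 * d1 - b3 * d4 = b1 * d2 - b4 * d3" using sp(2) by linarith
    thus "4 dvd b2 * d1 - b3 * d4" using M' by (simp add: four_dvd_even_mult dvd_diff)
  qed (use M' in auto)
  have cc: "4 dvd c2 + c3"
  proof (rule even_mult_odd_mod_4)
    have "c2 * a1 - c3 * a4 = a2 * c1 - a3 * c4" using sp(1) by (simp add: mult.commute)
    thus "4 dvd c2 * a1 - c3 * a4" using M' by (simp add: four_dvd_even_mult dvd_diff)
  qed (use M' in auto)
  from g show ?thesis
  proof cases
    case (gensT k)
    have "g ** M ** spinv g = m4 (a1 + k * c1) (a2 + k * c2) a3 a4 (b1 - k * (a1 - d1) - k * k * c1) (b2 + k * d2) (b3 - k * a3) b4
       c1 c2 c3 c4 (d1 - k * c1) d2 (d3 - k * c3) d4"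
      unfolding gensT gT_def Meq spinv_m4 by (simp add: algebra_simps)
    thus ?thesis using S unfolding Gamma24_m4 by (simp add: Gamma24_m4 M' ad dvd_diff dvd_mult)
  next
    case (gensV k)
    have "g ** M ** spinv g = m4 (a1 + k * a3) (a2 + k * a4 - k * (a1 + k * a3)) a3 (a4 - k * a3)
       (b1 + k * (b2 + b3) + k * k * b4) (b2 + k * b4) (b3 + k * b4) b4
       c1 (c2 - k * c1) (c3 - k * c1) (c4 - k * (c2 + c3) + k * k * c1) (d1 + k * d2) d2 (d3 - k * d1 + k * (d4 - k * d2)) (d4 - k * d2)"
      unfolding gensV gV_def Meq spinv_m4 by (simp add: algebra_simps)
    moreover have "even (a2 + k * a4 - k * (a1 + k * a3))" "even (d3 - k * d1 + k * (d4 - k * d2))" using M' by auto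
    ultimately show ?thesis using S by (simp add: Gamma24_m4 M' bb cc dvd_add dvd_diff dvd_mult)
  next
    case gensJ
    have "g ** M ** spinv g = m4 d1 (- c2) (- b3) a4 (- c1) (- d2) a3 b4 (- b1) a2 (- d3) c4 a1 b2 c3 d4"
      unfolding gensJ gJ_def Meq spinv_m4 by (simp add: algebra_simps)
    thus ?thesis using S by (simp add: Gamma24_m4 M')
  next
    case gensW
    have "g ** M ** spinv g = m4 a4 a3 a2 a1 b4 b3 b2 b1 c4 c3 c2 c1 d4 d3 d2 d1"
      unfolding gensW gW_def Meq spinv_m4 by (simp add: algebra_simps)
    thus ?thesis using S by (simp add: Gamma24_m4 M')
  qed
qed

lemma spinv_mult: "M \<in> Sp4Z \<Longrightarrow> N \<in> Sp4Z \<Longrightarrow> spinv (M ** N) = spinv N ** spinv M"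
proof -
  assume M: "M \<in> Sp4Z" and N: "N \<in> Sp4Z"
  have "spinv (M ** N) = spinv (M ** N) ** (M ** (N ** spinv N) ** spinv M)"
    using Sp4Z_inverse M N by simp
  also have "\<dots> = (spinv (M ** N) ** (M ** N)) ** (spinv N ** spinv M)" by (simp add: matrix_mul_assoc)
  finally show ?thesis using Sp4Z_inverse(2)[OF Sp4Z_mult[OF M N]] by simp
qed

lemma spinv_spinv: "spinv (spinv M) = M"
  by (cases M rule: m4_cases) simp

lemma Gamma24_conj:
  assumes "g \<in> Sp4Z" "M \<in> Gamma24" shows "g ** M ** spinv g \<in> Gamma24"
  using assms
proof (induction arbitrary: M rule: Sp4Z_induct)
  case one
  have "spinv (mat 1) = mat 1" by (simp add: mat_1_m4)
  thus ?case using one by simp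
next
  case (mult h g)
  have "h ** (g ** M ** spinv g) ** spinv h \<in> Gamma24"
    by (rule Gamma24_conj_gens[OF mult(1) mult(3)[OF mult(4)]])
  thus ?case unfolding spinv_mult[OF gens_Sp4Z[OF mult(1)] mult(2)] by (simp add: matrix_mul_assoc)
qed

section \<open>Lower unipotent matrices and multiplication by \<open>p\<close>\<close>

definition low where "low x y z = m4 1 0 0 1 0 0 0 0 x y y z 1 0 0 1"

lemma low_Sp4Z: "low x y z \<in> Sp4Z" by (simp add: low_def m4_Sp4Z)
lemma trans_Sp4Z: "trans x y z \<in> Sp4Z" by (simp add: trans_def m4_Sp4Z)

lemma act_trans: "M2 t1 t t t2 \<in> siegel2 \<Longrightarrow> act (trans x y z) (M2 t1 t t t2) = M2 (t1 + of_int x) (t + of_int y) (t + of_int y) (t2 + of_int z)"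
  by (rule act_eqI'[OF trans_Sp4Z]) (simp_all add: jmat_def nmat_def trans_def)

lemma fth_trans:
  assumes "\<Omega> \<in> siegel2"
  shows "fth (act (trans x y z) \<Omega>) a b = ip (x * a\<^sup>2 + 2 * y * a * b + z * b\<^sup>2) * fth \<Omega> a b"
proof -
  obtain t1 t t2 where O: "\<Omega> = M2 t1 t t t2" using assms by (rule siegel2_cases)
  note A = act_trans[OF assms[unfolded O], of x y z]
  have "qterm (act (trans x y z) \<Omega>) (2 * m + a) (2 * n + b) = ip (x * a\<^sup>2 + 2 * y * a * b + z * b\<^sup>2) * qterm \<Omega> (2 * m + a) (2 * n + b)" for m n
  proof -
    have E: "ip (x * a\<^sup>2 + 2 * y * a * b + z * b\<^sup>2) = ip (x * (2 * m + a)\<^sup>2 + 2 * y * (2 * m + a) * (2 * n + b) + z * (2 * n + b)\<^sup>2)"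
    proof (rule ip_cong)
      have "x * (2 * m + a)\<^sup>2 + 2 * y * (2 * m + a) * (2 * n + b) + z * (2 * n + b)\<^sup>2 - (x * a\<^sup>2 + 2 * y * a * b + z * b\<^sup>2) =
        4 * (x * m * m + x * m * a + y * m * (2 * n + b) + y * a * n + z * n * n + z * n * b)"
        by (simp add: power2_eq_square algebra_simps)
      thus "[x * a\<^sup>2 + 2 * y * a * b + z * b\<^sup>2 = x * (2 * m + a)\<^sup>2 + 2 * y * (2 * m + a) * (2 * n + b) + z * (2 * n + b)\<^sup>2] (mod 4)"
        by (metis cong_iff_dvd_diff cong_sym dvd_triv_left)
    qed
    show ?thesis unfolding E unfolding qterm_def O A ip_def exp_add[symmetric]
      by (rule arg_cong[where f = exp]) (simp add: algebra_simps power2_eq_square)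
  qed
  thus ?thesis unfolding fth_def by (simp add: case_prod_unfold infsum_cmult_right')
qed

text \<open>\<open>gF\<close> conjugates \<open>low\<close> to \<open>trans\<close> with the
  opposite symmetric matrix and exchanges \<open>gth\<close> with \<open>fth\<close>, on which a
  translation acts by a phase.\<close>

lemma gth_low:
  assumes O: "\<Omega> \<in> siegel2"
  obtains \<kappa> where "\<kappa> \<noteq> 0" "\<And>a b. gth (act (low x y z) \<Omega>) a b = \<kappa> * ip (- (x * a\<^sup>2 + 2 * y * a * b + z * b\<^sup>2)) * gth \<Omega> a b"
proof -
  have eq: "gF ** low x y z = trans (- x) (- y) (- z) ** gF" by (simp add: gF_def low_def trans_def)
  have OL: "act (low x y z) \<Omega> \<in> siegel2" using act_siegel2[OF low_Sp4Z O] .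
  have OF': "act gF \<Omega> \<in> siegel2" using act_siegel2[OF gF_Sp4Z O] .
  obtain k where k: "k \<noteq> 0" "\<And>a b. fth (act gF (act (low x y z) \<Omega>)) a b = k * gth (act (low x y z) \<Omega>) a b" using fth_gF[OF OL] by blast
  obtain l where l: "l \<noteq> 0" "\<And>a b. fth (act gF \<Omega>) a b = l * gth \<Omega> a b" using fth_gF[OF O] by blast
  have "act gF (act (low x y z) \<Omega>) = act (trans (- x) (- y) (- z)) (act gF \<Omega>)"
    unfolding act_mult[OF gF_Sp4Z low_Sp4Z O, symmetric] act_mult[OF trans_Sp4Z gF_Sp4Z O, symmetric] eq ..
  hence "k * gth (act (low x y z) \<Omega>) a b = ip (- (x * a\<^sup>2 + 2 * y * a * b + z * b\<^sup>2)) * (l * gth \<Omega> a b)" for a b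
    using k(2)[of a b] fth_trans[OF OF', of "-x" "-y" "-z" a b] l(2)[of a b] by (simp add: algebra_simps)
  hence "gth (act (low x y z) \<Omega>) a b = (l / k) * ip (- (x * a\<^sup>2 + 2 * y * a * b + z * b\<^sup>2)) * gth \<Omega> a b" for a b
    using k(1) by (simp add: field_simps)
  thus ?thesis using that[of "l / k"] k l by simp
qed

lemma gth_period: "gth \<Omega> (a + 2 * k) (b + 2 * l) = gth \<Omega> a b"
proof -
  have "sg ((a + 2 * k) * c + (b + 2 * l) * d) = sg (a * c + b * d)" for c d by (rule sg_cong) (simp add: algebra_simps)
  thus ?thesis by (simp add: gth_def)
qed

lemma gth_gW: "\<Omega> \<in> siegel2 \<Longrightarrow> gth (act gW \<Omega>) a b = gth \<Omega> b a"
  by (erule siegel2_cases) (simp add: gth_def fth_gW add_ac)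

lemma gth_gV: "\<Omega> \<in> siegel2 \<Longrightarrow> gth (act (gV 1) \<Omega>) a b = gth \<Omega> (a + b) b"
proof (erule siegel2_cases)
  fix t1 z t2 assume O: "\<Omega> = M2 t1 z z t2"
  have "fth \<Omega> 1 2 = fth \<Omega> 1 0" using fth_period[of \<Omega> 1 0 0 1] by simp
  thus ?thesis unfolding O by (simp add: gth_def fth_gV sg_add)
qed

text \<open>Multiplication by \<open>p\<close> is the action of the similitude
  \<open>diag(p, p, 1, 1)\<close>; conjugation by it multiplies \<open>B\<close> by \<open>p\<close>
  and divides \<open>C\<close> by \<open>p\<close>.\<close>

lemma scale_act:
  assumes M: "m4 a1 a2 a3 a4 b1 b2 b3 b4 (int p * c1) (int p * c2) (int p * c3) (int p * c4) d1 d2 d3 d4 \<in> Sp4Z" (is "?M \<in> _")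
    and N: "m4 a1 a2 a3 a4 (int p * b1) (int p * b2) (int p * b3) (int p * b4) c1 c2 c3 c4 d1 d2 d3 d4 \<in> Sp4Z" (is "?N \<in> _")
    and O: "\<Omega> \<in> siegel2" and p: "p > 0"
  shows "real p *\<^sub>R act ?M \<Omega> = act ?N (real p *\<^sub>R \<Omega>)"
proof (rule sym, rule act_eqI'[OF N])
  show "real p *\<^sub>R \<Omega> \<in> siegel2" using p O by (simp add: scaleR_siegel2)
  obtain t1 z t2 where Oeq: "\<Omega> = M2 t1 z z t2" using O by (rule siegel2_cases)
  have j: "jmat ?N (real p *\<^sub>R \<Omega>) = jmat ?M \<Omega>"
    unfolding jmat_def block_bm cmat_of_int_M2 Oeq scaleR_M2 M2_mult M2_arith by (simp add: scaleR_conv_of_real algebra_simps)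
  have n: "nmat ?N (real p *\<^sub>R \<Omega>) = real p *\<^sub>R nmat ?M \<Omega>"
    unfolding nmat_def block_bm cmat_of_int_M2 Oeq scaleR_M2 M2_mult M2_arith by (simp add: scaleR_conv_of_real algebra_simps)
  have sm: "(r *\<^sub>R X) ** Y = r *\<^sub>R (X ** Y)" for r and X Y :: cmat2
    by (cases X rule: M2_cases; cases Y rule: M2_cases) (simp add: scaleR_add_right)
  show "real p *\<^sub>R act ?M \<Omega> ** jmat ?N (real p *\<^sub>R \<Omega>) = nmat ?N (real p *\<^sub>R \<Omega>)"
    unfolding j n sm by (simp only: act_times_jmat[OF M O])
qed

lemma scale_low:
  assumes "\<Omega> \<in> siegel2" "p > 0"
  shows "real p *\<^sub>R act (low (int p * x) (int p * y) (int p * z)) \<Omega> = act (low x y z) (real p *\<^sub>R \<Omega>)"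
proof -
  have "m4 1 0 0 1 0 0 0 0 (int p * x) (int p * y) (int p * y) (int p * z) 1 0 0 1 \<in> Sp4Z"
    and "m4 1 0 0 1 (int p * 0) (int p * 0) (int p * 0) (int p * 0) x y y z 1 0 0 1 \<in> Sp4Z"
    by (simp_all add: m4_Sp4Z)
  from scale_act[OF this assms] show ?thesis by (simp add: low_def)
qed

lemma scale_gW: "\<Omega> \<in> siegel2 \<Longrightarrow> p > 0 \<Longrightarrow> real p *\<^sub>R act gW \<Omega> = act gW (real p *\<^sub>R \<Omega>)"
  by (erule siegel2_cases) (simp add: act_gW)

lemma scale_gV: "\<Omega> \<in> siegel2 \<Longrightarrow> p > 0 \<Longrightarrow> real p *\<^sub>R act (gV k) \<Omega> = act (gV k) (real p *\<^sub>R \<Omega>)"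
  by (erule siegel2_cases) (simp only: act_gV scaleR_M2, simp add: scaleR_conv_of_real algebra_simps)

text \<open>As \<open>p\<close> is odd, dividing the lower left block by \<open>p\<close> keeps its
  divisibility by 2 and by 4, so the conjugate stays in \<open>Gamma24\<close>.\<close>

lemma Gamma0_scale:
  assumes M: "M \<in> Gamma24 \<inter> Gamma0 p" and p: "odd p"
  obtains N where "N \<in> Gamma24" "\<And>\<Omega>. \<Omega> \<in> siegel2 \<Longrightarrow> real p *\<^sub>R act M \<Omega> = act N (real p *\<^sub>R \<Omega>)"
proof -
  have p0: "p > 0" using p by (auto intro: odd_pos)
  obtain a1 a2 a3 a4 b1 b2 b3 b4 c1 c2 c3 c4 d1 d2 d3 d4 where
    Meq: "M = m4 a1 a2 a3 a4 b1 b2 b3 b4 c1 c2 c3 c4 d1 d2 d3 d4" by (rule m4_cases)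
  have "M \<in> Gamma24" using M by blast
  note M' = Gamma24_parity[OF this[unfolded Meq]]
  have "int p dvd c1" "int p dvd c2" "int p dvd c3" "int p dvd c4"
    using M unfolding Meq Gamma0_def by (auto simp: cong_0_iff forall_2)
  then obtain e1 e2 e3 e4 where e: "c1 = int p * e1" "c2 = int p * e2" "c3 = int p * e3" "c4 = int p * e4"
    by (meson dvdE)
  have cop: "coprime (4::int) (int p)"
  proof -
    have "coprime ((2::int) ^ 2) (int p)" using p by (simp only: coprime_power_left_iff) simp
    thus ?thesis by simp
  qed
  have e4: "4 dvd e1" "4 dvd e4" using M' cop unfolding e by (simp_all add: coprime_dvd_mult_right_iff)
  have e2: "even e2" "even e3" using M' p unfolding e by auto
  let ?N = "m4 a1 a2 a3 a4 (int p * b1) (int p * b2) (int p * b3) (int p * b4) e1 e2 e3 e4 d1 d2 d3 d4"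
  have MS: "m4 a1 a2 a3 a4 b1 b2 b3 b4 c1 c2 c3 c4 d1 d2 d3 d4 \<in> Sp4Z" using M Gamma24_Sp4Z unfolding Meq by blast
  have NS: "?N \<in> Sp4Z"
  proof -
    have sp: "a1 * c2 + a3 * c4 = a2 * c1 + a4 * c3" "b1 * d2 + b3 * d4 = b2 * d1 + b4 * d3" 
     "a1 * d1 + a3 * d3 - c1 * b1 - c3 * b3 = 1" "a1 * d2 + a3 * d4 - c1 * b2 - c3 * b4 = 0"
     "a2 * d1 + a4 * d3 - c2 * b1 - c4 * b3 = 0" "a2 * d2 + a4 * d4 - c2 * b2 - c4 * b4 = 1"
      using MS unfolding m4_Sp4Z by blast+
    have "int p * (a1 * e2 + a3 * e4) = int p * (a2 * e1 + a4 * e3)" using sp(1) unfolding e by (simp add: algebra_simps)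
    hence "a1 * e2 + a3 * e4 = a2 * e1 + a4 * e3" using p0 by (metis mult_cancel_left of_nat_0_less_iff less_irrefl)
    moreover have "(int p * b1) * d2 + (int p * b3) * d4 = (int p * b2) * d1 + (int p * b4) * d3"
      using arg_cong[OF sp(2), of "\<lambda>x. int p * x"] by (simp only: distrib_left mult.assoc)
    ultimately show ?thesis using sp(3-) unfolding m4_Sp4Z e by (simp only: mult_ac simp_thms)
  qed
  have "?N \<in> Gamma24" using NS by (simp add: Gamma24_m4 M' e4 e2)
  moreover have "real p *\<^sub>R act M \<Omega> = act ?N (real p *\<^sub>R \<Omega>)" if "\<Omega> \<in> siegel2" for \<Omega>
    unfolding Meq e by (rule scale_act[OF MS[unfolded e] NS that p0])
  ultimately show ?thesis using that by blast
qed

text \<open>The exponents are, up to sign, the values of the symmetric matrix at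
  \<open>(1, 0)\<close>, \<open>(0, 1)\<close> and \<open>(1, 1)\<close>; the common factor cancels
  in the quotient.\<close>

lemma bprime_low:
  assumes "\<Omega> \<in> siegel2"
  shows "b' 1 (act (low x y z) \<Omega>) = ip (- x) * b' 1 \<Omega>" "b' 2 (act (low x y z) \<Omega>) = ip (- z) * b' 2 \<Omega>"
    "b' 3 (act (low x y z) \<Omega>) = ip (- (x + 2 * y + z)) * b' 3 \<Omega>"
    "theta 0 (act (low x y z) \<Omega> /\<^sub>R 2) = 0 \<longleftrightarrow> theta 0 (\<Omega> /\<^sub>R 2) = 0"
proof -
  obtain \<kappa> where k: "\<kappa> \<noteq> 0" "\<And>a b. gth (act (low x y z) \<Omega>) a b = \<kappa> * ip (- (x * a\<^sup>2 + 2 * y * a * b + z * b\<^sup>2)) * gth \<Omega> a b"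
    using gth_low[OF assms] by blast
  have L: "act (low x y z) \<Omega> \<in> siegel2" using act_siegel2[OF low_Sp4Z assms] .
  show "b' 1 (act (low x y z) \<Omega>) = ip (- x) * b' 1 \<Omega>" "b' 2 (act (low x y z) \<Omega>) = ip (- z) * b' 2 \<Omega>"
    "b' 3 (act (low x y z) \<Omega>) = ip (- (x + 2 * y + z)) * b' 3 \<Omega>"
    "theta 0 (act (low x y z) \<Omega> /\<^sub>R 2) = 0 \<longleftrightarrow> theta 0 (\<Omega> /\<^sub>R 2) = 0"
    unfolding bprime_eq[OF L] bprime_eq[OF assms] theta_half[OF L] theta_half[OF assms] k(2) using k(1) by simp_all
qed

lemma bprime_gW:
  assumes "\<Omega> \<in> siegel2"
  shows "b' 1 (act gW \<Omega>) = b' 2 \<Omega>" "b' 2 (act gW \<Omega>) = b' 1 \<Omega>" "b' 3 (act gW \<Omega>) = b' 3 \<Omega>"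
    "theta 0 (act gW \<Omega> /\<^sub>R 2) = theta 0 (\<Omega> /\<^sub>R 2)"
proof -
  have L: "act gW \<Omega> \<in> siegel2" using act_siegel2[OF gens_Sp4Z[OF gensW] assms] .
  show "b' 1 (act gW \<Omega>) = b' 2 \<Omega>" "b' 2 (act gW \<Omega>) = b' 1 \<Omega>" "b' 3 (act gW \<Omega>) = b' 3 \<Omega>"
    "theta 0 (act gW \<Omega> /\<^sub>R 2) = theta 0 (\<Omega> /\<^sub>R 2)"
    unfolding bprime_eq[OF L] bprime_eq[OF assms] theta_half[OF L] theta_half[OF assms] gth_gW[OF assms] by simp_all
qed

lemma bprime_gV:
  assumes "\<Omega> \<in> siegel2"
  shows "b' 1 (act (gV 1) \<Omega>) = b' 1 \<Omega>" "b' 2 (act (gV 1) \<Omega>) = b' 3 \<Omega>" "b' 3 (act (gV 1) \<Omega>) = b' 2 \<Omega>"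
    "theta 0 (act (gV 1) \<Omega> /\<^sub>R 2) = theta 0 (\<Omega> /\<^sub>R 2)"
proof -
  have L: "act (gV 1) \<Omega> \<in> siegel2" using act_siegel2[OF gens_Sp4Z[OF gensV] assms] .
  have "gth \<Omega> 2 1 = gth \<Omega> 0 1" using gth_period[of \<Omega> 0 1 1 0] by simp
  thus "b' 1 (act (gV 1) \<Omega>) = b' 1 \<Omega>" "b' 2 (act (gV 1) \<Omega>) = b' 3 \<Omega>" "b' 3 (act (gV 1) \<Omega>) = b' 2 \<Omega>"
    "theta 0 (act (gV 1) \<Omega> /\<^sub>R 2) = theta 0 (\<Omega> /\<^sub>R 2)"
    unfolding bprime_eq[OF L] bprime_eq[OF assms] theta_half[OF L] theta_half[OF assms] gth_gV[OF assms] by simp_all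
qed

lemma bprime_Gamma24:
  assumes "M \<in> Gamma24" "\<Omega> \<in> siegel2"
  shows "b' r (act M \<Omega>) = b' r \<Omega>" "theta 0 (act M \<Omega> /\<^sub>R 2) = 0 \<longleftrightarrow> theta 0 (\<Omega> /\<^sub>R 2) = 0"
proof -
  obtain \<kappa> where k: "\<kappa> \<noteq> 0" "\<And>a b. gth (act M \<Omega>) a b = \<kappa> * gth \<Omega> a b" using Gamma24_gth[OF assms] by blast
  have L: "act M \<Omega> \<in> siegel2" using act_siegel2 Gamma24_Sp4Z assms by blast
  show "b' r (act M \<Omega>) = b' r \<Omega>" "theta 0 (act M \<Omega> /\<^sub>R 2) = 0 \<longleftrightarrow> theta 0 (\<Omega> /\<^sub>R 2) = 0"
    unfolding bprime_eq[OF L] bprime_eq[OF assms(2)] theta_half[OF L] theta_half[OF assms(2)] k(2) using k(1) by simp_all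
qed

section \<open>Polynomials in three variables\<close>

text \<open>Stated for any ring homomorphism into the complex numbers, so that it applies in turn to
  the three nested levels of \<open>poly3\<close>.\<close>

lemma map_poly_eval_hom:
  fixes h :: "'a :: comm_ring_1 \<Rightarrow> complex"
  assumes h: "h 0 = 0" "h 1 = 1" "\<And>a b. h (a + b) = h a + h b" "\<And>a b. h (a * b) = h a * h b"
  shows "poly (map_poly h 0) x = 0" "poly (map_poly h 1) x = 1"
    "poly (map_poly h (P + Q)) x = poly (map_poly h P) x + poly (map_poly h Q) x"
    "poly (map_poly h (P * Q)) x = poly (map_poly h P) x * poly (map_poly h Q) x"
    "poly (map_poly h (monom a n)) x = h a * x ^ n"
proof -
  have pc: "poly (map_poly h (pCons a P)) x = h a + x * poly (map_poly h P) x" for a P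
    by (simp add: map_poly_pCons h)
  show "poly (map_poly h 0) x = 0" by simp
  show "poly (map_poly h 1) x = 1" using h by (simp add: map_poly_1')
  show add: "poly (map_poly h (P + Q)) x = poly (map_poly h P) x + poly (map_poly h Q) x" for P Q
    by (induction P Q rule: poly_induct2) (simp_all add: pc h algebra_simps)
  have sm: "poly (map_poly h (smult a P)) x = h a * poly (map_poly h P) x" for a P
    by (induction P) (simp_all add: pc h algebra_simps)
  show "poly (map_poly h (P * Q)) x = poly (map_poly h P) x * poly (map_poly h Q) x"
    by (induction P) (simp_all add: pc h algebra_simps add sm)
  show "poly (map_poly h (monom a n)) x = h a * x ^ n"
    using h by (simp add: map_poly_monom poly_monom)
qed

definition eval1 :: "rat poly \<Rightarrow> complex \<Rightarrow> complex" where "eval1 R z = poly (map_poly of_rat R) z"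
definition eval2 :: "rat poly poly \<Rightarrow> complex \<Rightarrow> complex \<Rightarrow> complex" where
  "eval2 Q y z = poly (map_poly (\<lambda>R. eval1 R z) Q) y"

lemma eval3_eval2: "eval3 P x y z = poly (map_poly (\<lambda>Q. eval2 Q y z) P) x"
  by (simp add: eval3_def eval2_def eval1_def)

lemma eval1_hom [simp]: "eval1 0 z = 0" "eval1 1 z = 1" "eval1 (P + Q) z = eval1 P z + eval1 Q z"
   "eval1 (P * Q) z = eval1 P z * eval1 Q z" "eval1 (monom a n) z = of_rat a * z ^ n"
  unfolding eval1_def by (rule map_poly_eval_hom; simp add: of_rat_add of_rat_mult)+

lemma eval2_hom [simp]: "eval2 0 y z = 0" "eval2 1 y z = 1" "eval2 (P + Q) y z = eval2 P y z + eval2 Q y z"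
   "eval2 (P * Q) y z = eval2 P y z * eval2 Q y z" "eval2 (monom a n) y z = eval1 a z * y ^ n"
  unfolding eval2_def by (rule map_poly_eval_hom; simp)+

lemma eval3_hom [simp]: "eval3 0 x y z = 0" "eval3 1 x y z = 1" "eval3 (P + Q) x y z = eval3 P x y z + eval3 Q x y z"
   "eval3 (P * Q) x y z = eval3 P x y z * eval3 Q x y z" "eval3 (monom a n) x y z = eval2 a y z * x ^ n"
  unfolding eval3_eval2 by (rule map_poly_eval_hom; simp)+

lemma eval_sum: "eval1 (sum f A) z = (\<Sum>i\<in>A. eval1 (f i) z)" "eval2 (sum g A) y z = (\<Sum>i\<in>A. eval2 (g i) y z)"
   "eval3 (sum h A) x y z = (\<Sum>i\<in>A. eval3 (h i) x y z)"
  by (induction A rule: infinite_finite_induct) simp_all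

lemma eval3_pCons_const: "eval3 [:R:] x y z = eval2 R y z"
  unfolding eval3_eval2 by (simp add: map_poly_pCons)

text \<open>Polynomials are built from coefficient functions cut off at a bound \<open>n\<close>;
  permutations and projections of monomials then become changes of the coefficient function.\<close>

definition mk2 :: "nat \<Rightarrow> (nat \<Rightarrow> nat \<Rightarrow> rat) \<Rightarrow> rat poly poly" where
  "mk2 n f = (\<Sum>j\<le>n. \<Sum>k\<le>n. monom (monom (f j k) k) j)"

definition mk3 :: "nat \<Rightarrow> (nat \<Rightarrow> nat \<Rightarrow> nat \<Rightarrow> rat) \<Rightarrow> poly3" where
  "mk3 n f = (\<Sum>i\<le>n. monom (mk2 n (f i)) i)"

lemma eval_mk2: "eval2 (mk2 n f) y z = (\<Sum>j\<le>n. \<Sum>k\<le>n. of_rat (f j k) * y ^ j * z ^ k)"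
  by (simp add: mk2_def eval_sum mult_ac)

lemma eval_mk3: "eval3 (mk3 n f) x y z = (\<Sum>i\<le>n. \<Sum>j\<le>n. \<Sum>k\<le>n. of_rat (f i j k) * x ^ i * y ^ j * z ^ k)"
  by (simp add: mk3_def eval_sum eval_mk2 sum_distrib_left sum_distrib_right mult_ac)

lemma coeff_mk2: "coeff (coeff (mk2 n f) j) k = (if j \<le> n \<and> k \<le> n then f j k else 0)"
proof -
  have "coeff (coeff (mk2 n f) j) k = (\<Sum>j'\<le>n. \<Sum>k'\<le>n. if j' = j then (if k' = k then f j' k' else 0) else 0)"
    unfolding mk2_def coeff_sum by (intro sum.cong refl) auto
  also have "\<dots> = (\<Sum>j'\<le>n. if j' = j then (if k \<le> n then f j' k else 0) else 0)"
    by (intro sum.cong refl) auto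
  finally show ?thesis by auto
qed

lemma coeff3_mk3: "coeff3 (mk3 n f) i j k = (if i \<le> n \<and> j \<le> n \<and> k \<le> n then f i j k else 0)"
proof -
  have "coeff (mk3 n f) i = (if i \<le> n then mk2 n (f i) else 0)"
    unfolding mk3_def coeff_sum by simp
  thus ?thesis by (simp add: coeff3_def coeff_mk2)
qed

lemma poly3_eqI: "(\<And>i j k. coeff3 P i j k = coeff3 Q i j k) \<Longrightarrow> P = Q"
  unfolding coeff3_def by (intro poly_eqI)

lemma poly2_bound: "\<exists>n. \<forall>j k. coeff (coeff Q j) k \<noteq> 0 \<longrightarrow> j \<le> n \<and> k \<le> n"
proof -
  define n where "n = degree Q + (\<Sum>j\<le>degree Q. degree (coeff Q j))"
  have "j \<le> n \<and> k \<le> n" if "coeff (coeff Q j) k \<noteq> 0" for j k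
  proof -
    have j: "j \<le> degree Q" using that by (intro le_degree) auto
    have "k \<le> degree (coeff Q j)" using that by (rule le_degree)
    also have "\<dots> \<le> (\<Sum>j\<le>degree Q. degree (coeff Q j))" using j by (intro member_le_sum) auto
    finally show ?thesis using j by (simp add: n_def)
  qed
  thus ?thesis by blast
qed

lemma poly3_bound: "\<exists>n. \<forall>i j k. coeff3 P i j k \<noteq> 0 \<longrightarrow> i \<le> n \<and> j \<le> n \<and> k \<le> n"
proof -
  have "\<forall>i. \<exists>n. \<forall>j k. coeff (coeff (coeff P i) j) k \<noteq> 0 \<longrightarrow> j \<le> n \<and> k \<le> n" using poly2_bound by blast
  from choice[OF this] obtain b where b: "\<forall>i j k. coeff (coeff (coeff P i) j) k \<noteq> 0 \<longrightarrow> j \<le> b i \<and> k \<le> b i" by blast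
  define n where "n = degree P + (\<Sum>i\<le>degree P. b i)"
  have "i \<le> n \<and> j \<le> n \<and> k \<le> n" if "coeff3 P i j k \<noteq> 0" for i j k
  proof -
    have i: "i \<le> degree P" using that unfolding coeff3_def by (intro le_degree) auto
    have "j \<le> b i" "k \<le> b i" using b that unfolding coeff3_def by blast+
    moreover have "b i \<le> (\<Sum>i\<le>degree P. b i)" using i by (intro member_le_sum) auto
    ultimately show ?thesis using i by (simp add: n_def)
  qed
  thus ?thesis by blast
qed

lemma mk3_coeff3:
  assumes "\<And>i j k. coeff3 P i j k \<noteq> 0 \<Longrightarrow> i \<le> n \<and> j \<le> n \<and> k \<le> n" shows "mk3 n (coeff3 P) = P"
  by (rule poly3_eqI) (use assms in \<open>auto simp: coeff3_mk3\<close>)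

lemma eval3_expand:
  assumes "\<And>i j k. coeff3 P i j k \<noteq> 0 \<Longrightarrow> i \<le> n \<and> j \<le> n \<and> k \<le> n"
  shows "eval3 P x y z = (\<Sum>i\<le>n. \<Sum>j\<le>n. \<Sum>k\<le>n. of_rat (coeff3 P i j k) * x ^ i * y ^ j * z ^ k)"
proof -
  have "mk3 n (coeff3 P) = P" by (rule mk3_coeff3) (use assms in blast)
  thus ?thesis using eval_mk3[of n "coeff3 P" x y z] by (simp only:)
qed

lemma eval2_expand:
  assumes "\<And>j k. coeff (coeff Q j) k \<noteq> 0 \<Longrightarrow> j \<le> n \<and> k \<le> n"
  shows "eval2 Q y z = (\<Sum>j\<le>n. \<Sum>k\<le>n. of_rat (coeff (coeff Q j) k) * y ^ j * z ^ k)"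
proof -
  have "mk2 n (\<lambda>j k. coeff (coeff Q j) k) = Q"
    by (intro poly_eqI) (use assms in \<open>auto simp: coeff_mk2\<close>)
  thus ?thesis using eval_mk2[of n "\<lambda>j k. coeff (coeff Q j) k"] by simp
qed

lemma poly_all_zero: "(\<And>x. poly p x = 0) \<Longrightarrow> p = (0 :: complex poly)"
  using poly_all_0_iff_0 by blast

lemma eval3_zero: assumes "\<And>x y z. eval3 P x y z = 0" shows "P = 0"
proof (rule poly3_eqI)
  fix i j k
  have "map_poly (\<lambda>Q. eval2 Q y z) P = 0" for y z
    by (rule poly_all_zero) (use assms in \<open>simp add: eval3_eval2\<close>)
  hence "coeff (map_poly (\<lambda>Q. eval2 Q y z) P) i = 0" for y z by simp
  hence e2: "eval2 (coeff P i) y z = 0" for y z by (simp add: coeff_map_poly)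
  have "map_poly (\<lambda>R. eval1 R z) (coeff P i) = 0" for z
    by (rule poly_all_zero) (use e2 in \<open>simp add: eval2_def\<close>)
  hence "coeff (map_poly (\<lambda>R. eval1 R z) (coeff P i)) j = 0" for z by simp
  hence e1: "eval1 (coeff (coeff P i) j) z = 0" for z by (simp add: coeff_map_poly)
  have "map_poly of_rat (coeff (coeff P i) j) = (0 :: complex poly)"
    by (rule poly_all_zero) (use e1 in \<open>simp add: eval1_def\<close>)
  hence "coeff (map_poly of_rat (coeff (coeff P i) j)) k = (0 :: complex)" by simp
  thus "coeff3 P i j k = coeff3 0 i j k" by (simp add: coeff_map_poly coeff3_def)
qed

lemma eval3_uminus: "eval3 (- P) x y z = - eval3 P x y z"
  using eval3_hom(3)[of P "- P" x y z] by (simp add: eq_neg_iff_add_eq_0 add.commute)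

lemma eval3_eqI: assumes "\<And>x y z. eval3 P x y z = eval3 Q x y z" shows "P = Q"
  using eval3_zero[of "P - Q"] eval3_hom(3)[of P "- Q"] assms by (simp add: eval3_uminus)

text \<open>A nonzero element of minimal degree of the ideal generated by \<open>L\<close> and \<open>Q\<close> divides constant
  multiples of both, so it is constant.\<close>
lemma eliminate_variable:
  fixes L Q :: "'a :: idom poly"
  assumes L: "prime_elem L" "degree L > 0" and ndvd: "\<not> L dvd Q"
  obtains A B R where "R \<noteq> 0" "[:R:] = A * L + B * Q"
proof -
  define I where "I = {P. P \<noteq> 0 \<and> (\<exists>A B. P = A * L + B * Q)}"
  have "1 * L + 0 * Q \<in> I" using L unfolding I_def by (intro CollectI conjI exI[of _ 1] exI[of _ 0]) auto
  then obtain P where P: "P \<in> I" "\<And>P'. P' \<in> I \<Longrightarrow> degree P \<le> degree P'"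
    using ex_has_least_nat[of "\<lambda>P. P \<in> I" _ degree] by blast
  obtain A B where AB: "P = A * L + B * Q" and P0: "P \<noteq> 0" using P(1) unfolding I_def by blast
  have div: "\<exists>a q. a \<noteq> 0 \<and> smult a F = P * q" if F: "F = C * L + D * Q" for F C D
  proof -
    \<comment> \<open>The coefficients form only a domain, so division with remainder needs the
      factor \<open>a\<close>. The remainder lies in the ideal and has smaller degree, hence is zero
      by minimality.\<close>
    obtain a q where a: "a \<noteq> 0" "smult a F = P * q + pseudo_mod F P" using pseudo_mod(1)[OF P0] by blast
    have r: "pseudo_mod F P = 0 \<or> degree (pseudo_mod F P) < degree P" using pseudo_mod(2)[OF P0] .
    have "pseudo_mod F P = smult a F - P * q" using a by simp
    also have "\<dots> = (smult a C - A * q) * L + (smult a D - B * q) * Q"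
      unfolding F AB by (simp add: algebra_simps smult_add_right)
    finally have "pseudo_mod F P \<in> I" if "pseudo_mod F P \<noteq> 0" unfolding I_def using that by blast
    hence "pseudo_mod F P = 0" using r P(2) by (meson not_less)
    thus ?thesis using a by auto
  qed
  obtain a q where a: "a \<noteq> 0" "smult a L = P * q" using div[of L 1 0] by auto
  obtain b r where b: "b \<noteq> 0" "smult b Q = P * r" using div[of Q 0 1] by auto
  have nconst: "\<not> L dvd [:c:]" if "c \<noteq> 0" for c
    using L(2) dvd_imp_degree_le[of L "[:c:]"] that by auto
  have "L dvd P * q" using a(2) by (metis dvd_smult dvd_refl)
  \<comment> \<open>If \<open>L\<close> divides \<open>P\<close>, it divides a constant multiple of
    \<open>Q\<close>, against \<open>ndvd\<close>. If it divides \<open>q\<close>, cancelling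
    \<open>L\<close> leaves \<open>P\<close> as a divisor of a nonzero constant.\<close>
  hence "L dvd P \<or> L dvd q" using L(1) prime_elem_dvd_mult_iff by blast
  hence "degree P = 0"
  proof
    assume "L dvd P"
    hence "L dvd smult b Q" using b by simp
    hence "L dvd [:b:] * Q" by simp
    hence False using L(1) nconst[OF b(1)] ndvd prime_elem_dvd_mult_iff by blast
    thus ?thesis ..
  next
    assume "L dvd q"
    then obtain q' where q': "q = L * q'" by blast
    have "L * (P * q') = L * [:a:]" using a(2) unfolding q' by (simp add: mult_ac)
    hence "P * q' = [:a:]" using L(1) by (metis mult_cancel_left prime_elem_not_zeroI)
    moreover have "q' \<noteq> 0" using calculation a(1) by auto
    ultimately have "degree P + degree q' = 0" using degree_mult_eq[OF P0, of q'] by (metis degree_pCons_0)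
    thus ?thesis by simp
  qed
  then obtain R where "P = [:R:]" using degree_eq_zeroE by blast
  thus ?thesis using that[of R A B] AB P0 by auto
qed

lemma poly3_unit:
  fixes A :: poly3 assumes "A dvd 1" obtains c where "A = [:[:[:c:]:]:]" "c \<noteq> 0"
proof -
  obtain A1 where "A = [:A1:]" "A1 dvd 1" using assms is_unit_polyE by metis
  moreover obtain A2 where "A1 = [:A2:]" "A2 dvd 1" using calculation is_unit_polyE by metis
  moreover obtain c where "A2 = [:c:]" "c dvd 1" using calculation is_unit_polyE by metis
  moreover have "c \<noteq> 0" using calculation by (metis dvd_0_left zero_neq_one)
  ultimately show ?thesis using that by blast
qed

lemma coeff3_const_mult: "coeff3 ([:[:[:c:]:]:] * P) i j k = c * coeff3 P i j k"
  by (simp add: coeff3_def)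

lemma degree_0_cofactor:
  fixes p q k :: "'a :: idom poly"
  assumes "q = k * p" "q \<noteq> 0" "coeff p (degree q) \<noteq> 0" obtains c where "k = [:c:]"
proof -
  have "k \<noteq> 0" "p \<noteq> 0" using assms by auto
  hence "degree q = degree k + degree p" using assms by (simp add: degree_mult_eq)
  moreover have "degree q \<le> degree p" using assms(3) by (rule le_degree)
  ultimately have "degree k = 0" by simp
  thus ?thesis using that degree_eq_zeroE by blast
qed

text \<open>The lexicographically leading monomial of \<open>Q\<close> occurs in \<open>P\<close>,
  so the cofactor has degree 0 in one variable after the other, outermost first.\<close>

lemma dvd_support_imp_const:
  fixes P Q :: poly3
  assumes dvd: "P dvd Q" and Q: "Q \<noteq> 0" and sub: "\<And>i j k. coeff3 Q i j k \<noteq> 0 \<Longrightarrow> coeff3 P i j k \<noteq> 0"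
  obtains c where "c \<noteq> 0" "\<And>i j k. coeff3 Q i j k = c * coeff3 P i j k"
proof -
  obtain K where K: "Q = K * P" using dvd by (metis dvdE mult.commute)
  define i where "i = degree Q"
  define j where "j = degree (coeff Q i)"
  define k where "k = degree (coeff (coeff Q i) j)"
  have Qi: "coeff Q i \<noteq> 0" using Q by (simp add: i_def)
  hence Qj: "coeff (coeff Q i) j \<noteq> 0" by (simp add: j_def)
  hence Qk: "coeff (coeff (coeff Q i) j) k \<noteq> 0" by (simp add: k_def)
  have Pk: "coeff (coeff (coeff P i) j) k \<noteq> 0" using sub Qk unfolding coeff3_def by blast
  have Pi: "coeff P (degree Q) \<noteq> 0" using Pk unfolding i_def by auto
  obtain K1 where K1: "K = [:K1:]" using degree_0_cofactor[OF K Q Pi] by blast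
  have e1: "coeff Q i = K1 * coeff P i" unfolding K K1 by simp
  have Pj: "coeff (coeff P i) (degree (coeff Q i)) \<noteq> 0" using Pk unfolding j_def by auto
  obtain K2 where K2: "K1 = [:K2:]" using degree_0_cofactor[OF e1 Qi Pj] by blast
  have e2: "coeff (coeff Q i) j = K2 * coeff (coeff P i) j" unfolding e1 K2 by simp
  have Pk': "coeff (coeff (coeff P i) j) (degree (coeff (coeff Q i) j)) \<noteq> 0" using Pk unfolding k_def .
  obtain c where c: "K2 = [:c:]" using degree_0_cofactor[OF e2 Qj Pk'] by blast
  have "coeff3 Q i j k = c * coeff3 P i j k" for i j k unfolding K K1 K2 c by (rule coeff3_const_mult)
  moreover have "c \<noteq> 0" using Q calculation by (metis coeff3_def coeff_0 mult_zero_left poly3_eqI)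
  ultimately show ?thesis using that by blast
qed

text \<open>Substituting in \<open>P' = A * P\<close> gives \<open>P = A' * P'\<close> with the
  transform \<open>A'\<close> of \<open>A\<close>; hence \<open>A' * A = 1\<close> and the cofactor
  is a unit.\<close>

lemma involution_dvd_imp_const:
  fixes P P' :: poly3
  assumes P: "P \<noteq> 0" and dvd: "P dvd P'"
    and ev: "\<And>x y z. eval3 P' x y z = eval3 P (u x y z) (v x y z) (w x y z)"
    and inv: "\<And>x y z. u (u x y z) (v x y z) (w x y z) = x \<and> v (u x y z) (v x y z) (w x y z) = y \<and> w (u x y z) (v x y z) (w x y z) = z"
    and ex: "\<And>A. \<exists>A'. \<forall>x y z. eval3 A' x y z = eval3 A (u x y z) (v x y z) (w x y z)"
  obtains c where "c \<noteq> 0" "\<And>i j k. coeff3 P' i j k = c * coeff3 P i j k"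
proof -
  obtain A where A: "P' = A * P" using dvd by (metis dvdE mult.commute)
  obtain A' where A': "\<And>x y z. eval3 A' x y z = eval3 A (u x y z) (v x y z) (w x y z)" using ex by blast
  have "P = A' * A * P"
  proof (rule eval3_eqI)
    fix x y z
    have "eval3 P x y z = eval3 P' (u x y z) (v x y z) (w x y z)" by (simp only: ev inv)
    also have "\<dots> = eval3 A' x y z * eval3 P (u x y z) (v x y z) (w x y z)" by (simp only: A eval3_hom A')
    also have "eval3 P (u x y z) (v x y z) (w x y z) = eval3 A x y z * eval3 P x y z" by (simp only: ev[symmetric] A eval3_hom)
    finally show "eval3 P x y z = eval3 (A' * A * P) x y z" by (simp add: mult_ac)
  qed
  hence "(A' * A) * P = 1 * P" by simp
  hence "A' * A = 1" using P mult_cancel_right by blast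
  hence "A dvd 1" by (metis dvd_triv_right)
  then obtain c where "A = [:[:[:c:]:]:]" "c \<noteq> 0" using poly3_unit by blast
  thus ?thesis using that[of c] A coeff3_const_mult by simp
qed

definition swap12 :: "poly3 \<Rightarrow> poly3" where
  "swap12 P = mk3 (SOME n. \<forall>i j k. coeff3 P i j k \<noteq> 0 \<longrightarrow> i \<le> n \<and> j \<le> n \<and> k \<le> n) (\<lambda>i j k. coeff3 P j i k)"
definition swap23 :: "poly3 \<Rightarrow> poly3" where
  "swap23 P = mk3 (SOME n. \<forall>i j k. coeff3 P i j k \<noteq> 0 \<longrightarrow> i \<le> n \<and> j \<le> n \<and> k \<le> n) (\<lambda>i j k. coeff3 P i k j)"

lemma swap_bound:
  fixes P defines "n \<equiv> (SOME n. \<forall>i j k. coeff3 P i j k \<noteq> 0 \<longrightarrow> i \<le> n \<and> j \<le> n \<and> k \<le> n)"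
  assumes "coeff3 P i j k \<noteq> 0" shows "i \<le> n \<and> j \<le> n \<and> k \<le> n"
proof -
  have "\<forall>i j k. coeff3 P i j k \<noteq> 0 \<longrightarrow> i \<le> n \<and> j \<le> n \<and> k \<le> n"
    unfolding n_def by (rule someI_ex[OF poly3_bound])
  thus ?thesis using assms by blast
qed

lemma coeff3_swap12: "coeff3 (swap12 P) i j k = coeff3 P j i k"
  unfolding swap12_def coeff3_mk3 using swap_bound[of P j i k] by auto

lemma coeff3_swap23: "coeff3 (swap23 P) i j k = coeff3 P i k j"
  unfolding swap23_def coeff3_mk3 using swap_bound[of P i k j] by auto

lemma eval3_swap12: "eval3 (swap12 P) x y z = eval3 P y x z"
proof -
  obtain n where n: "\<And>i j k. coeff3 P i j k \<noteq> 0 \<Longrightarrow> i \<le> n \<and> j \<le> n \<and> k \<le> n" using poly3_bound by metis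
  have "eval3 (swap12 P) x y z = (\<Sum>i\<le>n. \<Sum>j\<le>n. \<Sum>k\<le>n. of_rat (coeff3 P j i k) * x ^ i * y ^ j * z ^ k)"
    by (subst eval3_expand[of _ n]) (use n in \<open>auto simp: coeff3_swap12\<close>)
  also have "\<dots> = eval3 P y x z"
    by (subst sum.swap, subst eval3_expand[OF n]) (simp_all add: mult_ac)
  finally show ?thesis .
qed

lemma eval3_swap23: "eval3 (swap23 P) x y z = eval3 P x z y"
proof -
  obtain n where n: "\<And>i j k. coeff3 P i j k \<noteq> 0 \<Longrightarrow> i \<le> n \<and> j \<le> n \<and> k \<le> n" using poly3_bound by metis
  have "eval3 (swap23 P) x y z = (\<Sum>i\<le>n. \<Sum>j\<le>n. \<Sum>k\<le>n. of_rat (coeff3 P i k j) * x ^ i * y ^ j * z ^ k)"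
    by (subst eval3_expand[of _ n]) (use n in \<open>auto simp: coeff3_swap23\<close>)
  also have "\<dots> = (\<Sum>i\<le>n. \<Sum>k\<le>n. \<Sum>j\<le>n. of_rat (coeff3 P i k j) * x ^ i * y ^ j * z ^ k)"
    by (intro sum.cong refl sum.swap)
  also have "\<dots> = eval3 P x z y"
    by (subst eval3_expand[OF n]) (simp_all add: mult_ac)
  finally show ?thesis .
qed

section \<open>Counting the cosets\<close>

lemma Gamma0_m4: "m4 a1 a2 a3 a4 b1 b2 b3 b4 c1 c2 c3 c4 d1 d2 d3 d4 \<in> Gamma0 p \<longleftrightarrow>
   m4 a1 a2 a3 a4 b1 b2 b3 b4 c1 c2 c3 c4 d1 d2 d3 d4 \<in> Sp4Z \<and>
   int p dvd c1 \<and> int p dvd c2 \<and> int p dvd c3 \<and> int p dvd c4"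
  unfolding Gamma0_def mem_Collect_eq forall_2 block_bm M2_nth cong_0_iff by blast

lemma Gamma0_Sp4Z: "M \<in> Gamma0 p \<Longrightarrow> M \<in> Sp4Z" by (simp add: Gamma0_def)

lemma Gamma0_mult:
  assumes "M \<in> Gamma0 p" "N \<in> Gamma0 p" shows "M ** N \<in> Gamma0 p"
proof -
  have S: "M ** N \<in> Sp4Z" using assms Gamma0_Sp4Z Sp4Z_mult by blast
  obtain a1 a2 a3 a4 b1 b2 b3 b4 c1 c2 c3 c4 d1 d2 d3 d4 where
    M: "M = m4 a1 a2 a3 a4 b1 b2 b3 b4 c1 c2 c3 c4 d1 d2 d3 d4" by (rule m4_cases)
  obtain A1 A2 A3 A4 B1 B2 B3 B4 C1 C2 C3 C4 D1 D2 D3 D4 where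
    N: "N = m4 A1 A2 A3 A4 B1 B2 B3 B4 C1 C2 C3 C4 D1 D2 D3 D4" by (rule m4_cases)
  have c: "int p dvd c1" "int p dvd c2" "int p dvd c3" "int p dvd c4" "int p dvd C1" "int p dvd C2" "int p dvd C3" "int p dvd C4"
    using assms unfolding M N Gamma0_m4 by blast+
  have "int p dvd c1 * A1 + c2 * A3 + (d1 * C1 + d2 * C3)" "int p dvd c1 * A2 + c2 * A4 + (d1 * C2 + d2 * C4)"
    "int p dvd c3 * A1 + c4 * A3 + (d3 * C1 + d4 * C3)" "int p dvd c3 * A2 + c4 * A4 + (d3 * C2 + d4 * C4)"
    using c by (intro dvd_add; simp add: dvd_mult dvd_mult2)+
  thus ?thesis using S unfolding M N bm_mult M2_mult M2_arith Gamma0_m4 by blast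
qed

lemma Gamma0_spinv:
  assumes "M \<in> Gamma0 p" shows "spinv M \<in> Gamma0 p"
proof -
  have S: "spinv M \<in> Sp4Z" using assms Gamma0_Sp4Z Sp4Z_inverse(1) by blast
  obtain a1 a2 a3 a4 b1 b2 b3 b4 c1 c2 c3 c4 d1 d2 d3 d4 where
    M: "M = m4 a1 a2 a3 a4 b1 b2 b3 b4 c1 c2 c3 c4 d1 d2 d3 d4" by (rule m4_cases)
  show ?thesis using S assms unfolding M spinv_m4 Gamma0_m4 by simp
qed

text \<open>Equality of cosets of \<open>Gamma0 p\<close> inside the whole of \<open>Sp4Z\<close>;
  on \<open>Gamma24\<close> it becomes equality of cosets of the intersection.\<close>

definition rel0 :: "nat \<Rightarrow> imat4 \<Rightarrow> imat4 \<Rightarrow> bool" where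
  "rel0 p M N \<longleftrightarrow> M ** spinv N \<in> Gamma0 p"

lemma rel0_sym: "M \<in> Sp4Z \<Longrightarrow> N \<in> Sp4Z \<Longrightarrow> rel0 p M N \<Longrightarrow> rel0 p N M"
  unfolding rel0_def using Gamma0_spinv[of "M ** spinv N" p] spinv_mult[of M "spinv N"] Sp4Z_inverse(1)[of N] spinv_spinv[of N] by simp

lemma rel0_trans:
  assumes "M \<in> Sp4Z" "N \<in> Sp4Z" "K \<in> Sp4Z" "rel0 p M N" "rel0 p N K" shows "rel0 p M K"
proof -
  have "(M ** spinv N) ** (N ** spinv K) = M ** (spinv N ** N) ** spinv K" by (simp add: matrix_mul_assoc)
  thus ?thesis using Gamma0_mult assms Sp4Z_inverse(2)[of N] unfolding rel0_def by fastforce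
qed

lemma rel0_iff_coset:
  assumes "M \<in> Gamma24" "N \<in> Gamma24"
  shows "rel0 p M N \<longleftrightarrow> M \<in> (\<lambda>g. g ** N) ` (Gamma24 \<inter> Gamma0 p)"
proof
  assume r: "rel0 p M N"
  have "(M ** spinv N) ** N = M" using Sp4Z_inverse(2)[of N] assms Gamma24_Sp4Z by (simp add: matrix_mul_assoc[symmetric])
  moreover have "M ** spinv N \<in> Gamma24 \<inter> Gamma0 p" using r assms Gamma24_mult Gamma24_spinv unfolding rel0_def by blast
  ultimately show "M \<in> (\<lambda>g. g ** N) ` (Gamma24 \<inter> Gamma0 p)" by (metis image_eqI)
next
  assume "M \<in> (\<lambda>g. g ** N) ` (Gamma24 \<inter> Gamma0 p)"
  then obtain g where g: "g \<in> Gamma0 p" "M = g ** N" by blast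
  have "M ** spinv N = g" unfolding g using Sp4Z_inverse(3)[of N] assms Gamma24_Sp4Z by (simp add: matrix_mul_assoc[symmetric])
  thus "rel0 p M N" using g by (simp add: rel0_def)
qed

text \<open>The condition is \<open>C D'^T = D C'^T\<close> modulo \<open>p\<close>: the bottom rows
  of the two matrices are orthogonal for the symplectic form, that is, they span the same Lagrangian
  subspace.\<close>

lemma rel0_m4:
  assumes "M \<in> Sp4Z" "N \<in> Sp4Z" "M = m4 a1 a2 a3 a4 b1 b2 b3 b4 c1 c2 c3 c4 d1 d2 d3 d4"
    "N = m4 A1 A2 A3 A4 B1 B2 B3 B4 C1 C2 C3 C4 D1 D2 D3 D4"
  shows "rel0 p M N \<longleftrightarrow> int p dvd c1 * D1 + c2 * D2 - (d1 * C1 + d2 * C2) \<and> int p dvd c1 * D3 + c2 * D4 - (d1 * C3 + d2 * C4) \<and>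
    int p dvd c3 * D1 + c4 * D2 - (d3 * C1 + d4 * C2) \<and> int p dvd c3 * D3 + c4 * D4 - (d3 * C3 + d4 * C4)"
proof -
  have "M ** spinv N \<in> Sp4Z" using assms(1,2) Sp4Z_mult Sp4Z_inverse(1) by blast
  thus ?thesis unfolding rel0_def assms(3,4) spinv_m4 bm_mult M2_mult M2_arith Gamma0_m4 by (simp add: algebra_simps)
qed

lemma inverse_mod_prime:
  assumes "prime p" "\<not> int p dvd x" obtains e where "int p dvd e * x - 1"
proof -
  have "coprime (int p) x" using assms by (simp add: prime_imp_coprime)
  then obtain u v where "u * int p + v * x = 1" using bezout_int[of "int p" x] by auto
  hence "v * x - 1 = int p * (- u)" by (simp add: algebra_simps)
  thus ?thesis using that[of v] by (metis dvd_triv_left)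
qed

text \<open>A vanishing determinant makes the vectors proportional. The ratio is sought as
  \<open>k * s\<close> because the parameters of \<open>rep\<close> carry the factors 2 and 4 that
  keep it in \<open>Gamma24\<close>.\<close>

lemma proportional_mod_prime:
  assumes p: "prime p" and k: "\<not> int p dvd k" and y: "\<not> (int p dvd y1 \<and> int p dvd y2)" and d: "int p dvd x1 * y2 - x2 * y1"
  shows "\<exists>s<p. int p dvd x1 - k * int s * y1 \<and> int p dvd x2 - k * int s * y2"
proof -
  have main: "\<exists>s<p. int p dvd x1 - k * int s * y1 \<and> int p dvd x2 - k * int s * y2"
    if y1: "\<not> int p dvd y1" and d: "int p dvd x1 * y2 - x2 * y1" for x1 x2 y1 y2
  proof -
    have pp: "prime (int p)" using p by simp
    have "\<not> int p dvd k * y1" using k y1 pp by (simp add: prime_dvd_mult_iff)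
    then obtain e where e: "int p dvd e * (k * y1) - 1" using inverse_mod_prime[OF p] by blast
    define s where "s = nat ((e * x1) mod int p)"
    have p0: "int p > 0" using p prime_gt_0_nat by simp
    have s: "s < p" unfolding s_def using p0 by (simp add: nat_less_iff)
    have "int s = (e * x1) mod int p" unfolding s_def using p0 by simp
    hence sd: "int p dvd e * x1 - int s" by (simp add: dvd_minus_mod)
    have 1: "int p dvd x1 - k * int s * y1"
    proof -
      have "x1 - k * int s * y1 = (k * y1) * (e * x1 - int s) - x1 * (e * (k * y1) - 1)" by (simp add: algebra_simps)
      thus ?thesis using sd e by (simp add: dvd_diff dvd_mult)
    qed
    have "y1 * (x2 - k * int s * y2) = y2 * (x1 - k * int s * y1) - (x1 * y2 - x2 * y1)" by (simp add: algebra_simps)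
    hence "int p dvd y1 * (x2 - k * int s * y2)" using 1 d by (simp add: dvd_diff dvd_mult)
    hence "int p dvd x2 - k * int s * y2" using y1 pp by (simp add: prime_dvd_mult_iff)
    thus ?thesis using 1 s by blast
  qed
  show ?thesis
  proof (cases "int p dvd y1")
    case False thus ?thesis using main d by blast
  next
    case True
    have "int p dvd x2 * y1 - x1 * y2" using d by (simp add: dvd_diff_commute)
    thus ?thesis using main[of y2 x2 y1 x1] True y by blast
  qed
qed

text \<open>The last assumption makes \<open>(a, 4; 4\<beta>, p)\<close> a matrix of determinant 1 that is diagonal modulo 4
  and whose lower right entry vanishes modulo \<open>p\<close>.\<close>
locale odd_prime =
  fixes p :: nat and a \<beta> :: int
  assumes prime: "prime p" and gt2: "p > 2" and ab: "a * int p = 1 + 16 * \<beta>"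
begin

lemma odd_p: "odd p" using prime gt2 prime_odd_nat by blast
lemma odd_a: "odd a"
proof
  assume "even a"
  hence "even (1 + 16 * \<beta>)" unfolding ab[symmetric] by simp
  thus False by simp
qed
lemma prime_int: "prime (int p)" using prime by simp

text \<open>By \<open>ab\<close>, \<open>16 * \<beta>\<close> is -1 modulo \<open>p\<close>.\<close>

lemma not_dvd_4b: "\<not> int p dvd 4 * \<beta>"
proof
  assume "int p dvd 4 * \<beta>"
  hence "int p dvd 4 * (4 * \<beta>)" by (rule dvd_mult)
  hence "int p dvd a * int p - 16 * \<beta>" by (intro dvd_diff) auto
  hence "int p dvd 1" unfolding ab by simp
  thus False using prime_int not_prime_unit by blast
qed

lemma not_dvd_2: "\<not> int p dvd 2"
proof
  assume "int p dvd 2"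
  hence "int p \<le> 2" by (rule zdvd_imp_le) simp
  thus False using gt2 by simp
qed

lemma not_dvd_4: "\<not> int p dvd 4"
  using not_dvd_2 prime_int prime_dvd_mult_iff[of "int p" 2 2] by simp

text \<open>Modulo \<open>p\<close>, the cosets are the Lagrangian subspaces spanned by the rows of \<open>(C D)\<close>; the four
  cases are the Schubert cells of the Lagrangian Grassmannian.\<close>
fun rep :: "nat \<times> nat \<times> nat \<times> nat \<Rightarrow> imat4" where
  "rep (i, s, t, u) =
    (if i = 0 then low (4 * int s) (4 * int t) (4 * int u)
     else if i = 1 then emb2 a 4 (4 * \<beta>) (int p) ** low (4 * int t) 0 0 ** lev 1 0 (- 2 * int s) 1
     else if i = 2 then emb1 a 4 (4 * \<beta>) (int p) ** low 0 0 (4 * int s)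
     else emb1 a 4 (4 * \<beta>) (int p) ** emb2 a 4 (4 * \<beta>) (int p))"

text \<open>Coordinates that do not occur in a cell are fixed to 0, so that an index is determined
  by its coset; the cells have \<open>p^3\<close>, \<open>p^2\<close>, \<open>p\<close> and 1
  elements.\<close>

definition K :: "(nat \<times> nat \<times> nat \<times> nat) set" where
  "K = {0} \<times> {..<p} \<times> {..<p} \<times> {..<p} \<union> {1} \<times> {..<p} \<times> {..<p} \<times> {0} \<union> {2} \<times> {..<p} \<times> {0} \<times> {0} \<union> {(3, 0, 0, 0)}"

lemma finite_K: "finite K" by (simp add: K_def)

lemma card_K: "card K = p ^ 3 + p ^ 2 + p + 1"
proof -
  have "card K = card ({0::nat} \<times> {..<p} \<times> {..<p} \<times> {..<p}) + card ({1::nat} \<times> {..<p} \<times> {..<p} \<times> {0::nat}) + card ({2::nat} \<times> {..<p} \<times> {0::nat} \<times> {0::nat}) + card {(3::nat, 0::nat, 0::nat, 0::nat)}"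
    unfolding K_def by (subst card_Un_disjoint, force, force, force)+ simp
  thus ?thesis by (simp add: card_cartesian_product power2_eq_square power3_eq_cube)
qed

text \<open>The number is \<open>(p + 1) (p^2 + 1)\<close>, a product of two even factors.\<close>

lemma four_dvd_card_K: "4 dvd card K"
proof -
  obtain k where k: "p = 2 * k + 1" using odd_p oddE by blast
  have "p ^ 3 + p ^ 2 + p + 1 = 4 * ((k + 1) * (2 * k * k + 2 * k + 1))"
    unfolding k by (simp add: power2_eq_square power3_eq_cube algebra_simps)
  hence "card K = 4 * ((k + 1) * (2 * k * k + 2 * k + 1))" unfolding card_K .
  thus ?thesis by (metis dvd_triv_left)
qed

text \<open>Only the bottom rows enter \<open>rel0\<close>, so the upper halves of the products stay
  anonymous.\<close>

lemma rep_eq: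
  "rep (0, s, t, u) = m4 1 0 0 1 0 0 0 0 (4 * int s) (4 * int t) (4 * int t) (4 * int u) 1 0 0 1"
  "\<exists>a1 a2 a3 a4 b1 b2 b3 b4. rep (1, s, t, u) = m4 a1 a2 a3 a4 b1 b2 b3 b4 (4 * int t) 0 (4 * \<beta> * (- 2 * int s)) (4 * \<beta>) 1 (2 * int s) 0 (int p)"
  "\<exists>a1 a2 a3 a4 b1 b2 b3 b4. rep (2, s, t, u) = m4 a1 a2 a3 a4 b1 b2 b3 b4 (4 * \<beta>) 0 0 (4 * int s) (int p) 0 0 1"
  "\<exists>a1 a2 a3 a4 b1 b2 b3 b4. rep (3, s, t, u) = m4 a1 a2 a3 a4 b1 b2 b3 b4 (4 * \<beta>) 0 0 (4 * \<beta>) (int p) 0 0 (int p)"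
  by (simp_all add: low_def emb1_def emb2_def lev_def)

lemma emb_Gamma24: "emb1 a 4 (4 * \<beta>) (int p) \<in> Gamma24" "emb2 a 4 (4 * \<beta>) (int p) \<in> Gamma24"
  using ab odd_a odd_p by (simp_all add: emb1_def emb2_def Gamma24_m4 m4_Sp4Z)

lemma low_Gamma24: "low (4 * x) (4 * y) (4 * z) \<in> Gamma24"
  by (simp add: low_def Gamma24_m4 m4_Sp4Z)

lemma rep_Gamma24: "rep x \<in> Gamma24"
proof (cases x)
  case (fields i s t u)
  have "lev 1 0 (- 2 * int s) 1 \<in> Gamma24" by (simp add: lev_def Gamma24_m4 m4_Sp4Z)
  moreover have "low (4 * int t) 0 0 \<in> Gamma24" "low 0 0 (4 * int s) \<in> Gamma24"
    using low_Gamma24[of "int t" 0 0] low_Gamma24[of 0 0 "int s"] by simp_all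
  ultimately show ?thesis unfolding fields rep.simps using emb_Gamma24 low_Gamma24 Gamma24_mult by auto
qed

lemma rep_Sp4Z: "rep x \<in> Sp4Z" using rep_Gamma24 Gamma24_Sp4Z by blast

lemma rep_exhaust:
  assumes M: "M \<in> Sp4Z" shows "\<exists>x\<in>K. rel0 p M (rep x)"
proof -
  obtain a1 a2 a3 a4 b1 b2 b3 b4 c1 c2 c3 c4 d1 d2 d3 d4 where
    Meq: "M = m4 a1 a2 a3 a4 b1 b2 b3 b4 c1 c2 c3 c4 d1 d2 d3 d4" by (rule m4_cases)
  have "spinv M \<in> Sp4Z" using M Sp4Z_inverse by blast
  \<comment> \<open>Applied to the inverse, the symplectic relations give the symmetry of
    \<open>D C^T\<close>.\<close>
  hence F: "- d1 * c3 - d2 * c4 = - d3 * c1 - d4 * c2"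
    unfolding Meq spinv_m4 m4_Sp4Z by (simp add: algebra_simps)
  note r = rel0_m4[OF M rep_Sp4Z Meq]
  show ?thesis
  proof (cases "int p dvd d1 * d4 - d2 * d3")
    \<comment> \<open>Big cell: \<open>D\<close> is invertible modulo \<open>p\<close>, and
      \<open>4 s\<close>, \<open>4 t\<close>, \<open>4 u\<close> are the entries of the symmetric
      matrix \<open>D^(-1) C\<close>, computed with the adjugate of \<open>D\<close>.\<close>
    case False
    define \<Delta> where "\<Delta> = d1 * d4 - d2 * d3"
    have "\<not> int p dvd \<Delta>" using False by (simp add: \<Delta>_def)
    hence "\<not> int p dvd 4 * \<Delta>" using not_dvd_4 prime_int prime_dvd_mult_iff by metis
    then obtain e where e: "int p dvd e * (4 * \<Delta>) - 1" using inverse_mod_prime[OF prime] by blast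
    have p0: "int p > 0" using gt2 by simp
    define f where "f x = nat ((e * x) mod int p)" for x
    have f: "f x < p" "int p dvd e * x - int (f x)" for x
    proof -
      have "int (f x) = (e * x) mod int p" unfolding f_def using p0 by simp
      thus "f x < p" "int p dvd e * x - int (f x)" using p0 pos_mod_bound[OF p0, of "e * x"] by (linarith, simp add: dvd_minus_mod)
    qed
    have f': "int p dvd x - 4 * \<Delta> * int (f x)" for x
    proof -
      have "x - 4 * \<Delta> * int (f x) = 4 * \<Delta> * (e * x - int (f x)) - x * (e * (4 * \<Delta>) - 1)" by (simp add: algebra_simps)
      thus ?thesis using f(2)[of x] e by (simp add: dvd_diff dvd_mult)
    qed
    define s t u where "s = f (d4 * c1 - d2 * c3)" "t = f (d4 * c2 - d2 * c4)" "u = f (d1 * c4 - d3 * c2)"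
    have D: "int p dvd x" if "int p dvd \<Delta> * x" for x
      using that prime_int False by (simp add: prime_dvd_mult_iff \<Delta>_def)
    have 1: "int p dvd (d4 * c1 - d2 * c3) - 4 * \<Delta> * int s" "int p dvd (d4 * c2 - d2 * c4) - 4 * \<Delta> * int t" "int p dvd (d1 * c4 - d3 * c2) - 4 * \<Delta> * int u"
      unfolding s_t_u_def by (rule f')+
    have E: "d4 * c2 - d2 * c4 = d1 * c3 - d3 * c1" using F by (simp add: algebra_simps)
    have q2: "\<Delta> * (c1 - (d1 * (4 * int s) + d2 * (4 * int t))) = d1 * ((d4 * c1 - d2 * c3) - 4 * \<Delta> * int s) + d2 * ((d4 * c2 - d2 * c4) - 4 * \<Delta> * int t)"
      unfolding E \<Delta>_def by (simp add: algebra_simps)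
    have 2: "int p dvd c1 - (d1 * (4 * int s) + d2 * (4 * int t))" by (rule D, unfold q2, intro dvd_add dvd_mult 1)
    have q3: "\<Delta> * (c3 - (d3 * (4 * int s) + d4 * (4 * int t))) = d3 * ((d4 * c1 - d2 * c3) - 4 * \<Delta> * int s) + d4 * ((d4 * c2 - d2 * c4) - 4 * \<Delta> * int t)"
      unfolding E \<Delta>_def by (simp add: algebra_simps)
    have 3: "int p dvd c3 - (d3 * (4 * int s) + d4 * (4 * int t))" by (rule D, unfold q3, intro dvd_add dvd_mult 1)
    have q4: "\<Delta> * (c2 - (d1 * (4 * int t) + d2 * (4 * int u))) = d1 * ((d4 * c2 - d2 * c4) - 4 * \<Delta> * int t) + d2 * ((d1 * c4 - d3 * c2) - 4 * \<Delta> * int u)"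
      unfolding \<Delta>_def by (simp add: algebra_simps)
    have 4: "int p dvd c2 - (d1 * (4 * int t) + d2 * (4 * int u))" by (rule D, unfold q4, intro dvd_add dvd_mult 1)
    have q5: "\<Delta> * (c4 - (d3 * (4 * int t) + d4 * (4 * int u))) = d3 * ((d4 * c2 - d2 * c4) - 4 * \<Delta> * int t) + d4 * ((d1 * c4 - d3 * c2) - 4 * \<Delta> * int u)"
      unfolding \<Delta>_def by (simp add: algebra_simps)
    have 5: "int p dvd c4 - (d3 * (4 * int t) + d4 * (4 * int u))" by (rule D, unfold q5, intro dvd_add dvd_mult 1)
    have "(0, s, t, u) \<in> K" unfolding K_def s_t_u_def using f(1) by simp
    moreover have "rel0 p M (rep (0, s, t, u))" using r[OF rep_eq(1)] 2 3 4 5 by simp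
    ultimately show ?thesis by blast
  next
    case True
    show ?thesis
    proof (cases "int p dvd d1 \<and> int p dvd d3")
      \<comment> \<open>\<open>D\<close> is singular with nonzero first column: its second column is
        \<open>2 s\<close> times the first, and the first column of \<open>C\<close> plus
        \<open>2 s\<close> times the second is \<open>4 t\<close> times that same column of
        \<open>D\<close>.\<close>
      case False
      have "int p dvd d2 * d3 - d4 * d1" using True by (simp add: dvd_diff_commute mult.commute)
      then obtain s where s: "s < p" "int p dvd d2 - 2 * int s * d1" "int p dvd d4 - 2 * int s * d3"
        using proportional_mod_prime[OF prime not_dvd_2 False] by blast
      have "(c1 + 2 * int s * c2) * d3 - (c3 + 2 * int s * c4) * d1 = c4 * (d2 - 2 * int s * d1) - c2 * (d4 - 2 * int s * d3)"
        using F by (simp add: algebra_simps)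
      hence "int p dvd (c1 + 2 * int s * c2) * d3 - (c3 + 2 * int s * c4) * d1" using s by (simp add: dvd_diff dvd_mult)
      then obtain t where t: "t < p" "int p dvd (c1 + 2 * int s * c2) - 4 * int t * d1" "int p dvd (c3 + 2 * int s * c4) - 4 * int t * d3"
        using proportional_mod_prime[OF prime not_dvd_4 False] by blast
      obtain A1 A2 A3 A4 B1 B2 B3 B4 where R: "rep (1, s, t, 0) = m4 A1 A2 A3 A4 B1 B2 B3 B4 (4 * int t) 0 (4 * \<beta> * (- 2 * int s)) (4 * \<beta>) 1 (2 * int s) 0 (int p)"
        using rep_eq(2) by blast
      have "int p dvd c1 * 1 + c2 * (2 * int s) - (d1 * (4 * int t) + d2 * 0)" using t(2) by (simp add: algebra_simps)
      moreover have "int p dvd c3 * 1 + c4 * (2 * int s) - (d3 * (4 * int t) + d4 * 0)" using t(3) by (simp add: algebra_simps)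
      moreover have "int p dvd c1 * 0 + c2 * int p - (d1 * (4 * \<beta> * (- 2 * int s)) + d2 * (4 * \<beta>))"
      proof -
        have *: "c1 * 0 + c2 * int p - (d1 * (4 * \<beta> * (- 2 * int s)) + d2 * (4 * \<beta>)) = c2 * int p - (4 * \<beta>) * (d2 - 2 * int s * d1)" by (simp add: algebra_simps)
        show ?thesis unfolding * by (intro dvd_diff dvd_mult s(2) dvd_refl)
      qed
      moreover have "int p dvd c3 * 0 + c4 * int p - (d3 * (4 * \<beta> * (- 2 * int s)) + d4 * (4 * \<beta>))"
      proof -
        have *: "c3 * 0 + c4 * int p - (d3 * (4 * \<beta> * (- 2 * int s)) + d4 * (4 * \<beta>)) = c4 * int p - (4 * \<beta>) * (d4 - 2 * int s * d3)" by (simp add: algebra_simps)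
        show ?thesis unfolding * by (intro dvd_diff dvd_mult s(3) dvd_refl)
      qed
      ultimately have "rel0 p M (rep (1, s, t, 0))" unfolding r[OF R] by blast
      moreover have "(1, s, t, 0) \<in> K" using s(1) t(1) by (simp add: K_def)
      ultimately show ?thesis by blast
    next
      case d13: True
      show ?thesis
      proof (cases "int p dvd d2 \<and> int p dvd d4")
        \<comment> \<open>The first column of \<open>D\<close> vanishes and the second does not: the
          second column of \<open>C\<close> is \<open>4 s\<close> times it.\<close>
        case False
        have "c2 * d4 - c4 * d2 = c3 * d1 - c1 * d3" using F by (simp add: algebra_simps)
        hence "int p dvd c2 * d4 - c4 * d2" using d13 by (simp add: dvd_diff dvd_mult)
        then obtain s where s: "s < p" "int p dvd c2 - 4 * int s * d2" "int p dvd c4 - 4 * int s * d4"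
          using proportional_mod_prime[OF prime not_dvd_4 False] by blast
        obtain A1 A2 A3 A4 B1 B2 B3 B4 where R: "rep (2, s, 0, 0) = m4 A1 A2 A3 A4 B1 B2 B3 B4 (4 * \<beta>) 0 0 (4 * int s) (int p) 0 0 1"
          using rep_eq(3) by blast
        have "int p dvd c1 * int p + c2 * 0 - (d1 * (4 * \<beta>) + d2 * 0)" "int p dvd c3 * int p + c4 * 0 - (d3 * (4 * \<beta>) + d4 * 0)"
          using d13 by (simp_all add: dvd_diff dvd_mult2)
        moreover have "int p dvd c1 * 0 + c2 * 1 - (d1 * 0 + d2 * (4 * int s))" "int p dvd c3 * 0 + c4 * 1 - (d3 * 0 + d4 * (4 * int s))"
          using s by (simp_all add: algebra_simps)
        ultimately have "rel0 p M (rep (2, s, 0, 0))" unfolding r[OF R] by blast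
        moreover have "(2, s, 0, 0) \<in> K" using s(1) by (simp add: K_def)
        ultimately show ?thesis by blast
      next
        \<comment> \<open>\<open>D\<close> vanishes modulo \<open>p\<close>: the cell with a single
          point.\<close>
        case d24: True
        obtain A1 A2 A3 A4 B1 B2 B3 B4 where R: "rep (3, 0, 0, 0) = m4 A1 A2 A3 A4 B1 B2 B3 B4 (4 * \<beta>) 0 0 (4 * \<beta>) (int p) 0 0 (int p)"
          using rep_eq(4) by blast
        have "rel0 p M (rep (3, 0, 0, 0))" unfolding r[OF R] using d13 d24 by (simp add: dvd_diff dvd_mult2)
        moreover have "(3, 0, 0, 0) \<in> K" by (simp add: K_def)
        ultimately show ?thesis by blast
      qed
    qed
  qed
qed

lemma eq_if_dvd_diff: "s < p \<Longrightarrow> t < p \<Longrightarrow> \<not> int p dvd k \<Longrightarrow> int p dvd k * int s - k * int t \<Longrightarrow> s = t"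
proof -
  assume st: "s < p" "t < p" and "\<not> int p dvd k" "int p dvd k * int s - k * int t"
  hence "int p dvd k * (int s - int t)" by (simp add: right_diff_distrib)
  hence "int p dvd int s - int t" using \<open>\<not> int p dvd k\<close> prime_int by (simp add: prime_dvd_mult_iff)
  hence "int s mod int p = int t mod int p" by (simp add: mod_eq_dvd_iff)
  thus "s = t" using st by simp
qed

lemma not_dvd_4b_minus: "\<not> int p dvd 4 * \<beta> - x * int p" "\<not> int p dvd 4 * \<beta> - int p * x"
  using not_dvd_4b by (simp_all add: dvd_diff_left_iff)

text \<open>Different cells are told apart by an entry congruent to \<open>4 * \<beta>\<close> up to
  sign, hence nonzero modulo \<open>p\<close>; inside a cell the parameters agree modulo
  \<open>p\<close>. Ordering the first components halves the cases.\<close>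

lemma rep_separated_le:
  assumes x: "x \<in> K" and y: "y \<in> K" and le: "fst y \<le> fst x" and rel: "rel0 p (rep x) (rep y)"
  shows "x = y"
proof -
  obtain i s t u where xeq: "x = (i, s, t, u)" by (cases x)
  obtain i' s' t' u' where yeq: "y = (i', s', t', u')" by (cases y)
  have bx: "s < p" "t < p" "u < p" "s' < p" "t' < p" "u' < p" using x y gt2 unfolding xeq yeq K_def by auto
  have zx: "i \<noteq> 0 \<longrightarrow> u = 0" "i = 2 \<longrightarrow> t = 0" "i = 3 \<longrightarrow> s = 0 \<and> t = 0"
     "i' \<noteq> 0 \<longrightarrow> u' = 0" "i' = 2 \<longrightarrow> t' = 0" "i' = 3 \<longrightarrow> s' = 0 \<and> t' = 0"
    using x y unfolding xeq yeq K_def by auto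
  have ii: "i \<in> {0,1,2,3}" "i' \<in> {0,1,2,3}" "i' \<le> i" using x y le unfolding xeq yeq K_def by auto
  note rel' = rel[unfolded xeq yeq]
  obtain A1 A2 A3 A4 B1 B2 B3 B4 where R1: "rep (1, s, t, u) = m4 A1 A2 A3 A4 B1 B2 B3 B4 (4 * int t) 0 (4 * \<beta> * (- 2 * int s)) (4 * \<beta>) 1 (2 * int s) 0 (int p)"
    using rep_eq(2) by blast
  obtain P1 P2 P3 P4 Q1 Q2 Q3 Q4 where R1': "rep (1, s', t', u') = m4 P1 P2 P3 P4 Q1 Q2 Q3 Q4 (4 * int t') 0 (4 * \<beta> * (- 2 * int s')) (4 * \<beta>) 1 (2 * int s') 0 (int p)"
    using rep_eq(2) by blast
  obtain E1 E2 E3 E4 F1 F2 F3 F4 where R2: "rep (2, s, t, u) = m4 E1 E2 E3 E4 F1 F2 F3 F4 (4 * \<beta>) 0 0 (4 * int s) (int p) 0 0 1"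
    using rep_eq(3) by blast
  obtain G1 G2 G3 G4 H1 H2 H3 H4 where R2': "rep (2, s', t', u') = m4 G1 G2 G3 G4 H1 H2 H3 H4 (4 * \<beta>) 0 0 (4 * int s') (int p) 0 0 1"
    using rep_eq(3) by blast
  obtain U1 U2 U3 U4 V1 V2 V3 V4 where R3: "rep (3, s, t, u) = m4 U1 U2 U3 U4 V1 V2 V3 V4 (4 * \<beta>) 0 0 (4 * \<beta>) (int p) 0 0 (int p)"
    using rep_eq(4) by blast
  note rm = rel0_m4[OF rep_Sp4Z rep_Sp4Z]
  consider "i = 0" "i' = 0" | "i = 1" "i' = 0" | "i = 2" "i' = 0" | "i = 3" "i' = 0" | "i = 1" "i' = 1" | "i = 2" "i' = 1" | "i = 3" "i' = 1"
    | "i = 2" "i' = 2" | "i = 3" "i' = 2" | "i = 3" "i' = 3" using ii by auto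
  thus ?thesis
  proof cases
    case 1
    hence "rel0 p (rep (0, s, t, u)) (rep (0, s', t', u'))" using rel' by simp
    hence "int p dvd 4 * int s - 4 * int s'" "int p dvd 4 * int t - 4 * int t'" "int p dvd 4 * int u - 4 * int u'"
      unfolding rm[OF rep_eq(1) rep_eq(1)] by simp_all
    thus ?thesis using eq_if_dvd_diff[OF _ _ not_dvd_4] bx 1 unfolding xeq yeq by blast
  next
    case 2
    hence "rel0 p (rep (1, s, t, u)) (rep (0, s', t', u'))" using rel' by simp
    thus ?thesis unfolding rm[OF R1 rep_eq(1)] using not_dvd_4b_minus by simp
  next
    case 3
    hence "rel0 p (rep (2, s, t, u)) (rep (0, s', t', u'))" using rel' by simp
    thus ?thesis unfolding rm[OF R2 rep_eq(1)] using not_dvd_4b_minus by simp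
  next
    case 4
    hence "rel0 p (rep (3, s, t, u)) (rep (0, s', t', u'))" using rel' by simp
    thus ?thesis unfolding rm[OF R3 rep_eq(1)] using not_dvd_4b_minus by simp
  next
    case 5
    hence "rel0 p (rep (1, s, t, u)) (rep (1, s', t', u'))" using rel' by simp
    hence 1: "int p dvd 4 * int t - 4 * int t'" "int p dvd 0 * int p - (1 * (4 * \<beta> * (- 2 * int s')) + 2 * int s * (4 * \<beta>))"
      unfolding rm[OF R1 R1'] by simp_all
    have "0 * int p - (1 * (4 * \<beta> * (- 2 * int s')) + 2 * int s * (4 * \<beta>)) = (4 * \<beta>) * (2 * int s' - 2 * int s)" by (simp add: algebra_simps)
    hence "int p dvd 2 * int s' - 2 * int s" using 1(2) not_dvd_4b prime_int by (metis prime_dvd_mult_iff)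
    hence "s' = s" "t = t'" using 1(1) eq_if_dvd_diff[OF _ _ not_dvd_2] eq_if_dvd_diff[OF _ _ not_dvd_4] bx by blast+
    thus ?thesis using 5 zx unfolding xeq yeq by simp
  next
    case 6
    hence "rel0 p (rep (2, s, t, u)) (rep (1, s', t', u'))" using rel' by simp
    hence "int p dvd 4 * int s * int p - 4 * \<beta>" unfolding rm[OF R2 R1'] by simp
    hence "int p dvd 4 * \<beta> - 4 * int s * int p" by (simp add: dvd_diff_commute)
    thus ?thesis using not_dvd_4b_minus by blast
  next
    case 7
    hence "rel0 p (rep (3, s, t, u)) (rep (1, s', t', u'))" using rel' by simp
    thus ?thesis unfolding rm[OF R3 R1'] using not_dvd_4b_minus by simp
  next
    case 8
    hence "rel0 p (rep (2, s, t, u)) (rep (2, s', t', u'))" using rel' by simp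
    hence "int p dvd 4 * int s - 4 * int s'" unfolding rm[OF R2 R2'] by simp
    hence "s = s'" using eq_if_dvd_diff[OF _ _ not_dvd_4] bx by blast
    thus ?thesis using 8 zx unfolding xeq yeq by simp
  next
    case 9
    hence "rel0 p (rep (3, s, t, u)) (rep (2, s', t', u'))" using rel' by simp
    thus ?thesis unfolding rm[OF R3 R2'] using not_dvd_4b_minus by simp
  next
    case 10
    thus ?thesis using zx unfolding xeq yeq by simp
  qed
qed

lemma rep_separated:
  assumes "x \<in> K" "y \<in> K" "rel0 p (rep x) (rep y)" shows "x = y"
  using rep_separated_le[of x y] rep_separated_le[of y x] assms rel0_sym[OF rep_Sp4Z rep_Sp4Z, of p x y] nat_le_linear[of "fst x" "fst y"] by metis

text \<open>An index in \<open>K\<close> is sent to the element of \<open>R\<close> in the coset of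
  its representative, so every system \<open>R\<close> inherits the size of
  \<open>K\<close>.\<close>

lemma coset_reps_card:
  assumes R: "is_coset_reps p R" shows "finite R" "4 dvd card R"
proof -
  have R24: "R \<subseteq> Gamma24" using R by (simp add: is_coset_reps_def)
  have ex1: "\<exists>!\<gamma>. \<gamma> \<in> R \<and> rel0 p \<delta> \<gamma>" if "\<delta> \<in> Gamma24" for \<delta>
  proof -
    have "\<exists>!\<gamma>. \<gamma> \<in> R \<and> \<delta> \<in> (\<lambda>g. g ** \<gamma>) ` (Gamma24 \<inter> Gamma0 p)" using R that by (simp add: is_coset_reps_def)
    moreover have "(\<gamma> \<in> R \<and> \<delta> \<in> (\<lambda>g. g ** \<gamma>) ` (Gamma24 \<inter> Gamma0 p)) \<longleftrightarrow> (\<gamma> \<in> R \<and> rel0 p \<delta> \<gamma>)" for \<gamma>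
      using rel0_iff_coset[OF that] R24 by blast
    ultimately show ?thesis by simp
  qed
  define f where "f x = (THE \<gamma>. \<gamma> \<in> R \<and> rel0 p (rep x) \<gamma>)" for x
  have f: "f x \<in> R \<and> rel0 p (rep x) (f x)" for x unfolding f_def by (rule theI'[OF ex1[OF rep_Gamma24]])
  have R_Sp: "\<gamma> \<in> Sp4Z" if "\<gamma> \<in> R" for \<gamma> using that R24 Gamma24_Sp4Z by blast
  have "bij_betw f K R"
  proof (intro bij_betw_imageI inj_onI)
    fix x y assume xy: "x \<in> K" "y \<in> K" "f x = f y"
    have "rel0 p (f x) (rep y)" using rel0_sym[OF rep_Sp4Z R_Sp] f[of y] xy(3) by metis
    hence "rel0 p (rep x) (rep y)" using rel0_trans[OF rep_Sp4Z R_Sp rep_Sp4Z] f[of x] by metis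
    thus "x = y" using rep_separated xy by blast
  next
    show "f ` K = R"
    proof (intro equalityI subsetI)
      fix \<gamma> assume g: "\<gamma> \<in> R"
      obtain x where x: "x \<in> K" "rel0 p \<gamma> (rep x)" using rep_exhaust[OF R_Sp[OF g]] by blast
      have "rel0 p (rep x) \<gamma>" using rel0_sym[OF R_Sp[OF g] rep_Sp4Z x(2)] .
      hence "f x = \<gamma>" using ex1[OF rep_Gamma24[of x]] f[of x] g by blast
      thus "\<gamma> \<in> f ` K" using x by blast
    qed (use f in blast)
  qed
  thus "finite R" "4 dvd card R" using finite_K four_dvd_card_K by (auto simp: bij_betw_finite bij_betw_same_card)
qed

end

lemma odd_prime_exists:
  assumes "prime p" "p > 2" obtains a \<beta> where "odd_prime p a \<beta>"
proof -
  have "odd p" using assms prime_odd_nat by blast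
  hence "coprime ((2::int) ^ 4) (int p)" by (simp only: coprime_power_left_iff) simp
  then obtain u v where "u * 16 + v * int p = 1" using bezout_int[of 16 "int p"] by auto
  hence "v * int p = 1 + 16 * (- u)" by simp
  thus ?thesis using that[of v "-u"] assms by (simp add: odd_prime_def)
qed

section \<open>Holomorphy along complex lines\<close>

text \<open>Ensures that the part of a complex line inside the half-space is connected. The mixed
  term is bounded by multiplying the two determinant inequalities and comparing geometric and
  arithmetic mean.\<close>

lemma convex_siegel2: "convex siegel2"
proof (rule convexI)
  fix X Y :: cmat2 and u v :: real
  assume X: "X \<in> siegel2" and Y: "Y \<in> siegel2" and uv: "u \<ge> 0" "v \<ge> 0" "u + v = 1"
  obtain x1 x x2 where Xe: "X = M2 x1 x x x2" "Im x1 > 0" "(Im x)\<^sup>2 < Im x1 * Im x2" using X by (rule siegel2_cases)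
  obtain y1 y y2 where Ye: "Y = M2 y1 y y y2" "Im y1 > 0" "(Im y)\<^sup>2 < Im y1 * Im y2" using Y by (rule siegel2_cases)
  have x2: "Im x2 > 0" and y2: "Im y2 > 0" using Xe Ye siegel2_pos2 by blast+
  have "(Im x * Im y)\<^sup>2 \<le> (Im x1 * Im y2) * (Im y1 * Im x2)"
  proof -
    have "(Im x)\<^sup>2 * (Im y)\<^sup>2 \<le> (Im x1 * Im x2) * (Im y1 * Im y2)"
      using Xe Ye x2 by (intro mult_mono) auto
    thus ?thesis by (simp add: power_mult_distrib mult_ac)
  qed
  also have "\<dots> \<le> ((Im x1 * Im y2 + Im y1 * Im x2) / 2)\<^sup>2"
  proof -
    have "0 \<le> (Im x1 * Im y2 - Im y1 * Im x2)\<^sup>2" by simp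
    thus ?thesis by (simp add: power2_eq_square algebra_simps)
  qed
  finally have "\<bar>Im x * Im y\<bar> \<le> \<bar>(Im x1 * Im y2 + Im y1 * Im x2) / 2\<bar>" by (simp only: abs_le_square_iff)
  moreover have "0 < Im x1 * Im y2" "0 < Im y1 * Im x2" using Xe(2) Ye(2) x2 y2 by simp_all
  ultimately have c: "2 * (Im x * Im y) \<le> Im x1 * Im y2 + Im y1 * Im x2" by simp
  have pos: "u * Im x1 + v * Im y1 > 0"
  proof (cases "u = 0")
    case True thus ?thesis using uv Ye by simp
  next
    case False thus ?thesis using uv Xe Ye by (intro add_pos_nonneg) auto
  qed
  have "(u * Im x + v * Im y)\<^sup>2 = u\<^sup>2 * (Im x)\<^sup>2 + u * v * (2 * (Im x * Im y)) + v\<^sup>2 * (Im y)\<^sup>2" by (simp add: power2_eq_square algebra_simps)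
  also have "\<dots> < u\<^sup>2 * (Im x1 * Im x2) + u * v * (Im x1 * Im y2 + Im y1 * Im x2) + v\<^sup>2 * (Im y1 * Im y2)"
  proof (cases "u = 0")
    case True thus ?thesis using uv Ye by simp
  next
    case False
    thus ?thesis using uv Xe Ye c by (intro add_less_le_mono mult_strict_left_mono mult_left_mono) auto
  qed
  also have "\<dots> = (u * Im x1 + v * Im y1) * (u * Im x2 + v * Im y2)" by (simp add: power2_eq_square algebra_simps)
  finally have d: "(u * Im x + v * Im y)\<^sup>2 < (u * Im x1 + v * Im y1) * (u * Im x2 + v * Im y2)" .
  have "u *\<^sub>R X + v *\<^sub>R Y = M2 (u *\<^sub>R x1 + v *\<^sub>R y1) (u *\<^sub>R x + v *\<^sub>R y) (u *\<^sub>R x + v *\<^sub>R y) (u *\<^sub>R x2 + v *\<^sub>R y2)"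
    unfolding Xe(1) Ye(1) scaleR_M2 M2_arith ..
  thus "u *\<^sub>R X + v *\<^sub>R Y \<in> siegel2" using pos d by (simp only:) (rule siegel2I, simp_all)
qed

definition holo_path :: "complex set \<Rightarrow> (complex \<Rightarrow> cmat2) \<Rightarrow> bool" where
  "holo_path S \<tau> \<longleftrightarrow> open S \<and> \<tau> ` S \<subseteq> siegel2 \<and> (\<forall>i j. (\<lambda>s. \<tau> s $ i $ j) holomorphic_on S)"

text \<open>Stands in for holomorphy in several variables by testing along holomorphic curves. The
  notion is stable under \<open>act\<close>, which maps such curves to such curves.\<close>

definition line_holo :: "(cmat2 \<Rightarrow> complex) \<Rightarrow> bool" where
  "line_holo F \<longleftrightarrow> (\<forall>S \<tau>. holo_path S \<tau> \<longrightarrow> (\<lambda>s. F (\<tau> s)) holomorphic_on S)"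

lemma line_holo_const: "line_holo (\<lambda>\<Omega>. c)" by (simp add: line_holo_def)
lemma line_holo_mult: "line_holo F \<Longrightarrow> line_holo G \<Longrightarrow> line_holo (\<lambda>\<Omega>. F \<Omega> * G \<Omega>)"
  unfolding line_holo_def by (intro allI impI holomorphic_on_mult) blast+
lemma line_holo_power: "line_holo F \<Longrightarrow> line_holo (\<lambda>\<Omega>. F \<Omega> ^ n)"
  unfolding line_holo_def by (intro allI impI holomorphic_on_power) blast+
lemma line_holo_sum: "(\<And>i. i \<in> I \<Longrightarrow> line_holo (F i)) \<Longrightarrow> line_holo (\<lambda>\<Omega>. \<Sum>i\<in>I. F i \<Omega>)"
  unfolding line_holo_def by (intro allI impI holomorphic_on_sum) blast+
lemma line_holo_prod: "(\<And>i. i \<in> I \<Longrightarrow> line_holo (F i)) \<Longrightarrow> line_holo (\<lambda>\<Omega>. \<Prod>i\<in>I. F i \<Omega>)"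
  unfolding line_holo_def by (intro allI impI holomorphic_on_prod) blast+

lemma holo_path_scaleR: "holo_path S \<tau> \<Longrightarrow> r > 0 \<Longrightarrow> holo_path S (\<lambda>s. r *\<^sub>R \<tau> s)"
  unfolding holo_path_def by (auto simp: scaleR_conv_of_real[of _ "_ :: complex"] intro!: scaleR_siegel2 holomorphic_intros)

lemma holo_path_act: "M \<in> Sp4Z \<Longrightarrow> holo_path S \<tau> \<Longrightarrow> holo_path S (\<lambda>s. act M (\<tau> s))"
proof (induction rule: Sp4Z_induct)
  case one thus ?case by (simp add: act_one)
next
  case (mult g M)
  define \<sigma> where "\<sigma> = (\<lambda>s. act M (\<tau> s))"
  have S: "open S" "\<And>s. s \<in> S \<Longrightarrow> \<sigma> s \<in> siegel2" and h: "\<And>i j. (\<lambda>s. \<sigma> s $ i $ j) holomorphic_on S"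
    using mult by (auto simp: holo_path_def \<sigma>_def)
  have eq: "act (g ** M) (\<tau> s) = act g (\<sigma> s)" if "s \<in> S" for s
    unfolding \<sigma>_def using mult(4) that by (intro act_mult gens_Sp4Z mult) (auto simp: holo_path_def)
  have m: "\<sigma> s = M2 (\<sigma> s $ 1 $ 1) (\<sigma> s $ 1 $ 2) (\<sigma> s $ 1 $ 2) (\<sigma> s $ 2 $ 2)" and nz: "\<sigma> s $ 1 $ 1 \<noteq> 0" if "s \<in> S" for s
    using S(2)[OF that] unfolding siegel2_iff by auto
  have "holo_path S (\<lambda>s. act g (\<sigma> s))"
  proof -
    have im: "(\<lambda>s. act g (\<sigma> s)) ` S \<subseteq> siegel2" using S(2) mult(1) gens_act by blast
    define f1 f f2 where "f1 = (\<lambda>s. \<sigma> s $ 1 $ 1)" "f = (\<lambda>s. \<sigma> s $ 1 $ 2)" "f2 = (\<lambda>s. \<sigma> s $ 2 $ 2)"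
    note fd = f1_f_f2_def
    have hf: "f1 holomorphic_on S" "f holomorphic_on S" "f2 holomorphic_on S" unfolding fd by (rule h)+
    have n1: "f1 s \<noteq> 0" if "s \<in> S" for s using nz[OF that] by (simp add: fd)
    have "\<exists>e1 e e2. e1 holomorphic_on S \<and> e holomorphic_on S \<and> e2 holomorphic_on S \<and> (\<forall>s\<in>S. act g (\<sigma> s) = M2 (e1 s) (e s) (e s) (e2 s))"
      using mult(1)
    proof cases
      case (gensT k)
      have "\<forall>s\<in>S. act g (\<sigma> s) = M2 (f1 s + of_int k) (f s) (f s) (f2 s)"
        using m act_gT(1) unfolding gensT fd by metis
      moreover have "(\<lambda>s. f1 s + of_int k) holomorphic_on S" using hf by (intro holomorphic_intros)
      ultimately show ?thesis using hf by blast
    next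
      case (gensV k)
      have "\<forall>s\<in>S. act g (\<sigma> s) = M2 (f1 s + 2 * of_int k * f s + (of_int k)\<^sup>2 * f2 s) (f s + of_int k * f2 s) (f s + of_int k * f2 s) (f2 s)"
        using m act_gV(1) unfolding gensV fd by metis
      moreover have "(\<lambda>s. f1 s + 2 * of_int k * f s + (of_int k)\<^sup>2 * f2 s) holomorphic_on S" "(\<lambda>s. f s + of_int k * f2 s) holomorphic_on S"
        using hf by (auto intro!: holomorphic_intros)
      ultimately show ?thesis using hf by blast
    next
      case gensJ
      have "\<forall>s\<in>S. act g (\<sigma> s) = M2 (- 1 / f1 s) (f s / f1 s) (f s / f1 s) (f2 s - (f s)\<^sup>2 / f1 s)"
        using m nz act_gJ(1) unfolding gensJ fd by metis
      moreover have "(\<lambda>s. - 1 / f1 s) holomorphic_on S" "(\<lambda>s. f s / f1 s) holomorphic_on S" "(\<lambda>s. f2 s - (f s)\<^sup>2 / f1 s) holomorphic_on S"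
        using hf n1 by (intro holomorphic_intros; simp)+
      ultimately show ?thesis by blast
    next
      case gensW
      have "\<forall>s\<in>S. act g (\<sigma> s) = M2 (f2 s) (f s) (f s) (f1 s)"
        using m act_gW(1) unfolding gensW fd by metis
      thus ?thesis using hf by blast
    qed
    then obtain e1 e e2 where e: "e1 holomorphic_on S" "e holomorphic_on S" "e2 holomorphic_on S"
      "\<And>s. s \<in> S \<Longrightarrow> act g (\<sigma> s) = M2 (e1 s) (e s) (e s) (e2 s)" by blast
    have "(\<lambda>s. act g (\<sigma> s) $ i $ j) holomorphic_on S" for i j
    proof -
      have "(\<lambda>s. M2 (e1 s) (e s) (e s) (e2 s) $ i $ j) holomorphic_on S"
        using exhaust_2[of i] exhaust_2[of j] e(1-3) by auto
      thus ?thesis by (rule holomorphic_transform) (simp add: e(4))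
    qed
    thus ?thesis using S(1) im by (simp add: holo_path_def)
  qed
  hence 1: "(\<lambda>s. act g (\<sigma> s)) ` S \<subseteq> siegel2" "\<And>i j. (\<lambda>s. act g (\<sigma> s) $ i $ j) holomorphic_on S"
    by (auto simp: holo_path_def)
  have "(\<lambda>s. act (g ** M) (\<tau> s) $ i $ j) holomorphic_on S" for i j
    by (rule holomorphic_transform[OF 1(2)]) (simp add: eq)
  thus ?case using S(1) 1(1) eq by (auto simp: holo_path_def image_subset_iff)
qed

lemma line_holo_act: "M \<in> Sp4Z \<Longrightarrow> line_holo F \<Longrightarrow> line_holo (\<lambda>\<Omega>. F (act M \<Omega>))"
  using holo_path_act unfolding line_holo_def by blast

lemma line_holo_scaleR: "r > 0 \<Longrightarrow> line_holo F \<Longrightarrow> line_holo (\<lambda>\<Omega>. F (r *\<^sub>R \<Omega>))"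
  using holo_path_scaleR unfolding line_holo_def by blast

lemma line_holo_fth: "line_holo (\<lambda>\<Omega>. fth \<Omega> a b)"
  unfolding line_holo_def
proof (intro allI impI)
  fix S \<tau> assume "holo_path S \<tau>"
  hence S: "open S" "\<And>s. s \<in> S \<Longrightarrow> \<tau> s \<in> siegel2" and h: "\<And>i j. (\<lambda>s. \<tau> s $ i $ j) holomorphic_on S"
    by (auto simp: holo_path_def)
  show "(\<lambda>s. fth (\<tau> s) a b) holomorphic_on S"
    unfolding fth_def
  proof (rule holomorphic_on_infsum[OF S(1)])
    fix p :: "int \<times> int"
    show "(\<lambda>w. case p of (m, n) \<Rightarrow> qterm (\<tau> w) (2 * m + a) (2 * n + b)) holomorphic_on S"
      unfolding case_prod_unfold qterm_def by (intro holomorphic_intros h)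
  next
    fix s0 assume s0: "s0 \<in> S"
    obtain t1 z t2 where O: "\<tau> s0 = M2 t1 z z t2" "Im t1 > 0" "(Im z)\<^sup>2 < Im t1 * Im t2"
      using S(2)[OF s0] by (rule siegel2_cases)
    obtain \<epsilon> where e: "\<epsilon> > 0" "\<And>u v. \<epsilon> * (u\<^sup>2 + v\<^sup>2) \<le> Im t1 * u\<^sup>2 + 2 * Im z * u * v + Im t2 * v\<^sup>2"
      using quadratic_form_coercive[OF O(2,3)] by blast
    \<comment> \<open>With entries varying by less than \<open>\<epsilon> / 4\<close>, the diagonal
      and the off-diagonal perturbation each cost a quarter of \<open>\<epsilon>\<close>, so half of
      the coercivity survives on a whole disc.\<close>
    have "\<exists>r>0. \<forall>w. dist w s0 < r \<longrightarrow> norm (\<tau> w $ i $ j - \<tau> s0 $ i $ j) < \<epsilon> / 4" for i j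
    proof -
      have "isCont (\<lambda>s. \<tau> s $ i $ j) s0"
        using h[of i j] S(1) s0 holomorphic_on_imp_continuous_on continuous_on_eq_continuous_at by blast
      thus ?thesis using e(1) unfolding continuous_at_eps_delta dist_norm by (metis zero_less_divide_iff zero_less_numeral)
    qed
    then obtain r where r: "\<And>i j. r i j > 0" "\<And>i j w. dist w s0 < r i j \<Longrightarrow> norm (\<tau> w $ i $ j - \<tau> s0 $ i $ j) < \<epsilon> / 4" by metis
    define \<rho> where "\<rho> = min (r 1 1) (min (r 1 2) (r 2 2)) / 2"
    have rho: "\<rho> > 0" using r(1) by (simp add: \<rho>_def)
    have bnd: "norm (case p of (m, n) \<Rightarrow> qterm (\<tau> w) (2 * m + a) (2 * n + b)) \<le>
        (case p of (m, n) \<Rightarrow> exp (- (pi / 2 * (\<epsilon> / 2)) * ((real_of_int (2 * m + a))\<^sup>2 + (real_of_int (2 * n + b))\<^sup>2)))"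
      if w: "w \<in> cball s0 \<rho>" for p w
    proof -
      obtain m n where p: "p = (m, n)" by (cases p)
      have "dist w s0 < r i j" if "(i, j) \<in> {(1,1),(1,2),(2,2)}" for i j
        using w that r(1)[of 1 1] r(1)[of 1 2] r(1)[of 2 2] by (auto simp: \<rho>_def dist_commute)
      hence "norm (\<tau> w $ 1 $ 1 - t1) < \<epsilon> / 4" "norm (\<tau> w $ 1 $ 2 - z) < \<epsilon> / 4" "norm (\<tau> w $ 2 $ 2 - t2) < \<epsilon> / 4"
        using r(2)[of w 1 1] r(2)[of w 1 2] r(2)[of w 2 2] by (auto simp: O)
      hence d: "\<bar>Im (\<tau> w $ 1 $ 1) - Im t1\<bar> \<le> \<epsilon> / 4" "\<bar>Im (\<tau> w $ 1 $ 2) - Im z\<bar> \<le> \<epsilon> / 4" "\<bar>Im (\<tau> w $ 2 $ 2) - Im t2\<bar> \<le> \<epsilon> / 4"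
        using abs_Im_le_cmod order_trans less_imp_le minus_complex.simps(2) by metis+
      define u v where "u = real_of_int (2 * m + a)" "v = real_of_int (2 * n + b)"
      note uv = u_v_def
      have d': "Im t1 - Im (\<tau> w $ 1 $ 1) \<le> \<epsilon> / 4" "Im t2 - Im (\<tau> w $ 2 $ 2) \<le> \<epsilon> / 4" using d by linarith+
      have "\<epsilon> / 2 * (u\<^sup>2 + v\<^sup>2) \<le> Im (\<tau> w $ 1 $ 1) * u\<^sup>2 + 2 * Im (\<tau> w $ 1 $ 2) * u * v + Im (\<tau> w $ 2 $ 2) * v\<^sup>2"
      proof -
        have "(Im t1 - Im (\<tau> w $ 1 $ 1)) * u\<^sup>2 \<le> \<epsilon> / 4 * u\<^sup>2" "(Im t2 - Im (\<tau> w $ 2 $ 2)) * v\<^sup>2 \<le> \<epsilon> / 4 * v\<^sup>2"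
          by (rule mult_right_mono[OF d'(1)], simp, rule mult_right_mono[OF d'(2)], simp)
        moreover have "2 * (Im z - Im (\<tau> w $ 1 $ 2)) * (u * v) \<le> \<epsilon> / 4 * (u\<^sup>2 + v\<^sup>2)"
        proof -
          have "2 * \<bar>u * v\<bar> \<le> u\<^sup>2 + v\<^sup>2" using sum_squares_bound[of "\<bar>u\<bar>" "\<bar>v\<bar>"] by (simp add: abs_mult)
          hence "\<bar>Im z - Im (\<tau> w $ 1 $ 2)\<bar> * (2 * \<bar>u * v\<bar>) \<le> \<epsilon> / 4 * (u\<^sup>2 + v\<^sup>2)"
            using d(2) e(1) abs_minus_commute[of "Im z"] by (intro mult_mono) auto
          moreover have "2 * x * (u * v) \<le> \<bar>x\<bar> * (2 * \<bar>u * v\<bar>)" for x :: real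
            using abs_ge_self[of "x * (2 * (u * v))"] by (simp add: abs_mult mult_ac)
          ultimately show ?thesis using order_trans by blast
        qed
        ultimately show ?thesis using e(2)[of u v] by (simp add: algebra_simps)
      qed
      hence "pi / 2 * (\<epsilon> / 2 * (u\<^sup>2 + v\<^sup>2)) \<le> pi / 2 * (Im (\<tau> w $ 1 $ 1) * u\<^sup>2 + 2 * Im (\<tau> w $ 1 $ 2) * u * v + Im (\<tau> w $ 2 $ 2) * v\<^sup>2)"
        by (intro mult_left_mono) auto
      thus ?thesis unfolding p prod.case norm_qterm uv[symmetric] by (simp only: exp_le_cancel_iff mult_minus_left mult.assoc neg_le_iff_le)
    qed
    have sm: "(\<lambda>p. case p of (m, n) \<Rightarrow> exp (- (pi / 2 * (\<epsilon> / 2)) * ((real_of_int (2 * m + a))\<^sup>2 + (real_of_int (2 * n + b))\<^sup>2))) summable_on UNIV"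
    proof -
      have "(\<lambda>(m::int, n::int). exp (- (pi / 2 * (\<epsilon> / 2)) * ((real_of_int m)\<^sup>2 + (real_of_int n)\<^sup>2))) summable_on range (\<lambda>(m, n). (2 * m + a, 2 * n + b))"
        by (rule summable_on_subset_banach[OF summable_on_gaussian_int2]) (use e(1) in auto)
      hence "(\<lambda>(m::int, n::int). exp (- (pi / 2 * (\<epsilon> / 2)) * ((real_of_int m)\<^sup>2 + (real_of_int n)\<^sup>2))) \<circ> (\<lambda>(m, n). (2 * m + a, 2 * n + b)) summable_on UNIV"
        by (subst (asm) summable_on_reindex) (auto simp: inj_on_def)
      thus ?thesis by (simp add: o_def case_prod_unfold)
    qed
    show "\<exists>r>0. \<exists>M. M summable_on UNIV \<and> (\<forall>p\<in>UNIV. \<forall>w\<in>cball s0 r. norm (case p of (m, n) \<Rightarrow> qterm (\<tau> w) (2 * m + a) (2 * n + b)) \<le> M p)"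
      using rho sm bnd by blast
  qed
qed

lemma line_holo_gth: "line_holo (\<lambda>\<Omega>. gth \<Omega> a b)"
  unfolding gth_def by (intro line_holo_sum line_holo_mult line_holo_const line_holo_fth)

text \<open>The restriction to the complex line through two points reduces this to one variable.\<close>
lemma line_holo_mult_eq_0:
  assumes F: "line_holo F" and G: "line_holo G" and FG: "\<And>\<Omega>. \<Omega> \<in> siegel2 \<Longrightarrow> F \<Omega> * G \<Omega> = 0"
    and X: "X \<in> siegel2" "F X \<noteq> 0" and Y: "Y \<in> siegel2"
  shows "G Y = 0"
proof -
  obtain x1 x x2 where Xe: "X = M2 x1 x x x2" using X(1) by (rule siegel2_cases)
  obtain y1 y y2 where Ye: "Y = M2 y1 y y y2" using Y by (rule siegel2_cases)
  define l where "l s = M2 (x1 + s * (y1 - x1)) (x + s * (y - x)) (x + s * (y - x)) (x2 + s * (y2 - x2))" for s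
  define S where "S = l -` siegel2"
  have S_eq: "S = {s. 0 < Im (x1 + s * (y1 - x1))} \<inter> {s. (Im (x + s * (y - x)))\<^sup>2 < Im (x1 + s * (y1 - x1)) * Im (x2 + s * (y2 - x2))}"
    by (auto simp: S_def l_def siegel2_iff)
  have "open S" unfolding S_eq by (intro open_Int open_Collect_less continuous_intros)
  moreover have "convex S"
  proof (rule convexI)
    fix s t :: complex and u v :: real assume st: "s \<in> S" "t \<in> S" and uv: "u \<ge> 0" "v \<ge> 0" "u + v = 1"
    have u: "u = 1 - v" using uv by simp
    have "l (u *\<^sub>R s + v *\<^sub>R t) = u *\<^sub>R l s + v *\<^sub>R l t"
      unfolding l_def scaleR_M2 M2_arith M2_eq u by (simp add: scaleR_conv_of_real algebra_simps)
    thus "u *\<^sub>R s + v *\<^sub>R t \<in> S" using convexD[OF convex_siegel2 _ _ uv] st by (simp add: S_def)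
  qed
  ultimately have oc: "open S" "connected S" using convex_connected by auto
  have lij: "(\<lambda>s. l s $ i $ j) holomorphic_on S" for i j
    using exhaust_2[of i] exhaust_2[of j] by (auto simp: l_def intro!: holomorphic_intros)
  have hp: "holo_path S l" unfolding holo_path_def using oc lij by (auto simp: S_def)
  have 01: "0 \<in> S" "1 \<in> S" "l 0 = X" "l 1 = Y" using X Y by (auto simp: S_def l_def Xe Ye)
  have hF: "(\<lambda>s. F (l s)) holomorphic_on S" and hG: "(\<lambda>s. G (l s)) holomorphic_on S"
    using F G hp unfolding line_holo_def by blast+
  \<comment> \<open>On the open set \<open>U\<close> the first factor is nonzero, so
    \<open>G\<close> vanishes there; the identity theorem on the connected set \<open>S\<close>
    carries this from near \<open>l 0 = X\<close> to \<open>l 1 = Y\<close>.\<close>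
  define U where "U = {s \<in> S. F (l s) \<noteq> 0}"
  have "open U"
  proof -
    have "U = S \<inter> (\<lambda>s. F (l s)) -` (- {0})" by (auto simp: U_def)
    thus ?thesis using continuous_open_preimage[OF holomorphic_on_imp_continuous_on[OF hF] oc(1), of "- {0}"] by auto
  qed
  moreover have "0 \<in> U" using 01 X by (simp add: U_def)
  ultimately have lim: "0 islimpt U" by (simp add: open_imp_islimpt interior_open interior_limit_point)
  have "G (l s) = 0" if "s \<in> U" for s using FG[of "l s"] that by (auto simp: U_def S_def)
  hence "G (l 1) = 0"
    using analytic_continuation[OF hG oc, of U 0 1] 01 lim by (auto simp: U_def)
  thus ?thesis using 01 by simp
qed

text \<open>These functions have no zero divisors on the half-space, so finitely many nonvanishing
  conditions that hold somewhere hold at a common point.\<close>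

lemma line_holo_prod_nonzero:
  assumes "finite I" "\<And>i. i \<in> I \<Longrightarrow> line_holo (F i)" "\<And>i. i \<in> I \<Longrightarrow> \<exists>X\<in>siegel2. F i X \<noteq> 0"
  shows "\<exists>X\<in>siegel2. (\<Prod>i\<in>I. F i X) \<noteq> 0"
  using assms
proof (induction I rule: finite_induct)
  case empty
  have "M2 \<i> 0 0 \<i> \<in> siegel2" by (rule siegel2I) auto
  thus ?case by auto
next
  case (insert i I)
  then obtain X where X: "X \<in> siegel2" "(\<Prod>i\<in>I. F i X) \<noteq> 0" by auto
  obtain Y where Y: "Y \<in> siegel2" "F i Y \<noteq> 0" using insert by blast
  have "\<exists>\<Omega>\<in>siegel2. (\<Prod>i\<in>I. F i \<Omega>) * F i \<Omega> \<noteq> 0"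
  proof (rule ccontr)
    assume "\<not> ?thesis"
    hence "F i Y = 0" using insert X Y
      by (intro line_holo_mult_eq_0[of "\<lambda>\<Omega>. \<Prod>i\<in>I. F i \<Omega>" "F i" X Y] line_holo_prod) auto
    thus False using Y by simp
  qed
  thus ?case using insert by (auto simp: mult.commute)
qed

section \<open>Behaviour at the cusps\<close>

lemma tendsto_exp_neg_mult_at_top: "\<delta> > 0 \<Longrightarrow> ((\<lambda>s::real. exp (- (\<delta> * s))) \<longlongrightarrow> 0) at_top"
  by (rule filterlim_compose[OF exp_at_bot])
    (simp add: filterlim_uminus_at_bot filterlim_tendsto_pos_mult_at_top[OF tendsto_const _ filterlim_ident])

text \<open>For \<open>s \<ge> 1\<close> every scaled term outside \<open>B\<close> is at most its
  size at \<open>s = 1\<close> times a fixed multiple of \<open>exp (- (\<delta> * s))\<close>, so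
  the whole tail is exponentially small.\<close>

lemma leading_term:
  fixes Q :: "'i \<Rightarrow> real" and c :: "'i \<Rightarrow> complex"
  assumes B: "finite B" "B \<subseteq> A" "\<And>p. p \<in> B \<Longrightarrow> Q p = \<mu>"
    and gap: "\<delta> > 0" "\<And>p. p \<in> A - B \<Longrightarrow> Q p \<ge> \<mu> + \<delta>"
    and c: "\<And>p. norm (c p) \<le> 1" and sm: "(\<lambda>p. exp (- Q p)) summable_on A"
  shows "((\<lambda>s. of_real (exp (s * \<mu>)) * (\<Sum>\<^sub>\<infinity>p\<in>A. c p * of_real (exp (- (s * Q p))))) \<longlongrightarrow> (\<Sum>p\<in>B. c p)) at_top"
proof -
  define C where "C = exp \<mu> * exp \<delta> * (\<Sum>\<^sub>\<infinity>p\<in>A - B. exp (- Q p))"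
  have smD: "(\<lambda>p. exp (- Q p)) summable_on A - B" using summable_on_subset_banach[OF sm] by blast
  have bound: "norm (of_real (exp (s * \<mu>)) * (\<Sum>\<^sub>\<infinity>p\<in>A. c p * of_real (exp (- (s * Q p)))) - (\<Sum>p\<in>B. c p)) \<le> C * exp (- (\<delta> * s))"
    if s: "s \<ge> 1" for s
  proof -
    let ?g = "\<lambda>p. of_real (exp (s * \<mu>)) * (c p * of_real (exp (- (s * Q p))))"
    have le: "norm (?g p) \<le> exp \<mu> * exp \<delta> * exp (- (\<delta> * s)) * exp (- Q p)" if p: "p \<in> A - B" for p
    proof -
      have "(s - 1) * (Q p - \<mu>) \<ge> (s - 1) * \<delta>" using s gap(2)[OF p] by (intro mult_left_mono) auto
      hence *: "s * \<mu> + - (s * Q p) \<le> \<mu> + \<delta> + - (\<delta> * s) + - Q p" by (simp add: algebra_simps)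
      have "norm (?g p) = norm (c p) * exp (s * \<mu> + - (s * Q p))" by (simp add: norm_mult mult_exp_exp)
      also have "\<dots> \<le> 1 * exp (\<mu> + \<delta> + - (\<delta> * s) + - Q p)" using c * by (intro mult_mono) auto
      finally show ?thesis by (simp only: exp_add mult_1_left)
    qed
    have bsm: "(\<lambda>p. exp \<mu> * exp \<delta> * exp (- (\<delta> * s)) * exp (- Q p)) summable_on A - B"
      by (rule summable_on_cmult_right[OF smD])
    have gsm: "(\<lambda>p. norm (?g p)) summable_on A - B"
      by (rule summable_on_comparison_test[OF bsm]) (use le in auto)
    have rest: "norm (\<Sum>\<^sub>\<infinity>p\<in>A - B. ?g p) \<le> C * exp (- (\<delta> * s))"
    proof -
      have "norm (\<Sum>\<^sub>\<infinity>p\<in>A - B. ?g p) \<le> (\<Sum>\<^sub>\<infinity>p\<in>A - B. norm (?g p))" by (rule norm_infsum_bound[OF gsm])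
      also have "\<dots> \<le> (\<Sum>\<^sub>\<infinity>p\<in>A - B. exp \<mu> * exp \<delta> * exp (- (\<delta> * s)) * exp (- Q p))"
        by (rule infsum_mono[OF gsm bsm]) (use le in auto)
      also have "\<dots> = C * exp (- (\<delta> * s))" unfolding C_def infsum_cmult_right' by (simp add: mult_ac)
      finally show ?thesis .
    qed
    have "(\<Sum>\<^sub>\<infinity>p\<in>A. ?g p) = (\<Sum>\<^sub>\<infinity>p\<in>B \<union> (A - B). ?g p)" using B(2) by (simp add: Un_absorb1)
    also have "\<dots> = (\<Sum>\<^sub>\<infinity>p\<in>B. ?g p) + (\<Sum>\<^sub>\<infinity>p\<in>A - B. ?g p)"
      by (rule infsum_Un_disjoint[OF summable_on_finite[OF B(1)] abs_summable_summable[OF gsm]]) auto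
    also have "(\<Sum>\<^sub>\<infinity>p\<in>B. ?g p) = (\<Sum>p\<in>B. c p)"
    proof -
      have "?g p = c p" if "p \<in> B" for p
      proof -
        have "exp (s * \<mu>) * exp (- (s * Q p)) = 1" using B(3)[OF that] by (simp add: exp_minus field_simps)
        hence "complex_of_real (exp (s * \<mu>)) * of_real (exp (- (s * Q p))) = 1" unfolding of_real_mult[symmetric] by simp
        thus ?thesis by (metis mult.left_commute mult_1_right)
      qed
      hence "(\<Sum>p\<in>B. ?g p) = (\<Sum>p\<in>B. c p)" by (intro sum.cong refl)
      thus ?thesis unfolding infsum_finite[OF B(1)] .
    qed
    finally have "of_real (exp (s * \<mu>)) * (\<Sum>\<^sub>\<infinity>p\<in>A. c p * of_real (exp (- (s * Q p)))) - (\<Sum>p\<in>B. c p) = (\<Sum>\<^sub>\<infinity>p\<in>A - B. ?g p)"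
      unfolding infsum_cmult_right'[symmetric] by simp
    thus ?thesis using rest by simp
  qed
  have "((\<lambda>s. C * exp (- (\<delta> * s))) \<longlongrightarrow> 0) at_top"
    using tendsto_mult_right_zero[OF tendsto_exp_neg_mult_at_top[OF gap(1)], of C] .
  hence "((\<lambda>s. of_real (exp (s * \<mu>)) * (\<Sum>\<^sub>\<infinity>p\<in>A. c p * of_real (exp (- (s * Q p)))) - (\<Sum>p\<in>B. c p)) \<longlongrightarrow> 0) at_top"
    by (rule Lim_null_comparison[rotated]) (rule eventually_mono[OF eventually_ge_at_top[of 1]], rule bound)
  thus ?thesis by (rule LIM_zero_cancel)
qed

text \<open>Among the terms with nonzero coefficient the one of smallest exponent dominates;
  multiplying the relation by \<open>exp (s * e u)\<close> leaves \<open>f u * c u\<close> in the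
  limit.\<close>

lemma distinct_exponents:
  fixes h :: "'t \<Rightarrow> real \<Rightarrow> complex" and e :: "'t \<Rightarrow> real"
  assumes T: "finite T" and inj: "inj_on e T"
    and lim: "\<And>t. t \<in> T \<Longrightarrow> ((\<lambda>s. of_real (exp (s * e t)) * h t s) \<longlongrightarrow> c t) at_top" and c: "\<And>t. t \<in> T \<Longrightarrow> c t \<noteq> 0"
    and zero: "\<forall>\<^sub>F s in at_top. (\<Sum>t\<in>T. f t * h t s) = 0" and t: "t \<in> T"
  shows "f t = 0"
proof (rule ccontr)
  assume "f t \<noteq> 0"
  define T' where "T' = {t \<in> T. f t \<noteq> 0}"
  have T': "finite T'" "T' \<noteq> {}" using T t \<open>f t \<noteq> 0\<close> by (auto simp: T'_def)
  have "Min (e ` T') \<in> e ` T'" using T' by (intro Min_in) auto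
  then obtain u where u: "u \<in> T'" "e u = Min (e ` T')" by (auto simp: image_iff)
  have umin: "e u \<le> e v" if "v \<in> T'" for v unfolding u(2) using T' that by auto
  have "((\<lambda>s. f v * (of_real (exp (s * e u)) * h v s)) \<longlongrightarrow> (if v = u then f u * c u else 0)) at_top" if v: "v \<in> T" for v
  proof (cases "v = u \<or> f v = 0")
    case True
    thus ?thesis using tendsto_mult[OF tendsto_const lim[OF v], of "f v"] u by (auto simp: T'_def)
  next
    case False
    hence "e u < e v" using umin[of v] inj v u by (auto simp: T'_def inj_on_def less_le)
    have "((\<lambda>s. of_real (exp (- ((e v - e u) * s))) * (of_real (exp (s * e v)) * h v s)) \<longlongrightarrow> of_real 0 * c v) at_top"
      using \<open>e u < e v\<close> by (intro tendsto_mult tendsto_of_real tendsto_exp_neg_mult_at_top lim[OF v]) simp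
    moreover have "of_real (exp (- ((e v - e u) * s))) * (of_real (exp (s * e v)) * h v s) = of_real (exp (s * e u)) * h v s" for s
    proof -
      have "exp (- ((e v - e u) * s)) * exp (s * e v) = exp (s * e u)" unfolding exp_add[symmetric] by (simp add: algebra_simps)
      hence "complex_of_real (exp (- ((e v - e u) * s))) * of_real (exp (s * e v)) = of_real (exp (s * e u))" unfolding of_real_mult[symmetric] by simp
      thus ?thesis by (simp only: mult.assoc[symmetric])
    qed
    ultimately have "((\<lambda>s. of_real (exp (s * e u)) * h v s) \<longlongrightarrow> 0) at_top" by simp
    from tendsto_mult_right_zero[OF this, of "f v"] show ?thesis using False by simp
  qed
  hence "((\<lambda>s. \<Sum>v\<in>T. f v * (of_real (exp (s * e u)) * h v s)) \<longlongrightarrow> (\<Sum>v\<in>T. if v = u then f u * c u else 0)) at_top"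
    by (rule tendsto_sum)
  hence 1: "((\<lambda>s. \<Sum>v\<in>T. f v * (of_real (exp (s * e u)) * h v s)) \<longlongrightarrow> f u * c u) at_top"
    using T u by (simp add: T'_def)
  have "\<forall>\<^sub>F s in at_top. (\<Sum>v\<in>T. f v * (of_real (exp (s * e u)) * h v s)) = 0"
    using zero
  proof eventually_elim
    case (elim s)
    have "(\<Sum>v\<in>T. f v * (of_real (exp (s * e u)) * h v s)) = of_real (exp (s * e u)) * (\<Sum>v\<in>T. f v * h v s)"
      by (simp add: sum_distrib_left mult_ac)
    thus ?case using elim by simp
  qed
  hence "((\<lambda>s. \<Sum>v\<in>T. f v * (of_real (exp (s * e u)) * h v s)) \<longlongrightarrow> 0) at_top" by (rule tendsto_eventually)
  hence "f u * c u = 0" using tendsto_unique[OF _ 1] by simp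
  thus False using u c[of u] by (simp add: T'_def)
qed

definition par :: "int \<Rightarrow> int \<Rightarrow> (int \<times> int) set" where
  "par a b = {(m, n). even (m - a) \<and> even (n - b)}"

lemma fth_par: "fth \<Omega> a b = (\<Sum>\<^sub>\<infinity>(m, n)\<in>par a b. qterm \<Omega> m n)"
proof -
  have "bij_betw (\<lambda>(m, n). (2 * m + a, 2 * n + b)) UNIV (par a b)"
  proof (rule bij_betwI[where g = "\<lambda>(m, n). ((m - a) div 2, (n - b) div 2)"])
  qed (auto simp: par_def)
  from infsum_reindex_bij_betw[OF this, of "\<lambda>(m, n). qterm \<Omega> m n"] show ?thesis
    unfolding fth_def by (simp add: case_prod_unfold)
qed

lemma fth_leading:
  assumes q: "\<And>s m n. qterm (\<Omega> s) m n = c m n * of_real (exp (- (s * Q m n)))" and c: "\<And>m n. norm (c m n) = 1"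
    and O: "\<Omega> 1 \<in> siegel2"
    and B: "finite B" "B \<subseteq> par a b" "\<And>m n. (m, n) \<in> B \<Longrightarrow> Q m n = \<mu>"
    and gap: "\<And>m n. (m, n) \<in> par a b \<Longrightarrow> (m, n) \<notin> B \<Longrightarrow> Q m n \<ge> \<mu> + 1"
  shows "((\<lambda>s. of_real (exp (s * \<mu>)) * fth (\<Omega> s) a b) \<longlongrightarrow> (\<Sum>(m, n)\<in>B. c m n)) at_top"
proof -
  have sm: "(\<lambda>p. exp (- Q (fst p) (snd p))) summable_on par a b"
  proof -
    have "(\<lambda>p. norm (qterm (\<Omega> 1) (fst p) (snd p))) summable_on UNIV"
      using qterm_summable[OF O] unfolding summable_on_iff_abs_summable_on_complex by (simp add: case_prod_unfold)
    hence "(\<lambda>p. exp (- Q (fst p) (snd p))) summable_on UNIV" unfolding q by (simp add: norm_mult c)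
    thus ?thesis using summable_on_subset_banach by blast
  qed
  have "((\<lambda>s. of_real (exp (s * \<mu>)) * (\<Sum>\<^sub>\<infinity>p\<in>par a b. (\<lambda>p. c (fst p) (snd p)) p * of_real (exp (- (s * (\<lambda>p. Q (fst p) (snd p)) p))))) \<longlongrightarrow> (\<Sum>p\<in>B. (\<lambda>p. c (fst p) (snd p)) p)) at_top"
    by (rule leading_term[where \<delta> = 1]) (use B gap sm c in auto)
  thus ?thesis unfolding fth_par q by (simp add: case_prod_unfold)
qed

lemma odd_int_square_cases:
  fixes m :: int assumes "odd m" shows "m = 1 \<or> m = -1 \<or> real_of_int m ^ 2 \<ge> 9"
proof (cases "\<bar>m\<bar> \<ge> 3")
  case True
  hence "3 \<le> \<bar>real_of_int m\<bar>" by linarith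
  hence "3\<^sup>2 \<le> \<bar>real_of_int m\<bar>\<^sup>2" by (intro power_mono) auto
  thus ?thesis by simp
next
  case False
  hence "m \<in> {-2,-1,0,1,2}" by auto
  thus ?thesis using assms by auto
qed

lemma even_int_square_cases:
  fixes m :: int assumes "even m" shows "m = 0 \<or> real_of_int m ^ 2 \<ge> 4"
proof (cases "\<bar>m\<bar> \<ge> 2")
  case True
  hence "2 \<le> \<bar>real_of_int m\<bar>" by linarith
  hence "2\<^sup>2 \<le> \<bar>real_of_int m\<bar>\<^sup>2" by (intro power_mono) auto
  thus ?thesis by simp
next
  case False
  hence "m \<in> {-1,0,1}" by auto
  thus ?thesis using assms by auto
qed

text \<open>The off-diagonal entry is chosen such that the theta constants decay with the exponents 0, 1, \<open>N\<close>
  and \<open>N + 1/N\<close>; for large \<open>N\<close> these separate all monomials of bounded degree.\<close>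
definition cusp_path :: "nat \<Rightarrow> real \<Rightarrow> cmat2" where
  "cusp_path N s = M2 (\<i> * of_real (2 * s / pi)) (\<i> * of_real ((1 - 1 / N) * s / pi)) (\<i> * of_real ((1 - 1 / N) * s / pi)) (\<i> * of_real (2 * N * s / pi))"

definition cusp_form :: "nat \<Rightarrow> int \<Rightarrow> int \<Rightarrow> real" where
  "cusp_form N m n = (real_of_int m)\<^sup>2 + (1 - 1 / N) * of_int m * of_int n + N * (real_of_int n)\<^sup>2"

lemma qterm_cusp: "qterm (cusp_path N s) m n = of_real (exp (- (s * cusp_form N m n)))"
proof -
  define t where "t = 1 - 1 / real N"
  have "\<i> * pi / 2 * ((of_int m)\<^sup>2 * (\<i> * of_real (2 * s / pi)) + 2 * of_int m * of_int n * (\<i> * of_real (t * s / pi)) + (of_int n)\<^sup>2 * (\<i> * of_real (2 * real N * s / pi)))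
     = of_real (- (s * ((real_of_int m)\<^sup>2 + t * of_int m * of_int n + N * (real_of_int n)\<^sup>2)))"
    by (simp add: field_simps power2_eq_square)
  thus ?thesis unfolding qterm_def cusp_path_def cusp_form_def M2_nth t_def by (simp only: exp_of_real)
qed

lemma cusp_path_siegel2:
  assumes "N \<ge> 2" "s > 0" shows "cusp_path N s \<in> siegel2"
proof -
  define t where "t = 1 - 1 / real N"
  have t: "0 \<le> t" "t \<le> 1" using assms by (auto simp: t_def)
  define u where "u = s / pi"
  have u: "u > 0" using assms by (simp add: u_def)
  have "(t * u)\<^sup>2 \<le> (1 * u)\<^sup>2" using t u by (intro power_mono mult_right_mono) auto
  also have "\<dots> = 1 * u\<^sup>2" by simp
  also have "\<dots> < (4 * real N) * u\<^sup>2" using u assms by (intro mult_strict_right_mono) auto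
  finally have *: "(t * u)\<^sup>2 < (2 * u) * (2 * real N * u)" by (simp add: power2_eq_square mult_ac)
  have e: "2 * s / pi = 2 * u" "(1 - 1 / real N) * s / pi = t * u" "2 * real N * s / pi = 2 * real N * u"
    by (simp_all add: u_def t_def)
  show ?thesis unfolding cusp_path_def e by (rule siegel2I) (use * u in simp_all)
qed

text \<open>The first bound completes the square in \<open>m\<close>; the second uses that the cross
  coefficient lies between 0 and 1.\<close>

lemma cusp_form_lower:
  assumes "N \<ge> 2"
  shows "cusp_form N m n \<ge> (N - 1 / 4) * (real_of_int n)\<^sup>2"
    "cusp_form N m n \<ge> N * (real_of_int n)\<^sup>2 + (real_of_int m)\<^sup>2 - \<bar>real_of_int m\<bar> * \<bar>real_of_int n\<bar>"
proof -
  define t where "t = 1 - 1 / real N"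
  have t: "0 \<le> t" "t \<le> 1" using assms by (auto simp: t_def)
  have "t\<^sup>2 \<le> 1" using t by (simp add: power_le_one)
  hence "0 \<le> (1 - t\<^sup>2) / 4 * (real_of_int n)\<^sup>2" by simp
  moreover have "0 \<le> (real_of_int m + t * of_int n / 2)\<^sup>2" by simp
  ultimately show "cusp_form N m n \<ge> (N - 1 / 4) * (real_of_int n)\<^sup>2"
    unfolding cusp_form_def t_def[symmetric] by (simp add: power2_eq_square algebra_simps)
  have "\<bar>t * (of_int m * of_int n)\<bar> \<le> 1 * \<bar>real_of_int m * of_int n\<bar>" unfolding abs_mult[of t] using t by (intro mult_right_mono) auto
  hence "- (t * (of_int m * of_int n)) \<le> 1 * \<bar>real_of_int m * of_int n\<bar>" using abs_ge_minus_self order_trans by blast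
  thus "cusp_form N m n \<ge> N * (real_of_int n)\<^sup>2 + (real_of_int m)\<^sup>2 - \<bar>real_of_int m\<bar> * \<bar>real_of_int n\<bar>"
    unfolding cusp_form_def t_def[symmetric] by (simp add: abs_mult mult.assoc)
qed

text \<open>Each exponent is the minimum of \<open>cusp_form\<close> on a parity class and each
  limit the number of minimal vectors; in class \<open>(1, 1)\<close> these have entries of opposite
  sign.\<close>

lemma cusp_leading:
  assumes N: "N \<ge> 2"
  shows "((\<lambda>s. of_real (exp (s * 0)) * fth (cusp_path N s) 0 0) \<longlongrightarrow> 1) at_top"
    "((\<lambda>s. of_real (exp (s * 1)) * fth (cusp_path N s) 1 0) \<longlongrightarrow> 2) at_top"
    "((\<lambda>s. of_real (exp (s * real N)) * fth (cusp_path N s) 0 1) \<longlongrightarrow> 2) at_top"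
    "((\<lambda>s. of_real (exp (s * (real N + 1 / real N))) * fth (cusp_path N s) 1 1) \<longlongrightarrow> 2) at_top"
proof -
  have N': "real N \<ge> 2" "1 / real N \<le> 1 / 2" "1 / real N > 0" using N by (auto simp: field_simps)
  have leading: "((\<lambda>s. of_real (exp (s * \<mu>)) * fth (cusp_path N s) a b) \<longlongrightarrow> of_nat (card B)) at_top"
    if "finite B" "B \<subseteq> par a b" "\<And>m n. (m, n) \<in> B \<Longrightarrow> cusp_form N m n = \<mu>"
      "\<And>m n. (m, n) \<in> par a b \<Longrightarrow> (m, n) \<notin> B \<Longrightarrow> cusp_form N m n \<ge> \<mu> + 1" for \<mu> a b B
    using fth_leading[where c = "\<lambda>m n. 1" and Q = "cusp_form N" and \<Omega> = "cusp_path N" and B = B and a = a and b = b and \<mu> = \<mu>]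
      that cusp_path_siegel2[OF N, of 1] by (simp add: qterm_cusp case_prod_unfold)
  have big: "cusp_form N m n \<ge> 4 * real N - 1" if "(real_of_int n)\<^sup>2 \<ge> 4" for m n
  proof -
    have "(N - 1 / 4) * (real_of_int n)\<^sup>2 \<ge> (real N - 1 / 4) * 4" using that N' by (intro mult_left_mono) auto
    thus ?thesis using cusp_form_lower(1)[OF N, of n m] by simp
  qed
  have big9: "cusp_form N m n \<ge> 9 * real N - 9 / 4" if "(real_of_int n)\<^sup>2 \<ge> 9" for m n
  proof -
    have "(N - 1 / 4) * (real_of_int n)\<^sup>2 \<ge> (real N - 1 / 4) * 9" using that N' by (intro mult_left_mono) auto
    thus ?thesis using cusp_form_lower(1)[OF N, of n m] by (simp add: algebra_simps)
  qed
  have unit: "cusp_form N m n \<ge> N + 2" if "n = 1 \<or> n = -1" "\<bar>m\<bar> \<ge> 2" for m n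
  proof -
    have "2 \<le> \<bar>real_of_int m\<bar>" using that by linarith
    hence "2 * (2 - 1) \<le> \<bar>real_of_int m\<bar> * (\<bar>real_of_int m\<bar> - 1)" by (intro mult_mono) auto
    hence "(real_of_int m)\<^sup>2 - \<bar>real_of_int m\<bar> \<ge> 2" by (simp add: power2_eq_square algebra_simps)
    thus ?thesis using cusp_form_lower(2)[OF N, of n m] that by auto
  qed
  have "((\<lambda>s. of_real (exp (s * 0)) * fth (cusp_path N s) 0 0) \<longlongrightarrow> of_nat (card ({(0, 0)} :: (int \<times> int) set))) at_top"
  proof (rule leading)
    fix m n :: int assume mn: "(m, n) \<in> par 0 0" "(m, n) \<notin> {(0, 0)}"
    show "0 + 1 \<le> cusp_form N m n"
    proof (cases "n = 0")
      case True thus ?thesis using mn even_int_square_cases[of m] by (auto simp: par_def cusp_form_def)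
    next
      case False thus ?thesis using mn even_int_square_cases[of n] big[of n m] N' by (auto simp: par_def)
    qed
  qed (auto simp: par_def cusp_form_def)
  thus "((\<lambda>s. of_real (exp (s * 0)) * fth (cusp_path N s) 0 0) \<longlongrightarrow> 1) at_top" by simp
  have "((\<lambda>s. of_real (exp (s * 1)) * fth (cusp_path N s) 1 0) \<longlongrightarrow> of_nat (card ({(1, 0), (-1, 0)} :: (int \<times> int) set))) at_top"
  proof (rule leading)
    fix m n :: int assume mn: "(m, n) \<in> par 1 0" "(m, n) \<notin> {(1, 0), (-1, 0)}"
    show "1 + 1 \<le> cusp_form N m n"
    proof (cases "n = 0")
      case True thus ?thesis using mn odd_int_square_cases[of m] by (auto simp: par_def cusp_form_def)
    next
      case False thus ?thesis using mn even_int_square_cases[of n] big[of n m] N' by (auto simp: par_def)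
    qed
  qed (auto simp: par_def cusp_form_def)
  thus "((\<lambda>s. of_real (exp (s * 1)) * fth (cusp_path N s) 1 0) \<longlongrightarrow> 2) at_top" by simp
  have "((\<lambda>s. of_real (exp (s * real N)) * fth (cusp_path N s) 0 1) \<longlongrightarrow> of_nat (card ({(0, 1), (0, -1)} :: (int \<times> int) set))) at_top"
  proof (rule leading)
    fix m n :: int assume mn: "(m, n) \<in> par 0 1" "(m, n) \<notin> {(0, 1), (0, -1)}"
    hence e: "even m" "odd n" by (auto simp: par_def)
    show "real N + 1 \<le> cusp_form N m n"
    proof (cases "n = 1 \<or> n = -1")
      case True
      hence "m \<noteq> 0" using mn by auto
      hence "\<bar>m\<bar> \<ge> 2" using e by presburger
      thus ?thesis using unit[OF True, of m] by linarith
    next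
      case False thus ?thesis using e odd_int_square_cases[of n] big9[of n m] N' by auto
    qed
  qed (auto simp: par_def cusp_form_def)
  thus "((\<lambda>s. of_real (exp (s * real N)) * fth (cusp_path N s) 0 1) \<longlongrightarrow> 2) at_top" by simp
  have "((\<lambda>s. of_real (exp (s * (real N + 1 / real N))) * fth (cusp_path N s) 1 1) \<longlongrightarrow> of_nat (card ({(1, -1), (-1, 1)} :: (int \<times> int) set))) at_top"
  proof (rule leading)
    fix m n :: int assume mn: "(m, n) \<in> par 1 1" "(m, n) \<notin> {(1, -1), (-1, 1)}"
    hence e: "odd m" "odd n" by (auto simp: par_def)
    show "real N + 1 / N + 1 \<le> cusp_form N m n"
    proof (cases "n = 1 \<or> n = -1")
      case True
      show ?thesis
      proof (cases "m = 1 \<or> m = -1")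
        \<comment> \<open>Equal signs give the value \<open>N + 2 - 1 / N\<close>, which exceeds
          \<open>N + 1 / N\<close> by at least 1 exactly because \<open>N \<ge> 2\<close>.\<close>
        case m: True
        hence "(m = 1 \<and> n = 1) \<or> (m = -1 \<and> n = -1)" using True mn by auto
        thus ?thesis using N' by (auto simp: cusp_form_def)
      next
        case False
        hence "\<bar>m\<bar> \<ge> 2" using e by presburger
        hence "real (N + 2) \<le> cusp_form N m n" by (rule unit[OF True])
        hence "real N + 2 \<le> cusp_form N m n" by simp
        thus ?thesis using N'(2) by linarith
      qed
    next
      case False
      hence "(real_of_int n)\<^sup>2 \<ge> 9" using e odd_int_square_cases[of n] by auto
      hence "9 * real N - 9 / 4 \<le> cusp_form N m n" by (rule big9)
      thus ?thesis using N'(1,2) by linarith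
    qed
  qed (auto simp: par_def cusp_form_def)
  thus "((\<lambda>s. of_real (exp (s * (real N + 1 / real N))) * fth (cusp_path N s) 1 1) \<longlongrightarrow> 2) at_top" by simp
qed

lemma tendsto_weighted_power:
  assumes "((\<lambda>s. of_real (exp (s * e)) * F s) \<longlongrightarrow> (c::complex)) at_top"
  shows "((\<lambda>s. of_real (exp (s * (real n * e))) * F s ^ n) \<longlongrightarrow> c ^ n) at_top"
proof -
  have "of_real (exp (s * (real n * e))) * F s ^ n = (of_real (exp (s * e)) * F s) ^ n" for s
  proof -
    have "exp (s * (real n * e)) = exp (s * e) ^ n" by (simp add: exp_of_nat_mult[symmetric] mult_ac)
    thus ?thesis by (simp add: power_mult_distrib)
  qed
  thus ?thesis using tendsto_power[OF assms, of n] by simp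
qed

lemma tendsto_weighted_mult:
  assumes "((\<lambda>s. of_real (exp (s * e)) * F s) \<longlongrightarrow> (c::complex)) at_top" "((\<lambda>s. of_real (exp (s * e')) * G s) \<longlongrightarrow> d) at_top"
  shows "((\<lambda>s. of_real (exp (s * (e + e'))) * (F s * G s)) \<longlongrightarrow> c * d) at_top"
proof -
  have *: "of_real (exp (s * (e + e'))) * (F s * G s) = (of_real (exp (s * e)) * F s) * (of_real (exp (s * e')) * G s)" for s
    unfolding distrib_left exp_add of_real_mult by (simp only: mult.assoc mult.left_commute[of _ "F s"])
  show ?thesis unfolding * by (rule tendsto_mult[OF assms])
qed

lemma mod_div_unique: "k < N \<Longrightarrow> k' < N \<Longrightarrow> N * x + k = N * y + k' \<Longrightarrow> k = k' \<and> x = (y::nat)"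
  by (metis div_mult_self4 div_less add.commute mod_less mod_mult_self4 add_0_right less_nat_zero_code neq0_conv nonzero_mult_div_cancel_left add_right_cancel mult_left_cancel)

text \<open>The relation is read at the images under \<open>gF\<close> of the cusp path, where the
  \<open>gth\<close> become \<open>fth\<close>. Times \<open>N\<close>, the exponent of a monomial
  is written in base \<open>N\<close> with lowest digits \<open>k\<close> and \<open>i\<close> and
  leading part \<open>j + k\<close>, so distinct monomials have distinct exponents.\<close>

lemma theta_alg_independent:
  fixes f :: "nat \<Rightarrow> nat \<Rightarrow> nat \<Rightarrow> complex"
  assumes zero: "\<And>\<Omega>. \<Omega> \<in> siegel2 \<Longrightarrow> (\<Sum>i\<le>n. \<Sum>j\<le>n. \<Sum>k\<le>n. f i j k * gth \<Omega> 1 0 ^ i * gth \<Omega> 0 1 ^ j * gth \<Omega> 1 1 ^ k * gth \<Omega> 0 0 ^ (3 * n - (i + j + k))) = 0"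
    and ijk: "i \<le> n" "j \<le> n" "k \<le> n"
  shows "f i j k = 0"
proof -
  \<comment> \<open>\<open>n + 2\<close> exceeds all degrees, as digits require, and is at least 2
    as in \<open>cusp_leading\<close>.\<close>
  define N where "N = n + 2"
  have N: "N \<ge> 2" by (simp add: N_def)
  define T where "T = {..n} \<times> {..n} \<times> {..n}"
  define F where "F a b s = fth (cusp_path N s) a b" for a b s
  define h where "h = (\<lambda>(i, j, k) s. (F 1 0 s ^ i * F 0 1 s ^ j) * (F 1 1 s ^ k * F 0 0 s ^ (3 * n - (i + j + k))))"
  define e where "e = (\<lambda>(i, j, k). (real i * 1 + real j * N) + (real k * (N + 1 / N) + real (3 * n - (i + j + k)) * 0))"
  define c where "c = (\<lambda>(i::nat, j::nat, k::nat). (2 ^ i * 2 ^ j) * (2 ^ k * 1 ^ (3 * n - (i + j + k))) :: complex)"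
  have "(\<lambda>(i, j, k). f i j k) (i, j, k) = 0"
  proof (rule distinct_exponents[of T e h c])
    show "finite T" by (simp add: T_def)
    show "inj_on e T"
    proof (rule inj_onI)
      fix x y assume xy: "x \<in> T" "y \<in> T" "e x = e y"
      obtain i j k where x: "x = (i, j, k)" by (cases x)
      obtain i' j' k' where y: "y = (i', j', k')" by (cases y)
      have b: "i < N" "k < N" "i' < N" "k' < N" using xy by (auto simp: T_def x y N_def)
      have "N * e z = real (N * (N * (snd (snd z) + fst (snd z)) + fst z) + snd (snd z))" for z
      proof -
        obtain i j k where z: "z = (i, j, k)" by (cases z)
        have "d * ((a * 1 + b * d) + (c * (d + r) + q * 0)) = d * (d * (c + b) + a) + c * (d * r)" for a b c d q r :: real
          by (simp add: algebra_simps)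
        hence "N * e z = real N * (real N * (real k + real j) + real i) + real k * (real N * (1 / real N))" unfolding z e_def prod.case .
        also have "real N * (1 / real N) = 1" using N by simp
        finally show ?thesis unfolding z by simp
      qed
      from this[of x] this[of y] have "real (N * (N * (k + j) + i) + k) = real (N * (N * (k' + j') + i') + k')"
        using xy(3) unfolding x y by simp
      hence "N * (N * (k + j) + i) + k = N * (N * (k' + j') + i') + k'" by (simp only: of_nat_eq_iff)
      hence "k = k'" "N * (k + j) + i = N * (k' + j') + i'" using mod_div_unique[OF b(2,4)] by blast+
      moreover from this have "i = i'" "k + j = k' + j'" using mod_div_unique[OF b(1,3)] by blast+
      ultimately show "x = y" unfolding x y by simp
    qed
    fix t assume "t \<in> T"
    obtain i j k where t: "t = (i, j, k)" by (cases t)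
    show "c t \<noteq> 0" by (simp add: t c_def)
    show "((\<lambda>s. of_real (exp (s * e t)) * h t s) \<longlongrightarrow> c t) at_top"
      unfolding t e_def h_def c_def prod.case F_def
      by (intro tendsto_weighted_mult tendsto_weighted_power cusp_leading N)
  next
    have "(\<Sum>t\<in>T. (case t of (i, j, k) \<Rightarrow> f i j k) * h t s) = 0" if s: "s > 0" for s
    proof -
      have O: "cusp_path N s \<in> siegel2" using cusp_path_siegel2[OF N s] .
      obtain \<kappa> where k: "\<kappa> \<noteq> 0" "\<And>a b. gth (act gF (cusp_path N s)) a b = \<kappa> * fth (cusp_path N s) a b"
        using gth_gF[OF O] by blast
      have O': "act gF (cusp_path N s) \<in> siegel2" using act_siegel2[OF gF_Sp4Z O] .
      have "(\<Sum>i\<le>n. \<Sum>j\<le>n. \<Sum>k\<le>n. \<kappa> ^ (3 * n) * (f i j k * h (i, j, k) s)) = 0"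
      proof -
        have *: "f i j k * (\<kappa> * F 1 0 s) ^ i * (\<kappa> * F 0 1 s) ^ j * (\<kappa> * F 1 1 s) ^ k * (\<kappa> * F 0 0 s) ^ (3 * n - (i + j + k)) = \<kappa> ^ (3 * n) * (f i j k * h (i, j, k) s)"
          if "i \<le> n" "j \<le> n" "k \<le> n" for i j k
        proof -
          have "\<kappa> ^ (3 * n) = \<kappa> ^ i * \<kappa> ^ j * \<kappa> ^ k * \<kappa> ^ (3 * n - (i + j + k))"
            unfolding power_add[symmetric] using that by simp
          thus ?thesis by (simp add: h_def power_mult_distrib mult_ac)
        qed
        have "(\<Sum>i\<le>n. \<Sum>j\<le>n. \<Sum>k\<le>n. \<kappa> ^ (3 * n) * (f i j k * h (i, j, k) s)) = (\<Sum>i\<le>n. \<Sum>j\<le>n. \<Sum>k\<le>n.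
            f i j k * (\<kappa> * F 1 0 s) ^ i * (\<kappa> * F 0 1 s) ^ j * (\<kappa> * F 1 1 s) ^ k * (\<kappa> * F 0 0 s) ^ (3 * n - (i + j + k)))"
          by (intro sum.cong refl) (simp only: * atMost_iff)
        also have "\<dots> = 0" using zero[OF O'] unfolding k(2) F_def[symmetric] .
        finally show ?thesis .
      qed
      hence "\<kappa> ^ (3 * n) * (\<Sum>i\<le>n. \<Sum>j\<le>n. \<Sum>k\<le>n. f i j k * h (i, j, k) s) = 0" by (simp only: sum_distrib_left)
      hence "(\<Sum>i\<le>n. \<Sum>j\<le>n. \<Sum>k\<le>n. f i j k * h (i, j, k) s) = 0" using k(1) by simp
      moreover have "(\<Sum>t\<in>T. (case t of (i, j, k) \<Rightarrow> f i j k) * h t s) = (\<Sum>i\<le>n. \<Sum>j\<le>n. \<Sum>k\<le>n. f i j k * h (i, j, k) s)"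
        unfolding T_def by (simp add: sum.cartesian_product case_prod_unfold)
      ultimately show ?thesis by simp
    qed
    thus "\<forall>\<^sub>F s in at_top. (\<Sum>t\<in>T. (case t of (i, j, k) \<Rightarrow> f i j k) * h t s) = 0"
      by (intro eventually_mono[OF eventually_gt_at_top[of 0]]) blast
  qed (use ijk in \<open>simp add: T_def\<close>)
  thus ?thesis by simp
qed

text \<open>With \<open>t\<^sub>1\<close> and \<open>t\<^sub>2\<close> as in the definition, \<open>W_path p l s\<close> is the image of \<open>(t\<^sub>1, 1/2; 1/2, t\<^sub>2)\<close> under the
  base change \<open>(1, p + 1; 0, 1)\<close> followed by the base change \<open>diag(p, 1)\<close>. The entry \<open>1/2\<close> makes the abelian
  surface isogenous to a product and \<open>f\<^sub>1\<^sub>1\<close> vanish before the second base change.\<close>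
definition W_path :: "nat \<Rightarrow> nat \<Rightarrow> real \<Rightarrow> cmat2" where
  "W_path p l s = (let t1 = \<i> * of_real (2 * s / pi); t2 = \<i> * of_real (2 * l * s / pi) in
     M2 (of_nat (p * p) * t1) (of_nat (p * (p + 1)) * t1 + of_nat p / 2) (of_nat (p * (p + 1)) * t1 + of_nat p / 2)
       (of_nat ((p + 1) * (p + 1)) * t1 + of_nat (p + 1) + t2))"

text \<open>The lattice coordinate that, together with \<open>n\<close>, makes the quadratic form
  along the path diagonal.\<close>

definition W1 :: "nat \<Rightarrow> int \<Rightarrow> int \<Rightarrow> int" where "W1 p m n = int p * m + int (p + 1) * n"
definition W_form :: "nat \<Rightarrow> nat \<Rightarrow> int \<Rightarrow> int \<Rightarrow> real" where
  "W_form p l m n = (real_of_int (W1 p m n))\<^sup>2 + l * (real_of_int n)\<^sup>2"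

lemma qterm_W: "qterm (W_path p l s) m n = ip (W1 p m n * n) * of_real (exp (- (s * W_form p l m n)))"
proof -
  define T1 where "T1 = \<i> * complex_of_real (2 * s / pi)"
  define T2 where "T2 = \<i> * complex_of_real (2 * real l * s / pi)"
  have "(of_int m)\<^sup>2 * (of_nat (p * p) * T1) + 2 * of_int m * of_int n * (of_nat (p * (p + 1)) * T1 + of_nat p / 2)
     + (of_int n)\<^sup>2 * (of_nat ((p + 1) * (p + 1)) * T1 + of_nat (p + 1) + T2) =
     of_int (W1 p m n * n) + ((of_int (W1 p m n))\<^sup>2 * T1 + (of_int n)\<^sup>2 * T2)"
    unfolding W1_def by (simp add: algebra_simps power2_eq_square)
  moreover have "\<i> * pi / 2 * ((of_int (W1 p m n))\<^sup>2 * T1 + (of_int n)\<^sup>2 * T2) = of_real (- (s * W_form p l m n))"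
    unfolding T1_def T2_def W_form_def by (simp add: field_simps power2_eq_square)
  ultimately have "\<i> * pi / 2 * ((of_int m)\<^sup>2 * (of_nat (p * p) * T1) + 2 * of_int m * of_int n * (of_nat (p * (p + 1)) * T1 + of_nat p / 2)
     + (of_int n)\<^sup>2 * (of_nat ((p + 1) * (p + 1)) * T1 + of_nat (p + 1) + T2)) = \<i> * pi / 2 * of_int (W1 p m n * n) + of_real (- (s * W_form p l m n))"
    by (simp only: distrib_left)
  thus ?thesis unfolding qterm_def W_path_def Let_def M2_nth T1_def[symmetric] T2_def[symmetric] ip_def by (simp only: exp_add exp_of_real)
qed

lemma W_path_siegel2:
  assumes "p > 0" "l > 0" "s > 0" shows "W_path p l s \<in> siegel2"
proof -
  define u where "u = 2 * s / pi"
  have u: "u > 0" using assms by (simp add: u_def)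
  have e: "2 * real l * s / pi = l * u" "2 * s / pi = u" by (simp_all add: u_def)
  have i: "Im (of_nat k * (\<i> * complex_of_real x)) = k * x" for k x by simp
  have "0 < (real (p * p) * u) * (l * u)" using u assms by simp
  hence *: "(real (p * (p + 1)) * u)\<^sup>2 < (real (p * p) * u) * (real ((p + 1) * (p + 1)) * u + l * u)"
    by (simp add: power2_eq_square algebra_simps)
  show ?thesis unfolding W_path_def Let_def e
  proof (rule siegel2I)
    show "0 < Im (of_nat (p * p) * (\<i> * complex_of_real u))" unfolding i using u assms by simp
    show "(Im (of_nat (p * (p + 1)) * (\<i> * complex_of_real u) + of_nat p / 2))\<^sup>2 < Im (of_nat (p * p) * (\<i> * complex_of_real u)) *
       Im (of_nat ((p + 1) * (p + 1)) * (\<i> * complex_of_real u) + of_nat (p + 1) + \<i> * complex_of_real (real l * u))"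
      using * unfolding plus_complex.sel i by simp
  qed
qed

lemma odd_W1: "odd p \<Longrightarrow> odd m \<Longrightarrow> odd (W1 p m n)"
  by (simp add: W1_def)

text \<open>The weight \<open>l\<close> forces \<open>n\<close> to be as small as possible. In class
  \<open>(1, 1)\<close> the coordinate \<open>W1\<close> is odd, so the minimum is
  \<open>1 + l\<close>; it is attained at two vectors with \<open>W1 = n\<close>, both with the
  imaginary unit as phase.\<close>

lemma W_leading:
  assumes p: "odd p" "p > 2" and l: "l \<ge> p * p"
  shows "((\<lambda>s. of_real (exp (s * 0)) * fth (W_path p l s) 0 0) \<longlongrightarrow> 1) at_top"
    "((\<lambda>s. of_real (exp (s * real (p * p))) * fth (W_path p l s) 1 0) \<longlongrightarrow> 2) at_top"
    "((\<lambda>s. of_real (exp (s * (1 + real l))) * fth (W_path p l s) 1 1) \<longlongrightarrow> 2 * \<i>) at_top"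
proof -
  have pp: "real (p * p) \<ge> 9"
  proof -
    have "3 * 3 \<le> p * p" using p by (intro mult_mono) auto
    thus ?thesis by linarith
  qed
  have l': "real l \<ge> real (p * p)" using l by linarith
  have l0: "l > 0" using l' pp by linarith
  have c: "norm (ip k) = 1" for k by (simp add: ip_def)
  note q = qterm_W[of p l]
  have O: "W_path p l 1 \<in> siegel2" using W_path_siegel2 p l0 by simp
  have big: "W_form p l m n \<ge> 4 * real l" if "(real_of_int n)\<^sup>2 \<ge> 4" for m n
  proof -
    have "real l * 4 \<le> real l * (real_of_int n)\<^sup>2" using that by (intro mult_left_mono) auto
    thus ?thesis unfolding W_form_def using zero_le_power2[of "real_of_int (W1 p m n)"] by linarith
  qed
  have big9: "W_form p l m n \<ge> 9 * real l" if "(real_of_int n)\<^sup>2 \<ge> 9" for m n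
  proof -
    have "real l * 9 \<le> real l * (real_of_int n)\<^sup>2" using that by (intro mult_left_mono) auto
    thus ?thesis unfolding W_form_def using zero_le_power2[of "real_of_int (W1 p m n)"] by linarith
  qed
  have n0: "W_form p l m 0 = real (p * p) * (real_of_int m)\<^sup>2" for m by (simp add: W_form_def W1_def power2_eq_square)
  have "((\<lambda>s. of_real (exp (s * 0)) * fth (W_path p l s) 0 0) \<longlongrightarrow> (\<Sum>(m, n)\<in>{(0, 0)}. ip (W1 p m n * n))) at_top"
  proof (rule fth_leading[OF q c O])
    fix m n :: int assume mn: "(m, n) \<in> par 0 0" "(m, n) \<notin> {(0, 0)}"
    show "0 + 1 \<le> W_form p l m n"
    proof (cases "n = 0")
      case True
      hence "(real_of_int m)\<^sup>2 \<ge> 1" using mn even_int_square_cases[of m] by (auto simp: par_def)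
      hence "real (p * p) * (real_of_int m)\<^sup>2 \<ge> 9 * 1" using pp by (intro mult_mono) auto
      thus ?thesis unfolding True n0 by simp
    next
      case False thus ?thesis using mn even_int_square_cases[of n] big[of n m] l' pp by (auto simp: par_def)
    qed
  qed (auto simp: par_def n0)
  thus "((\<lambda>s. of_real (exp (s * 0)) * fth (W_path p l s) 0 0) \<longlongrightarrow> 1) at_top" by simp
  have "((\<lambda>s. of_real (exp (s * real (p * p))) * fth (W_path p l s) 1 0) \<longlongrightarrow> (\<Sum>(m, n)\<in>{(1, 0), (-1, 0)}. ip (W1 p m n * n))) at_top"
  proof (rule fth_leading[OF q c O])
    fix m n :: int assume mn: "(m, n) \<in> par 1 0" "(m, n) \<notin> {(1, 0), (-1, 0)}"
    show "real (p * p) + 1 \<le> W_form p l m n"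
    proof (cases "n = 0")
      case True
      hence "(real_of_int m)\<^sup>2 \<ge> 9" using mn odd_int_square_cases[of m] by (auto simp: par_def)
      hence "real (p * p) * (real_of_int m)\<^sup>2 \<ge> real (p * p) * 9" using pp by (intro mult_left_mono) auto
      thus ?thesis unfolding True n0 using pp by linarith
    next
      case False
      hence "(real_of_int n)\<^sup>2 \<ge> 4" using mn even_int_square_cases[of n] by (auto simp: par_def)
      thus ?thesis using big[of n m] l' pp by linarith
    qed
  qed (auto simp: par_def n0)
  thus "((\<lambda>s. of_real (exp (s * real (p * p))) * fth (W_path p l s) 1 0) \<longlongrightarrow> 2) at_top" by simp
  have "((\<lambda>s. of_real (exp (s * (1 + real l))) * fth (W_path p l s) 1 1) \<longlongrightarrow> (\<Sum>(m, n)\<in>{(-1, 1), (1, -1)}. ip (W1 p m n * n))) at_top"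
  proof (rule fth_leading[OF q c O])
    fix m n :: int assume mn: "(m, n) \<in> par 1 1" "(m, n) \<notin> {(-1, 1), (1, -1)}"
    hence e: "odd m" "odd n" by (auto simp: par_def)
    show "1 + real l + 1 \<le> W_form p l m n"
    proof (cases "n = 1 \<or> n = -1")
      case True
      \<comment> \<open>The vectors with \<open>n = 1\<close> or \<open>n = -1\<close> and
        \<open>W1 = - n\<close>, whose phases would cancel the leading term, are not in the lattice:
        they would require \<open>p\<close> to divide 2.\<close>
      have "W1 p m n \<noteq> 1 \<and> W1 p m n \<noteq> -1"
      proof (rule ccontr)
        assume "\<not> ?thesis"
        hence W: "(int p * (m + n) + n = 1) \<or> (int p * (m + n) + n = -1)" by (auto simp: W1_def algebra_simps)
        have mnz: "m + n \<noteq> 0" using True mn(2) by auto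
        have "int p * (m + n) \<in> {-2, 0, 2}" using W True by auto
        hence "\<bar>int p * (m + n)\<bar> \<le> 2" by auto
        moreover have "\<bar>int p * (m + n)\<bar> \<ge> int p * 1"
          unfolding abs_mult using mnz by (intro mult_mono) auto
        ultimately show False using p by simp
      qed
      hence "(real_of_int (W1 p m n))\<^sup>2 \<ge> 9" using odd_int_square_cases[OF odd_W1[OF p(1) e(1)]] by auto
      moreover have "(real_of_int n)\<^sup>2 = 1" using True by auto
      ultimately show ?thesis by (simp add: W_form_def)
    next
      case False
      hence "(real_of_int n)\<^sup>2 \<ge> 9" using odd_int_square_cases[OF e(2)] by auto
      thus ?thesis using big9[of n m] l' pp by linarith
    qed
  qed (auto simp: par_def W_form_def W1_def)
  thus "((\<lambda>s. of_real (exp (s * (1 + real l))) * fth (W_path p l s) 1 1) \<longlongrightarrow> 2 * \<i>) at_top"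
    by (simp add: W1_def algebra_simps)
qed

section \<open>The locus determines its equation up to a constant\<close>

text \<open>As \<open>c\<close> and its square have the same parity, an even translation multiplies
  by a character and so shifts the characteristic. With \<open>x = 1\<close> it moves
  \<open>(0, 0)\<close> to \<open>(1, 1)\<close>.\<close>

lemma gth_trans:
  assumes "\<Omega> \<in> siegel2"
  shows "gth (act (trans (2 * x) 0 (2 * x)) \<Omega>) a b = gth \<Omega> (a + x) (b + x)"
proof -
  have "fth (act (trans (2 * x) 0 (2 * x)) \<Omega>) c d = sg (x * c\<^sup>2 + x * d\<^sup>2) * fth \<Omega> c d" for c d
  proof -
    have "2 * x * c\<^sup>2 + 2 * 0 * c * d + 2 * x * d\<^sup>2 = 2 * (x * c\<^sup>2 + x * d\<^sup>2)" by (simp add: algebra_simps)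
    thus ?thesis unfolding fth_trans[OF assms] by (simp only: ip_2)
  qed
  thus ?thesis by (simp add: gth_def sg_add distrib_right mult_ac)
qed

lemma scale_gF:
  assumes O: "\<Omega> \<in> siegel2" and r: "r > 0"
  shows "r *\<^sub>R act gF \<Omega> = act gF ((1 / r) *\<^sub>R \<Omega>)"
proof -
  obtain t1 z t2 where X: "\<Omega> = M2 t1 z z t2" by (rule siegel2_cases[OF O])
  obtain y1 y2 y3 y4 where Y: "act gF \<Omega> = M2 y1 y2 y3 y4" by (rule M2_cases)
  have "act gF \<Omega> ** jmat gF \<Omega> = nmat gF \<Omega>" by (rule act_times_jmat[OF gF_Sp4Z O])
  hence e: "y1 * t1 + y2 * z = -1" "y1 * z + y2 * t2 = 0" "y3 * t1 + y4 * z = 0" "y3 * z + y4 * t2 = -1"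
    unfolding Y by (simp_all add: X jmat_def nmat_def gF_def)
  have "act gF ((1 / r) *\<^sub>R \<Omega>) = r *\<^sub>R act gF \<Omega>"
  proof (rule act_eqI'[OF gF_Sp4Z scaleR_siegel2[OF _ O]])
    show "r *\<^sub>R act gF \<Omega> ** jmat gF ((1 / r) *\<^sub>R \<Omega>) = nmat gF ((1 / r) *\<^sub>R \<Omega>)"
      unfolding Y using e r by (simp add: X jmat_def nmat_def gF_def)
  qed (use r in simp)
  thus ?thesis by simp
qed

lemma emb2_Sp4Z: "a * d - b * c = 1 \<Longrightarrow> emb2 a b c d \<in> Sp4Z"
  using emb2_gen Sp4Z_eq_gen by blast

lemma act_emb2:
  assumes O: "M2 t1 z z t2 \<in> siegel2" and det: "a * d - b * c = 1"
  defines "\<delta> \<equiv> of_int c * t2 + of_int d"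
  shows "\<delta> \<noteq> 0" "act (emb2 a b c d) (M2 t1 z z t2) = M2 (t1 - of_int c * z\<^sup>2 / \<delta>) (z / \<delta>) (z / \<delta>) ((of_int a * t2 + of_int b) / \<delta>)"
proof -
  have j: "jmat (emb2 a b c d) (M2 t1 z z t2) = M2 1 0 (of_int c * z) \<delta>"
    by (simp add: jmat_def emb2_def \<delta>_def)
  have n: "nmat (emb2 a b c d) (M2 t1 z z t2) = M2 t1 z (of_int a * z) (of_int a * t2 + of_int b)"
    by (simp add: nmat_def emb2_def)
  show d: "\<delta> \<noteq> 0" using invertible_jmat[OF emb2_Sp4Z[OF det] O] unfolding j invertible_M2 by simp
  have "of_int a * of_int d - of_int b * of_int c = (1::complex)" using det by (metis of_int_1 of_int_diff of_int_mult)
  hence k: "\<delta> * (of_int a * z) = z + z * of_int c * (of_int a * t2 + of_int b)" unfolding \<delta>_def by algebra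
  show "act (emb2 a b c d) (M2 t1 z z t2) = M2 (t1 - of_int c * z\<^sup>2 / \<delta>) (z / \<delta>) (z / \<delta>) ((of_int a * t2 + of_int b) / \<delta>)"
  proof (rule act_eqI'[OF emb2_Sp4Z[OF det] O])
    have "z / \<delta> + (of_int a * t2 + of_int b) / \<delta> * (of_int c * z) = of_int a * z" using d k by (simp add: field_simps)
    thus "M2 (t1 - of_int c * z\<^sup>2 / \<delta>) (z / \<delta>) (z / \<delta>) ((of_int a * t2 + of_int b) / \<delta>) ** jmat (emb2 a b c d) (M2 t1 z z t2) = nmat (emb2 a b c d) (M2 t1 z z t2)"
      unfolding j n using d by (simp add: power2_eq_square field_simps)
  qed
qed


text \<open>The part of the locus inside the affine chart, expressed by points instead of
  classes.\<close>

definition zero_locus :: "nat \<Rightarrow> cmat2 set" where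
  "zero_locus p = {\<Omega> \<in> siegel2. theta 0 (\<Omega> /\<^sub>R 2) \<noteq> 0 \<and> (\<exists>M\<in>Gamma24. theta 0 ((real p *\<^sub>R act M \<Omega>) /\<^sub>R 2) = 0)}"

section \<open>Points of the locus from products of elliptic curves, and divisibility by its
  equation\<close>

context odd_prime
begin

lemma p_pos: "p > 0" using gt2 by simp

text \<open>In the coordinate \<open>w = m + (p + 1) n\<close> the real part of the off-diagonal
  structure contributes the phase \<open>i^(p n w)\<close>. Reflecting \<open>w\<close> preserves
  the parity class and, as \<open>p n w\<close> is odd, changes the sign, so the terms cancel in
  pairs.\<close>

lemma fth_scaled_W:
  fixes T T2 :: complex
  defines "z \<equiv> of_nat (p * (p + 1)) * T + of_nat p / 2"
  shows "fth (M2 (of_nat p * T) z z (of_nat p * (of_nat ((p + 1) * (p + 1)) * T + of_nat (p + 1) + T2))) 1 1 = 0" (is "fth ?D 1 1 = 0")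
proof -
  let ?\<sigma> = "\<lambda>(m, n). (- m - 2 * int (p + 1) * n, n)"
  have b: "bij_betw ?\<sigma> (par 1 1) (par 1 1)"
    by (rule bij_betwI[where g = ?\<sigma>]) (auto simp: par_def)
  have q: "qterm ?D m n = ip (int p * n * (m + int (p + 1) * n)) *
     exp (\<i> * pi / 2 * (of_nat p * T * (of_int (m + int (p + 1) * n))\<^sup>2 + (of_int n)\<^sup>2 * (of_nat p * T2)))" for m n
    unfolding qterm_def ip_def exp_add[symmetric] M2_nth z_def
    by (rule arg_cong[where f = exp]) (simp add: algebra_simps power2_eq_square)
  have s: "qterm ?D (- m - 2 * int (p + 1) * n) n = - qterm ?D m n" if "(m, n) \<in> par 1 1" for m n
  proof -
    define w where "w = m + int (p + 1) * n"
    have w': "- m - 2 * int (p + 1) * n + int (p + 1) * n = - w" by (simp add: w_def algebra_simps)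
    have "odd (int p * n * w)" using that odd_p by (simp add: w_def par_def)
    hence "sg (int p * n * w) = -1" by (simp add: sg_def)
    moreover have "ip (int p * n * w) = ip (2 * (int p * n * w)) * ip (int p * n * - w)"
      unfolding ip_add[symmetric] by (rule arg_cong[where f = ip]) simp
    ultimately have "ip (int p * n * - w) = - ip (int p * n * w)" unfolding ip_2 by simp
    thus ?thesis unfolding q w' w_def[symmetric] by simp
  qed
  have "fth ?D 1 1 = (\<Sum>\<^sub>\<infinity>x\<in>par 1 1. (\<lambda>(m, n). qterm ?D m n) (?\<sigma> x))"
    unfolding fth_par by (rule infsum_reindex_bij_betw[OF b, symmetric])
  also have "\<dots> = (\<Sum>\<^sub>\<infinity>(m, n)\<in>par 1 1. - qterm ?D m n)" by (rule infsum_cong) (use s in auto)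
  also have "\<dots> = - fth ?D 1 1" unfolding fth_par by (simp add: case_prod_unfold infsum_uminus)
  finally show ?thesis by simp
qed

text \<open>\<open>g\<close> turns the characteristic \<open>(0, 0)\<close> into
  \<open>(1, 1)\<close>. The element of \<open>Gamma24\<close> is chosen so that the isogeny divides
  the first entry of \<open>X\<close> by \<open>p\<close> and multiplies the last one by
  \<open>p\<close>, which produces the matrix of \<open>fth_scaled_W\<close>.\<close>

lemma W_locus:
  assumes l: "l > 0" and s: "s > 0"
  defines "g \<equiv> trans 2 0 2 ** gF" and "X \<equiv> W_path p l s"
  shows "act g X \<in> siegel2" "\<exists>\<kappa>. \<kappa> \<noteq> 0 \<and> (\<forall>a b. gth (act g X) a b = \<kappa> * fth X (a + 1) (b + 1))"
    "\<exists>M\<in>Gamma24. gth (real p *\<^sub>R act M (act g X)) 0 0 = 0"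
proof -
  have X: "X \<in> siegel2" unfolding X_def by (rule W_path_siegel2[OF p_pos l s])
  have g: "g \<in> Sp4Z" unfolding g_def by (intro Sp4Z_mult trans_Sp4Z gF_Sp4Z)
  show O: "act g X \<in> siegel2" by (rule act_siegel2[OF g X])
  have FX: "act gF X \<in> siegel2" by (rule act_siegel2[OF gF_Sp4Z X])
  obtain \<kappa> where k: "\<kappa> \<noteq> 0" "\<And>a b. gth (act gF X) a b = \<kappa> * fth X a b" using gth_gF[OF X] by blast
  have "gth (act g X) a b = \<kappa> * fth X (a + 1) (b + 1)" for a b
    unfolding g_def act_mult[OF trans_Sp4Z gF_Sp4Z X] using gth_trans[OF FX, of 1] k(2) by simp
  thus "\<exists>\<kappa>. \<kappa> \<noteq> 0 \<and> (\<forall>a b. gth (act g X) a b = \<kappa> * fth X (a + 1) (b + 1))" using k(1) by blast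
  define E where "E = emb2 a 4 (4 * \<beta>) (int p)"
  define M' where "M' = spinv E"
  have E: "E \<in> Sp4Z" using emb_Gamma24(2) Gamma24_Sp4Z unfolding E_def by blast
  have M': "M' \<in> Gamma24" unfolding M'_def E_def by (intro Gamma24_spinv emb_Gamma24)
  have M'S: "M' \<in> Sp4Z" using M' Gamma24_Sp4Z by blast
  \<comment> \<open>\<open>M'\<close> is adapted to \<open>X\<close>; conjugation by
    \<open>g\<close> adapts it to \<open>act g X\<close>, and normality keeps it in
    \<open>Gamma24\<close>.\<close>
  define M where "M = g ** M' ** spinv g"
  have M: "M \<in> Gamma24" unfolding M_def by (rule Gamma24_conj[OF g M'])
  have ig: "spinv g \<in> Sp4Z" by (rule Sp4Z_inverse(1)[OF g])
  have "act M (act g X) = act (g ** M') (act (spinv g) (act g X))" unfolding M_def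
    by (rule act_mult[OF Sp4Z_mult[OF g M'S] ig O])
  also have "act (spinv g) (act g X) = X" using act_mult[OF ig g X] Sp4Z_inverse(2)[OF g] by (simp add: act_one)
  also have "act (g ** M') X = act g (act M' X)" by (rule act_mult[OF g M'S X])
  finally have act1: "act M (act g X) = act g (act M' X)" .
  define Y where "Y = act M' X"
  have Y: "Y \<in> siegel2" unfolding Y_def by (rule act_siegel2[OF M'S X])
  have EY: "act E Y = X" unfolding Y_def M'_def using act_mult[OF E Sp4Z_inverse(1)[OF E] X] Sp4Z_inverse(3)[OF E] by (simp add: act_one)
  define \<tau> where "\<tau> = (1 / real p) *\<^sub>R Y"
  have \<tau>: "\<tau> \<in> siegel2" unfolding \<tau>_def by (rule scaleR_siegel2[OF _ Y]) (use p_pos in simp)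
  have F\<tau>: "act gF \<tau> \<in> siegel2" by (rule act_siegel2[OF gF_Sp4Z \<tau>])
  have "real p *\<^sub>R act g Y = real p *\<^sub>R act (trans 2 0 2) (act gF Y)" unfolding g_def act_mult[OF trans_Sp4Z gF_Sp4Z Y] ..
  also have "\<dots> = act (trans (2 * int p) 0 (2 * int p)) (real p *\<^sub>R act gF Y)"
  proof -
    have FY: "act gF Y \<in> siegel2" by (rule act_siegel2[OF gF_Sp4Z Y])
    obtain t1 z t2 where e: "act gF Y = M2 t1 z z t2" by (rule siegel2_cases[OF FY])
    have "real p *\<^sub>R act gF Y \<in> siegel2" by (rule scaleR_siegel2[OF _ FY]) (use p_pos in simp)
    hence *: "M2 (real p *\<^sub>R t1) (real p *\<^sub>R z) (real p *\<^sub>R z) (real p *\<^sub>R t2) \<in> siegel2" unfolding e scaleR_M2 .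
    have **: "M2 t1 z z t2 \<in> siegel2" using FY unfolding e .
    show ?thesis unfolding e scaleR_M2 act_trans[OF *] unfolding act_trans[OF **] scaleR_M2 M2_eq
      by (simp add: scaleR_conv_of_real distrib_left mult.commute)
  qed
  also have "real p *\<^sub>R act gF Y = act gF \<tau>" unfolding \<tau>_def by (rule scale_gF[OF Y]) (use p_pos in simp)
  finally have e: "real p *\<^sub>R act g Y = act (trans (2 * int p) 0 (2 * int p)) (act gF \<tau>)" .
  obtain \<kappa>' where k': "\<And>a b. gth (act gF \<tau>) a b = \<kappa>' * fth \<tau> a b" using gth_gF[OF \<tau>] by blast
  have "gth (real p *\<^sub>R act g Y) 0 0 = \<kappa>' * fth \<tau> (int p) (int p)" unfolding e gth_trans[OF F\<tau>] k' by simp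
  moreover have "fth \<tau> (int p) (int p) = fth \<tau> 1 1" by (rule per2D[OF per2_fth]) (use odd_p in auto)
  moreover have "fth \<tau> 1 1 = 0"
  proof -
    \<comment> \<open>In the second variable, dividing by \<open>p\<close> and then applying
      \<open>Z\<close> gives \<open>p\<close> times the action of \<open>E\<close>. The determinant
      is again 1 by \<open>ab\<close>.\<close>
    define Z where "Z = emb2 (int p * a) 4 (4 * \<beta>) 1"
    have "4 dvd 4 * \<beta>" "odd (int p * a)" using odd_p odd_a by auto
    have dZ: "int p * a * 1 - 4 * (4 * \<beta>) = 1" using ab by (simp add: mult.commute)
    have dE: "a * int p - 4 * (4 * \<beta>) = 1" using ab by simp
    have Z: "Z \<in> Gamma24" unfolding Z_def emb2_def Gamma24_m4
      using emb2_Sp4Z[OF dZ] odd_p odd_a unfolding emb2_def by simp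
    obtain y1 w y2 where y: "Y = M2 y1 w w y2" by (rule siegel2_cases[OF Y])
    have ys: "M2 y1 w w y2 \<in> siegel2" using Y unfolding y .
    have yt: "M2 (y1 / p) (w / p) (w / p) (y2 / p) = \<tau>" unfolding \<tau>_def y scaleR_M2 by (simp add: scaleR_conv_of_real)
    have ts: "M2 (y1 / p) (w / p) (w / p) (y2 / p) \<in> siegel2" unfolding yt by (rule \<tau>)
    define \<delta> where "\<delta> = of_int (4 * \<beta>) * y2 + of_int (int p)"
    have d0: "\<delta> \<noteq> 0" unfolding \<delta>_def by (rule act_emb2(1)[OF ys dE])
    have p0: "complex_of_nat p \<noteq> 0" using p_pos by simp
    have aE: "X = M2 (y1 - of_int (4 * \<beta>) * w\<^sup>2 / \<delta>) (w / \<delta>) (w / \<delta>) ((of_int a * y2 + of_int 4) / \<delta>)"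
      unfolding EY[symmetric] E_def y \<delta>_def by (rule act_emb2(2)[OF ys dE])
    have "act Z \<tau> = M2 (y1 / p - of_int (4 * \<beta>) * (w / p)\<^sup>2 / (of_int (4 * \<beta>) * (y2 / p) + of_int 1)) (w / p / (of_int (4 * \<beta>) * (y2 / p) + of_int 1)) (w / p / (of_int (4 * \<beta>) * (y2 / p) + of_int 1))
       ((of_int (int p * a) * (y2 / p) + of_int 4) / (of_int (4 * \<beta>) * (y2 / p) + of_int 1))"
      unfolding Z_def yt[symmetric] by (rule act_emb2(2)[OF ts dZ])
    also have "of_int (4 * \<beta>) * (y2 / p) + of_int 1 = \<delta> / p" using p0 by (simp add: \<delta>_def field_simps)
    finally have aZ: "act Z \<tau> = M2 (y1 / p - of_int (4 * \<beta>) * (w / p)\<^sup>2 / (\<delta> / p)) (w / p / (\<delta> / p)) (w / p / (\<delta> / p)) ((of_int (int p * a) * (y2 / p) + of_int 4) / (\<delta> / p))" .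
    have "y1 / p - of_int (4 * \<beta>) * (w / p)\<^sup>2 / (\<delta> / p) = (y1 - of_int (4 * \<beta>) * w\<^sup>2 / \<delta>) / p"
      using p0 d0 by (simp add: field_simps power2_eq_square)
    moreover have "w / p / (\<delta> / p) = w / \<delta>" using p0 d0 by (simp add: field_simps)
    moreover have "(of_int (int p * a) * (y2 / p) + of_int 4) / (\<delta> / p) = of_nat p * ((of_int a * y2 + of_int 4) / \<delta>)"
      using p0 d0 by (simp add: field_simps)
    ultimately have "act Z \<tau> = M2 (X $ 1 $ 1 / p) (X $ 1 $ 2) (X $ 1 $ 2) (of_nat p * X $ 2 $ 2)"
      unfolding aZ aE M2_nth by (simp only:)
    also have "X $ 1 $ 1 / p = of_nat p * (\<i> * of_real (2 * s / pi))"
      unfolding X_def W_path_def Let_def M2_nth using p0 by simp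
    finally have f0: "fth (act Z \<tau>) 1 1 = 0"
      using fth_scaled_W[of "\<i> * of_real (2 * s / pi)" "\<i> * of_real (2 * real l * s / pi)"]
      unfolding X_def W_path_def Let_def M2_nth by (simp only:)
    obtain \<mu> where m: "\<mu> \<noteq> 0" "\<And>a b. fth (act Z \<tau>) a b = \<mu> * fth \<tau> a b" using Gamma24_fth[OF Z \<tau>] by blast
    show ?thesis using f0 m(1) unfolding m(2) mult_eq_0_iff by blast
  qed
  ultimately have "gth (real p *\<^sub>R act M (act g X)) 0 0 = 0" unfolding act1 Y_def[symmetric] by simp
  thus "\<exists>M\<in>Gamma24. gth (real p *\<^sub>R act M (act g X)) 0 0 = 0" using M by blast
qed

lemma zero_locus_gth:
  "\<Omega> \<in> zero_locus p \<longleftrightarrow> \<Omega> \<in> siegel2 \<and> gth \<Omega> 0 0 \<noteq> 0 \<and> (\<exists>M\<in>Gamma24. gth (real p *\<^sub>R act M \<Omega>) 0 0 = 0)"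
proof (cases "\<Omega> \<in> siegel2")
  case True
  have "theta 0 ((real p *\<^sub>R act M \<Omega>) /\<^sub>R 2) = gth (real p *\<^sub>R act M \<Omega>) 0 0" if "M \<in> Gamma24" for M
    using theta_half[OF scaleR_siegel2[OF _ act_siegel2[OF Gamma24_Sp4Z[OF that] True]], of "real p" 0] p_pos by simp
  moreover have "theta 0 (\<Omega> /\<^sub>R 2) = gth \<Omega> 0 0" using theta_half[OF True, of 0] by simp
  ultimately show ?thesis using True unfolding zero_locus_def by auto
qed (simp add: zero_locus_def)

text \<open>Along the path \<open>b' 2\<close> and \<open>b' 3\<close> are
  \<open>F 1 0 / F 1 1\<close> and \<open>F 0 0 / F 1 1\<close>, with decay exponents
  \<open>p * p\<close>, 0 and \<open>1 + l\<close>. After clearing denominators the exponent of a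
  monomial is a number in base \<open>1 + l\<close> with last digit
  \<open>j * (p * p)\<close>.\<close>

lemma zero_locus_two_variables:
  assumes R: "\<And>\<Omega>. \<Omega> \<in> zero_locus p \<Longrightarrow> eval2 R (b' 2 \<Omega>) (b' 3 \<Omega>) = 0"
  shows "R = 0"
proof -
  obtain n where n: "\<And>j k. coeff (coeff R j) k \<noteq> 0 \<Longrightarrow> j \<le> n \<and> k \<le> n" using poly2_bound[of R] by blast
  have ex: "eval2 R y z = (\<Sum>j\<le>n. \<Sum>k\<le>n. of_rat (coeff (coeff R j) k) * y ^ j * z ^ k)" for y z
    by (rule eval2_expand) (rule n)
  \<comment> \<open>Large enough that \<open>j * (p * p)\<close> stays below the base
    \<open>1 + l\<close> for all \<open>j \<le> n\<close>.\<close>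
  define l where "l = (n + 1) * (p * p)"
  have l: "l \<ge> p * p" "l > 0" using p_pos by (auto simp: l_def)
  define F where "F a b s = fth (W_path p l s) a b" for a b s
  define T where "T = {..n} \<times> {..n}"
  define e where "e = (\<lambda>(j, k). (real j * real (p * p) + real k * 0) + real (2 * n - (j + k)) * (1 + real l))"
  define h where "h = (\<lambda>(j, k) s. F 1 0 s ^ j * F 0 0 s ^ k * F 1 1 s ^ (2 * n - (j + k)))"
  define c where "c = (\<lambda>(j, k). (2::complex) ^ j * 1 ^ k * (2 * \<i>) ^ (2 * n - (j + k)))"
  note lead = W_leading[OF odd_p gt2 l(1)]
  have "(case t of (j, k) \<Rightarrow> of_rat (coeff (coeff R j) k)) = (0::complex)" if t: "t \<in> T" for t
  proof (rule distinct_exponents[where T = T and e = e and h = h and c = c and t = t])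
    show "finite T" by (simp add: T_def)
    show "inj_on e T"
    proof (rule inj_onI)
      fix x y assume "x \<in> T" "y \<in> T" and xy: "e x = e y"
      then obtain j k j' k' where x: "x = (j, k)" and y: "y = (j', k')" and b: "j \<le> n" "k \<le> n" "j' \<le> n" "k' \<le> n"
        by (auto simp: T_def)
      have lt: "i * (p * p) < 1 + l" if "i \<le> n" for i
      proof -
        have "i * (p * p) \<le> n * (p * p)" by (rule mult_le_mono1[OF that])
        also have "n * (p * p) < 1 + l" unfolding l_def by simp
        finally show ?thesis .
      qed
      have "real ((1 + l) * (2 * n - (j + k)) + j * (p * p)) = real ((1 + l) * (2 * n - (j' + k')) + j' * (p * p))"
        using xy unfolding x y e_def prod.case by (simp only: of_nat_add of_nat_mult of_nat_1) (simp add: algebra_simps)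
      hence "(1 + l) * (2 * n - (j + k)) + j * (p * p) = (1 + l) * (2 * n - (j' + k')) + j' * (p * p)" by (simp only: of_nat_eq_iff)
      from mod_div_unique[OF lt[OF b(1)] lt[OF b(3)] this] have "j * (p * p) = j' * (p * p)" "2 * n - (j + k) = 2 * n - (j' + k')" by auto
      thus "x = y" unfolding x y using b p_pos by auto
    qed
    fix u assume "u \<in> T"
    obtain j k where u: "u = (j, k)" by (cases u)
    show "c u \<noteq> 0" by (simp add: u c_def)
    show "((\<lambda>s. of_real (exp (s * e u)) * h u s) \<longlongrightarrow> c u) at_top"
      unfolding u e_def h_def c_def prod.case F_def
      by (intro tendsto_weighted_mult tendsto_weighted_power lead)
  next
    have "((\<lambda>s. of_real (exp (s * (1 + real l))) * F 1 1 s) \<longlongrightarrow> 2 * \<i>) at_top" unfolding F_def by (rule lead(3))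
    from tendsto_imp_eventually_ne[OF this, of 0] have "\<forall>\<^sub>F s in at_top. F 1 1 s \<noteq> 0" by (auto elim: eventually_mono)
    thus "\<forall>\<^sub>F s in at_top. (\<Sum>t\<in>T. (case t of (j, k) \<Rightarrow> of_rat (coeff (coeff R j) k)) * h t s) = 0"
      using eventually_gt_at_top[of 0]
    proof eventually_elim
      case (elim s)
      define \<Omega> where "\<Omega> = act (trans 2 0 2 ** gF) (W_path p l s)"
      note W = W_locus[OF l(2) elim(2), folded \<Omega>_def]
      obtain \<kappa> where k: "\<kappa> \<noteq> 0" "\<And>a b. gth \<Omega> a b = \<kappa> * fth (W_path p l s) (a + 1) (b + 1)" using W(2) by blast
      have f: "fth (W_path p l s) 1 2 = F 1 0 s" "fth (W_path p l s) 2 2 = F 0 0 s"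
        unfolding F_def by (rule per2D[OF per2_fth]; simp)+
      have b: "b' 2 \<Omega> = F 1 0 s / F 1 1 s" "b' 3 \<Omega> = F 0 0 s / F 1 1 s"
        unfolding bprime_eq[OF W(1)] k(2) using k(1) f by (simp_all add: F_def)
      have "\<Omega> \<in> zero_locus p" unfolding zero_locus_gth using W(1,3) k elim(1) by (simp add: F_def)
      from R[OF this] have "(\<Sum>j\<le>n. \<Sum>k\<le>n. of_rat (coeff (coeff R j) k) * (F 1 0 s / F 1 1 s) ^ j * (F 0 0 s / F 1 1 s) ^ k) = 0"
        unfolding b ex .
      hence "0 = (\<Sum>j\<le>n. \<Sum>k\<le>n. of_rat (coeff (coeff R j) k) * (F 1 0 s / F 1 1 s) ^ j * (F 0 0 s / F 1 1 s) ^ k) * F 1 1 s ^ (2 * n)" by simp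
      also have "\<dots> = (\<Sum>j\<le>n. \<Sum>k\<le>n. of_rat (coeff (coeff R j) k) * h (j, k) s)"
        unfolding sum_distrib_right
      proof (intro sum.cong refl)
        fix j k assume "j \<in> {..n}" "k \<in> {..n}"
        hence "F 1 1 s ^ (2 * n) = F 1 1 s ^ j * F 1 1 s ^ k * F 1 1 s ^ (2 * n - (j + k))" unfolding power_add[symmetric] by simp
        thus "of_rat (coeff (coeff R j) k) * (F 1 0 s / F 1 1 s) ^ j * (F 0 0 s / F 1 1 s) ^ k * F 1 1 s ^ (2 * n) = of_rat (coeff (coeff R j) k) * h (j, k) s"
          using elim(1) by (simp add: h_def power_divide field_simps)
      qed
      also have "\<dots> = (\<Sum>t\<in>T. (case t of (j, k) \<Rightarrow> of_rat (coeff (coeff R j) k)) * h t s)"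
        unfolding T_def by (simp add: sum.cartesian_product case_prod_unfold)
      finally show ?case by simp
    qed
  qed (rule t)
  hence "coeff (coeff R j) k = 0" for j k using n[of j k] by (cases "j \<le> n \<and> k \<le> n") (auto simp: T_def)
  thus ?thesis by (intro poly_eqI) simp
qed

text \<open>Substitutes for the Nullstellensatz. If \<open>b' 1\<close> does not occur in
  \<open>L\<close>, then \<open>L\<close> itself is the forbidden relation; otherwise primality of
  \<open>L\<close>, from unique factorisation, feeds the elimination.\<close>

lemma dvd_if_vanishes_on_zero_locus:
  assumes L: "irreducible L" "\<And>\<Omega>. \<Omega> \<in> zero_locus p \<Longrightarrow> eval_b' L \<Omega> = 0"
    and Q: "\<And>\<Omega>. \<Omega> \<in> zero_locus p \<Longrightarrow> eval_b' Q \<Omega> = 0"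
  shows "L dvd Q"
proof (rule ccontr)
  assume nd: "\<not> L dvd Q"
  have "\<exists>A B R. R \<noteq> 0 \<and> [:R:] = A * L + B * Q"
  proof (cases "degree L = 0")
    case True
    then obtain R where R: "L = [:R:]" by (rule degree_eq_zeroE)
    have "R \<noteq> 0" using L(1) R by auto
    moreover have "[:R:] = 1 * L + 0 * Q" using R by simp
    ultimately show ?thesis by blast
  next
    case False
    have "prime_elem L" using L(1) by (rule irreducible_imp_prime_elem)
    moreover have "degree L > 0" using False by simp
    ultimately obtain A B R where "R \<noteq> 0" "[:R:] = A * L + B * Q" by (rule eliminate_variable[OF _ _ nd])
    thus ?thesis by blast
  qed
  then obtain A B R where R: "R \<noteq> 0" "[:R:] = A * L + B * Q" by blast
  have "eval2 R (b' 2 \<Omega>) (b' 3 \<Omega>) = 0" if "\<Omega> \<in> zero_locus p" for \<Omega>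
  proof -
    have "eval2 R (b' 2 \<Omega>) (b' 3 \<Omega>) = eval3 [:R:] (b' 1 \<Omega>) (b' 2 \<Omega>) (b' 3 \<Omega>)" by (simp add: eval3_pCons_const)
    also have "\<dots> = 0" unfolding R(2) using L(2)[OF that] Q[OF that] by (simp add: eval_b'_def)
    finally show ?thesis .
  qed
  thus False using zero_locus_two_variables R(1) by blast
qed

end

section \<open>Exponents of the polynomial of the locus\<close>

lemma ip_power: "ip a ^ n = ip (a * int n)"
  by (induction n) (simp_all add: ip_add[symmetric] algebra_simps)

lemma ip_2_3: "ip 2 = - 1" "ip 3 = - \<i>"
  using ip_2[of 1] ip_add[of 2 1] by simp_all

lemma mod_4_cases: "(k::int) mod 4 = 0 \<or> k mod 4 = 1 \<or> k mod 4 = 2 \<or> k mod 4 = 3" by presburger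

lemma ip_mod: "ip (k mod 4) = ip k" by (rule ip_cong) (simp add: cong_def)

lemma ip_eq_iff: "ip a = ip b \<longleftrightarrow> [a = b] (mod 4)"
proof
  assume "ip a = ip b"
  hence "ip (a mod 4) = ip (b mod 4)" by (simp only: ip_mod)
  thus "[a = b] (mod 4)" using mod_4_cases[of a] mod_4_cases[of b] unfolding cong_def
    by (auto simp: ip_2_3 complex_eq_iff)
qed (rule ip_cong)

text \<open>Character orthogonality on the cyclic group of order 4; it serves to project on exponent
  classes.\<close>

lemma ip_orthogonality: "(\<Sum>t<4. ip (int t * k)) = (if 4 dvd k then 4 else 0)"
proof -
  have "ip (c * k) = ip (c * (k mod 4))" for c by (rule ip_cong) (simp add: cong_def mod_mult_right_eq)
  hence "(\<Sum>t<4. ip (int t * k)) = 1 + ip (k mod 4) + ip (2 * (k mod 4)) + ip (3 * (k mod 4))"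
    by (simp add: numeral_eq_Suc lessThan_Suc ip_mod algebra_simps) (metis mult.commute)
  moreover have "ip 4 = 1" "ip 6 = -1" "ip 9 = \<i>"
    using ip_4[of 1] ip_add[of 4 2] ip_add[of "4 * 2" 1] ip_4[of 2] by (simp_all add: ip_2_3)
  ultimately show ?thesis using mod_4_cases[of k] by (auto simp: ip_2_3 dvd_eq_mod_eq_0)
qed

context odd_prime
begin

text \<open>The conjugate by \<open>g\<close> of a witness \<open>M\<close> for a point is a witness
  for its image; \<open>h\<close> is what \<open>g\<close> becomes after multiplication by
  \<open>p\<close>.\<close>

lemma zero_locus_act:
  assumes g: "g \<in> Sp4Z" "h \<in> Sp4Z"
    and scale: "\<And>\<Omega>. \<Omega> \<in> siegel2 \<Longrightarrow> real p *\<^sub>R act g \<Omega> = act h (real p *\<^sub>R \<Omega>)"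
    and zg: "\<And>\<Omega>. \<Omega> \<in> siegel2 \<Longrightarrow> theta 0 (act g \<Omega> /\<^sub>R 2) = 0 \<longleftrightarrow> theta 0 (\<Omega> /\<^sub>R 2) = 0"
    and zh: "\<And>\<Omega>. \<Omega> \<in> siegel2 \<Longrightarrow> theta 0 (act h \<Omega> /\<^sub>R 2) = 0 \<longleftrightarrow> theta 0 (\<Omega> /\<^sub>R 2) = 0"
    and \<Omega>: "\<Omega> \<in> zero_locus p"
  shows "act g \<Omega> \<in> zero_locus p"
proof -
  have O: "\<Omega> \<in> siegel2" "theta 0 (\<Omega> /\<^sub>R 2) \<noteq> 0" using \<Omega> by (auto simp: zero_locus_def)
  obtain M where M: "M \<in> Gamma24" "theta 0 ((real p *\<^sub>R act M \<Omega>) /\<^sub>R 2) = 0" using \<Omega> by (auto simp: zero_locus_def)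
  have MS: "M \<in> Sp4Z" using M Gamma24_Sp4Z by blast
  have gO: "act g \<Omega> \<in> siegel2" by (rule act_siegel2[OF g(1) O(1)])
  have MO: "act M \<Omega> \<in> siegel2" by (rule act_siegel2[OF MS O(1)])
  have ig: "spinv g \<in> Sp4Z" by (rule Sp4Z_inverse(1)[OF g(1)])
  have "act (g ** M ** spinv g) (act g \<Omega>) = act (g ** M) (act (spinv g) (act g \<Omega>))"
    by (rule act_mult[OF Sp4Z_mult[OF g(1) MS] ig gO])
  also have "act (spinv g) (act g \<Omega>) = \<Omega>" using act_mult[OF ig g(1) O(1)] Sp4Z_inverse(2)[OF g(1)] by (simp add: act_one)
  also have "act (g ** M) \<Omega> = act g (act M \<Omega>)" by (rule act_mult[OF g(1) MS O(1)])
  finally have "real p *\<^sub>R act (g ** M ** spinv g) (act g \<Omega>) = act h (real p *\<^sub>R act M \<Omega>)" using scale[OF MO] by simp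
  moreover have "theta 0 (act h (real p *\<^sub>R act M \<Omega>) /\<^sub>R 2) = 0"
    using zh[OF scaleR_siegel2[OF _ MO, of "real p"]] M(2) p_pos by simp
  ultimately have "theta 0 ((real p *\<^sub>R act (g ** M ** spinv g) (act g \<Omega>)) /\<^sub>R 2) = 0" by simp
  thus ?thesis unfolding zero_locus_def using gO zg[OF O(1)] O(2) Gamma24_conj[OF g(1) M(1)] by blast
qed

lemma zero_locus_low: "\<Omega> \<in> zero_locus p \<Longrightarrow> act (low (int p * x) (int p * y) (int p * z)) \<Omega> \<in> zero_locus p"
  by (rule zero_locus_act[where h = "low x y z"]) (use low_Sp4Z scale_low p_pos bprime_low(4) in auto)

lemma zero_locus_gW: "\<Omega> \<in> zero_locus p \<Longrightarrow> act gW \<Omega> \<in> zero_locus p"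
  by (rule zero_locus_act[where h = gW]) (use gens_Sp4Z[OF gensW] scale_gW p_pos bprime_gW(4) in auto)

lemma zero_locus_gV: "\<Omega> \<in> zero_locus p \<Longrightarrow> act (gV 1) \<Omega> \<in> zero_locus p"
  by (rule zero_locus_act[where h = "gV 1"]) (use gens_Sp4Z[OF gensV] scale_gV p_pos bprime_gV(4) in auto)

lemma zero_locus_siegel2: "\<Omega> \<in> zero_locus p \<Longrightarrow> \<Omega> \<in> siegel2"
  by (simp add: zero_locus_def)

lemma L'_vanishes:
  assumes "is_L' p L" "\<Omega> \<in> zero_locus p" shows "eval_b' L \<Omega> = 0"
proof -
  have "\<Omega> \<in> siegel2" "theta 0 (\<Omega> /\<^sub>R 2) \<noteq> 0" "Gamma24_class \<Omega> \<in> isogeny_locus p"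
    using assms(2) unfolding zero_locus_def isogeny_locus_def by blast+
  thus ?thesis using assms(1) by (simp add: is_L'_def describes_locus_def)
qed

text \<open>Averaging \<open>L\<close> over four lower unipotent matrices against a character
  extracts the monomials with \<open>i + k\<close> in the class of \<open>r\<close>. The factor
  \<open>p\<close> in the phase is invertible modulo 4, so it does not blur the classes.\<close>

lemma L'_component:
  assumes L: "is_L' p L" and n: "\<And>i j k. coeff3 L i j k \<noteq> 0 \<Longrightarrow> i \<le> n \<and> j \<le> n \<and> k \<le> n"
    and O: "\<Omega> \<in> zero_locus p"
  shows "eval_b' (mk3 n (\<lambda>i j k. if [i + k = r] (mod 4) then coeff3 L i j k else 0)) \<Omega> = 0"
proof -
  have S: "\<Omega> \<in> siegel2" using O by (rule zero_locus_siegel2)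
  let ?q = "int p"
  have ex: "eval3 L x y z = (\<Sum>i\<le>n. \<Sum>j\<le>n. \<Sum>k\<le>n. of_rat (coeff3 L i j k) * x ^ i * y ^ j * z ^ k)" for x y z
    by (rule eval3_expand) (rule n)
  define c where "c i j k = of_rat (coeff3 L i j k) * b' 1 \<Omega> ^ i * b' 2 \<Omega> ^ j * b' 3 \<Omega> ^ k" for i j k
  have "(\<Sum>i\<le>n. \<Sum>j\<le>n. \<Sum>k\<le>n. ip (int t * (- ?q * (int i + int k))) * c i j k) = 0" for t :: nat
  proof -
    let ?X = "act (low (?q * int t) (?q * 0) (?q * 0)) \<Omega>"
    have "0 = eval_b' L ?X" by (rule L'_vanishes[OF L zero_locus_low[OF O], symmetric])
    also have "\<dots> = (\<Sum>i\<le>n. \<Sum>j\<le>n. \<Sum>k\<le>n. ip (int t * (- ?q * (int i + int k))) * c i j k)"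
      unfolding eval_b'_def ex bprime_low[OF S]
    proof (intro sum.cong refl)
      fix i j k
      have "int t * (- ?q * (int i + int k)) = - (?q * int t) * int i + - (?q * int t + 2 * (?q * 0) + ?q * 0) * int k"
        by (simp add: algebra_simps)
      thus "of_rat (coeff3 L i j k) * (ip (- (?q * int t)) * b' 1 \<Omega>) ^ i * (ip (- (?q * 0)) * b' 2 \<Omega>) ^ j *
         (ip (- (?q * int t + 2 * (?q * 0) + ?q * 0)) * b' 3 \<Omega>) ^ k = ip (int t * (- ?q * (int i + int k))) * c i j k"
        by (simp only: ip_add ip_power power_mult_distrib c_def) simp
    qed
    finally show ?thesis by simp
  qed
  hence "0 = (\<Sum>t<4. ip (int t * (?q * int r)) * (\<Sum>i\<le>n. \<Sum>j\<le>n. \<Sum>k\<le>n. ip (int t * (- ?q * (int i + int k))) * c i j k))" by simp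
  also have "\<dots> = (\<Sum>t<4. \<Sum>i\<le>n. \<Sum>j\<le>n. \<Sum>k\<le>n. ip (int t * (?q * (int r - (int i + int k)))) * c i j k)"
    unfolding sum_distrib_left
  proof (intro sum.cong refl)
    fix t i j k
    have "int t * (?q * (int r - (int i + int k))) = int t * (?q * int r) + int t * (- ?q * (int i + int k))" by (simp add: algebra_simps)
    thus "ip (int t * (?q * int r)) * (ip (int t * (- ?q * (int i + int k))) * c i j k) = ip (int t * (?q * (int r - (int i + int k)))) * c i j k"
      by (simp only: ip_add mult.assoc)
  qed
  also have "\<dots> = (\<Sum>i\<le>n. \<Sum>t<4. \<Sum>j\<le>n. \<Sum>k\<le>n. ip (int t * (?q * (int r - (int i + int k)))) * c i j k)"
    by (rule sum.swap)
  also have "\<dots> = (\<Sum>i\<le>n. \<Sum>j\<le>n. \<Sum>t<4. \<Sum>k\<le>n. ip (int t * (?q * (int r - (int i + int k)))) * c i j k)"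
    by (intro sum.cong refl sum.swap)
  also have "\<dots> = (\<Sum>i\<le>n. \<Sum>j\<le>n. \<Sum>k\<le>n. \<Sum>t<4. ip (int t * (?q * (int r - (int i + int k)))) * c i j k)"
    by (intro sum.cong refl sum.swap)
  also have "\<dots> = (\<Sum>i\<le>n. \<Sum>j\<le>n. \<Sum>k\<le>n. 4 * (of_rat (if [i + k = r] (mod 4) then coeff3 L i j k else 0) * b' 1 \<Omega> ^ i * b' 2 \<Omega> ^ j * b' 3 \<Omega> ^ k))"
  proof (intro sum.cong refl)
    fix i j k
    have "coprime 4 ?q" using odd_p coprime_power_left_iff[of 2 2 ?q] by simp
    hence "4 dvd ?q * (int r - (int i + int k)) \<longleftrightarrow> 4 dvd int r - (int i + int k)" by (rule coprime_dvd_mult_right_iff)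
    also have "\<dots> \<longleftrightarrow> [int (i + k) = int r] (mod int 4)" by (simp add: cong_iff_dvd_diff dvd_diff_commute)
    finally have "4 dvd ?q * (int r - (int i + int k)) \<longleftrightarrow> [i + k = r] (mod 4)" by (simp only: cong_int_iff)
    thus "(\<Sum>t<4. ip (int t * (?q * (int r - (int i + int k)))) * c i j k) =
       4 * (of_rat (if [i + k = r] (mod 4) then coeff3 L i j k else 0) * b' 1 \<Omega> ^ i * b' 2 \<Omega> ^ j * b' 3 \<Omega> ^ k)"
      unfolding sum_distrib_right[symmetric] ip_orthogonality by (simp add: c_def)
  qed
  also have "\<dots> = 4 * eval_b' (mk3 n (\<lambda>i j k. if [i + k = r] (mod 4) then coeff3 L i j k else 0)) \<Omega>"
    unfolding eval_b'_def eval_mk3 sum_distrib_left ..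
  finally show ?thesis by simp
qed

text \<open>With \<open>r\<close> read off a monomial that occurs, the component is nonzero and
  divisible by \<open>L\<close>. Its monomials are among those of \<open>L\<close>, so it is a
  constant multiple of \<open>L\<close> and contains them all.\<close>

lemma L'_support_residue:
  assumes L: "is_L' p L"
  obtains r :: nat where "\<And>i j k. coeff3 L i j k \<noteq> 0 \<Longrightarrow> [i + k = r] (mod 4)"
proof -
  have irr: "irreducible L" using L by (simp add: is_L'_def)
  obtain n where n: "\<And>i j k. coeff3 L i j k \<noteq> 0 \<Longrightarrow> i \<le> n \<and> j \<le> n \<and> k \<le> n" using poly3_bound by metis
  have "L \<noteq> 0" using irr by auto
  then obtain i0 j0 k0 where c0: "coeff3 L i0 j0 k0 \<noteq> 0" using poly3_eqI[of L 0] by (auto simp: coeff3_def)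
  define r where "r = i0 + k0"
  define Q where "Q = mk3 n (\<lambda>i j k. if [i + k = r] (mod 4) then coeff3 L i j k else 0)"
  have cQ: "coeff3 Q i j k = (if [i + k = r] (mod 4) then coeff3 L i j k else 0)" for i j k
    unfolding Q_def coeff3_mk3 using n[of i j k] by auto
  have "coeff3 Q i0 j0 k0 \<noteq> 0" unfolding cQ using c0 by (simp add: r_def)
  hence Q0: "Q \<noteq> 0" by (auto simp: coeff3_def)
  have "L dvd Q"
  proof (rule dvd_if_vanishes_on_zero_locus[OF irr])
    fix \<Omega> assume O: "\<Omega> \<in> zero_locus p"
    show "eval_b' L \<Omega> = 0" by (rule L'_vanishes[OF L O])
    show "eval_b' Q \<Omega> = 0" unfolding Q_def by (rule L'_component[OF L _ O]) (rule n)
  qed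
  then obtain c where c: "c \<noteq> 0" "\<And>i j k. coeff3 Q i j k = c * coeff3 L i j k"
    by (rule dvd_support_imp_const[OF _ Q0]) (simp_all add: cQ split: if_splits)
  have "[i + k = r] (mod 4)" if "coeff3 L i j k \<noteq> 0" for i j k
    using c(2)[of i j k] c(1) that unfolding cQ by (auto split: if_splits)
  thus ?thesis by (rule that)
qed

text \<open>\<open>gW\<close> and \<open>gV 1\<close> preserve the locus and exchange
  \<open>b' 1\<close> with \<open>b' 2\<close>, respectively \<open>b' 2\<close> with
  \<open>b' 3\<close>; as these are involutions, the cofactor is constant.\<close>

lemma L'_symmetric:
  assumes L: "is_L' p L"
  shows "coeff3 L j i k \<noteq> 0 \<longleftrightarrow> coeff3 L i j k \<noteq> 0" "coeff3 L i k j \<noteq> 0 \<longleftrightarrow> coeff3 L i j k \<noteq> 0"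
proof -
  have irr: "irreducible L" and L0: "L \<noteq> 0" using L by (auto simp: is_L'_def)
  have ex: "\<exists>A'. \<forall>x y z. eval3 A' x y z = eval3 A y x z" for A using eval3_swap12 by blast
  have "L dvd swap12 L"
  proof (rule dvd_if_vanishes_on_zero_locus[OF irr L'_vanishes[OF L]], assumption)
    fix \<Omega> assume "\<Omega> \<in> zero_locus p"
    thus "eval_b' (swap12 L) \<Omega> = 0" using L'_vanishes[OF L zero_locus_gW] bprime_gW[OF zero_locus_siegel2]
      by (simp add: eval_b'_def eval3_swap12)
  qed
  then obtain c where c: "c \<noteq> 0" "\<And>i j k. coeff3 (swap12 L) i j k = c * coeff3 L i j k"
    by (rule involution_dvd_imp_const[OF L0, where u = "\<lambda>x y z. y" and v = "\<lambda>x y z. x" and w = "\<lambda>x y z. z"])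
      (use eval3_swap12 ex in blast)+
  show "coeff3 L j i k \<noteq> 0 \<longleftrightarrow> coeff3 L i j k \<noteq> 0" using c(1) c(2)[of i j k] unfolding coeff3_swap12 by simp
  have ex: "\<exists>A'. \<forall>x y z. eval3 A' x y z = eval3 A x z y" for A using eval3_swap23 by blast
  have "L dvd swap23 L"
  proof (rule dvd_if_vanishes_on_zero_locus[OF irr L'_vanishes[OF L]], assumption)
    fix \<Omega> assume "\<Omega> \<in> zero_locus p"
    thus "eval_b' (swap23 L) \<Omega> = 0" using L'_vanishes[OF L zero_locus_gV] bprime_gV[OF zero_locus_siegel2]
      by (simp add: eval_b'_def eval3_swap23)
  qed
  then obtain c where c: "c \<noteq> 0" "\<And>i j k. coeff3 (swap23 L) i j k = c * coeff3 L i j k"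
    by (rule involution_dvd_imp_const[OF L0, where u = "\<lambda>x y z. x" and v = "\<lambda>x y z. z" and w = "\<lambda>x y z. y"])
      (use eval3_swap23 ex in blast)+
  show "coeff3 L i k j \<noteq> 0 \<longleftrightarrow> coeff3 L i j k \<noteq> 0" using c(1) c(2)[of i j k] unfolding coeff3_swap23 by simp
qed

text \<open>Odd exponents of \<open>b' 3\<close> make \<open>L\<close> divisible by
  \<open>b' 3\<close>, hence by irreducibility a constant times it; but there \<open>b' 1\<close>
  has the even exponent 0.\<close>

lemma L'_not_all_odd:
  assumes irr: "irreducible L" and odd: "\<And>i j k. coeff3 L i j k \<noteq> 0 \<Longrightarrow> odd i \<and> odd k"
  shows False
proof -
  obtain n where n: "\<And>i j k. coeff3 L i j k \<noteq> 0 \<Longrightarrow> i \<le> n \<and> j \<le> n \<and> k \<le> n" using poly3_bound by metis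
  define Z :: poly3 where "Z = [:[:[:0, 1:]:]:]"
  define Q where "Q = mk3 n (\<lambda>i j k. coeff3 L i j (Suc k))"
  have cZ: "coeff3 (Z * P) i j k = (case k of 0 \<Rightarrow> 0 | Suc k' \<Rightarrow> coeff3 P i j k')" for P i j k
    by (cases k) (simp_all add: coeff3_def Z_def coeff_pCons)
  have "L = Z * Q"
  proof (rule poly3_eqI)
    fix i j k
    show "coeff3 L i j k = coeff3 (Z * Q) i j k"
    proof (cases k)
      case 0 thus ?thesis using odd[of i j 0] by (auto simp: cZ)
    next
      case (Suc k') show ?thesis unfolding Suc using n[of i j "Suc k'"]
        by (cases "coeff3 L i j (Suc k') = 0") (simp_all add: cZ Q_def coeff3_mk3)
    qed
  qed
  moreover have "\<not> Z dvd 1" by (rule notI, erule poly3_unit) (simp add: Z_def)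
  ultimately have "Q dvd 1" using irr by (auto simp: irreducible_def)
  then obtain c where c: "Q = [:[:[:c:]:]:]" "c \<noteq> 0" by (rule poly3_unit)
  have "coeff3 L 0 0 (Suc 0) = coeff3 Q 0 0 0" unfolding \<open>L = Z * Q\<close> by (simp only: cZ nat.case)
  hence "coeff3 L 0 0 (Suc 0) \<noteq> 0" using c by (simp add: coeff3_def)
  thus False using odd by fastforce
qed

text \<open>By symmetry all pairwise sums of exponents are \<open>r\<close> modulo 4, and so are
  \<open>2 * i\<close>, \<open>2 * j\<close>, \<open>2 * k\<close>. If \<open>r\<close> were not 0
  modulo 4, all exponents would be odd, which is excluded.\<close>

lemma L'_exponents:
  assumes L: "is_L' p L" and c: "coeff3 L i j k \<noteq> 0"
  shows "even i" "even j" "even k" "[i + j = 0] (mod 4)" "[j + k = 0] (mod 4)"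
proof -
  obtain r where r: "\<And>i j k. coeff3 L i j k \<noteq> 0 \<Longrightarrow> [i + k = r] (mod 4)" using L'_support_residue[OF L] by blast
  have s: "[i + k = r] (mod 4)" "[j + k = r] (mod 4)" "[i + j = r] (mod 4)" if "coeff3 L i j k \<noteq> 0" for i j k
    using r[OF that] r[of j i k] r[of i k j] that L'_symmetric[OF L] by blast+
  have e: "[2 * i = r] (mod 4)" if c: "coeff3 L i j k \<noteq> 0" for i j k
  proof -
    have "[(i + k) + (i + j) = r + (j + k)] (mod 4)"
      by (intro cong_add s(1)[OF c] cong_trans[OF s(3)[OF c] cong_sym[OF s(2)[OF c]]])
    hence "[2 * i + (j + k) = r + (j + k)] (mod 4)" by (simp add: mult_2 add_ac)
    thus ?thesis by (simp only: cong_add_rcancel_nat)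
  qed
  have e': "[2 * i = r] (mod 4)" "[2 * j = r] (mod 4)" "[2 * k = r] (mod 4)" if "coeff3 L i j k \<noteq> 0" for i j k
    using that e[of i j k] e[of j i k] e[of k i j] L'_symmetric[OF L] by blast+
  have irr: "irreducible L" using L by (simp add: is_L'_def)
  have r0: "[r = 0] (mod 4)"
  proof (rule ccontr)
    assume nr: "\<not> [r = 0] (mod 4)"
    have o: "odd i" if "[2 * i = r] (mod 4)" for i
    proof
      assume "even i"
      hence "[2 * i = 0] (mod 4)" by (auto simp: cong_0_iff elim!: evenE)
      thus False using nr cong_trans[OF cong_sym[OF that]] by blast
    qed
    have "odd i \<and> odd k" if "coeff3 L i j k \<noteq> 0" for i j k using o e'[OF that] by blast
    thus False using L'_not_all_odd[OF irr] by blast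
  qed
  have o: "even i" if "[2 * i = r] (mod 4)" for i
  proof -
    have "4 dvd 2 * i" using cong_trans[OF that r0] by (simp only: cong_0_iff)
    thus ?thesis by presburger
  qed
  show "even i" "even j" "even k" using o e'[OF c] by blast+
  show "[i + j = 0] (mod 4)" "[j + k = 0] (mod 4)" using cong_trans[OF _ r0] s[OF c] by blast+
qed

end

section \<open>Exponents of the numerators\<close>

text \<open>If it vanished identically, the homogenised constant polynomial 1 would be a
  relation.\<close>

lemma gth_00_nonzero: "\<exists>X\<in>siegel2. gth X 0 0 \<noteq> 0"
proof (rule ccontr)
  assume "\<not> ?thesis"
  hence z: "gth \<Omega> 0 0 = 0" if "\<Omega> \<in> siegel2" for \<Omega> using that by blast
  have "(if (0::nat) = 0 \<and> (0::nat) = 0 \<and> (0::nat) = 0 then 1 else 0) = (0::complex)"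
    by (rule theta_alg_independent[where n = 1 and f = "\<lambda>i j k. if i = 0 \<and> j = 0 \<and> k = 0 then 1 else 0"])
      (simp_all add: z)
  thus False by simp
qed

lemma bprime_sum_homogeneous:
  assumes O: "\<Omega> \<in> siegel2" and g: "gth \<Omega> 0 0 \<noteq> 0"
  shows "(\<Sum>i\<le>n. \<Sum>j\<le>n. \<Sum>k\<le>n. f i j k * b' 1 \<Omega> ^ i * b' 2 \<Omega> ^ j * b' 3 \<Omega> ^ k) * gth \<Omega> 0 0 ^ (3 * n) =
    (\<Sum>i\<le>n. \<Sum>j\<le>n. \<Sum>k\<le>n. f i j k * gth \<Omega> 1 0 ^ i * gth \<Omega> 0 1 ^ j * gth \<Omega> 1 1 ^ k * gth \<Omega> 0 0 ^ (3 * n - (i + j + k)))"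
  unfolding sum_distrib_right
proof (intro sum.cong refl)
  fix i j k assume "i \<in> {..n}" "j \<in> {..n}" "k \<in> {..n}"
  hence e: "gth \<Omega> 0 0 ^ (3 * n) = gth \<Omega> 0 0 ^ i * gth \<Omega> 0 0 ^ j * gth \<Omega> 0 0 ^ k * gth \<Omega> 0 0 ^ (3 * n - (i + j + k))"
    unfolding power_add[symmetric] by simp
  have b: "gth \<Omega> 1 0 ^ i = b' 1 \<Omega> ^ i * gth \<Omega> 0 0 ^ i" "gth \<Omega> 0 1 ^ j = b' 2 \<Omega> ^ j * gth \<Omega> 0 0 ^ j"
    "gth \<Omega> 1 1 ^ k = b' 3 \<Omega> ^ k * gth \<Omega> 0 0 ^ k"
    using g by (simp_all add: bprime_eq[OF O] power_divide)
  show "f i j k * b' 1 \<Omega> ^ i * b' 2 \<Omega> ^ j * b' 3 \<Omega> ^ k * gth \<Omega> 0 0 ^ (3 * n) =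
     f i j k * gth \<Omega> 1 0 ^ i * gth \<Omega> 0 1 ^ j * gth \<Omega> 1 1 ^ k * gth \<Omega> 0 0 ^ (3 * n - (i + j + k))"
    unfolding e b by (simp only: mult_ac)
qed

text \<open>The excluded points are the zeros of a finite product of functions, none identically
  zero. Multiplied by this product the homogenised sum vanishes everywhere, so the sum itself does,
  and algebraic independence applies.\<close>

lemma bprime_generically_independent:
  assumes R: "finite R" "R \<subseteq> Sp4Z" and p: "p > 0" and L: "L \<noteq> 0"
    and zero: "\<And>\<Omega>. \<Omega> \<in> regular_points p R \<Longrightarrow> eval_b' L \<Omega> \<noteq> 0 \<Longrightarrow>
      (\<Sum>i\<le>n. \<Sum>j\<le>n. \<Sum>k\<le>n. f i j k * b' 1 \<Omega> ^ i * b' 2 \<Omega> ^ j * b' 3 \<Omega> ^ k) = 0"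
    and ijk: "i \<le> n" "j \<le> n" "k \<le> n"
  shows "f i j k = 0"
proof -
  define S where "S n f \<Omega> = (\<Sum>i\<le>n. \<Sum>j\<le>n. \<Sum>k\<le>n. f i j k * gth \<Omega> 1 0 ^ i * gth \<Omega> 0 1 ^ j * gth \<Omega> 1 1 ^ k * gth \<Omega> 0 0 ^ (3 * n - (i + j + k)))"
    for n f \<Omega>
  have S_holo: "line_holo (S n f)" for n f
    unfolding S_def by (intro line_holo_sum line_holo_mult line_holo_power line_holo_const line_holo_gth)
  obtain d where d: "\<And>i j k. coeff3 L i j k \<noteq> 0 \<Longrightarrow> i \<le> d \<and> j \<le> d \<and> k \<le> d" using poly3_bound by metis
  define H where "H = S d (\<lambda>i j k. of_rat (coeff3 L i j k))"
  define G where "G \<gamma> \<Omega> = gth (real p *\<^sub>R act \<gamma> \<Omega>) 0 0" for \<gamma> \<Omega>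
  define I where "I = insert H (insert (\<lambda>\<Omega>. gth \<Omega> 0 0) (G ` R))"
  have ps: "real p *\<^sub>R act \<gamma> \<Omega> \<in> siegel2" if "\<gamma> \<in> R" "\<Omega> \<in> siegel2" for \<gamma> \<Omega>
    by (rule scaleR_siegel2) (use p R that act_siegel2 in auto)
  obtain X where X: "X \<in> siegel2" "gth X 0 0 \<noteq> 0" using gth_00_nonzero by blast
  have fin: "finite I" using R by (simp add: I_def)
  have "G \<gamma> = (\<lambda>\<Omega>. (\<lambda>\<Omega>. (\<lambda>\<Omega>. gth \<Omega> 0 0) (real p *\<^sub>R \<Omega>)) (act \<gamma> \<Omega>))" for \<gamma> by (simp add: G_def fun_eq_iff)
  hence G_holo: "line_holo (G \<gamma>)" if "\<gamma> \<in> R" for \<gamma>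
    using line_holo_act[OF _ line_holo_scaleR[OF _ line_holo_gth]] R p that by (simp add: subset_iff)
  have holo: "line_holo F" if "F \<in> I" for F
    using that G_holo S_holo line_holo_gth by (auto simp: I_def H_def)
  have ne: "\<exists>X\<in>siegel2. F X \<noteq> 0" if F: "F \<in> I" for F
  proof -
    consider "F = H" | "F = (\<lambda>\<Omega>. gth \<Omega> 0 0)" | \<gamma> where "\<gamma> \<in> R" "F = G \<gamma>" using F unfolding I_def by blast
    thus ?thesis
    proof cases
      case 1
      show ?thesis
      proof (rule ccontr)
        assume "\<not> ?thesis"
        hence z: "\<And>\<Omega>. \<Omega> \<in> siegel2 \<Longrightarrow> S d (\<lambda>i j k. of_rat (coeff3 L i j k)) \<Omega> = 0" by (auto simp: 1 H_def)
        have "complex_of_rat (coeff3 L i j k) = 0" if "i \<le> d" "j \<le> d" "k \<le> d" for i j k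
          by (rule theta_alg_independent[where n = d and f = "\<lambda>i j k. of_rat (coeff3 L i j k)", OF z[unfolded S_def] that])
        hence "coeff3 L i j k = 0" for i j k using d[of i j k] by (cases "i \<le> d \<and> j \<le> d \<and> k \<le> d") auto
        thus False using L poly3_eqI[of L 0] by (simp add: coeff3_def)
      qed
    next
      case 2 thus ?thesis using X by blast
    next
      case 3
      have g: "\<gamma> \<in> Sp4Z" using 3 R by blast
      have pX: "(1 / real p) *\<^sub>R X \<in> siegel2" by (rule scaleR_siegel2[OF _ X(1)]) (use p in simp)
      \<comment> \<open>Chosen so that its transform by \<open>\<gamma>\<close>, multiplied by
        \<open>p\<close>, is the point \<open>X\<close> at which the theta constant is
        nonzero.\<close>
      define Y where "Y = act (spinv \<gamma>) ((1 / real p) *\<^sub>R X)"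
      have Y: "Y \<in> siegel2" unfolding Y_def by (rule act_siegel2[OF Sp4Z_inverse(1)[OF g] pX])
      have "act \<gamma> Y = (1 / real p) *\<^sub>R X"
        unfolding Y_def using act_mult[OF g Sp4Z_inverse(1)[OF g] pX] Sp4Z_inverse(3)[OF g] by (simp add: act_one)
      hence "F Y = gth X 0 0" using p 3 by (simp add: G_def)
      thus ?thesis using X(2) Y by (intro bexI[of _ Y]) simp_all
    qed
  qed
  define E where "E \<Omega> = (\<Prod>F\<in>I. F \<Omega>)" for \<Omega>
  obtain X0 where X0: "X0 \<in> siegel2" "E X0 \<noteq> 0" using line_holo_prod_nonzero[of I "\<lambda>F. F", OF fin holo ne] by (auto simp: E_def)
  have E_holo: "line_holo E" unfolding E_def by (rule line_holo_prod) (rule holo)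
  have EG: "E \<Omega> * S n f \<Omega> = 0" if O: "\<Omega> \<in> siegel2" for \<Omega>
  proof (cases "E \<Omega> = 0")
    case False
    hence nz: "F \<Omega> \<noteq> 0" if "F \<in> I" for F using that fin by (auto simp: E_def)
    have g0: "gth \<Omega> 0 0 \<noteq> 0" using nz[of "\<lambda>\<Omega>. gth \<Omega> 0 0"] by (simp add: I_def)
    have "G \<gamma> \<Omega> \<noteq> 0" if "\<gamma> \<in> R" for \<gamma> using nz[of "G \<gamma>"] that by (simp add: I_def)
    hence reg: "\<Omega> \<in> regular_points p R" unfolding regular_points_def G_def
      using O g0 theta_half[OF O, of 0] theta_half[OF ps[OF _ O], of _ 0] by simp
    have "eval_b' L \<Omega> * gth \<Omega> 0 0 ^ (3 * d) = H \<Omega>"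
    proof -
      have ex: "eval_b' L \<Omega> = (\<Sum>i\<le>d. \<Sum>j\<le>d. \<Sum>k\<le>d. of_rat (coeff3 L i j k) * b' 1 \<Omega> ^ i * b' 2 \<Omega> ^ j * b' 3 \<Omega> ^ k)"
        unfolding eval_b'_def by (rule eval3_expand) (rule d)
      show ?thesis unfolding ex H_def S_def by (rule bprime_sum_homogeneous[OF O g0])
    qed
    moreover have "H \<Omega> \<noteq> 0" using nz by (simp add: I_def)
    ultimately have "eval_b' L \<Omega> \<noteq> 0" by auto
    from zero[OF reg this] have "S n f \<Omega> = 0" unfolding S_def using bprime_sum_homogeneous[OF O g0, where n = n and f = f] by simp
    thus ?thesis by simp
  qed simp
  have "S n f \<Omega> = 0" if "\<Omega> \<in> siegel2" for \<Omega>
    by (rule line_holo_mult_eq_0[OF E_holo S_holo EG X0 that])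
  from theta_alg_independent[OF this[unfolded S_def] ijk] show ?thesis .
qed

lemma eval_b'_low:
  assumes n: "\<And>i j k. coeff3 P i j k \<noteq> 0 \<Longrightarrow> i \<le> n \<and> j \<le> n \<and> k \<le> n" and O: "\<Omega> \<in> siegel2"
  shows "eval_b' P (act (low x y z) \<Omega>) = (\<Sum>i\<le>n. \<Sum>j\<le>n. \<Sum>k\<le>n.
    of_rat (coeff3 P i j k) * ip (- (x * int i + z * int j + (x + 2 * y + z) * int k)) * b' 1 \<Omega> ^ i * b' 2 \<Omega> ^ j * b' 3 \<Omega> ^ k)"
proof -
  have ex: "eval_b' P (act (low x y z) \<Omega>) = (\<Sum>i\<le>n. \<Sum>j\<le>n. \<Sum>k\<le>n. of_rat (coeff3 P i j k) * b' 1 (act (low x y z) \<Omega>) ^ i *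
    b' 2 (act (low x y z) \<Omega>) ^ j * b' 3 (act (low x y z) \<Omega>) ^ k)"
    unfolding eval_b'_def by (rule eval3_expand) (rule n)
  show ?thesis unfolding ex bprime_low[OF O]
  proof (intro sum.cong refl)
    fix i j k
    have "- (x * int i + z * int j + (x + 2 * y + z) * int k) = - x * int i + - z * int j + - (x + 2 * y + z) * int k" by (simp add: algebra_simps)
    thus "of_rat (coeff3 P i j k) * (ip (- x) * b' 1 \<Omega>) ^ i * (ip (- z) * b' 2 \<Omega>) ^ j * (ip (- (x + 2 * y + z)) * b' 3 \<Omega>) ^ k =
      of_rat (coeff3 P i j k) * ip (- (x * int i + z * int j + (x + 2 * y + z) * int k)) * b' 1 \<Omega> ^ i * b' 2 \<Omega> ^ j * b' 3 \<Omega> ^ k"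
      by (simp only: ip_add ip_power power_mult_distrib mult_ac)
  qed
qed

text \<open>Scaling the roots by \<open>u\<close> means substituting \<open>X / u\<close> and
  multiplying by \<open>u\<close> to the degree.\<close>

lemma prod_scaled_linear:
  fixes u :: complex
  assumes "u \<noteq> 0"
  shows "coeff (\<Prod>\<gamma>\<in>S. [:- (u * a \<gamma>), 1:]) l = u ^ card S * inverse u ^ l * coeff (\<Prod>\<gamma>\<in>S. [:- a \<gamma>, 1:]) l"
proof -
  have "[:- (u * a \<gamma>), 1:] = smult u (pcompose [:- a \<gamma>, 1:] [:0, inverse u:])" for \<gamma>
    using assms by (simp add: pcompose_pCons)
  hence "(\<Prod>\<gamma>\<in>S. [:- (u * a \<gamma>), 1:]) = smult (u ^ card S) (pcompose (\<Prod>\<gamma>\<in>S. [:- a \<gamma>, 1:]) [:0, inverse u:])"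
    by (simp add: prod_smult pcompose_prod)
  thus ?thesis by (simp add: coeff_pcompose_linear)
qed

context odd_prime
begin

text \<open>\<open>g\<close> may lie outside \<open>Gamma24\<close>, but it normalises the
  intersection of \<open>Gamma24\<close> with \<open>Gamma0 p\<close>, so conjugation by it permutes
  the cosets.\<close>

lemma coset_permutation:
  assumes R: "is_coset_reps p R" and g: "g \<in> Gamma0 p"
  obtains \<pi> where "bij_betw \<pi> R R" "\<And>\<gamma>. \<gamma> \<in> R \<Longrightarrow> \<exists>\<delta>\<in>Gamma24 \<inter> Gamma0 p. \<gamma> ** g = g ** (\<delta> ** \<pi> \<gamma>)"
proof -
  have gS: "g \<in> Sp4Z" using g Gamma0_Sp4Z by blast
  have ig: "spinv g \<in> Sp4Z" by (rule Sp4Z_inverse(1)[OF gS])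
  have R24: "\<gamma> \<in> Gamma24" if "\<gamma> \<in> R" for \<gamma> using that R by (auto simp: is_coset_reps_def)
  have uniq: "\<gamma> = \<gamma>'" if "\<gamma> \<in> R" "\<gamma>' \<in> R" "\<gamma> = h ** \<gamma>'" "h \<in> Gamma24 \<inter> Gamma0 p" for \<gamma> \<gamma>' h
  proof -
    have "mat 1 \<in> Gamma24 \<inter> Gamma0 p" using Gamma24_one one_Sp4Z by (simp add: mat_1_m4 Gamma0_m4)
    hence "\<gamma> \<in> (\<lambda>g. g ** \<gamma>) ` (Gamma24 \<inter> Gamma0 p)" by (rule rev_image_eqI) simp
    moreover have "\<gamma> \<in> (\<lambda>g. g ** \<gamma>') ` (Gamma24 \<inter> Gamma0 p)" using that by blast
    moreover have "\<exists>!\<rho>. \<rho> \<in> R \<and> \<gamma> \<in> (\<lambda>g. g ** \<rho>) ` (Gamma24 \<inter> Gamma0 p)" using R R24[OF that(1)] by (simp add: is_coset_reps_def)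
    ultimately show ?thesis using that(1,2) by blast
  qed
  have "\<exists>\<rho>. \<rho> \<in> R \<and> (\<exists>\<delta>\<in>Gamma24 \<inter> Gamma0 p. spinv g ** \<gamma> ** g = \<delta> ** \<rho>)" if "\<gamma> \<in> R" for \<gamma>
  proof -
    have "spinv g ** \<gamma> ** g \<in> Gamma24" using Gamma24_conj[OF ig R24[OF that]] by (simp add: spinv_spinv)
    hence "\<exists>!\<rho>. \<rho> \<in> R \<and> spinv g ** \<gamma> ** g \<in> (\<lambda>h. h ** \<rho>) ` (Gamma24 \<inter> Gamma0 p)" using R by (simp add: is_coset_reps_def)
    thus ?thesis by blast
  qed
  then obtain \<pi> where \<pi>: "\<And>\<gamma>. \<gamma> \<in> R \<Longrightarrow> \<pi> \<gamma> \<in> R \<and> (\<exists>\<delta>\<in>Gamma24 \<inter> Gamma0 p. spinv g ** \<gamma> ** g = \<delta> ** \<pi> \<gamma>)" by metis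
  have cancel: "g ** (spinv g ** M) = M" "spinv g ** (g ** M) = M" for M
    using Sp4Z_inverse(2,3)[OF gS] by (simp_all add: matrix_mul_assoc)
  have "inj_on \<pi> R"
  proof (rule inj_onI)
    fix \<gamma> \<gamma>' assume G: "\<gamma> \<in> R" "\<gamma>' \<in> R" and e: "\<pi> \<gamma> = \<pi> \<gamma>'"
    obtain \<delta> where \<delta>: "\<delta> \<in> Gamma24 \<inter> Gamma0 p" "spinv g ** \<gamma> ** g = \<delta> ** \<pi> \<gamma>" using \<pi>[OF G(1)] by blast
    obtain \<delta>' where \<delta>': "\<delta>' \<in> Gamma24 \<inter> Gamma0 p" "spinv g ** \<gamma>' ** g = \<delta>' ** \<pi> \<gamma>" using \<pi>[OF G(2)] e by auto
    have \<delta>'S: "\<delta>' \<in> Sp4Z" using \<delta>' Gamma0_Sp4Z by blast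
    define h where "h = g ** (\<delta> ** spinv \<delta>') ** spinv g"
    have h: "h \<in> Gamma24 \<inter> Gamma0 p" unfolding h_def using \<delta> \<delta>' g gS
      by (intro IntI Gamma24_conj Gamma24_mult Gamma24_spinv Gamma0_mult Gamma0_spinv) auto
    have "spinv g ** \<gamma>' = \<delta>' ** (\<pi> \<gamma> ** spinv g)"
      using arg_cong[OF \<delta>'(2), of "\<lambda>M. M ** spinv g"] Sp4Z_inverse(3)[OF gS] by (simp add: matrix_mul_assoc[symmetric])
    hence "h ** \<gamma>' = g ** (\<delta> ** (spinv \<delta>' ** (\<delta>' ** (\<pi> \<gamma> ** spinv g))))" unfolding h_def by (simp add: matrix_mul_assoc[symmetric])
    also have "spinv \<delta>' ** (\<delta>' ** (\<pi> \<gamma> ** spinv g)) = \<pi> \<gamma> ** spinv g" using Sp4Z_inverse(2)[OF \<delta>'S] by (simp add: matrix_mul_assoc)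
    also have "\<delta> ** (\<pi> \<gamma> ** spinv g) = spinv g ** (\<gamma> ** (g ** spinv g))" using \<delta>(2) by (simp add: matrix_mul_assoc)
    finally have "\<gamma> = h ** \<gamma>'" using Sp4Z_inverse(3)[OF gS] by (simp add: cancel)
    thus "\<gamma> = \<gamma>'" using uniq[OF G _ h] by blast
  qed
  moreover have "\<pi> ` R = R"
    by (rule card_subset_eq[OF coset_reps_card(1)[OF R]]) (use \<pi> calculation in \<open>auto simp: card_image\<close>)
  ultimately have "bij_betw \<pi> R R" by (simp add: bij_betw_def)
  moreover have "\<exists>\<delta>\<in>Gamma24 \<inter> Gamma0 p. \<gamma> ** g = g ** (\<delta> ** \<pi> \<gamma>)" if G: "\<gamma> \<in> R" for \<gamma>
  proof -
    obtain \<delta> where \<delta>: "\<delta> \<in> Gamma24 \<inter> Gamma0 p" "spinv g ** \<gamma> ** g = \<delta> ** \<pi> \<gamma>" using \<pi>[OF G] by blast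
    have "g ** (\<delta> ** \<pi> \<gamma>) = \<gamma> ** g" unfolding \<delta>(2)[symmetric] using cancel(1)[of "\<gamma> ** g"] by (simp add: matrix_mul_assoc[symmetric])
    thus ?thesis by (intro bexI[OF _ \<delta>(1)]) (rule sym)
  qed
  ultimately show ?thesis by (rule that)
qed

text \<open>The factor \<open>p\<close> puts the matrix into \<open>Gamma0 p\<close> and makes it
  act as \<open>low x y z\<close> after multiplication of the argument by \<open>p\<close>.\<close>

definition lowp where "lowp x y z = low (int p * x) (int p * y) (int p * z)"

lemma lowp_Gamma0: "lowp x y z \<in> Gamma0 p"
  using low_Sp4Z[of "int p * x" "int p * y" "int p * z"] unfolding lowp_def low_def Gamma0_m4 by simp

lemma lowp_Sp4Z: "lowp x y z \<in> Sp4Z" unfolding lowp_def by (rule low_Sp4Z)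

text \<open>In \<open>\<gamma> g = g \<delta> (\<pi> \<gamma>)\<close>, multiplication by
  \<open>p\<close> turns \<open>g\<close> into \<open>low x y z\<close> and \<open>\<delta>\<close>
  into an element of \<open>Gamma24\<close>, under which the \<open>b' r\<close> are invariant; only
  the phase of \<open>low\<close> remains.\<close>

lemma twist_lowp:
  assumes R: "is_coset_reps p R"
  obtains \<pi> where "bij_betw \<pi> R R"
    "\<And>\<gamma> \<Omega>. \<gamma> \<in> R \<Longrightarrow> \<Omega> \<in> siegel2 \<Longrightarrow> twist p \<gamma> (b' 1) (act (lowp x y z) \<Omega>) = ip (- x) * twist p (\<pi> \<gamma>) (b' 1) \<Omega>"
    "\<And>\<gamma> \<Omega>. \<gamma> \<in> R \<Longrightarrow> \<Omega> \<in> siegel2 \<Longrightarrow> twist p \<gamma> (b' 2) (act (lowp x y z) \<Omega>) = ip (- z) * twist p (\<pi> \<gamma>) (b' 2) \<Omega>"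
    "\<And>\<gamma> \<Omega>. \<gamma> \<in> R \<Longrightarrow> \<Omega> \<in> siegel2 \<Longrightarrow> theta 0 ((real p *\<^sub>R act \<gamma> (act (lowp x y z) \<Omega>)) /\<^sub>R 2) = 0 \<longleftrightarrow> theta 0 ((real p *\<^sub>R act (\<pi> \<gamma>) \<Omega>) /\<^sub>R 2) = 0"
proof -
  let ?g = "lowp x y z"
  obtain \<pi> where \<pi>: "bij_betw \<pi> R R" "\<And>\<gamma>. \<gamma> \<in> R \<Longrightarrow> \<exists>\<delta>\<in>Gamma24 \<inter> Gamma0 p. \<gamma> ** ?g = ?g ** (\<delta> ** \<pi> \<gamma>)"
    using coset_permutation[OF R lowp_Gamma0] by blast
  have RS: "\<gamma> \<in> Sp4Z" if "\<gamma> \<in> R" for \<gamma> using that R Gamma24_Sp4Z by (auto simp: is_coset_reps_def)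
  have key: "\<exists>N\<in>Gamma24. real p *\<^sub>R act \<gamma> (act ?g \<Omega>) = act (low x y z) (act N (real p *\<^sub>R act (\<pi> \<gamma>) \<Omega>))"
    if G: "\<gamma> \<in> R" and O: "\<Omega> \<in> siegel2" for \<gamma> \<Omega>
  proof -
    obtain \<delta> where \<delta>: "\<delta> \<in> Gamma24 \<inter> Gamma0 p" "\<gamma> ** ?g = ?g ** (\<delta> ** \<pi> \<gamma>)" using \<pi>(2)[OF G] by blast
    obtain N where N: "N \<in> Gamma24" "\<And>\<Omega>. \<Omega> \<in> siegel2 \<Longrightarrow> real p *\<^sub>R act \<delta> \<Omega> = act N (real p *\<^sub>R \<Omega>)"
      using Gamma0_scale[OF \<delta>(1) odd_p] by blast
    have \<delta>S: "\<delta> \<in> Sp4Z" using \<delta>(1) Gamma0_Sp4Z by blast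
    have \<pi>S: "\<pi> \<gamma> \<in> Sp4Z" using \<pi>(1) G by (intro RS) (auto simp: bij_betw_def)
    have X: "act (\<pi> \<gamma>) \<Omega> \<in> siegel2" by (rule act_siegel2[OF \<pi>S O])
    have Y: "act \<delta> (act (\<pi> \<gamma>) \<Omega>) \<in> siegel2" by (rule act_siegel2[OF \<delta>S X])
    have "act \<gamma> (act ?g \<Omega>) = act (?g ** (\<delta> ** \<pi> \<gamma>)) \<Omega>" unfolding \<delta>(2)[symmetric] by (rule act_mult[OF RS[OF G] lowp_Sp4Z O, symmetric])
    also have "\<dots> = act ?g (act (\<delta> ** \<pi> \<gamma>) \<Omega>)" by (rule act_mult[OF lowp_Sp4Z Sp4Z_mult[OF \<delta>S \<pi>S] O])
    also have "act (\<delta> ** \<pi> \<gamma>) \<Omega> = act \<delta> (act (\<pi> \<gamma>) \<Omega>)" by (rule act_mult[OF \<delta>S \<pi>S O])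
    finally have "real p *\<^sub>R act \<gamma> (act ?g \<Omega>) = act (low x y z) (act N (real p *\<^sub>R act (\<pi> \<gamma>) \<Omega>))"
      using scale_low[OF Y p_pos] N(2)[OF X] by (simp add: lowp_def)
    thus ?thesis using N(1) by blast
  qed
  show ?thesis
  proof (rule that[OF \<pi>(1)])
    fix \<gamma> \<Omega> assume G: "\<gamma> \<in> R" and O: "\<Omega> \<in> siegel2"
    obtain N where N: "N \<in> Gamma24" and e: "real p *\<^sub>R act \<gamma> (act ?g \<Omega>) = act (low x y z) (act N (real p *\<^sub>R act (\<pi> \<gamma>) \<Omega>))"
      using key[OF G O] by blast
    have \<pi>S: "\<pi> \<gamma> \<in> Sp4Z" using \<pi>(1) G by (intro RS) (auto simp: bij_betw_def)
    have X: "real p *\<^sub>R act (\<pi> \<gamma>) \<Omega> \<in> siegel2" by (rule scaleR_siegel2[OF _ act_siegel2[OF \<pi>S O]]) (use p_pos in simp)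
    have Y: "act N (real p *\<^sub>R act (\<pi> \<gamma>) \<Omega>) \<in> siegel2" by (rule act_siegel2[OF Gamma24_Sp4Z[OF N] X])
    show "twist p \<gamma> (b' 1) (act ?g \<Omega>) = ip (- x) * twist p (\<pi> \<gamma>) (b' 1) \<Omega>"
      "twist p \<gamma> (b' 2) (act ?g \<Omega>) = ip (- z) * twist p (\<pi> \<gamma>) (b' 2) \<Omega>"
      unfolding twist_def e bprime_low[OF Y] bprime_Gamma24[OF N X] by simp_all
    show "theta 0 ((real p *\<^sub>R act \<gamma> (act ?g \<Omega>)) /\<^sub>R 2) = 0 \<longleftrightarrow> theta 0 ((real p *\<^sub>R act (\<pi> \<gamma>) \<Omega>) /\<^sub>R 2) = 0"
      unfolding e bprime_low(4)[OF Y] bprime_Gamma24(2)[OF N X] ..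
  qed
qed

text \<open>All roots are multiplied by \<open>ip (- x)\<close>. The coefficient at \<open>l\<close>
  has degree \<open>card R - l\<close> in the roots, and 4 divides \<open>card R\<close>. In
  \<open>Psi\<close> one root fewer enters and the factor \<open>b' 2\<close> brings
  \<open>ip (- z)\<close>, whence the extra \<open>x - z\<close>.\<close>

lemma modular_poly_lowp:
  assumes R: "is_coset_reps p R" and m: "m \<in> {1, 2}" and O: "\<Omega> \<in> regular_points p R"
  shows "act (lowp x y z) \<Omega> \<in> regular_points p R"
    "coeff (modular_poly m p R (act (lowp x y z) \<Omega>)) l = ip (int l * x + (int m - 1) * (x - z)) * coeff (modular_poly m p R \<Omega>) l"
proof -
  let ?g = "lowp x y z"
  have S: "\<Omega> \<in> siegel2" using O by (simp add: regular_points_def)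
  obtain \<pi> where \<pi>: "bij_betw \<pi> R R"
    "\<And>\<gamma> \<Omega>. \<gamma> \<in> R \<Longrightarrow> \<Omega> \<in> siegel2 \<Longrightarrow> twist p \<gamma> (b' 1) (act ?g \<Omega>) = ip (- x) * twist p (\<pi> \<gamma>) (b' 1) \<Omega>"
    "\<And>\<gamma> \<Omega>. \<gamma> \<in> R \<Longrightarrow> \<Omega> \<in> siegel2 \<Longrightarrow> twist p \<gamma> (b' 2) (act ?g \<Omega>) = ip (- z) * twist p (\<pi> \<gamma>) (b' 2) \<Omega>"
    "\<And>\<gamma> \<Omega>. \<gamma> \<in> R \<Longrightarrow> \<Omega> \<in> siegel2 \<Longrightarrow> theta 0 ((real p *\<^sub>R act \<gamma> (act ?g \<Omega>)) /\<^sub>R 2) = 0 \<longleftrightarrow> theta 0 ((real p *\<^sub>R act (\<pi> \<gamma>) \<Omega>) /\<^sub>R 2) = 0"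
    using twist_lowp[OF R] by blast
  have \<pi>R: "\<pi> \<gamma> \<in> R" if "\<gamma> \<in> R" for \<gamma> using \<pi>(1) that by (auto simp: bij_betw_def)
  have "theta 0 (act ?g \<Omega> /\<^sub>R 2) \<noteq> 0"
    using O bprime_low(4)[OF S] unfolding lowp_def regular_points_def by blast
  thus "act ?g \<Omega> \<in> regular_points p R"
    using O \<pi>(4)[OF _ S] \<pi>R act_siegel2[OF lowp_Sp4Z S] by (auto simp: regular_points_def)
  define a where "a \<gamma> = twist p \<gamma> (b' 1) \<Omega>" for \<gamma>
  define c where "c \<gamma> = twist p \<gamma> (b' 2) \<Omega>" for \<gamma>
  note fin = coset_reps_card(1)[OF R]
  have u0: "ip (- x) \<noteq> 0" by simp
  have ui: "inverse (ip (- x)) ^ l = ip (int l * x)" by (simp add: ip_minus ip_power mult.commute)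
  have un: "ip (- x) ^ card R = 1"
  proof -
    obtain k where "card R = 4 * k" using coset_reps_card(2)[OF R] by blast
    thus ?thesis using ip_4[of "- x * int k"] by (simp add: ip_power mult_ac)
  qed
  show "coeff (modular_poly m p R (act ?g \<Omega>)) l = ip (int l * x + (int m - 1) * (x - z)) * coeff (modular_poly m p R \<Omega>) l"
  proof (cases "m = 1")
    case True
    have "Phi1 p R (act ?g \<Omega>) = (\<Prod>\<gamma>\<in>R. [:- (ip (- x) * a (\<pi> \<gamma>)), 1:])"
      unfolding Phi1_def a_def by (intro prod.cong refl) (simp only: \<pi>(2)[OF _ S])
    also have "\<dots> = (\<Prod>\<gamma>\<in>R. [:- (ip (- x) * a \<gamma>), 1:])" by (rule prod.reindex_bij_betw[OF \<pi>(1)])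
    finally have "coeff (Phi1 p R (act ?g \<Omega>)) l = ip (int l * x) * coeff (Phi1 p R \<Omega>) l"
      by (simp only: prod_scaled_linear[OF u0] un ui mult_1_left) (simp add: Phi1_def a_def)
    thus ?thesis using True by (simp add: modular_poly_def)
  next
    case False
    hence m2: "m = 2" using m by simp
    have br: "bij_betw \<pi> (R - {\<gamma>}) (R - {\<pi> \<gamma>})" if "\<gamma> \<in> R" for \<gamma>
      using bij_betw_DiffI[OF \<pi>(1), of "{\<gamma>}" "{\<pi> \<gamma>}"] that \<pi>R by simp
    have "Psi 2 p R (act ?g \<Omega>) = (\<Sum>\<gamma>\<in>R. smult (ip (- z) * c (\<pi> \<gamma>)) (\<Prod>\<gamma>'\<in>R - {\<pi> \<gamma>}. [:- (ip (- x) * a \<gamma>'), 1:]))"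
      unfolding Psi_def
    proof (intro sum.cong refl)
      fix \<gamma> assume G: "\<gamma> \<in> R"
      have "(\<Prod>\<gamma>'\<in>R - {\<gamma>}. [:- twist p \<gamma>' (b' 1) (act ?g \<Omega>), 1:]) = (\<Prod>\<gamma>'\<in>R - {\<gamma>}. [:- (ip (- x) * a (\<pi> \<gamma>')), 1:])"
        unfolding a_def by (intro prod.cong refl) (simp only: \<pi>(2)[OF _ S] Diff_iff)
      also have "\<dots> = (\<Prod>\<gamma>'\<in>R - {\<pi> \<gamma>}. [:- (ip (- x) * a \<gamma>'), 1:])" by (rule prod.reindex_bij_betw[OF br[OF G]])
      finally show "smult (twist p \<gamma> (b' 2) (act ?g \<Omega>)) (\<Prod>\<gamma>'\<in>R - {\<gamma>}. [:- twist p \<gamma>' (b' 1) (act ?g \<Omega>), 1:]) =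
        smult (ip (- z) * c (\<pi> \<gamma>)) (\<Prod>\<gamma>'\<in>R - {\<pi> \<gamma>}. [:- (ip (- x) * a \<gamma>'), 1:])"
        by (simp only: \<pi>(3)[OF G S] c_def)
    qed
    also have "\<dots> = (\<Sum>\<gamma>\<in>R. smult (ip (- z) * c \<gamma>) (\<Prod>\<gamma>'\<in>R - {\<gamma>}. [:- (ip (- x) * a \<gamma>'), 1:]))"
      by (rule sum.reindex_bij_betw[OF \<pi>(1)])
    finally have "coeff (Psi 2 p R (act ?g \<Omega>)) l =
      (\<Sum>\<gamma>\<in>R. ip (- z) * c \<gamma> * (ip (- x) ^ card (R - {\<gamma>}) * ip (int l * x) * coeff (\<Prod>\<gamma>'\<in>R - {\<gamma>}. [:- a \<gamma>', 1:]) l))"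
      by (simp only: coeff_sum coeff_smult prod_scaled_linear[OF u0] ui)
    also have "\<dots> = (\<Sum>\<gamma>\<in>R. ip (int l * x + (x - z)) * (c \<gamma> * coeff (\<Prod>\<gamma>'\<in>R - {\<gamma>}. [:- a \<gamma>', 1:]) l))"
    proof (intro sum.cong refl)
      fix \<gamma> assume G: "\<gamma> \<in> R"
      have "ip (- x) * ip (- x) ^ card (R - {\<gamma>}) = 1"
        using un unfolding card.remove[OF fin(1) G] power_Suc .
      hence "ip x * (ip (- x) * ip (- x) ^ card (R - {\<gamma>})) = ip x" by simp
      moreover have "ip x * ip (- x) = 1" unfolding ip_add[symmetric] by simp
      ultimately have "ip (- x) ^ card (R - {\<gamma>}) = ip x" unfolding mult.assoc[symmetric] by simp
      moreover have "ip (int l * x + (x - z)) = ip (- z) * ip x * ip (int l * x)" unfolding ip_add[symmetric] by (rule arg_cong[where f = ip]) simp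
      ultimately show "ip (- z) * c \<gamma> * (ip (- x) ^ card (R - {\<gamma>}) * ip (int l * x) * coeff (\<Prod>\<gamma>'\<in>R - {\<gamma>}. [:- a \<gamma>', 1:]) l) =
        ip (int l * x + (x - z)) * (c \<gamma> * coeff (\<Prod>\<gamma>'\<in>R - {\<gamma>}. [:- a \<gamma>', 1:]) l)" by (simp only: mult_ac)
    qed
    also have "\<dots> = ip (int l * x + (x - z)) * coeff (Psi 2 p R \<Omega>) l"
      by (simp add: Psi_def coeff_sum sum_distrib_left a_def c_def)
    finally show ?thesis using m2 by (simp add: modular_poly_def)
  qed
qed

text \<open>Every monomial of \<open>L\<close> is invariant under \<open>lowp x y z\<close> by
  \<open>L'_exponents\<close>, so the numerator alone takes up the factor \<open>w\<close> of the
  coefficient; generic independence permits comparison monomial by monomial.\<close>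

lemma numerator_congruence:
  assumes R: "is_coset_reps p R" and L: "is_L' p L" and m: "m \<in> {1, 2}"
    and quot: "coeff_is_quotient p R m l N L" and c: "coeff3 N i j k \<noteq> 0"
  shows "[- int p * (x * int i + z * int j + (x + 2 * y + z) * int k) = int l * x + (int m - 1) * (x - z)] (mod 4)"
proof -
  define e where "e i j k = - (int p * x * int i + int p * z * int j + (int p * x + 2 * (int p * y) + int p * z) * int k)" for i j k :: nat
  define w where "w = ip (int l * x + (int m - 1) * (x - z))"
  obtain n1 n2 where n1: "\<And>i j k. coeff3 L i j k \<noteq> 0 \<Longrightarrow> i \<le> n1 \<and> j \<le> n1 \<and> k \<le> n1"
    and n2: "\<And>i j k. coeff3 N i j k \<noteq> 0 \<Longrightarrow> i \<le> n2 \<and> j \<le> n2 \<and> k \<le> n2" using poly3_bound by metis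
  have L0: "L \<noteq> 0" using L by (auto simp: is_L'_def)
  have Linv: "eval_b' L (act (lowp x y z) \<Omega>) = eval_b' L \<Omega>" if O: "\<Omega> \<in> siegel2" for \<Omega>
  proof -
    have ex: "eval_b' L \<Omega> = (\<Sum>i\<le>n1. \<Sum>j\<le>n1. \<Sum>k\<le>n1. of_rat (coeff3 L i j k) * b' 1 \<Omega> ^ i * b' 2 \<Omega> ^ j * b' 3 \<Omega> ^ k)"
      unfolding eval_b'_def by (rule eval3_expand) (rule n1)
    have lo: "eval_b' L (act (lowp x y z) \<Omega>) = (\<Sum>i\<le>n1. \<Sum>j\<le>n1. \<Sum>k\<le>n1. of_rat (coeff3 L i j k) * ip (e i j k) * b' 1 \<Omega> ^ i * b' 2 \<Omega> ^ j * b' 3 \<Omega> ^ k)"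
      unfolding lowp_def e_def by (rule eval_b'_low[OF _ O]) (rule n1)
    have "of_rat (coeff3 L i j k) * ip (e i j k) = (of_rat (coeff3 L i j k) :: complex)" for i j k
    proof (cases "coeff3 L i j k = 0")
      case False
      note ev = L'_exponents[OF L False]
      have ij: "4 dvd int i + int j" and jk: "4 dvd int j + int k"
        using ev(4,5) by (simp_all add: cong_0_iff flip: of_nat_add int_dvd_int_iff)
      obtain k' where k': "int k = 2 * k'" using ev(3) by (metis even_of_nat evenE)
      have "e i j k = - int p * x * (int i + int j) - int p * x * (int j + int k) + 2 * int p * x * int j - int p * z * (int j + int k) - 2 * int p * y * int k"
        by (simp add: e_def algebra_simps)
      moreover obtain j' where "int j = 2 * j'" using ev(2) by (metis even_of_nat evenE)
      ultimately have "e i j k = - int p * x * (int i + int j) - int p * x * (int j + int k) + 4 * (int p * x * j') - int p * z * (int j + int k) - 4 * (int p * y * k')"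
        using k' by simp
      hence "4 dvd e i j k" using ij jk by (simp add: dvd_diff dvd_add)
      thus ?thesis by (metis dvdE ip_4 mult.right_neutral)
    qed simp
    thus ?thesis by (simp only: ex lo)
  qed
  have "complex_of_rat (coeff3 N i j k) * (ip (e i j k) - w) = 0"
  proof (rule bprime_generically_independent[where L = L and p = p and R = R and n = n2 and f = "\<lambda>i j k. of_rat (coeff3 N i j k) * (ip (e i j k) - w)"])
    show "finite R" by (rule coset_reps_card(1)[OF R])
    show "R \<subseteq> Sp4Z" using R Gamma24_Sp4Z by (auto simp: is_coset_reps_def)
    show "p > 0" by (rule p_pos)
    show "L \<noteq> 0" by (rule L0)
    show "i \<le> n2" "j \<le> n2" "k \<le> n2" using n2[OF c] by auto
    fix \<Omega> assume reg: "\<Omega> \<in> regular_points p R" and nz: "eval_b' L \<Omega> \<noteq> 0"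
    have O: "\<Omega> \<in> siegel2" using reg by (simp add: regular_points_def)
    have q: "\<And>\<Omega>. \<Omega> \<in> regular_points p R \<Longrightarrow> eval_b' L \<Omega> \<noteq> 0 \<Longrightarrow> coeff (modular_poly m p R \<Omega>) l = eval_b' N \<Omega> / eval_b' L \<Omega>"
      using quot by (simp add: coeff_is_quotient_def)
    have "eval_b' N (act (lowp x y z) \<Omega>) / eval_b' L \<Omega> = w * (eval_b' N \<Omega> / eval_b' L \<Omega>)"
      using q[OF modular_poly_lowp(1)[OF R m reg]] q[OF reg nz] modular_poly_lowp(2)[OF R m reg, of x y z l] nz by (simp add: Linv[OF O] w_def)
    hence N: "eval_b' N (act (lowp x y z) \<Omega>) = w * eval_b' N \<Omega>" using nz by simp
    have ex: "eval_b' N \<Omega> = (\<Sum>i\<le>n2. \<Sum>j\<le>n2. \<Sum>k\<le>n2. of_rat (coeff3 N i j k) * b' 1 \<Omega> ^ i * b' 2 \<Omega> ^ j * b' 3 \<Omega> ^ k)"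
      unfolding eval_b'_def by (rule eval3_expand) (rule n2)
    have lo: "eval_b' N (act (lowp x y z) \<Omega>) = (\<Sum>i\<le>n2. \<Sum>j\<le>n2. \<Sum>k\<le>n2. of_rat (coeff3 N i j k) * ip (e i j k) * b' 1 \<Omega> ^ i * b' 2 \<Omega> ^ j * b' 3 \<Omega> ^ k)"
      unfolding lowp_def e_def by (rule eval_b'_low[OF _ O]) (rule n2)
    have "(\<Sum>i\<le>n2. \<Sum>j\<le>n2. \<Sum>k\<le>n2. of_rat (coeff3 N i j k) * (ip (e i j k) - w) * b' 1 \<Omega> ^ i * b' 2 \<Omega> ^ j * b' 3 \<Omega> ^ k)
      = eval_b' N (act (lowp x y z) \<Omega>) - w * eval_b' N \<Omega>"
      unfolding ex lo sum_distrib_left sum_subtractf[symmetric] by (intro sum.cong refl) (simp add: algebra_simps)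
    thus "(\<Sum>i\<le>n2. \<Sum>j\<le>n2. \<Sum>k\<le>n2. of_rat (coeff3 N i j k) * (ip (e i j k) - w) * b' 1 \<Omega> ^ i * b' 2 \<Omega> ^ j * b' 3 \<Omega> ^ k) = 0"
      using N by simp
  qed
  hence "ip (e i j k) = w" using c by simp
  hence "[e i j k = int l * x + (int m - 1) * (x - z)] (mod 4)" unfolding w_def ip_eq_iff .
  thus ?thesis unfolding e_def by (simp add: algebra_simps)
qed

text \<open>The three unit vectors \<open>(x, y, z)\<close> give three relations; the square of
  \<open>p\<close> is 1 modulo 4, which moves the factor \<open>p\<close> across, and
  \<open>y = 1\<close> shows that \<open>k\<close> is even.\<close>

lemma numerator_exponents:
  assumes R: "is_coset_reps p R" and L: "is_L' p L" and m: "m \<in> {1, 2}"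
    and quot: "coeff_is_quotient p R m l N L" and c: "coeff3 N i j k \<noteq> 0"
  shows "[i = l + m + 1] (mod 2)" "[int (i + j) = - int (p * l)] (mod 4)" "[int (j + k) = int p * (int m - 1)] (mod 4)"
proof -
  define P M I J K l' where "P = int p" and "M = int m - 1" and "I = int i" and "J = int j" and "K = int k" and "l' = int l"
  note d = P_def M_def I_def J_def K_def l'_def
  note cong = numerator_congruence[OF R L m quot c]
  have A: "4 dvd P * (I + K) + l' + M"
    using cong[where x = 1 and y = 0 and z = 0] unfolding cong_iff_dvd_diff d by (subst dvd_minus_iff[symmetric]) (simp add: algebra_simps)
  have B: "4 dvd P * (J + K) - M"
    using cong[where x = 0 and y = 0 and z = 1] unfolding cong_iff_dvd_diff d by (subst dvd_minus_iff[symmetric]) (simp add: algebra_simps)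
  have C: "4 dvd 2 * (P * K)"
    using cong[where x = 0 and y = 1 and z = 0] unfolding cong_iff_dvd_diff d by (subst dvd_minus_iff[symmetric]) (simp add: algebra_simps)
  have oP: "odd P" using odd_p by (simp add: d)
  obtain q where q: "P = 2 * q + 1" using oP by (rule oddE)
  have PP: "4 dvd 1 - P * P" unfolding q by (rule dvdI[of _ _ "- q * q - q"]) (simp add: algebra_simps)
  have "even t" if "4 dvd 2 * t" for t :: int using that by presburger
  hence "even (P * K)" using C by blast
  hence eK: "even K" using oP by simp
  \<comment> \<open>The combination that eliminates \<open>M\<close> and leaves of \<open>K\<close>
    only a multiple of \<open>2 * (P * K)\<close>, which \<open>C\<close> removes.\<close>
  have "I + J + P * l' = P * (P * (I + K) + l' + M) + P * (P * (J + K) - M) - P * (2 * (P * K)) + (1 - P * P) * (I + J)"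
    by (simp add: algebra_simps)
  also have "4 dvd \<dots>" by (intro dvd_add dvd_diff dvd_mult dvd_mult2 A B C PP)
  finally show "[int (i + j) = - int (p * l)] (mod 4)" unfolding cong_iff_dvd_diff by (simp add: d)
  have "J + K - P * M = P * (P * (J + K) - M) + (1 - P * P) * (J + K)" by (simp add: algebra_simps)
  also have "4 dvd \<dots>" by (intro dvd_add dvd_mult dvd_mult2 B PP)
  finally show "[int (j + k) = int p * (int m - 1)] (mod 4)" unfolding cong_iff_dvd_diff by (simp add: d)
  have "even (P * (I + K) + l' + M)" by (rule dvd_trans[OF _ A]) simp
  hence "even (I + l' + M)" using oP eK by simp
  moreover have "int i - int (l + m + 1) = (I + l' + M) - 2 * (l' + int m)" by (simp add: d)
  moreover have "even ((I + l' + M) - 2 * (l' + int m))" using calculation(1) by (rule dvd_diff) simp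
  ultimately have "even (int i - int (l + m + 1))" by (simp only:)
  hence "[int i = int (l + m + 1)] (mod int 2)" by (simp add: cong_iff_dvd_diff)
  thus "[i = l + m + 1] (mod 2)" by (simp only: cong_int_iff)
qed

end

theorem theorem45:
  fixes p :: nat and L :: poly3 and R :: "imat4 set"
  assumes "prime p" and "p > 2"
    and "is_L' p L"
    and "is_coset_reps p R"
  shows "(\<forall>i j k. coeff3 L i j k \<noteq> 0 \<longrightarrow>
            even i \<and> even j \<and> even k \<and> [i + j = 0] (mod 4) \<and> [j + k = 0] (mod 4)) \<and>
         (is_common_denominator p R L \<longrightarrow>
            (\<forall>m\<in>{1, 2}. \<forall>l N. coeff_is_quotient p R m l N L \<longrightarrow>
               (\<forall>i j k. coeff3 N i j k \<noteq> 0 \<longrightarrow>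
                  [i = l + m + 1] (mod 2) \<and>
                  [int (i + j) = - int (p * l)] (mod 4) \<and>
                  [int (j + k) = int p * (int m - 1)] (mod 4))))"
proof -
  obtain a \<beta> where "odd_prime p a \<beta>" using odd_prime_exists assms(1,2) by blast
  then interpret odd_prime p a \<beta> .
  show ?thesis
    by (intro conjI allI impI ballI)
      ((erule L'_exponents[OF assms(3)])+, (rule numerator_exponents[OF assms(4,3)], assumption+)+)
qed

end
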